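(* Let $\mathbb F$ be an algebraically closed field of characteristic different from $2$. Let $T$ be an elementary abelian $2$-group of even dimension with a nondegenerate alternating bicharacter $\beta$, let $q,s\ge0$ be integers (not both zero), $\tau=(t_1,\ldots,t_q)$ with $t_i\in T$, $\mu=(\mu_1,\ldots,\mu_s)$ with $\mu_i\in\mathbb F^\times$. Let $\Gamma=\Gamma_{\mathcal M}(T,q,s,\tau)$ be the grading on $\mathcal R=M_{q+2s}(\mathcal D)$ and $\varphi=\varphi_{\tau,\mu}$ the anti-automorphism of $\mathcal R$ defined in the context, and assume that $\Gamma$ is a fine $\varphi$-grading. Let $\Sigma=\Sigma(\tau)$, so $|\Sigma|=q$. 1) $\mathrm{Stab}(\Gamma,\varphi)=\mathrm{Diag}(\Gamma)$. 2) $\mathrm{Aut}^*(\Gamma,\varphi)/\mathrm{Stab}(\Gamma,\varphi)$ is isomorphic to an extension of the group $$\big((T^{q+s-1}\times\mathbb Z_2^s)\rtimes(\mathrm{Sym}\,\Sigma\times\mathrm{Sym}(s))\big)\rtimes\mathrm{Aut}^*\Sigma$$ by $\mathbb Z_2^{q+s-1}$ (the latter being the normal subgroup), with the following actions: $T^{q+s-1}$ is identified with $T^{q+s}/T$ and $\mathbb Z_2^{q+s-1}$ is identified with $\mathbb Z_2^{q+s}/\mathbb Z_2$, where $T$ and $\mathbb Z_2$ are imbedded diagonally, and then - $\mathrm{Sym}\,\Sigma\subset\mathrm{Sym}(q)$ acts on $T^{q+s}/T$ and $\mathbb Z_2^{q+s}/\mathbb Z_2$ by permuting the first $q$ components and trivially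 on $\mathbb Z_2^s$; - $\mathrm{Sym}(s)$ acts on $T^{q+s}/T$ and $\mathbb Z_2^{q+s}/\mathbb Z_2$ by permuting the last $s$ components and naturally on $\mathbb Z_2^s$; - $\mathrm{Aut}^*\Sigma$ acts on $\mathrm{Sym}\,\Sigma$ and $\mathbb Z_2^{q+s}/\mathbb Z_2$ through the restriction homomorphism $\mathrm{Aut}^*\Sigma\to\mathrm{Sym}(q)$, trivially on $\mathrm{Sym}(s)$, and as follows on $(T^{q+s}/T)\times\mathbb Z_2^s$: an element $(u,\alpha)\in\mathrm{Aut}^*\Sigma\subset T\rtimes\mathrm{Aut}(T,\beta)$ sends a pair $\big((u_1,\ldots,u_q,u_{q+1},\ldots,u_{q+s})T,\underline x\big)$ to $$\big((\alpha(u_{\pi^{-1}(1)}),\ldots,\alpha(u_{\pi^{-1}(q)}),\alpha(u_{q+1})u^{x_1},\ldots,\alpha(u_{q+s})u^{x_s})T,\underline x\big),$$ where $\pi$ is the image of $(u,\alpha)$ under the restriction homomorphism; - $T^{q+s-1}\times\mathbb Z_2^s$ acts trivially on $\mathbb Z_2^{q+s-1}$. 3) If $\varphi$ is an involution, then $\mathrm{Aut}(\Gamma,\varphi)/\mathrm{Stab}(\Gamma,\varphi)$ is isomorphic to $$\big((T^{q+s-1}\times\mathbb Z_2^s)\rtimes(\mathrm{Sym}\,\Sigma\times\mathrm{Sym}(s))\big)\rtimes\mathrm{Aut}\,\Sigma,$$ with the following actions: $T^{q+s-1}$ is identified with $T^{q+s}/T$, where $T$ is imbedded diagonally, and then - $\mathrm{Sym}\,\Sigma\subset\mathrm{Sym}(q)$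 acts on $T^{q+s}/T$ by permuting the first $q$ components and trivially on $\mathbb Z_2^s$; - $\mathrm{Sym}(s)$ acts on $T^{q+s}/T$ by permuting the last $s$ components and naturally on $\mathbb Z_2^s$; - $\mathrm{Aut}\,\Sigma$ acts on $\mathrm{Sym}\,\Sigma$ as a subgroup of $\mathrm{Aut}^*\Sigma$, i.e., through the twisted action on $T$ and restriction to $\Sigma$, trivially on $\mathrm{Sym}(s)$, and as follows on $(T^{q+s}/T)\times\mathbb Z_2^s$: an element $\alpha\in\mathrm{Aut}\,\Sigma\subset\mathrm{Aut}(T,\beta)$ sends a pair $\big((u_1,\ldots,u_q,u_{q+1},\ldots,u_{q+s})T,\underline x\big)$ to $$\big((\alpha(u_{\pi^{-1}(1)}),\ldots,\alpha(u_{\pi^{-1}(q)}),\alpha(u_{q+1})t_\alpha^{x_1},\ldots,\alpha(u_{q+s})t_\alpha^{x_s})T,\underline x\big),$$ where $\pi$ is the image of $(t_\alpha,\alpha)$ under the restriction to $\Sigma$.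
   Context: Gradings. All grading groups are abelian. For a grading $\Gamma:\mathcal A=\bigoplus_{g}\mathcal A_g$ on an algebra $\mathcal A$: $\mathrm{Aut}(\Gamma)$ is the group of automorphisms of $\mathcal A$ that permute the components of $\Gamma$; $\mathrm{Stab}(\Gamma)$ is the subgroup of automorphisms mapping each component to itself; $\mathrm{Diag}(\Gamma)$ is the subgroup of automorphisms acting on each component as a nonzero scalar. If $\varphi$ is an anti-automorphism of $\mathcal A$, $\Gamma$ is a $\varphi$-grading if $\varphi(\mathcal A_g)=\mathcal A_g$ for all $g$ and $\varphi^2\in\mathrm{Diag}(\Gamma)$. A $\varphi$-grading is fine if it is not a proper coarsening of another $\varphi$-grading (coarsening: each component of the finer grading is contained in a component of the coarser one; proper: some inclusion is proper). Define $$\mathrm{Aut}^*(\Gamma,\varphi)=\{\psi\in\mathrm{Aut}(\Gamma):\psi\varphi\psi^{-1}=\xi\varphi\text{ for some }\xi\in\mathrm{Diag}(\Gamma)\},$$ $$\mathrm{Aut}(\Gamma,\varphi)=\{\psi\in\mathrm{Aut}(\Gamma):\psi\varphi\psi^{-1}=\varphi\},\qquad \mathrm{Stab}(\Gamma,\varphi)=\{\psi\in\mathrm{Stab}(\Gamma):\psi\varphi\psi^{-1}=\varphi\}.$$ The algebra $\mathcal D$. $T$ is an elementary abelian $2$-group of even dimension $2r$ (over the field of two elements), written multiplicatively, and $\beta\colon T\times T\to\{\pm1\}\subset\mathbb F^\times$ is a nondegenerate alternating bicharacter. Choose a basis $a_1,b_1,\ldots,a_r,b_r$ of $T$ with $\beta(a_i,b_i)=-1$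 and all other values of $\beta$ on pairs of distinct basis elements (up to order) equal to $1$. Let $\mathcal D=M_2(\mathbb F)^{\otimes r}=M_{2^r}(\mathbb F)$ (Kronecker product), let $X_{a_i}$, respectively $X_{b_i}$, be the tensor with $\begin{bmatrix}-1&0\\0&1\end{bmatrix}$, respectively $\begin{bmatrix}0&1\\1&0\end{bmatrix}$, in the $i$-th factor and identity matrices elsewhere, and $X_t=X_{a_1}^{i_1}X_{b_1}^{j_1}\cdots X_{a_r}^{i_r}X_{b_r}^{j_r}$ for $t=a_1^{i_1}b_1^{j_1}\cdots a_r^{i_r}b_r^{j_r}$ (exponents in $\{0,1\}$). Then $\mathcal D=\bigoplus_{t\in T}\mathbb F X_t$ is a $T$-grading with all nonzero homogeneous elements invertible and $X_uX_v=\beta(u,v)X_vX_u$. The matrix transpose satisfies ${}^tX_u=\beta(u)X_u$ with $\beta(u)\in\{\pm1\}$; this defines $\beta\colon T\to\{\pm1\}$, a quadratic form with polar form $\beta(\cdot,\cdot)$. The grading. Let $\widetilde G$ be the abelian group generated by $T$ and symbols $\widetilde g_1,\ldots,\widetilde g_{q+2s}$ with defining relations (in addition to those of $T$) $$\widetilde g_1^2t_1=\cdots=\widetilde g_q^2t_q=\widetilde g_{q+1}\widetilde g_{q+2}=\cdots=\widetilde g_{q+2s-1}\widetilde g_{q+2s}.$$ With $n=(q+2s)2^r$, identify $\mathcal R=M_n(\mathbb F)$ with $M_{q+2s}(\mathcal D)=M_{q+2s}(\mathbb F)\otimes\mathcal D$. The grading $\Gamma_{\mathcal M}(T,q,s,\tau)$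 on $\mathcal R$ is defined by $\deg(E_{ij}\otimes X_t)=\widetilde g_i\,t\,\widetilde g_j^{-1}$; it is a grading by the subgroup $\widetilde G^0\subset\widetilde G$ generated by the support. The anti-automorphism. $\varphi_{\tau,\mu}(X)=\Phi^{-1}({}^tX)\Phi$, where ${}^tX$ is the transpose in $M_n(\mathbb F)$ and $$\Phi=\mathrm{diag}\left(X_{t_1},\ldots,X_{t_q},\begin{bmatrix}0&I\\\mu_1I&0\end{bmatrix},\ldots,\begin{bmatrix}0&I\\\mu_sI&0\end{bmatrix}\right)$$ with $I$ the identity element of $\mathcal D$. Groups attached to $\Sigma$. $\Sigma=\Sigma(\tau)$ is the multiset in $T$ formed by $t_1,\ldots,t_q$. If $m_1,\ldots,m_\ell$ are the multiplicities of its distinct elements, $\mathrm{Sym}\,\Sigma=\mathrm{Sym}(m_1)\times\cdots\times\mathrm{Sym}(m_\ell)\subset\mathrm{Sym}(q)$, the subgroup preserving each of the blocks $\{i:t_i=x\}$, $x$ in the underlying set of $\Sigma$. $\mathrm{Aut}(T,\beta)$ is the group of automorphisms of $T$ preserving the bicharacter $\beta(\cdot,\cdot)$. The group $T\rtimes\mathrm{Aut}(T,\beta)$ acts on $T$ by letting $(u,\alpha)$ send $t$ to $\alpha(t)u$ (the natural action). $\mathrm{Aut}^*\Sigma$ is the stabilizer of the multiset $\Sigma$ in $T\rtimes\mathrm{Aut}(T,\beta)$ (elements permuting the elements of $\Sigma$ and preserving multiplicities). Any bijection $\theta\colon T\to T$ stabilizing $\Sigma$ determines a permutation in $\mathrm{Sym}(q)$,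 its restriction to $\Sigma$: it permutes the blocks in the same way as $\theta$ permutes the elements of $\Sigma$ (sending the block of $x$ to the block of $\theta(x)$) and preserves the order within each block. This gives the restriction homomorphism $\mathrm{Aut}^*\Sigma\to\mathrm{Sym}(q)$, and $\mathrm{Aut}^*\Sigma$ acts on $\mathrm{Sym}\,\Sigma$ through it by permuting the factors (conjugation in $\mathrm{Sym}(q)$). For $\alpha\in\mathrm{Aut}(T,\beta)$, $t_\alpha\in T$ is the unique element with $\beta(t_\alpha,t)=\beta(\alpha^{-1}(t))\beta(t)$ for all $t\in T$. The twisted action of $\mathrm{Aut}(T,\beta)$ on $T$ is $\alpha\cdot t=\alpha(t)t_\alpha$, i.e., the natural action pulled back along the injective homomorphism $\alpha\mapsto(t_\alpha,\alpha)$ to $T\rtimes\mathrm{Aut}(T,\beta)$. $\mathrm{Aut}\,\Sigma$ is the stabilizer of $\Sigma$ in $\mathrm{Aut}(T,\beta)$ under the twisted action; via $\alpha\mapsto(t_\alpha,\alpha)$ it is regarded as a subgroup of $\mathrm{Aut}^*\Sigma$. Elements of $\mathbb Z_2^s$ are written $\underline x=(x_1,\ldots,x_s)$; $\mathrm{Sym}(m)$ is the symmetric group on $m$ letters. *)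

theory Defs
  imports
    "HOL-Algebra.Bij"
    "HOL-Algebra.Sym_Groups"
    "HOL-Algebra.Product_Groups"
    "HOL-Library.Multiset"
    "HOL-Computational_Algebra.Polynomial"
    "Jordan_Normal_Form.Matrix"
begin

text \<open>
  Conventions.  Tuples are indexed from 1, as in \<^const>\<open>sym_group\<close>, and functions on a set are
  extensional, as in \<^const>\<open>BijGroup\<close> and \<^const>\<open>product_group\<close>.  All groups act from the left, so a
  permutation \<open>p\<close> moves the entry in position \<open>i\<close> of a tuple to position \<open>p i\<close>.
\<close>


section \<open>Gradings on the algebra of n by n matrices\<close>

abbreviation mat_ring :: "nat \<Rightarrow> 'f::field mat ring"
  where "mat_ring n \<equiv> ring_mat TYPE('f) n ()"

abbreviation mat_bij_group :: "nat \<Rightarrow> ('f mat \<Rightarrow> 'f::field mat) monoid"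
  where "mat_bij_group n \<equiv> BijGroup (carrier_mat n n)"

definition mat_subspace :: "nat \<Rightarrow> 'f::field mat set \<Rightarrow> bool"
  where "mat_subspace n V \<longleftrightarrow>
    V \<subseteq> carrier_mat n n \<and> 0\<^sub>m n n \<in> V \<and>
    (\<forall>X\<in>V. \<forall>Y\<in>V. X + Y \<in> V) \<and> (\<forall>c. \<forall>X\<in>V. c \<cdot>\<^sub>m X \<in> V)"

definition mat_linear :: "nat \<Rightarrow> ('f mat \<Rightarrow> 'f::field mat) \<Rightarrow> bool"
  where "mat_linear n \<psi> \<longleftrightarrow>
    (\<forall>X\<in>carrier_mat n n. \<forall>Y\<in>carrier_mat n n. \<psi> (X + Y) = \<psi> X + \<psi> Y) \<and>
    (\<forall>c. \<forall>X\<in>carrier_mat n n. \<psi> (c \<cdot>\<^sub>m X) = c \<cdot>\<^sub>m \<psi> X)"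

definition automorphisms :: "nat \<Rightarrow> ('f mat \<Rightarrow> 'f::field mat) set"
  where "automorphisms n = {\<psi> \<in> Bij (carrier_mat n n). mat_linear n \<psi> \<and>
    (\<forall>X\<in>carrier_mat n n. \<forall>Y\<in>carrier_mat n n. \<psi> (X * Y) = \<psi> X * \<psi> Y)}"

definition anti_automorphisms :: "nat \<Rightarrow> ('f mat \<Rightarrow> 'f::field mat) set"
  where "anti_automorphisms n = {\<psi> \<in> Bij (carrier_mat n n). mat_linear n \<psi> \<and>
    (\<forall>X\<in>carrier_mat n n. \<forall>Y\<in>carrier_mat n n. \<psi> (X * Y) = \<psi> Y * \<psi> X)}"

text \<open>The decomposition of \<open>X\<close> is the function \<open>f\<close> of finite support with \<open>f g \<in> A g\<close>.\<close>

definition mat_grading :: "nat \<Rightarrow> 'g monoid \<Rightarrow> ('g \<Rightarrow> 'f::field mat set) \<Rightarrow> bool"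
  where "mat_grading n G A \<longleftrightarrow>
    comm_group G \<and>
    (\<forall>g\<in>carrier G. mat_subspace n (A g)) \<and>
    (\<forall>X\<in>carrier_mat n n. \<exists>!f. f \<in> (\<Pi>\<^sub>E g\<in>carrier G. A g) \<and>
        finite {g \<in> carrier G. f g \<noteq> 0\<^sub>m n n} \<and>
        X = (\<Oplus>\<^bsub>mat_ring n\<^esub> g\<in>{g \<in> carrier G. f g \<noteq> 0\<^sub>m n n}. f g)) \<and>
    (\<forall>g\<in>carrier G. \<forall>h\<in>carrier G. \<forall>X\<in>A g. \<forall>Y\<in>A h. X * Y \<in> A (g \<otimes>\<^bsub>G\<^esub> h))"

definition components :: "nat \<Rightarrow> 'g monoid \<Rightarrow> ('g \<Rightarrow> 'f::field mat set) \<Rightarrow> 'f mat set set"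
  where "components n G A = {A g | g. g \<in> carrier G \<and> A g \<noteq> {0\<^sub>m n n}}"

definition Aut_gr :: "nat \<Rightarrow> 'g monoid \<Rightarrow> ('g \<Rightarrow> 'f::field mat set) \<Rightarrow> ('f mat \<Rightarrow> 'f mat) set"
  where "Aut_gr n G A =
    {\<psi> \<in> automorphisms n. bij_betw (\<lambda>V. \<psi> ` V) (components n G A) (components n G A)}"

definition Stab_gr :: "nat \<Rightarrow> 'g monoid \<Rightarrow> ('g \<Rightarrow> 'f::field mat set) \<Rightarrow> ('f mat \<Rightarrow> 'f mat) set"
  where "Stab_gr n G A = {\<psi> \<in> automorphisms n. \<forall>V\<in>components n G A. \<psi> ` V = V}"

definition Diag_gr :: "nat \<Rightarrow> 'g monoid \<Rightarrow> ('g \<Rightarrow> 'f::field mat set) \<Rightarrow> ('f mat \<Rightarrow> 'f mat) set"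
  where "Diag_gr n G A =
    {\<psi> \<in> automorphisms n. \<forall>V\<in>components n G A. \<exists>c. c \<noteq> 0 \<and> (\<forall>X\<in>V. \<psi> X = c \<cdot>\<^sub>m X)}"

definition phi_grading ::
    "nat \<Rightarrow> ('f mat \<Rightarrow> 'f mat) \<Rightarrow> 'g monoid \<Rightarrow> ('g \<Rightarrow> 'f::field mat set) \<Rightarrow> bool"
  where "phi_grading n \<phi> G A \<longleftrightarrow>
    \<phi> \<in> anti_automorphisms n \<and> mat_grading n G A \<and>
    (\<forall>g\<in>carrier G. \<phi> ` A g = A g) \<and>
    \<phi> \<otimes>\<^bsub>mat_bij_group n\<^esub> \<phi> \<in> Diag_gr n G A"

definition proper_coarsening :: "'f mat set set \<Rightarrow> 'f::field mat set set \<Rightarrow> bool"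
  where "proper_coarsening \<C> \<C>' \<longleftrightarrow>
    (\<forall>V'\<in>\<C>'. \<exists>V\<in>\<C>. V' \<subseteq> V) \<and> (\<exists>V'\<in>\<C>'. \<exists>V\<in>\<C>. V' \<subset> V)"

text \<open>
  The competing \<open>\<phi>\<close>-gradings range over all gradings by abelian groups \<open>H\<close> carried by a set of
  natural numbers.  HOL cannot quantify over the type of \<open>H\<close> here, and this is no restriction: the
  support of a grading of a matrix algebra is finite, so it generates a countable group, and
  regrading by that group changes only zero components.
\<close>

definition fine_phi_grading ::
    "nat \<Rightarrow> ('f mat \<Rightarrow> 'f mat) \<Rightarrow> 'g monoid \<Rightarrow> ('g \<Rightarrow> 'f::field mat set) \<Rightarrow> bool"
  where "fine_phi_grading n \<phi> G A \<longleftrightarrow>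
    phi_grading n \<phi> G A \<and>
    \<not> (\<exists>(H :: nat monoid) B. phi_grading n \<phi> H B \<and>
          proper_coarsening (components n G A) (components n H B))"

definition Aut_star ::
    "nat \<Rightarrow> 'g monoid \<Rightarrow> ('g \<Rightarrow> 'f::field mat set) \<Rightarrow> ('f mat \<Rightarrow> 'f mat) \<Rightarrow> ('f mat \<Rightarrow> 'f mat) set"
  where "Aut_star n G A \<phi> = {\<psi> \<in> Aut_gr n G A. \<exists>\<xi>\<in>Diag_gr n G A.
    \<psi> \<otimes>\<^bsub>mat_bij_group n\<^esub> \<phi> \<otimes>\<^bsub>mat_bij_group n\<^esub> inv\<^bsub>mat_bij_group n\<^esub> \<psi> = \<xi> \<otimes>\<^bsub>mat_bij_group n\<^esub> \<phi>}"

definition Aut_phi ::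
    "nat \<Rightarrow> 'g monoid \<Rightarrow> ('g \<Rightarrow> 'f::field mat set) \<Rightarrow> ('f mat \<Rightarrow> 'f mat) \<Rightarrow> ('f mat \<Rightarrow> 'f mat) set"
  where "Aut_phi n G A \<phi> = {\<psi> \<in> Aut_gr n G A.
    \<psi> \<otimes>\<^bsub>mat_bij_group n\<^esub> \<phi> \<otimes>\<^bsub>mat_bij_group n\<^esub> inv\<^bsub>mat_bij_group n\<^esub> \<psi> = \<phi>}"

definition Stab_phi ::
    "nat \<Rightarrow> 'g monoid \<Rightarrow> ('g \<Rightarrow> 'f::field mat set) \<Rightarrow> ('f mat \<Rightarrow> 'f mat) \<Rightarrow> ('f mat \<Rightarrow> 'f mat) set"
  where "Stab_phi n G A \<phi> = {\<psi> \<in> Stab_gr n G A.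
    \<psi> \<otimes>\<^bsub>mat_bij_group n\<^esub> \<phi> \<otimes>\<^bsub>mat_bij_group n\<^esub> inv\<^bsub>mat_bij_group n\<^esub> \<psi> = \<phi>}"


section \<open>The group T and the graded division algebra D\<close>

definition elementary_abelian_2_group :: "'t monoid \<Rightarrow> bool"
  where "elementary_abelian_2_group T \<longleftrightarrow>
    comm_group T \<and> finite (carrier T) \<and> (\<forall>t\<in>carrier T. t \<otimes>\<^bsub>T\<^esub> t = \<one>\<^bsub>T\<^esub>)"

definition nondeg_alternating_bicharacter :: "'t monoid \<Rightarrow> ('t \<Rightarrow> 't \<Rightarrow> 'f::field) \<Rightarrow> bool"
  where "nondeg_alternating_bicharacter T \<beta> \<longleftrightarrow>
    (\<forall>u\<in>carrier T. \<forall>v\<in>carrier T. \<beta> u v \<in> {1, -1}) \<and>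
    (\<forall>u\<in>carrier T. \<forall>v\<in>carrier T. \<forall>w\<in>carrier T.
        \<beta> (u \<otimes>\<^bsub>T\<^esub> v) w = \<beta> u w * \<beta> v w \<and> \<beta> u (v \<otimes>\<^bsub>T\<^esub> w) = \<beta> u v * \<beta> u w) \<and>
    (\<forall>u\<in>carrier T. \<beta> u u = 1) \<and>
    (\<forall>u\<in>carrier T. (\<forall>v\<in>carrier T. \<beta> u v = 1) \<longrightarrow> u = \<one>\<^bsub>T\<^esub>)"

definition exponents :: "nat \<Rightarrow> ((nat \<Rightarrow> nat) \<times> (nat \<Rightarrow> nat)) set"
  where "exponents r = ({1..r} \<rightarrow>\<^sub>E {0,1}) \<times> ({1..r} \<rightarrow>\<^sub>E {0,1})"

definition basis_product ::
    "'t monoid \<Rightarrow> nat \<Rightarrow> (nat \<Rightarrow> 't) \<Rightarrow> (nat \<Rightarrow> 't) \<Rightarrow> (nat \<Rightarrow> nat) \<times> (nat \<Rightarrow> nat) \<Rightarrow> 't"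
  where "basis_product T r a b = (\<lambda>(i, j).
    \<Otimes>\<^bsub>T\<^esub> k\<in>{1..r}. a k [^]\<^bsub>T\<^esub> i k \<otimes>\<^bsub>T\<^esub> b k [^]\<^bsub>T\<^esub> j k)"

text \<open>The bijection says that \<open>a 1, b 1, \<dots>, a r, b r\<close> is a basis over the field of two elements.\<close>

definition symplectic_basis ::
    "'t monoid \<Rightarrow> ('t \<Rightarrow> 't \<Rightarrow> 'f::field) \<Rightarrow> nat \<Rightarrow> (nat \<Rightarrow> 't) \<Rightarrow> (nat \<Rightarrow> 't) \<Rightarrow> bool"
  where "symplectic_basis T \<beta> r a b \<longleftrightarrow>
    a ` {1..r} \<subseteq> carrier T \<and> b ` {1..r} \<subseteq> carrier T \<and>
    bij_betw (basis_product T r a b) (exponents r) (carrier T) \<and>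
    (\<forall>k\<in>{1..r}. \<forall>l\<in>{1..r}.
        \<beta> (a k) (b l) = (if k = l then -1 else 1) \<and> \<beta> (a k) (a l) = 1 \<and> \<beta> (b k) (b l) = 1)"

definition kronecker :: "'f::field mat \<Rightarrow> 'f mat \<Rightarrow> 'f mat"
  where "kronecker A B = mat (dim_row A * dim_row B) (dim_col A * dim_col B)
    (\<lambda>(i, j). A $$ (i div dim_row B, j div dim_col B) * B $$ (i mod dim_row B, j mod dim_col B))"

definition in_factor :: "nat \<Rightarrow> 'f::field mat \<Rightarrow> nat \<Rightarrow> 'f mat"
  where "in_factor r M k =
    foldr kronecker (map (\<lambda>l. if l = k then M else 1\<^sub>m 2) [1..<r+1]) (1\<^sub>m 1)"

definition X_a :: "nat \<Rightarrow> nat \<Rightarrow> 'f::field mat"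
  where "X_a r = in_factor r (mat_of_rows_list 2 [[-1, 0], [0, 1]])"

definition X_b :: "nat \<Rightarrow> nat \<Rightarrow> 'f::field mat"
  where "X_b r = in_factor r (mat_of_rows_list 2 [[0, 1], [1, 0]])"

definition X_mat :: "'t monoid \<Rightarrow> nat \<Rightarrow> (nat \<Rightarrow> 't) \<Rightarrow> (nat \<Rightarrow> 't) \<Rightarrow> 't \<Rightarrow> 'f::field mat"
  where "X_mat T r a b t =
    (let (i, j) = the_inv_into (exponents r) (basis_product T r a b) t in
      foldr (*) (map (\<lambda>k. X_a r k ^\<^sub>m i k * X_b r k ^\<^sub>m j k) [1..<r+1]) (1\<^sub>m (2 ^ r)))"

text \<open>The quadratic form \<open>\<beta>(u)\<close>, given by the transposes of the basis elements of \<open>D\<close>.\<close>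

definition quad_form :: "'t monoid \<Rightarrow> nat \<Rightarrow> (nat \<Rightarrow> 't) \<Rightarrow> (nat \<Rightarrow> 't) \<Rightarrow> 't \<Rightarrow> 'f::field"
  where "quad_form T r a b u =
    (THE c. transpose_mat (X_mat T r a b u) = c \<cdot>\<^sub>m X_mat T r a b u)"


section \<open>The grading and the anti-automorphism\<close>

text \<open>
  The grading group is presented as the quotient of \<open>T \<times> \<int>\<^sup>k\<close> by the subgroup generated by the
  quotients of the words that the defining relations set equal; here \<open>k = q + 2s\<close>, and
  \<open>\<int>\<^sup>k\<close> is free abelian on the symbols.
\<close>

definition word_group :: "'t monoid \<Rightarrow> nat \<Rightarrow> nat \<Rightarrow> ('t \<times> (nat \<Rightarrow> int)) monoid"
  where "word_group T q s = T \<times>\<times> product_group {1..q+2*s} (\<lambda>_. integer_group)"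

definition word_T :: "nat \<Rightarrow> nat \<Rightarrow> 't \<Rightarrow> 't \<times> (nat \<Rightarrow> int)"
  where "word_T q s t = (t, \<lambda>m\<in>{1..q+2*s}. 0)"

definition word_symbol :: "'t monoid \<Rightarrow> nat \<Rightarrow> nat \<Rightarrow> nat \<Rightarrow> 't \<times> (nat \<Rightarrow> int)"
  where "word_symbol T q s i = (\<one>\<^bsub>T\<^esub>, \<lambda>m\<in>{1..q+2*s}. if m = i then 1 else 0)"

definition equated_words :: "'t monoid \<Rightarrow> nat \<Rightarrow> nat \<Rightarrow> (nat \<Rightarrow> 't) \<Rightarrow> ('t \<times> (nat \<Rightarrow> int)) set"
  where "equated_words T q s \<tau> =
    (\<lambda>i. word_symbol T q s i [^]\<^bsub>word_group T q s\<^esub> (2::nat) \<otimes>\<^bsub>word_group T q s\<^esub> word_T q s (\<tau> i)) ` {1..q} \<union>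
    (\<lambda>j. word_symbol T q s (q + 2*j - 1) \<otimes>\<^bsub>word_group T q s\<^esub> word_symbol T q s (q + 2*j)) ` {1..s}"

definition relators :: "'t monoid \<Rightarrow> nat \<Rightarrow> nat \<Rightarrow> (nat \<Rightarrow> 't) \<Rightarrow> ('t \<times> (nat \<Rightarrow> int)) set"
  where "relators T q s \<tau> = generate (word_group T q s)
    {v \<otimes>\<^bsub>word_group T q s\<^esub> inv\<^bsub>word_group T q s\<^esub> w | v w.
       v \<in> equated_words T q s \<tau> \<and> w \<in> equated_words T q s \<tau>}"

definition G_tilde :: "'t monoid \<Rightarrow> nat \<Rightarrow> nat \<Rightarrow> (nat \<Rightarrow> 't) \<Rightarrow> ('t \<times> (nat \<Rightarrow> int)) set monoid"
  where "G_tilde T q s \<tau> = word_group T q s Mod relators T q s \<tau>"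

definition deg_M ::
    "'t monoid \<Rightarrow> nat \<Rightarrow> nat \<Rightarrow> (nat \<Rightarrow> 't) \<Rightarrow> nat \<Rightarrow> 't \<Rightarrow> nat \<Rightarrow> ('t \<times> (nat \<Rightarrow> int)) set"
  where "deg_M T q s \<tau> i t j =
    (let cls = (\<lambda>w. relators T q s \<tau> #>\<^bsub>word_group T q s\<^esub> w) in
      cls (word_symbol T q s i) \<otimes>\<^bsub>G_tilde T q s \<tau>\<^esub> cls (word_T q s t)
        \<otimes>\<^bsub>G_tilde T q s \<tau>\<^esub> inv\<^bsub>G_tilde T q s \<tau>\<^esub> cls (word_symbol T q s j))"

definition G_tilde0 :: "'t monoid \<Rightarrow> nat \<Rightarrow> nat \<Rightarrow> (nat \<Rightarrow> 't) \<Rightarrow> ('t \<times> (nat \<Rightarrow> int)) set monoid"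
  where "G_tilde0 T q s \<tau> = (G_tilde T q s \<tau>)
    \<lparr>carrier := generate (G_tilde T q s \<tau>)
      {deg_M T q s \<tau> i t j | i t j. i \<in> {1..q+2*s} \<and> t \<in> carrier T \<and> j \<in> {1..q+2*s}}\<rparr>"

definition matrix_unit :: "nat \<Rightarrow> nat \<Rightarrow> nat \<Rightarrow> 'f::field mat"
  where "matrix_unit k i j = mat k k (\<lambda>(x, y). if x + 1 = i \<and> y + 1 = j then 1 else 0)"

definition Gamma_M ::
    "'t monoid \<Rightarrow> nat \<Rightarrow> (nat \<Rightarrow> 't) \<Rightarrow> (nat \<Rightarrow> 't) \<Rightarrow> nat \<Rightarrow> nat \<Rightarrow> (nat \<Rightarrow> 't)
      \<Rightarrow> ('t \<times> (nat \<Rightarrow> int)) set \<Rightarrow> 'f::field mat set"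
  where "Gamma_M T r a b q s \<tau> g =
    mat_subspace ((q + 2*s) * 2^r) hull
      {kronecker (matrix_unit (q + 2*s) i j) (X_mat T r a b t) | i t j.
        i \<in> {1..q+2*s} \<and> t \<in> carrier T \<and> j \<in> {1..q+2*s} \<and> deg_M T q s \<tau> i t j = g}"

definition Phi_mat ::
    "'t monoid \<Rightarrow> nat \<Rightarrow> (nat \<Rightarrow> 't) \<Rightarrow> (nat \<Rightarrow> 't) \<Rightarrow> nat \<Rightarrow> nat \<Rightarrow> (nat \<Rightarrow> 't) \<Rightarrow> (nat \<Rightarrow> 'f) \<Rightarrow> 'f::field mat"
  where "Phi_mat T r a b q s \<tau> \<mu> = diag_block_mat
    (map (\<lambda>i. X_mat T r a b (\<tau> i)) [1..<q+1] @
     map (\<lambda>j. four_block_mat (0\<^sub>m (2^r) (2^r)) (1\<^sub>m (2^r))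
                              (\<mu> j \<cdot>\<^sub>m 1\<^sub>m (2^r)) (0\<^sub>m (2^r) (2^r))) [1..<s+1])"

definition phi_map ::
    "'t monoid \<Rightarrow> nat \<Rightarrow> (nat \<Rightarrow> 't) \<Rightarrow> (nat \<Rightarrow> 't) \<Rightarrow> nat \<Rightarrow> nat \<Rightarrow> (nat \<Rightarrow> 't) \<Rightarrow> (nat \<Rightarrow> 'f)
      \<Rightarrow> 'f mat \<Rightarrow> 'f::field mat"
  where "phi_map T r a b q s \<tau> \<mu> =
    (let n = (q + 2*s) * 2^r; \<Phi> = Phi_mat T r a b q s \<tau> \<mu> in
      (\<lambda>X\<in>carrier_mat n n. inv\<^bsub>mat_ring n\<^esub> \<Phi> * transpose_mat X * \<Phi>))"


section \<open>Semidirect products and extensions\<close>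

definition semidirect ::
    "('n, 'a) monoid_scheme \<Rightarrow> ('h, 'b) monoid_scheme \<Rightarrow> ('h \<Rightarrow> 'n \<Rightarrow> 'n) \<Rightarrow> ('n \<times> 'h) monoid"
  where "semidirect N H act =
    \<lparr>carrier = carrier N \<times> carrier H,
     monoid.mult = (\<lambda>(n, h) (n', h'). (n \<otimes>\<^bsub>N\<^esub> act h n', h \<otimes>\<^bsub>H\<^esub> h')),
     one = (\<one>\<^bsub>N\<^esub>, \<one>\<^bsub>H\<^esub>)\<rparr>"

text \<open>
  \<open>E\<close> is an extension of \<open>Q\<close> by the abelian group \<open>N\<close> that induces the action \<open>act\<close> of \<open>Q\<close> on \<open>N\<close>
  by conjugation in \<open>E\<close>.
\<close>

definition is_extension_of_by ::
    "('e, 'a) monoid_scheme \<Rightarrow> ('q, 'b) monoid_scheme \<Rightarrow> ('n, 'c) monoid_scheme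
      \<Rightarrow> ('q \<Rightarrow> 'n \<Rightarrow> 'n) \<Rightarrow> bool"
  where "is_extension_of_by E Q N act \<longleftrightarrow>
    group E \<and> group Q \<and> comm_group N \<and>
    (\<exists>\<iota> \<kappa>. \<iota> \<in> mon N E \<and> \<kappa> \<in> epi E Q \<and> kernel E Q \<kappa> = \<iota> ` carrier N \<and>
      (\<forall>e\<in>carrier E. \<forall>x\<in>carrier N. e \<otimes>\<^bsub>E\<^esub> \<iota> x \<otimes>\<^bsub>E\<^esub> inv\<^bsub>E\<^esub> e = \<iota> (act (\<kappa> e) x)))"


section \<open>The groups attached to the multiset\<close>

definition Sigma_mset :: "nat \<Rightarrow> (nat \<Rightarrow> 't) \<Rightarrow> 't multiset"
  where "Sigma_mset q \<tau> = image_mset \<tau> (mset_set {1..q})"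

definition Sym_Sigma :: "nat \<Rightarrow> (nat \<Rightarrow> 't) \<Rightarrow> (nat \<Rightarrow> nat) monoid"
  where "Sym_Sigma q \<tau> =
    (sym_group q)\<lparr>carrier := {p \<in> carrier (sym_group q). \<forall>i\<in>{1..q}. \<tau> (p i) = \<tau> i}\<rparr>"

definition Aut_T :: "'t monoid \<Rightarrow> ('t \<Rightarrow> 't \<Rightarrow> 'f::field) \<Rightarrow> ('t \<Rightarrow> 't) monoid"
  where "Aut_T T \<beta> = (AutoGroup T)\<lparr>carrier :=
    {\<alpha> \<in> carrier (AutoGroup T). \<forall>u\<in>carrier T. \<forall>v\<in>carrier T. \<beta> (\<alpha> u) (\<alpha> v) = \<beta> u v}\<rparr>"

definition nat_act :: "'t monoid \<Rightarrow> 't \<times> ('t \<Rightarrow> 't) \<Rightarrow> 't \<Rightarrow> 't"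
  where "nat_act T c t = snd c t \<otimes>\<^bsub>T\<^esub> fst c"

definition Aut_star_Sigma ::
    "'t monoid \<Rightarrow> ('t \<Rightarrow> 't \<Rightarrow> 'f::field) \<Rightarrow> nat \<Rightarrow> (nat \<Rightarrow> 't) \<Rightarrow> ('t \<times> ('t \<Rightarrow> 't)) monoid"
  where "Aut_star_Sigma T \<beta> q \<tau> = (semidirect T (Aut_T T \<beta>) (\<lambda>\<alpha> t. \<alpha> t))\<lparr>carrier :=
    {c \<in> carrier T \<times> carrier (Aut_T T \<beta>).
      image_mset (nat_act T c) (Sigma_mset q \<tau>) = Sigma_mset q \<tau>}\<rparr>"

definition restriction :: "nat \<Rightarrow> (nat \<Rightarrow> 't) \<Rightarrow> ('t \<Rightarrow> 't) \<Rightarrow> nat \<Rightarrow> nat"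
  where "restriction q \<tau> \<theta> = (THE p. p permutes {1..q} \<and>
    (\<forall>i\<in>{1..q}. \<tau> (p i) = \<theta> (\<tau> i)) \<and>
    (\<forall>i\<in>{1..q}. \<forall>j\<in>{1..q}. \<tau> i = \<tau> j \<and> i < j \<longrightarrow> p i < p j))"

definition t_elem ::
    "'t monoid \<Rightarrow> ('t \<Rightarrow> 't \<Rightarrow> 'f::field) \<Rightarrow> nat \<Rightarrow> (nat \<Rightarrow> 't) \<Rightarrow> (nat \<Rightarrow> 't) \<Rightarrow> ('t \<Rightarrow> 't) \<Rightarrow> 't"
  where "t_elem T \<beta> r a b \<alpha> = (THE u. u \<in> carrier T \<and>
    (\<forall>t\<in>carrier T. \<beta> u t = quad_form T r a b (inv_into (carrier T) \<alpha> t) * quad_form T r a b t))"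

definition twisted_embed ::
    "'t monoid \<Rightarrow> ('t \<Rightarrow> 't \<Rightarrow> 'f::field) \<Rightarrow> nat \<Rightarrow> (nat \<Rightarrow> 't) \<Rightarrow> (nat \<Rightarrow> 't) \<Rightarrow> ('t \<Rightarrow> 't)
      \<Rightarrow> 't \<times> ('t \<Rightarrow> 't)"
  where "twisted_embed T \<beta> r a b \<alpha> = (t_elem T \<beta> r a b \<alpha>, \<alpha>)"

definition Aut_Sigma ::
    "'t monoid \<Rightarrow> ('t \<Rightarrow> 't \<Rightarrow> 'f::field) \<Rightarrow> nat \<Rightarrow> (nat \<Rightarrow> 't) \<Rightarrow> (nat \<Rightarrow> 't) \<Rightarrow> nat \<Rightarrow> (nat \<Rightarrow> 't)
      \<Rightarrow> ('t \<Rightarrow> 't) monoid"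
  where "Aut_Sigma T \<beta> r a b q \<tau> = (Aut_T T \<beta>)\<lparr>carrier := {\<alpha> \<in> carrier (Aut_T T \<beta>).
    image_mset (\<lambda>t. \<alpha> t \<otimes>\<^bsub>T\<^esub> t_elem T \<beta> r a b \<alpha>) (Sigma_mset q \<tau>) = Sigma_mset q \<tau>}\<rparr>"


section \<open>The semidirect products and the actions\<close>

definition tuples_mod_diag :: "nat \<Rightarrow> ('x, 'm) monoid_scheme \<Rightarrow> (nat \<Rightarrow> 'x) set monoid"
  where "tuples_mod_diag m K =
    product_group {1..m} (\<lambda>_. K) Mod ((\<lambda>x. \<lambda>i\<in>{1..m}. x) ` carrier K)"

abbreviation Z2_power :: "nat \<Rightarrow> (nat \<Rightarrow> int) monoid"
  where "Z2_power s \<equiv> product_group {1..s} (\<lambda>_. integer_mod_group 2)"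

text \<open>\<open>p\<close> permutes the first \<open>q\<close> entries and \<open>\<sigma>\<close> the last \<open>s\<close> entries.\<close>

definition permute_tuple :: "nat \<Rightarrow> nat \<Rightarrow> (nat \<Rightarrow> nat) \<Rightarrow> (nat \<Rightarrow> nat) \<Rightarrow> (nat \<Rightarrow> 'x) \<Rightarrow> nat \<Rightarrow> 'x"
  where "permute_tuple q s p \<sigma> w =
    (\<lambda>i\<in>{1..q+s}. if i \<le> q then w (inv' p i) else w (q + inv' \<sigma> (i - q)))"

definition sym_act ::
    "nat \<Rightarrow> nat \<Rightarrow> (nat \<Rightarrow> nat) \<times> (nat \<Rightarrow> nat) \<Rightarrow> (nat \<Rightarrow> 't) set \<times> (nat \<Rightarrow> int)
      \<Rightarrow> (nat \<Rightarrow> 't) set \<times> (nat \<Rightarrow> int)"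
  where "sym_act q s = (\<lambda>(p, \<sigma>) (C, x).
    (permute_tuple q s p \<sigma> ` C, \<lambda>j\<in>{1..s}. x (inv' \<sigma> j)))"

definition inner_group ::
    "'t monoid \<Rightarrow> nat \<Rightarrow> nat \<Rightarrow> (nat \<Rightarrow> 't)
      \<Rightarrow> (((nat \<Rightarrow> 't) set \<times> (nat \<Rightarrow> int)) \<times> ((nat \<Rightarrow> nat) \<times> (nat \<Rightarrow> nat))) monoid"
  where "inner_group T q s \<tau> =
    semidirect (tuples_mod_diag (q + s) T \<times>\<times> Z2_power s) (Sym_Sigma q \<tau> \<times>\<times> sym_group s) (sym_act q s)"

text \<open>
  An element \<open>c = (u, \<alpha>)\<close> acts on both factors of \<open>inner_group\<close>; permuting the factors of
  \<open>Sym \<Sigma>\<close> through \<open>\<pi>\<close> is conjugation by \<open>\<pi>\<close>.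
\<close>

definition star_act ::
    "'t monoid \<Rightarrow> nat \<Rightarrow> nat \<Rightarrow> (nat \<Rightarrow> 't) \<Rightarrow> 't \<times> ('t \<Rightarrow> 't)
      \<Rightarrow> ((nat \<Rightarrow> 't) set \<times> (nat \<Rightarrow> int)) \<times> ((nat \<Rightarrow> nat) \<times> (nat \<Rightarrow> nat))
      \<Rightarrow> ((nat \<Rightarrow> 't) set \<times> (nat \<Rightarrow> int)) \<times> ((nat \<Rightarrow> nat) \<times> (nat \<Rightarrow> nat))"
  where "star_act T q s \<tau> = (\<lambda>c ((C, x), (p, \<sigma>)).
    let u = fst c; \<alpha> = snd c; \<pi> = restriction q \<tau> (nat_act T c) in
      (((\<lambda>w. \<lambda>i\<in>{1..q+s}. if i \<le> q then \<alpha> (w (inv' \<pi> i))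
                            else \<alpha> (w i) \<otimes>\<^bsub>T\<^esub> u [^]\<^bsub>T\<^esub> x (i - q)) ` C, x),
       (\<pi> \<circ> p \<circ> inv' \<pi>, \<sigma>)))"

definition Weyl_star_group ::
    "'t monoid \<Rightarrow> ('t \<Rightarrow> 't \<Rightarrow> 'f::field) \<Rightarrow> nat \<Rightarrow> nat \<Rightarrow> (nat \<Rightarrow> 't)
      \<Rightarrow> ((((nat \<Rightarrow> 't) set \<times> (nat \<Rightarrow> int)) \<times> ((nat \<Rightarrow> nat) \<times> (nat \<Rightarrow> nat))) \<times> ('t \<times> ('t \<Rightarrow> 't))) monoid"
  where "Weyl_star_group T \<beta> q s \<tau> =
    semidirect (inner_group T q s \<tau>) (Aut_star_Sigma T \<beta> q \<tau>) (star_act T q s \<tau>)"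

text \<open>
  The action on \<open>\<int>\<^sub>2\<^sup>q\<^sup>+\<^sup>s / \<int>\<^sub>2\<close>: the element \<open>(((C, x), (p, \<sigma>)), c)\<close> is the product of \<open>(C, x)\<close>,
  which acts trivially, \<open>(p, \<sigma>)\<close> and \<open>c\<close>, in this order.
\<close>

definition Z2_act ::
    "'t monoid \<Rightarrow> nat \<Rightarrow> nat \<Rightarrow> (nat \<Rightarrow> 't)
      \<Rightarrow> (((nat \<Rightarrow> 't) set \<times> (nat \<Rightarrow> int)) \<times> ((nat \<Rightarrow> nat) \<times> (nat \<Rightarrow> nat))) \<times> ('t \<times> ('t \<Rightarrow> 't))
      \<Rightarrow> (nat \<Rightarrow> int) set \<Rightarrow> (nat \<Rightarrow> int) set"
  where "Z2_act T q s \<tau> = (\<lambda>(((C, x), (p, \<sigma>)), c) Z.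
    permute_tuple q s p \<sigma> ` (permute_tuple q s (restriction q \<tau> (nat_act T c)) id ` Z))"

definition Weyl_group ::
    "'t monoid \<Rightarrow> ('t \<Rightarrow> 't \<Rightarrow> 'f::field) \<Rightarrow> nat \<Rightarrow> (nat \<Rightarrow> 't) \<Rightarrow> (nat \<Rightarrow> 't) \<Rightarrow> nat \<Rightarrow> nat \<Rightarrow> (nat \<Rightarrow> 't)
      \<Rightarrow> ((((nat \<Rightarrow> 't) set \<times> (nat \<Rightarrow> int)) \<times> ((nat \<Rightarrow> nat) \<times> (nat \<Rightarrow> nat))) \<times> ('t \<Rightarrow> 't)) monoid"
  where "Weyl_group T \<beta> r a b q s \<tau> =
    semidirect (inner_group T q s \<tau>) (Aut_Sigma T \<beta> r a b q \<tau>)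
      (\<lambda>\<alpha>. star_act T q s \<tau> (twisted_embed T \<beta> r a b \<alpha>))"

end

theory Submission
 imports Defs "Jordan_Normal_Form.Determinant"
begin

text \<open>
 The matrices \<open>E i j \<otimes> X t\<close> form a basis, and an automorphism that permutes the components is
 monomial with respect to it: the component of the identity permutes the diagonal idempotents, so
 \<open>E i j \<otimes> X t\<close> goes to a multiple of \<open>E (P i) (P j) \<otimes> X (u i \<cdot> \<alpha> t \<cdot> u j)\<close>.  Membership in the starred group
 says that this permutation of labels commutes with the one induced by \<open>\<phi>\<close> and that the cocycle
 comparing \<open>\<psi> \<phi>\<close> with \<open>\<phi> \<psi>\<close> is invariant under it.  The permutations of labels that commute
 with \<open>\<phi>\<close> form the iterated semidirect product; all of them lift, since weights can be adjusted by
 roots in the algebraically closed field.  The lifts of the identity are, modulo the diagonal group,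
 the sign vectors up to a common sign.  If \<open>\<phi>\<close> is an involution, commuting with it forces the
 translation part to be \<open>t\<^sub>\<alpha>\<close>, and the lift exists because the quadratic form is 1 at \<open>t\<^sub>\<alpha>\<close>, which
 a Gauss sum shows.
\<close>

text \<open>Both target groups are realised inside the finite group of permutations of labels. The
  iterated semidirect products start as bare records; their group axioms are pulled back along the
  injective map \<open>theta\<close>. The translation part u of (u, alpha) is an invariant of a
  label permutation, the common value of t_{P i} u_i u_{i*} alpha(t_i), where i* is the partner of
  i: on a diagonal index it says that (u, alpha) moves t_i to t_{P i}, on a hyperbolic pair that the
  two translations differ by u. This is where the factor u^(x_j) of the action comes from. The
  scalars comparing psi phi with phi psi are multiplicative on labels. On labels (i, t, i) they form
  the character beta(t_alpha u, alpha(t)), which no diagonal conjugation can change; the remaining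
  scalars can be rescaled. Fineness, beyond the axioms of a phi-grading, serves to exclude q = 2, s
  = 0, t_1 = t_2: there exchanging the two indices fixes every component, and Pauli matrices refine
  the grading.\<close>

notation smult_mat (infixl \<open>\<star>\<close> 70)

section \<open>Quotients that are extensions, and group laws pulled back along embeddings\<close>

lemma (in group) rcos_eq_iff:
 assumes "subgroup D G" "x : carrier G" "y : carrier G"
 shows "D #> x = D #> y \<longleftrightarrow> x \<otimes> inv y : D"
proof -
 interpret D: subgroup D G by fact
 have "D #> x = D #> y \<longleftrightarrow> x : D #> y"
 proof
  assume "D #> x = D #> y"
  then show "x : D #> y" using rcos_self[OF assms(2) assms(1)] by simp
 next
  assume "x : D #> y"
  then show "D #> x = D #> y" using repr_independence[OF _ assms(3,1)] by simp
 qed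
 also have "... \<longleftrightarrow> x \<otimes> inv y : D"
  using D.rcos_module[OF is_group assms(3,2)] .
 finally show ?thesis .
qed

text \<open>The map \<open>sg\<close> induces an isomorphism from the kernel of \<open>h\<close>
  modulo \<open>D\<close> onto \<open>N\<close>, and its inverse is the embedding that an extension
  asks for. The data come in this direction because signs are read off automorphisms. Equivariance
  of \<open>sg\<close> under conjugation becomes the prescribed action.\<close>

lemma is_extension_of_by_quotient:
 assumes E: "group E" and D: "D \<lhd> E" and h: "h : epi E Q" and Q: "group Q" and N: "comm_group N"
  and DK: "D <= kernel E Q h"
  and s_hom: "sg : hom (E\<lparr>carrier := kernel E Q h\<rparr>) N"
  and s_onto: "sg ` kernel E Q h = carrier N"
  and s_ker: "!!x. x : kernel E Q h ==> sg x = \<one>\<^bsub>N\<^esub> \<longleftrightarrow> x : D"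
  and s_conj: "!!e x. e : carrier E ==> x : kernel E Q h ==>
    sg (e \<otimes>\<^bsub>E\<^esub> x \<otimes>\<^bsub>E\<^esub> inv\<^bsub>E\<^esub> e) = act (h e) (sg x)"
 shows "is_extension_of_by (E Mod D) Q N act"
proof -
 interpret E: group E by fact
 interpret D: normal D E by fact
 interpret Q: group Q by fact
 interpret N: comm_group N by fact
 interpret h: group_hom E Q h
  using h by unfold_locales (auto simp: epi_def)
 let ?K = "kernel E Q h"
 have subK: "subgroup ?K E" by (rule h.subgroup_kernel)
 interpret EK: group "E\<lparr>carrier := ?K\<rparr>" by (rule E.subgroup_imp_group[OF subK])
 interpret sg: group_hom "E\<lparr>carrier := ?K\<rparr>" N sg
  using s_hom by unfold_locales auto
 have sgc: "sg x : carrier N" if "x : ?K" for x using sg.hom_closed[of x] that by simp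
 have KE: "x : carrier E" if "x : ?K" for x using that by (simp add: kernel_def)
 have s_inv: "sg (inv\<^bsub>E\<^esub> x) = inv\<^bsub>N\<^esub> sg x" if "x : ?K" for x
  using sg.hom_inv[of x] that E.m_inv_consistent[OF subK that] by simp
 have sdiv: "sg (x \<otimes>\<^bsub>E\<^esub> inv\<^bsub>E\<^esub> y) = sg x \<otimes>\<^bsub>N\<^esub> inv\<^bsub>N\<^esub> sg y" if "x : ?K" "y : ?K" for x y
  using sg.hom_mult[of x "inv\<^bsub>E\<^esub> y"] that subgroup.m_inv_closed[OF subK] s_inv by simp
 have cos_eq: "D #>\<^bsub>E\<^esub> x = D #>\<^bsub>E\<^esub> y \<longleftrightarrow> sg x = sg y" if xy: "x : ?K" "y : ?K" for x y
 proof -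
  have "x \<otimes>\<^bsub>E\<^esub> inv\<^bsub>E\<^esub> y : ?K"
   using xy subK by (simp add: subgroup.m_closed subgroup.m_inv_closed)
  then have "D #>\<^bsub>E\<^esub> x = D #>\<^bsub>E\<^esub> y \<longleftrightarrow> sg (x \<otimes>\<^bsub>E\<^esub> inv\<^bsub>E\<^esub> y) = \<one>\<^bsub>N\<^esub>"
   using E.rcos_eq_iff[OF D.is_subgroup, of x y] KE xy s_ker by simp
  also have "... \<longleftrightarrow> sg x = sg y"
   unfolding sdiv[OF xy] using N.inv_solve_right'[OF N.one_closed sgc[OF xy(1)] sgc[OF xy(2)]] sgc[OF xy(2)] by simp
  finally show ?thesis .
 qed
 obtain k where k: "k : hom (E Mod D) Q" "!!x. x : carrier E ==> k (D #>\<^bsub>E\<^esub> x) = h x"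
  using h.FactGroup_universal_kernel[OF D DK] by blast
 \<comment> \<open>An arbitrary section of \<open>sg\<close>. It need not be multiplicative, but its
   coset modulo \<open>D\<close> is, because \<open>D\<close> is the kernel of
   \<open>sg\<close>.\<close>
 define pre where "pre z = (SOME x. x : ?K & sg x = z)" for z
 have pre: "pre z : ?K" "sg (pre z) = z" if "z : carrier N" for z
 proof -
  have "\<exists>x. x : ?K & sg x = z" using that unfolding s_onto[symmetric] by blast
  then have "pre z : ?K & sg (pre z) = z" unfolding pre_def by (rule someI_ex)
  then show "pre z : ?K" "sg (pre z) = z" by auto
 qed
 define i where "i z = D #>\<^bsub>E\<^esub> pre z" for z
 have i_sg: "i (sg x) = D #>\<^bsub>E\<^esub> x" if "x : ?K" for x
 proof -
  show ?thesis unfolding i_def using cos_eq[of "pre (sg x)" x] pre sgc[OF that] that by simp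
 qed
 interpret M: group "E Mod D" by (rule D.factorgroup_is_group)
 have i_hom: "i : hom N (E Mod D)"
 proof (rule homI)
  fix z assume "z : carrier N"
  then show "i z : carrier (E Mod D)"
   unfolding i_def using pre KE by (simp add: carrier_FactGroup)
 next
  fix y z assume yz: "y : carrier N" "z : carrier N"
  have "i (y \<otimes>\<^bsub>N\<^esub> z) = i (sg (pre y \<otimes>\<^bsub>E\<^esub> pre z))"
   using sg.hom_mult[of "pre y" "pre z"] pre yz by simp
  also have "... = D #>\<^bsub>E\<^esub> (pre y \<otimes>\<^bsub>E\<^esub> pre z)"
   using pre yz subK by (intro i_sg) (simp add: subgroup.m_closed)
  also have "... = i y \<otimes>\<^bsub>E Mod D\<^esub> i z"
   unfolding i_def using pre yz KE by (simp add: D.rcos_sum)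
  finally show "i (y \<otimes>\<^bsub>N\<^esub> z) = i y \<otimes>\<^bsub>E Mod D\<^esub> i z" .
 qed
 have i_inj: "inj_on i (carrier N)"
 proof (rule inj_onI)
  fix y z assume "y : carrier N" "z : carrier N" "i y = i z"
  then show "y = z" unfolding i_def using cos_eq[of "pre y" "pre z"] pre by simp
 qed
 have "kernel (E Mod D) Q k = i ` carrier N"
 proof (intro equalityI subsetI)
  fix X assume "X : kernel (E Mod D) Q k"
  then obtain x where x: "x : carrier E" "X = D #>\<^bsub>E\<^esub> x" "k X = \<one>\<^bsub>Q\<^esub>"
   by (auto simp: kernel_def carrier_FactGroup)
  then have xK: "x : ?K" using k(2)[OF x(1)] by (simp add: kernel_def)
  show "X : i ` carrier N" using i_sg[OF xK] x(2) sgc[OF xK] by (intro image_eqI[of _ _ "sg x"]) simp_all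
 next
  fix X assume "X : i ` carrier N"
  then obtain z where z: "z : carrier N" "X = i z" by auto
  have "h (pre z) = \<one>\<^bsub>Q\<^esub>" using pre(1)[OF z(1)] by (simp add: kernel_def)
  then have "k X = \<one>\<^bsub>Q\<^esub>" using k(2)[OF KE[OF pre(1)[OF z(1)]]] z(2) by (simp add: i_def)
  moreover have "X : carrier (E Mod D)" using z i_hom by (auto simp: hom_def)
  ultimately show "X : kernel (E Mod D) Q k" by (simp add: kernel_def)
 qed
 moreover have "k : epi (E Mod D) Q"
 proof -
  have "carrier Q <= k ` carrier (E Mod D)"
  proof
   fix y assume "y : carrier Q"
   then obtain x where "x : carrier E" "y = h x" using h by (auto simp: epi_def)
   then show "y : k ` carrier (E Mod D)"
    using k(2)[of x] by (intro image_eqI[of _ _ "D #>\<^bsub>E\<^esub> x"]) (auto simp: carrier_FactGroup)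
  qed
  then show ?thesis using k(1) by (simp add: epi_iff_subset)
 qed
 moreover have "X \<otimes>\<^bsub>E Mod D\<^esub> i z \<otimes>\<^bsub>E Mod D\<^esub> inv\<^bsub>E Mod D\<^esub> X = i (act (k X) z)"
  if X: "X : carrier (E Mod D)" and z: "z : carrier N" for X z
 proof -
  obtain e where e: "e : carrier E" "X = D #>\<^bsub>E\<^esub> e"
   using X by (auto simp: carrier_FactGroup)
  have inK: "e \<otimes>\<^bsub>E\<^esub> pre z \<otimes>\<^bsub>E\<^esub> inv\<^bsub>E\<^esub> e : ?K"
   using normal.inv_op_closed2[OF h.normal_kernel e(1) pre(1)[OF z]] by simp
  have "inv\<^bsub>E Mod D\<^esub> X = D #>\<^bsub>E\<^esub> inv\<^bsub>E\<^esub> e"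
   using e D.inv_FactGroup[OF X] D.rcos_inv by simp
  then have "X \<otimes>\<^bsub>E Mod D\<^esub> i z \<otimes>\<^bsub>E Mod D\<^esub> inv\<^bsub>E Mod D\<^esub> X = D #>\<^bsub>E\<^esub> (e \<otimes>\<^bsub>E\<^esub> pre z \<otimes>\<^bsub>E\<^esub> inv\<^bsub>E\<^esub> e)"
   using e KE[OF pre(1)[OF z]] by (simp add: i_def D.rcos_sum)
  also have "... = i (sg (e \<otimes>\<^bsub>E\<^esub> pre z \<otimes>\<^bsub>E\<^esub> inv\<^bsub>E\<^esub> e))" using i_sg[OF inK] by simp
  also have "... = i (act (k X) z)"
   using s_conj[OF e(1) pre(1)[OF z]] pre(2)[OF z] e k by simp
  finally show ?thesis .
 qed
 ultimately show ?thesis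
  unfolding is_extension_of_by_def mon_def using i_hom i_inj M.is_group Q N by blast
qed

text \<open>Every axiom is checked after applying \<open>h\<close>. This serves the iterated
  semidirect products, whose associativity would otherwise require that each action is by
  automorphisms compatible with the layer below.\<close>

lemma group_embedding:
 assumes G: "group G" and mult: "!!x y. x : carrier S ==> y : carrier S ==> x \<otimes>\<^bsub>S\<^esub> y : carrier S"
  and h: "h : hom S G" and inj: "inj_on h (carrier S)" and sub: "subgroup (h ` carrier S) G"
  and one: "\<one>\<^bsub>S\<^esub> : carrier S" "h \<one>\<^bsub>S\<^esub> = \<one>\<^bsub>G\<^esub>"
 shows "group S"
proof -
 interpret G: group G by fact
 have hm: "h (x \<otimes>\<^bsub>S\<^esub> y) = h x \<otimes>\<^bsub>G\<^esub> h y" "h x : carrier G" if "x : carrier S" "y : carrier S" for x y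
  using h that by (auto simp: hom_def)
 have eqI: "x = y" if "x : carrier S" "y : carrier S" "h x = h y" for x y
  using inj that by (auto dest: inj_onD)
 show ?thesis
 proof (rule groupI)
  fix x assume x: "x : carrier S"
  have "inv\<^bsub>G\<^esub> h x : h ` carrier S" using sub x by (simp add: subgroup.m_inv_closed)
  then obtain y where "y : carrier S" "h y = inv\<^bsub>G\<^esub> h x" by auto
  then show "\<exists>y\<in>carrier S. y \<otimes>\<^bsub>S\<^esub> x = \<one>\<^bsub>S\<^esub>"
   using x hm one mult by (intro bexI[of _ y] eqI) auto
 qed (use mult one hm G.m_assoc in \<open>auto intro!: eqI\<close>)
qed

section \<open>Monomial bases of the matrix algebra\<close>

lemma mat_subspaceI:
 assumes "V <= carrier_mat n n" "0\<^sub>m n n : V" "!!X Y. X : V ==> Y : V ==> X + Y : V"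
  "!!c X. X : V ==> c \<star> X : V"
 shows "mat_subspace n V"
 using assms by (auto simp: mat_subspace_def)

lemma mat_subspaceD:
 assumes "mat_subspace n V"
 shows "V <= carrier_mat n n" "0\<^sub>m n n : V" "!!X Y. X : V ==> Y : V ==> X + Y : V"
  "!!c X. X : V ==> c \<star> X : V"
 using assms by (auto simp: mat_subspace_def)

lemma mat_subspace_carrier: "mat_subspace n (carrier_mat n n)"
 by (rule mat_subspaceI) auto

lemma mat_subspace_hull:
 assumes "S <= carrier_mat n n"
 shows "mat_subspace n (mat_subspace n hull S)"
proof (rule mat_subspaceI)
 show "mat_subspace n hull S <= carrier_mat n n"
  using assms mat_subspace_carrier by (rule hull_minimal)
qed (auto simp: hull_def mat_subspace_def)

text \<open>Makes linear identities accessible to \<open>span_induct\<close>: their solutions form a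
  subspace, so it is enough to test basis matrices.\<close>

lemma mat_subspace_zero_of:
 assumes "!!X Y. X : carrier_mat n n ==> Y : carrier_mat n n ==> f (X + Y) = f X + (f Y :: 'f::field)"
  and "!!c X. X : carrier_mat n n ==> f (c \<star> X) = c * f X"
 shows "mat_subspace n {X : carrier_mat n n. f X = 0}"
proof (rule mat_subspaceI)
 have "f (0 \<star> 0\<^sub>m n n) = 0 * f (0\<^sub>m n n)" by (rule assms) simp
 then show "0\<^sub>m n n : {X : carrier_mat n n. f X = 0}" by simp
qed (auto simp: assms)

text \<open>The bilinear form trace(X Y^T), without conjugation, so that it makes sense over every
  field.\<close>

definition mat_ip :: "nat => 'f::field mat => 'f mat => 'f"
 where "mat_ip n X Y = (\<Sum>x<n. \<Sum>y<n. X $$ (x, y) * Y $$ (x, y))"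

lemma mat_ip_add:
 "X : carrier_mat n n ==> Y : carrier_mat n n ==> mat_ip n (X + Y) Z = mat_ip n X Z + mat_ip n Y Z"
 by (simp add: mat_ip_def distrib_right sum.distrib)

lemma mat_ip_smult: "X : carrier_mat n n ==> mat_ip n (c \<star> X) Z = c * mat_ip n X Z"
 by (simp add: mat_ip_def sum_distrib_left mult.assoc)

definition lin_map :: "nat => ('f mat => 'f::field mat) => bool"
 where "lin_map n ps \<longleftrightarrow> mat_linear n ps & (\<forall>X\<in>carrier_mat n n. ps X : carrier_mat n n)"

lemma lin_mapD:
 assumes "lin_map n ps"
 shows "X : carrier_mat n n ==> ps X : carrier_mat n n"
  "X : carrier_mat n n ==> Y : carrier_mat n n ==> ps (X + Y) = ps X + ps Y"
  "X : carrier_mat n n ==> ps (c \<star> X) = c \<star> ps X"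
 using assms by (auto simp: lin_map_def mat_linear_def)

lemma lin_map_zero: "lin_map n ps ==> ps (0\<^sub>m n n) = 0\<^sub>m n n"
proof -
 assume lin: "lin_map n ps"
 have c: "ps (0\<^sub>m n n) : carrier_mat n n" using lin_mapD(1)[OF lin] by simp
 have "ps (0\<^sub>m n n) = 0 \<star> ps (0\<^sub>m n n)"
  using lin_mapD(3)[OF lin, of "0\<^sub>m n n" 0] by simp
 also have "... = 0\<^sub>m n n" using c by (auto intro!: eq_matI)
 finally show ?thesis .
qed

lemma lin_map_comp: "lin_map n ps ==> lin_map n ps' ==> lin_map n (%X. ps (ps' X))"
 by (simp add: lin_map_def mat_linear_def)

lemma lin_map_id: "lin_map n (%X. X)"
 by (simp add: lin_map_def mat_linear_def)

lemma lin_map_eq_subspace: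
 assumes "lin_map n ps" "lin_map n ps'"
 shows "mat_subspace n {X : carrier_mat n n. ps X = ps' X}"
 using assms by (intro mat_subspaceI) (auto simp: lin_mapD lin_map_zero)

text \<open>Orthogonality with a common nonzero norm \<open>N\<close> stands in for linear
  independence: a coordinate is then an explicit sum over entries instead of a chosen
  scalar.\<close>

locale mat_basis =
 fixes n :: nat and B :: "'i set" and e :: "'i => 'f::field mat" and N :: 'f
 assumes fin: "finite B"
  and e_carrier: "b : B ==> e b : carrier_mat n n"
  and orth: "b : B ==> b' : B ==> mat_ip n (e b) (e b') = (if b = b' then N else 0)"
  and N0: "N ~= 0"
  and span: "carrier_mat n n <= mat_subspace n hull (e ` B)"
begin

lemma span_induct:
 assumes "mat_subspace n V" "!!b. b : B ==> e b : V" "X : carrier_mat n n"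
 shows "X : V"
 using hull_minimal[of "e ` B" V "mat_subspace n"] assms span by blast

definition coef :: "'f mat => 'i => 'f"
 where "coef X b = mat_ip n X (e b) / N"

lemma coef_add: "X : carrier_mat n n ==> Y : carrier_mat n n ==> coef (X + Y) b = coef X b + coef Y b"
 by (simp add: coef_def mat_ip_add add_divide_distrib)

lemma coef_smult: "X : carrier_mat n n ==> coef (c \<star> X) b = c * coef X b"
 by (simp add: coef_def mat_ip_smult)

lemma coef_e: "b : B ==> b' : B ==> coef (e b) b' = (if b = b' then 1 else 0)"
 by (simp add: coef_def orth N0)

lemma coef_0: "coef (0\<^sub>m n n) b = 0"
 by (simp add: coef_def mat_ip_def)

text \<open>The sum is taken entry by entry, which avoids finite sums in a matrix ring. The
  relabelling \<open>F\<close> lets one notion serve for expansions and for monomial maps.\<close>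

definition lin_comb :: "'i set => ('i => 'f) => ('i => 'i) => 'f mat"
 where "lin_comb A c F = mat n n (%(x, y). \<Sum>b\<in>A. c b * e (F b) $$ (x, y))"

lemma lin_comb_carrier [simp]: "lin_comb A c F : carrier_mat n n"
 by (simp add: lin_comb_def)

lemma lin_comb_insert:
 assumes "finite A" "a \<notin> A" "F a : B"
 shows "lin_comb (insert a A) c F = c a \<star> e (F a) + lin_comb A c F"
 using assms e_carrier[OF assms(3)] by (intro eq_matI) (auto simp: lin_comb_def)

lemma lin_comb_empty: "lin_comb {} c F = 0\<^sub>m n n"
 by (auto simp: lin_comb_def intro!: eq_matI)

lemma lin_comb_in_subspace:
 assumes "mat_subspace n V" "finite A" "!!a. a : A ==> F a : B" "!!a. a : A ==> c a ~= 0 ==> e (F a) : V"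
 shows "lin_comb A c F : V"
 using assms(2,3,4)
proof (induction A rule: finite_induct)
 case empty
 then show ?case using mat_subspaceD(2)[OF assms(1)] by (simp add: lin_comb_empty)
next
 case (insert a A)
 have "c a \<star> e (F a) : V"
 proof (cases "c a = 0")
  case True
  then have "c a \<star> e (F a) = 0\<^sub>m n n" using e_carrier[of "F a"] insert.prems by (auto intro!: eq_matI)
  then show ?thesis using mat_subspaceD(2)[OF assms(1)] by simp
 qed (use insert.prems mat_subspaceD(4)[OF assms(1)] in auto)
 then show ?case
  using insert mat_subspaceD(3)[OF assms(1)] by (simp add: lin_comb_insert)
qed

lemma lin_comb_add: "lin_comb A (%b. c b + d b) F = lin_comb A c F + lin_comb A d F"
 by (auto simp: lin_comb_def distrib_right sum.distrib intro!: eq_matI)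

lemma lin_comb_smult: "lin_comb A (%b. k * c b) F = k \<star> lin_comb A c F"
 by (auto simp: lin_comb_def sum_distrib_left mult.assoc intro!: eq_matI)

lemma lin_comb_single:
 assumes "a : A" "finite A" "F a : B"
 shows "lin_comb A (%b. if a = b then k else 0) F = k \<star> e (F a)"
proof (rule eq_matI)
 fix x y assume "x < dim_row (k \<star> e (F a))" "y < dim_col (k \<star> e (F a))"
 then show "lin_comb A (%b. if a = b then k else 0) F $$ (x, y) = (k \<star> e (F a)) $$ (x, y)"
  using assms e_carrier[OF assms(3)] by (auto simp: lin_comb_def if_distrib[of "%z. z * _"] sum.delta' cong: if_cong)
qed (use e_carrier[OF assms(3)] in \<open>auto simp: lin_comb_def\<close>)

text \<open>Restricted to the carrier so that it can be an element of
  \<open>BijGroup\<close>.\<close>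

definition mono_map :: "('i => 'i) => ('i => 'f) => 'f mat => 'f mat"
 where "mono_map F w = (\<lambda>X\<in>carrier_mat n n. lin_comb B (%b. coef X b * w b) F)"

lemma lin_map_mono_map: "lin_map n (mono_map F w)"
proof -
 have "lin_comb B (%b. coef (X + Y) b * w b) F
   = lin_comb B (%b. coef X b * w b) F + lin_comb B (%b. coef Y b * w b) F"
  if "X : carrier_mat n n" "Y : carrier_mat n n" for X Y
  using that by (simp add: coef_add distrib_right lin_comb_add)
 moreover have "lin_comb B (%b. coef (k \<star> X) b * w b) F = k \<star> lin_comb B (%b. coef X b * w b) F"
  if "X : carrier_mat n n" for X k
  using that by (simp add: coef_smult mult.assoc lin_comb_smult)
 ultimately show ?thesis by (simp add: lin_map_def mat_linear_def mono_map_def)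
qed

lemma mono_map_e:
 assumes "b : B" "F b : B"
 shows "mono_map F w (e b) = w b \<star> e (F b)"
proof -
 have "lin_comb B (%b'. coef (e b) b' * w b') F = lin_comb B (%b'. if b = b' then w b else 0) F"
  unfolding lin_comb_def
  by (intro arg_cong[of _ _ "mat n n"] ext) (auto intro!: sum.cong simp: coef_e[OF assms(1)])
 then show ?thesis
  using assms e_carrier[OF assms(1)] fin by (simp add: mono_map_def lin_comb_single)
qed

lemma lin_map_ext:
 assumes "lin_map n ps" "lin_map n ps'" "!!b. b : B ==> ps (e b) = ps' (e b)" "X : carrier_mat n n"
 shows "ps X = ps' X"
 using span_induct[OF lin_map_eq_subspace[OF assms(1,2)] _ assms(4)] assms(3) e_carrier by auto

lemma expansion:
 assumes "X : carrier_mat n n"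
 shows "lin_comb B (coef X) (%b. b) = X"
proof -
 have "mono_map (%b. b) (%_. 1) X = X"
  using e_carrier by (intro lin_map_ext[OF lin_map_mono_map lin_map_id _ assms]) (auto simp: mono_map_e intro!: eq_matI)
 then show ?thesis using assms by (simp add: mono_map_def)
qed

lemma mat_coef_eqI:
 assumes "X : carrier_mat n n" "Y : carrier_mat n n" "!!b. b : B ==> coef X b = coef Y b"
 shows "X = Y"
proof -
 have "lin_comb B (coef X) (%b. b) = lin_comb B (coef Y) (%b. b)"
  unfolding lin_comb_def
  by (intro arg_cong[of _ _ "mat n n"] ext) (auto intro!: sum.cong simp: assms(3))
 then show ?thesis using expansion assms by simp
qed

lemma coef_single:
 assumes "X : carrier_mat n n" "a : B" "!!b. b : B ==> b ~= a ==> coef X b = 0"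
 shows "X = coef X a \<star> e a"
 using assms e_carrier[OF assms(2)] by (intro mat_coef_eqI) (auto simp: coef_smult coef_e)

text \<open>Turns a component of the grading, given as a hull of basis matrices, into vanishing
  conditions on coordinates.\<close>

lemma hull_eq_coef_zero:
 assumes "A <= B"
 shows "mat_subspace n hull (e ` A) = {X : carrier_mat n n. \<forall>b\<in>B - A. coef X b = 0}"
proof (rule hull_unique)
 show "e ` A <= {X : carrier_mat n n. \<forall>b\<in>B - A. coef X b = 0}"
  using assms e_carrier by (auto simp: coef_e subset_iff)
 show "mat_subspace n {X : carrier_mat n n. \<forall>b\<in>B - A. coef X b = 0}"
  by (rule mat_subspaceI) (auto simp: coef_add coef_smult coef_0)
 fix V assume V: "e ` A <= V" "mat_subspace n V"
 show "{X : carrier_mat n n. \<forall>b\<in>B - A. coef X b = 0} <= V"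
 proof
  fix X assume X: "X : {X : carrier_mat n n. \<forall>b\<in>B - A. coef X b = 0}"
  have "lin_comb B (coef X) (%b. b) : V"
   using X V by (intro lin_comb_in_subspace fin) auto
  then show "X : V" using X by (simp add: expansion)
 qed
qed

lemma mono_map_Bij:
 assumes F: "bij_betw F B B" and w: "!!b. b : B ==> w b ~= 0"
 shows "mono_map F w : Bij (carrier_mat n n)"
proof -
 define F' where "F' = inv_into B F"
 \<comment> \<open>The inverse of a monomial map is monomial for the inverse relabelling; the weight
   to invert is the one at the source label.\<close>
 define w' where "w' b = inverse (w (F' b))" for b
 have F': "F b : B" "F' b : B" "F' (F b) = b" "F (F' b) = b" if "b : B" for b
  using F that unfolding F'_def
  by (auto simp: bij_betw_def inv_into_f_f f_inv_into_f intro: inv_into_into)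
 have 1: "mono_map F' w' (mono_map F w X) = X" if "X : carrier_mat n n" for X
 proof (rule lin_map_ext[OF lin_map_comp[OF lin_map_mono_map lin_map_mono_map] lin_map_id _ that])
  fix b assume b: "b : B"
  show "mono_map F' w' (mono_map F w (e b)) = e b"
   using b w[OF b] F'[OF b] e_carrier[OF b] e_carrier[of "F b"] F'(2)[of "F b"]
   by (simp add: mono_map_e lin_mapD(3)[OF lin_map_mono_map] w'_def)
     (auto intro!: eq_matI simp flip: mult.assoc)
 qed
 have 2: "mono_map F w (mono_map F' w' X) = X" if "X : carrier_mat n n" for X
 proof (rule lin_map_ext[OF lin_map_comp[OF lin_map_mono_map lin_map_mono_map] lin_map_id _ that])
  fix b assume b: "b : B"
  show "mono_map F w (mono_map F' w' (e b)) = e b"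
   using b w[of "F' b"] F'[OF b] e_carrier[OF b] e_carrier[of "F' b"] 
   by (simp add: mono_map_e lin_mapD(3)[OF lin_map_mono_map] w'_def)
     (auto intro!: eq_matI simp flip: mult.assoc)
 qed
 have "bij_betw (mono_map F w) (carrier_mat n n) (carrier_mat n n)"
  by (rule bij_betw_byWitness[where f' = "mono_map F' w'"]) (auto simp: 1 2 lin_mapD(1)[OF lin_map_mono_map])
 then show ?thesis by (simp add: Bij_def mono_map_def)
qed

text \<open>Both sides are bilinear; the extension from basis matrices is made in the second
  variable and then in the first.\<close>

lemma mult_ext:
 assumes lin: "lin_map n ps"
  and mult: "!!b b'. b : B ==> b' : B ==> ps (e b * e b') = ps (e b) * ps (e b')"
  and X: "X : carrier_mat n n" and Y: "Y : carrier_mat n n"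
 shows "ps (X * Y) = ps X * ps Y"
proof -
 have 1: "ps (e b * Y) = ps (e b) * ps Y" if b: "b : B" and Y: "Y : carrier_mat n n" for b Y
 proof (rule lin_map_ext[OF _ _ _ Y])
  show "lin_map n (%Y. ps (e b * Y))"
   using e_carrier[OF b] lin by (auto simp: lin_map_def mat_linear_def mult_add_distrib_mat[of _ n n _ n] mult_smult_distrib[of _ n n _ n])
  show "lin_map n (%Y. ps (e b) * ps Y)"
   using lin_mapD(1)[OF lin e_carrier[OF b]] lin
   by (auto simp: lin_map_def mat_linear_def mult_add_distrib_mat[of _ n n _ n] mult_smult_distrib[of _ n n _ n])
 qed (use mult b in auto)
 show ?thesis
 proof (rule lin_map_ext[OF _ _ _ X])
  show "lin_map n (%X. ps (X * Y))"
   using Y lin by (auto simp: lin_map_def mat_linear_def add_mult_distrib_mat[of _ n n] mult_smult_assoc_mat[of _ n n])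
  show "lin_map n (%X. ps X * ps Y)"
   using lin_mapD(1)[OF lin Y] lin
   by (auto simp: lin_map_def mat_linear_def add_mult_distrib_mat[of _ n n] mult_smult_assoc_mat[of _ n n])
 qed (use 1 Y in auto)
qed

lemma mono_map_automorphism:
 assumes F: "bij_betw F B B" and w: "!!b. b : B ==> w b ~= 0"
  and mult: "!!b b'. b : B ==> b' : B ==>
   mono_map F w (e b * e b') = mono_map F w (e b) * mono_map F w (e b')"
 shows "mono_map F w : automorphisms n"
 using mono_map_Bij[OF F w] lin_map_mono_map[of F w] mult_ext[OF lin_map_mono_map mult]
 by (simp add: automorphisms_def lin_map_def)

end

section \<open>Quadratic forms and cocycles on elementary abelian 2-groups\<close>

locale elementary_2_group = comm_group T for T :: "'t monoid" (structure) +
 assumes fin_T: "finite (carrier T)"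
  and sq: "t : carrier T ==> t \<otimes> t = \<one>"
begin

abbreviation "\<T> == carrier T"


lemma cancel2 [simp]: "t : \<T> ==> u : \<T> ==> t \<otimes> (t \<otimes> u) = u"
 by (simp add: sq flip: m_assoc)

lemma inv_self [simp]: "t : \<T> ==> inv t = t"
 by (simp add: sq inv_equality)

lemmas ac = m_assoc m_comm m_lcomm sq

lemma mult_eq_one: "t : \<T> ==> u : \<T> ==> t \<otimes> u = \<one> \<longleftrightarrow> t = u"
 by (metis inv_equality inv_self sq)

lemma translate_bij: "v : \<T> ==> bij_betw (%t. t \<otimes> v) \<T> \<T>"
 by (rule bij_betw_byWitness[where f' = "%t. t \<otimes> v"]) (auto simp: m_assoc sq)

lemma sum_translate: "v : \<T> ==> (\<Sum>t\<in>\<T>. f (t \<otimes> v)) = (\<Sum>t\<in>\<T>. f t)"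
 by (rule sum.reindex_bij_betw[OF translate_bij])

text \<open>A symmetric 2-cocycle describes an abelian extension of \<open>T\<close> by the
  multiplicative group of the field, which is divisible, so the extension splits. Concretely, a
  solution on a maximal subgroup H is extended to the coset of any missing element with the help of
  a square root.\<close>

lemma symmetric_cocycle_split:
 fixes c :: "'t => 't => 'f::alg_closed_field"
 assumes nz: "!!x y. x : \<T> ==> y : \<T> ==> c x y ~= 0"
  and sym: "!!x y. x : \<T> ==> y : \<T> ==> c x y = c y x"
  and coc: "!!x y z. x : \<T> ==> y : \<T> ==> z : \<T> ==>
   c x y * c (x \<otimes> y) z = c x (y \<otimes> z) * c y z"
 obtains d where "!!t. t : \<T> ==> d t ~= 0"
  "!!x y. x : \<T> ==> y : \<T> ==> c x y * d (x \<otimes> y) = d x * d y"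
proof -
 define good where "good H \<longleftrightarrow> H <= \<T> & \<one> : H & (\<forall>x\<in>H. \<forall>y\<in>H. x \<otimes> y : H) &
  (\<exists>d. \<forall>x\<in>H. d x ~= 0 & (\<forall>y\<in>H. c x y * d (x \<otimes> y) = d x * d y))" for H
 have "good {\<one>}" unfolding good_def using nz by (auto intro!: exI[of _ "%_. c \<one> \<one>"])
 moreover have "finite (Collect good)"
  by (rule finite_subset[OF _ finite_Pow_iff[THEN iffD2, OF fin_T]]) (auto simp: good_def)
 ultimately obtain H where H: "good H" and max: "!!H'. good H' ==> H <= H' ==> H = H'"
  using finite_has_maximal[of "Collect good"] by auto
 have HT: "H <= \<T>" and H1: "\<one> : H" and Hm: "!!x y. x : H ==> y : H ==> x \<otimes> y : H"
  using H by (auto simp: good_def)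
 obtain d where dd: "\<forall>x\<in>H. d x ~= 0 & (\<forall>y\<in>H. c x y * d (x \<otimes> y) = d x * d y)"
  using H unfolding good_def by blast
 then have d0: "!!x. x : H ==> d x ~= 0"
  and d: "!!x y. x : H ==> y : H ==> c x y * d (x \<otimes> y) = d x * d y"
  by blast+
 have "\<T> <= H"
 proof
  fix x assume x: "x : \<T>"
  show "x : H"
  proof (rule ccontr)
   assume xH: "x \<notin> H"
   define H' where "H' = {y : \<T>. y : H | y \<otimes> x : H}"
   \<comment> \<open>The intended value at \<open>x\<close>: as \<open>x\<close> squares to \<one>,
     the equation at the pair (x, x) prescribes the square of that value.\<close>
   obtain z where z: "z ^ 2 = c x x * d \<one>" using nth_root_exists[of 2] by auto
   have z0: "z ~= 0" using z d0[OF H1] nz[OF x x] by auto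
   \<comment> \<open>On the coset H x the value is forced by the equation for the pair (h,
     x).\<close>
   define d' where "d' y = (if y : H then d y else d (y \<otimes> x) * z / c (y \<otimes> x) x)" for y
   have notH: "h \<otimes> x \<notin> H" if h: "h : H" for h
   proof
    assume "h \<otimes> x : H"
    then have "h \<otimes> (h \<otimes> x) : H" using Hm h by blast
    then show False using xH x h HT by (auto simp: subset_iff)
   qed
   have d'x: "d' (h \<otimes> x) = d h * z / c h x" if h: "h : H" for h
    using notH[OF h] h HT x by (auto simp: d'_def m_assoc sq subset_iff)
   \<comment> \<open>The cocycle is not normalised, so the constant \<open>c \<one> \<one>\<close>
     has to be carried along.\<close>
   have d1: "d \<one> = c \<one> \<one>" using d[OF H1 H1] d0[OF H1] by simp
   have c1: "c \<one> k = c \<one> \<one>" if k: "k : \<T>" for k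
    using coc[of \<one> \<one> k] k nz[of \<one> k] by simp
   have cases: "y : H | (\<exists>h\<in>H. y = h \<otimes> x)" if "y : H'" for y
    using that x unfolding H'_def by (auto simp: m_assoc sq intro!: bexI[of _ "y \<otimes> x"])
   have 1: "c h (k \<otimes> x) * d' (h \<otimes> (k \<otimes> x)) = d' h * d' (k \<otimes> x)" if h: "h : H" and k: "k : H" for h k
   proof -
    have hk: "h : \<T>" "k : \<T>" using h k HT by auto
    have "c h (k \<otimes> x) * d' (h \<otimes> (k \<otimes> x)) = c h (k \<otimes> x) * (d (h \<otimes> k) * z / c (h \<otimes> k) x)"
     using d'x[OF Hm[OF h k]] hk x by (simp add: m_assoc)
    also have "... = c h k * d (h \<otimes> k) * z / c k x"
     using coc[OF hk x] nz[of k x] nz[of "h \<otimes> k" x] hk x by (simp add: field_simps)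
    also have "... = d' h * d' (k \<otimes> x)"
     using d[OF h k] d'x[OF k] h by (simp add: d'_def)
    finally show ?thesis .
   qed
   have 2: "c (h \<otimes> x) (k \<otimes> x) * d' ((h \<otimes> x) \<otimes> (k \<otimes> x)) = d' (h \<otimes> x) * d' (k \<otimes> x)"
    if h: "h : H" and k: "k : H" for h k
   proof -
    have hk: "h : \<T>" "k : \<T>" using h k HT by auto
    have "c h x * c (h \<otimes> x) (k \<otimes> x) = c h k * c x (k \<otimes> x)"
     using coc[of h x "k \<otimes> x"] hk x m_lcomm[of x k x] by (simp add: sq)
    moreover have "c x (k \<otimes> x) * c k x = c \<one> \<one> * c x x"
     using coc[of x x k] hk x c1[of k] sym[of x k] by (simp add: sq m_comm mult.commute)
    ultimately have "c h x * c k x * c (h \<otimes> x) (k \<otimes> x) = c h k * c x x * c \<one> \<one>"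
     by (metis mult.assoc mult.commute mult.left_commute)
    then have e: "c (h \<otimes> x) (k \<otimes> x) = c h k * c x x * c \<one> \<one> / (c h x * c k x)"
     using nz[of h x] nz[of k x] hk x by (simp add: field_simps)
    have "(h \<otimes> x) \<otimes> (k \<otimes> x) = h \<otimes> k" using hk x by (simp add: m_ac sq)
    then have "c (h \<otimes> x) (k \<otimes> x) * d' ((h \<otimes> x) \<otimes> (k \<otimes> x)) = (c h k * d (h \<otimes> k)) * (c x x * d \<one>) / (c h x * c k x)"
     using Hm[OF h k] by (simp add: d'_def e d1)
    also have "... = d' (h \<otimes> x) * d' (k \<otimes> x)"
     unfolding d'x[OF h] d'x[OF k] d[OF h k] z[symmetric] by (simp add: power2_eq_square)
    finally show ?thesis .
   qed
   have 3: "c y w * d' (y \<otimes> w) = d' y * d' w" if y: "y : H'" and w: "w : H'" for y w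
   proof -
    have yw: "y : \<T>" "w : \<T>" using y w by (auto simp: H'_def)
    consider "y : H" "w : H" | h where "h : H" "y : H" "w = h \<otimes> x" | h where "h : H" "w : H" "y = h \<otimes> x"
     | h k where "h : H" "k : H" "y = h \<otimes> x" "w = k \<otimes> x"
     using cases[OF y] cases[OF w] by blast
    then show ?thesis
    proof cases
     case 1
     then show ?thesis using d Hm by (simp add: d'_def)
    next
     case 3
     then show ?thesis using 1[of w h] sym[OF yw] m_comm[OF yw] by (simp add: mult.commute)
    qed (use 1 2 in auto)
   qed
   have "good H'"
    unfolding good_def
   proof (intro conjI ballI exI[of _ d'])
    fix y w assume yw: "y : H'" "w : H'"
    then have yw': "y : \<T>" "w : \<T>" by (auto simp: H'_def)
    consider "y : H" "w : H" | "y : H" "w \<otimes> x : H" | "y \<otimes> x : H" "w : H" | "y \<otimes> x : H" "w \<otimes> x : H"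
     using yw by (auto simp: H'_def)
    then have "y \<otimes> w : H | y \<otimes> w \<otimes> x : H"
    proof cases
     case 1 then show ?thesis using Hm by blast
    next
     case 2 then show ?thesis using Hm[of y "w \<otimes> x"] yw' x by (simp add: m_assoc)
    next
     case 3 then show ?thesis using Hm[of "y \<otimes> x" w] yw' x by (simp add: m_ac)
    next
     case 4 then show ?thesis using Hm[of "y \<otimes> x" "w \<otimes> x"] yw' x by (simp add: m_ac sq)
    qed
    then show "y \<otimes> w : H'" using yw' by (simp add: H'_def)
   next
    fix y assume "y : H'"
    then show "d' y ~= 0" using d0 z0 nz x HT by (auto simp: d'_def H'_def)
   qed (use 3 H1 in \<open>auto simp: H'_def\<close>)
   moreover have "H <= H'" using HT by (auto simp: H'_def)
   moreover have "x : H'" using x H1 by (simp add: H'_def sq)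
   ultimately show False using max[of H'] xH by blast
  qed
 qed
 then show ?thesis using that d0 d by blast
qed

end

locale bicharacter_group = elementary_2_group T for T :: "'t monoid" (structure) +
 fixes \<beta> :: "'t => 't => 'f::field"
 assumes beta: "nondeg_alternating_bicharacter T \<beta>"
  and two: "(2::'f) ~= 0"
  and card_T: "of_nat (card \<T>) ~= (0::'f)"
begin

lemma beta_pm: "u : \<T> ==> v : \<T> ==> \<beta> u v = 1 | \<beta> u v = -1"
 and beta_mult_l: "u : \<T> ==> v : \<T> ==> w : \<T> ==> \<beta> (u \<otimes> v) w = \<beta> u w * \<beta> v w"
 and beta_mult_r: "u : \<T> ==> v : \<T> ==> w : \<T> ==> \<beta> u (v \<otimes> w) = \<beta> u v * \<beta> u w"
 and beta_self: "u : \<T> ==> \<beta> u u = 1"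
 and beta_nondeg: "u : \<T> ==> (!!v. v : \<T> ==> \<beta> u v = 1) ==> u = \<one>"
 using beta unfolding nondeg_alternating_bicharacter_def by auto

lemma beta_sq [simp]: "u : \<T> ==> v : \<T> ==> \<beta> u v * \<beta> u v = 1"
 using beta_pm[of u v] by auto

lemma beta_nz: "u : \<T> ==> v : \<T> ==> \<beta> u v ~= 0"
 using beta_pm[of u v] by auto

lemma beta_one_l [simp]: "v : \<T> ==> \<beta> \<one> v = 1"
 using beta_mult_l[of \<one> \<one> v] beta_sq[of \<one> v] by simp

lemma beta_one_r [simp]: "v : \<T> ==> \<beta> v \<one> = 1"
 using beta_mult_r[of v \<one> \<one>] beta_sq[of v \<one>] by simp

lemma one_neq_minus: "(1::'f) ~= -1"
proof
 assume "(1::'f) = -1"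
 then have "(1::'f) + 1 = 0" by (metis add.right_inverse)
 then show False using two by simp
qed

lemma beta_sym: "u : \<T> ==> v : \<T> ==> \<beta> u v = \<beta> v u"
proof -
 assume uv: "u : \<T>" "v : \<T>"
 have "\<beta> (u \<otimes> v) (u \<otimes> v) = (\<beta> u u * \<beta> u v) * (\<beta> v u * \<beta> v v)"
  using uv by (simp add: beta_mult_l beta_mult_r)
 then have "\<beta> u v * \<beta> v u = 1" using uv by (simp add: beta_self)
 then show ?thesis using beta_pm[OF uv] beta_pm[of v u] uv one_neq_minus by auto
qed

text \<open>Translation by \<open>v\<close> permutes the terms and multiplies the sum by
  \<open>ka v\<close>, which differs from 1.\<close>

lemma character_sum_zero:
 assumes chi: "!!u v. u : \<T> ==> v : \<T> ==> ka (u \<otimes> v) = ka u * (ka v :: 'f)"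
  and v: "v : \<T>" "ka v ~= 1"
 shows "(\<Sum>t\<in>\<T>. ka t) = 0"
proof -
 have "(\<Sum>t\<in>\<T>. ka t) = (\<Sum>t\<in>\<T>. ka (t \<otimes> v))"
  by (rule sum_translate[symmetric, OF v(1)])
 also have "... = (\<Sum>t\<in>\<T>. ka t) * ka v"
  using v by (simp add: chi sum_distrib_right)
 finally have "(\<Sum>t\<in>\<T>. ka t) * (ka v - 1) = 0" by (simp add: algebra_simps)
 then show ?thesis using v by simp
qed

text \<open>Fourier inversion: the transforms \<open>S u\<close> add up to \<open>card \<T>\<close>
  times \<open>ka \<one>\<close>, which is nonzero in the field, so one of them does not vanish. The
  product character it sums is then trivial.\<close>

lemma character_is_beta:
 assumes chi: "!!u v. u : \<T> ==> v : \<T> ==> ka (u \<otimes> v) = ka u * (ka v :: 'f)"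
  and chi0: "!!u. u : \<T> ==> ka u * ka u = 1"
 obtains u where "u : \<T>" "!!t. t : \<T> ==> \<beta> u t = ka t"
proof -
 define S where "S u = (\<Sum>t\<in>\<T>. ka t * \<beta> u t)" for u
 have "\<exists>u\<in>\<T>. S u ~= 0"
 proof (rule ccontr)
  assume "~ ?thesis"
  then have "0 = (\<Sum>u\<in>\<T>. S u)" by simp
  also have "... = (\<Sum>t\<in>\<T>. ka t * (\<Sum>u\<in>\<T>. \<beta> u t))"
   unfolding S_def by (subst sum.swap) (simp add: sum_distrib_left)
  also have "... = (\<Sum>t\<in>\<T>. if t = \<one> then of_nat (card \<T>) * ka \<one> else 0)"
  proof (rule sum.cong[OF refl])
   fix t assume t: "t : \<T>"
   show "ka t * (\<Sum>u\<in>\<T>. \<beta> u t) = (if t = \<one> then of_nat (card \<T>) * ka \<one> else 0)"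
   proof (cases "t = \<one>")
    case False
    then obtain v where v: "v : \<T>" "\<beta> t v ~= 1" using beta_nondeg t by blast
    then have "(\<Sum>u\<in>\<T>. \<beta> u t) = 0"
     using t beta_sym[OF t v(1)] by (intro character_sum_zero[of "%u. \<beta> u t" v]) (auto simp: beta_mult_l)
    then show ?thesis using False by simp
   qed simp
  qed
  also have "... = of_nat (card \<T>) * ka \<one>" using fin_T by (simp add: sum.delta)
  finally show False using card_T chi0[of \<one>] by auto
 qed
 then obtain u where u: "u : \<T>" "S u ~= 0" by blast
 have "ka t * \<beta> u t = 1" if "t : \<T>" for t
  using character_sum_zero[of "%t. ka t * \<beta> u t" t] u that
  by (auto simp: S_def chi beta_mult_r mult_ac)
 then have "\<beta> u t = ka t" if "t : \<T>" for t
  using chi0[OF that] beta_sq[OF u(1) that] that by (metis mult.assoc mult.right_neutral)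
 then show ?thesis using that u by blast
qed

lemma beta_inj: "u : \<T> ==> v : \<T> ==> (!!t. t : \<T> ==> \<beta> u t = \<beta> v t) ==> u = v"
 using beta_nondeg[of "u \<otimes> v"] mult_eq_one[of u v] by (simp add: beta_mult_l)

lemma Aut_T_D:
 assumes "au : carrier (Aut_T T \<beta>)"
 shows "t : \<T> ==> au t : \<T>"
  "t : \<T> ==> u : \<T> ==> au (t \<otimes> u) = au t \<otimes> au u"
  "bij_betw au \<T> \<T>" "au : extensional \<T>"
  "t : \<T> ==> u : \<T> ==> \<beta> (au t) (au u) = \<beta> t u"
 using assms unfolding Aut_T_def AutoGroup_def auto_def hom_def Bij_def by auto

lemma Aut_T_one: "au : carrier (Aut_T T \<beta>) ==> au \<one> = \<one>"
 using Aut_T_D(2)[of au \<one> \<one>] Aut_T_D(1)[of au \<one>] by (simp add: sq)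

lemma Aut_T_inj: "au : carrier (Aut_T T \<beta>) ==> t : \<T> ==> u : \<T> ==> au t = au u \<longleftrightarrow> t = u"
 using Aut_T_D(3)[of au] by (auto simp: bij_betw_def inj_on_def)

lemma Aut_T_I:
 assumes "!!t. t : \<T> ==> au t : \<T>" "au : extensional \<T>"
  "!!t u. t : \<T> ==> u : \<T> ==> au (t \<otimes> u) = au t \<otimes> au u"
  "!!t u. t : \<T> ==> u : \<T> ==> \<beta> (au t) (au u) = \<beta> t u"
  "inj_on au \<T>"
 shows "au : carrier (Aut_T T \<beta>)"
proof -
 have "au ` \<T> = \<T>"
  using assms(1,5) fin_T by (intro endo_inj_surj) auto
 then show ?thesis
  using assms unfolding Aut_T_def AutoGroup_def auto_def hom_def Bij_def bij_betw_def by auto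
qed

lemma Aut_T_mult:
 assumes "au : carrier (Aut_T T \<beta>)" "ga : carrier (Aut_T T \<beta>)"
 shows "au \<otimes>\<^bsub>Aut_T T \<beta>\<^esub> ga = compose \<T> au ga"
 using assms unfolding Aut_T_def AutoGroup_def auto_def by (simp add: BijGroup_def)

lemma Aut_T_compose:
 assumes "au : carrier (Aut_T T \<beta>)" "ga : carrier (Aut_T T \<beta>)"
 shows "compose \<T> au ga : carrier (Aut_T T \<beta>)"
 using assms Aut_T_D[OF assms(1)] Aut_T_D[OF assms(2)]
 by (intro Aut_T_I) (auto simp: compose_def inj_on_def Aut_T_inj)

lemma one_Aut_T: "\<one>\<^bsub>Aut_T T \<beta>\<^esub> = (\<lambda>t\<in>\<T>. t)" "(\<lambda>t\<in>\<T>. t) : carrier (Aut_T T \<beta>)"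
 by (simp add: Aut_T_def AutoGroup_def BijGroup_def) (rule Aut_T_I, auto)

end

locale quadratic_group = bicharacter_group T \<beta> for T :: "'t monoid" (structure) and \<beta> :: "'t => 't => 'f::field" +
 fixes Q :: "'t => 'f"
 assumes Q_pm: "t : \<T> ==> Q t = 1 | Q t = -1"
  and Q_mult: "t : \<T> ==> u : \<T> ==> Q (t \<otimes> u) = Q t * Q u * \<beta> t u"
begin

lemma Q_sq [simp]: "t : \<T> ==> Q t * Q t = 1"
 using Q_pm[of t] by auto

lemma Q_one [simp]: "Q \<one> = 1"
 using Q_mult[of \<one> \<one>] by simp

text \<open>The element t_alpha for an abstract form \<open>Q\<close>; \<open>t_elem_tw\<close>
  identifies it with \<open>t_elem\<close>.\<close>

definition tw :: "('t => 't) => 't"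
 where "tw au = (THE u. u : \<T> & (\<forall>t\<in>\<T>. \<beta> u t = Q (inv_into \<T> au t) * Q t))"

text \<open>Two quadratic forms with the same polar form differ by a character, and nondegeneracy
  writes that character as \<open>\<beta> u\<close>. The two forms are \<open>Q\<close> and its
  transport along \<open>au\<close>.\<close>

lemma tw:
 assumes au: "au : carrier (Aut_T T \<beta>)"
 shows "tw au : \<T>" "t : \<T> ==> \<beta> (tw au) (au t) = Q t * Q (au t)"
proof -
 let ?i = "inv_into \<T> au"
 have im: "au ` \<T> = \<T>" using Aut_T_D(3)[OF au] by (simp add: bij_betw_def)
 have i: "?i t : \<T>" "au (?i t) = t" "?i (au t) = t" if "t : \<T>" for t
  using that im Aut_T_D(3)[OF au] by (auto simp: inv_into_into f_inv_into_f bij_betw_def)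
 have i_mult: "?i (t \<otimes> u) = ?i t \<otimes> ?i u" if "t : \<T>" "u : \<T>" for t u
  using i[OF that(1)] i[OF that(2)] i(3)[of "?i t \<otimes> ?i u"] Aut_T_D(2)[OF au, of "?i t" "?i u"] by simp
 have i_beta: "\<beta> (?i t) (?i u) = \<beta> t u" if "t : \<T>" "u : \<T>" for t u
  using i[OF that(1)] i[OF that(2)] Aut_T_D(5)[OF au, of "?i t" "?i u"] by simp
 have sq1: "x * y * (x * y) = 1" if "x * x = 1" "y * y = 1" for x y :: 'f
  using that by (metis mult.assoc mult.commute mult.right_neutral)
 have "Q (?i (t \<otimes> u)) * Q (t \<otimes> u) = Q (?i t) * Q t * (Q (?i u) * Q u)"
  if t: "t : \<T>" and u: "u : \<T>" for t u
 proof -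
  have "Q (?i (t \<otimes> u)) * Q (t \<otimes> u) = Q (?i t) * Q t * (Q (?i u) * Q u) * (\<beta> t u * \<beta> t u)"
   using t u by (simp add: i_mult Q_mult i i_beta mult_ac)
  then show ?thesis using beta_sq[OF t u] by simp
 qed
 then obtain u where u: "u : \<T>" "!!t. t : \<T> ==> \<beta> u t = Q (?i t) * Q t"
  using character_is_beta[of "%t. Q (?i t) * Q t"] i sq1 Q_sq by (smt (verit, ccfv_threshold))
 have "tw au = u"
  unfolding tw_def
 proof (rule the_equality)
  fix v assume "v : \<T> & (\<forall>t\<in>\<T>. \<beta> v t = Q (?i t) * Q t)"
  then show "v = u" using u by (intro beta_inj) auto
 qed (use u in auto)
 then show "tw au : \<T>" "t : \<T> ==> \<beta> (tw au) (au t) = Q t * Q (au t)"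
  using u i Aut_T_D(1)[OF au] by auto
qed

lemma tw_unique:
 assumes au: "au : carrier (Aut_T T \<beta>)" and u: "u : \<T>" "!!t. t : \<T> ==> \<beta> u (au t) = Q t * Q (au t)"
 shows "tw au = u"
proof (rule beta_inj[OF tw(1)[OF au] u(1)])
 fix t assume "t : \<T>"
 then obtain v where "v : \<T>" "t = au v" using Aut_T_D(3)[OF au] by (auto simp: bij_betw_def)
 then show "\<beta> (tw au) t = \<beta> u t" using tw(2)[OF au] u(2) by simp
qed

text \<open>The crossed homomorphism law. It makes alpha -> (t_alpha, alpha) a homomorphism into the
  semidirect product of T with Aut(T, beta).\<close>

lemma tw_compose:
 assumes au: "au : carrier (Aut_T T \<beta>)" and ga: "ga : carrier (Aut_T T \<beta>)"
 shows "tw (compose \<T> au ga) = tw au \<otimes> au (tw ga)"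
proof (rule tw_unique[OF Aut_T_compose[OF au ga]])
 show "tw au \<otimes> au (tw ga) : \<T>" using tw(1) Aut_T_D(1) au ga by simp
 fix t assume t: "t : \<T>"
 have g: "ga t : \<T>" using Aut_T_D(1)[OF ga t] .
 have "\<beta> (tw au \<otimes> au (tw ga)) (au (ga t)) = \<beta> (tw au) (au (ga t)) * \<beta> (tw ga) (ga t)"
  using tw(1)[OF au] tw(1)[OF ga] Aut_T_D(1,5)[OF au] g by (simp add: beta_mult_l)
 also have "... = (Q (ga t) * Q (ga t)) * (Q t * Q (au (ga t)))"
  using tw(2)[OF au g] tw(2)[OF ga t] by (simp add: mult_ac)
 also have "... = Q t * Q (au (ga t))" using g by simp
 finally show "\<beta> (tw au \<otimes> au (tw ga)) (compose \<T> au ga t) = Q t * Q (compose \<T> au ga t)"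
  using t by (simp add: compose_def)
qed

text \<open>A nonzero Gauss sum distinguishes the form from its translates, hence controls the form at \<open>t\<^sub>\<alpha>\<close>.\<close>

lemma Gauss_sum_nz: "(\<Sum>t\<in>\<T>. Q t) ~= 0"
proof -
 have "(\<Sum>t\<in>\<T>. Q t) * (\<Sum>t\<in>\<T>. Q t) = (\<Sum>t\<in>\<T>. \<Sum>v\<in>\<T>. Q t * Q v)"
  by (simp add: sum_product)
 \<comment> \<open>The shift of v by t replaces the product of forms by Q(v) beta(v, t). The sums
   over t then vanish except at v = \<one>, and the square of the Gauss sum is the order of
   T.\<close>
 also have "... = (\<Sum>t\<in>\<T>. \<Sum>v\<in>\<T>. Q t * Q (v \<otimes> t))"
  by (rule sum.cong) (simp_all add: sum_translate[where f = "%v. Q _ * Q v"])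
 also have "... = (\<Sum>t\<in>\<T>. \<Sum>v\<in>\<T>. Q v * \<beta> v t)"
 proof (intro sum.cong refl)
  fix t v assume tv: "t : \<T>" "v : \<T>"
  have "Q t * Q (v \<otimes> t) = (Q t * Q t) * (Q v * \<beta> v t)" using tv by (simp add: Q_mult mult_ac)
  then show "Q t * Q (v \<otimes> t) = Q v * \<beta> v t" using tv by simp
 qed
 also have "... = (\<Sum>v\<in>\<T>. Q v * (\<Sum>t\<in>\<T>. \<beta> v t))"
  by (subst sum.swap) (simp add: sum_distrib_left)
 also have "... = (\<Sum>v\<in>\<T>. if v = \<one> then of_nat (card \<T>) else 0)"
 proof (rule sum.cong[OF refl])
  fix t assume t: "t : \<T>"
  show "Q t * (\<Sum>u\<in>\<T>. \<beta> t u) = (if t = \<one> then of_nat (card \<T>) else 0)"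
  proof (cases "t = \<one>")
   case False
   then obtain v where v: "v : \<T>" "\<beta> t v ~= 1" using beta_nondeg t by blast
   then have "(\<Sum>u\<in>\<T>. \<beta> t u) = 0"
    using t by (intro character_sum_zero[of "%u. \<beta> t u" v]) (auto simp: beta_mult_r)
   then show ?thesis using False by simp
  qed simp
 qed
 also have "... = of_nat (card \<T>)" using fin_T by (simp add: sum.delta)
 finally show ?thesis using card_T by auto
qed

text \<open>Completing the square: the choice of t_alpha gives Q(t) = Q(alpha(t) t_alpha)
  Q(t_alpha), and t -> alpha(t) t_alpha permutes T. Summation yields G = G Q(t_alpha) for the Gauss
  sum G, which is nonzero.\<close>

lemma Q_tw:
 assumes au: "au : carrier (Aut_T T \<beta>)"
 shows "Q (tw au) = 1" 
proof -
 have "(\<Sum>t\<in>\<T>. Q t) = (\<Sum>t\<in>\<T>. Q (au t \<otimes> tw au) * Q (tw au))"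
 proof (rule sum.cong[OF refl])
  fix t assume t: "t : \<T>"
  have at: "au t : \<T>" using Aut_T_D(1)[OF au t] .
  have "Q (au t \<otimes> tw au) * Q (tw au) = Q (au t) * (Q (tw au) * Q (tw au)) * \<beta> (tw au) (au t)"
   using at tw(1)[OF au] by (simp add: Q_mult beta_sym mult_ac)
  also have "... = (Q (au t) * Q (au t)) * Q t" using tw[OF au] t by (simp add: mult_ac)
  finally show "Q t = Q (au t \<otimes> tw au) * Q (tw au)" using at by simp
 qed
 also have "... = (\<Sum>t\<in>\<T>. Q (t \<otimes> tw au)) * Q (tw au)"
  using sum.reindex_bij_betw[OF Aut_T_D(3)[OF au], of "%t. Q (t \<otimes> tw au)"] by (simp flip: sum_distrib_right)
 also have "... = (\<Sum>t\<in>\<T>. Q t) * Q (tw au)"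
  by (simp add: sum_translate[OF tw(1)[OF au]])
 finally show ?thesis using Gauss_sum_nz by simp
qed

end

section \<open>Cosets of the diagonal\<close>

text \<open>A coset of the diagonal, named by a representative. Maps of tuples are computed on
  representatives and carried to cosets by \<open>diag_coset_image\<close>.\<close>

definition diag_coset :: "nat => ('x, 'm) monoid_scheme => (nat => 'x) => (nat => 'x) set"
 where "diag_coset m K w = (%z. \<lambda>i\<in>{1..m}. z \<otimes>\<^bsub>K\<^esub> w i) ` carrier K"

context
 fixes K :: "('x, 'm) monoid_scheme" and m :: nat
 assumes K: "comm_group K"
begin

interpretation K: comm_group K by (rule K)

lemma comm_group_product_group: "comm_group (product_group {1..m} (%_. K))"
proof -
 have "group (product_group {1..m} (%_. K))" by simp
 then show ?thesis
  by (rule group.group_comm_groupI) (auto simp: K.m_comm PiE_iff intro!: restrict_ext)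
qed

lemma diag_subgroup: "subgroup ((%x. \<lambda>i\<in>{1..m}. x) ` carrier K) (product_group {1..m} (%_. K))"
proof (rule group.subgroupI)
 show "inv\<^bsub>product_group {1..m} (%_. K)\<^esub> d : (%x. \<lambda>i\<in>{1..m}. x) ` carrier K"
  if d: "d : (%x. \<lambda>i\<in>{1..m}. x) ` carrier K" for d
 proof -
  obtain x where x: "d = (\<lambda>i\<in>{1..m}. x)" "x : carrier K" by (rule imageE[OF d])
  then have "inv\<^bsub>product_group {1..m} (%_. K)\<^esub> d = (\<lambda>i\<in>{1..m}. inv\<^bsub>K\<^esub> x)"
   by (subst inv_product_group) (auto intro!: restrict_ext)
  then show ?thesis using x by auto
 qed
 show "d \<otimes>\<^bsub>product_group {1..m} (%_. K)\<^esub> e : (%x. \<lambda>i\<in>{1..m}. x) ` carrier K"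
  if d: "d : (%x. \<lambda>i\<in>{1..m}. x) ` carrier K" and e: "e : (%x. \<lambda>i\<in>{1..m}. x) ` carrier K" for d e
 proof -
  obtain x where "d = (\<lambda>i\<in>{1..m}. x)" "x : carrier K" by (rule imageE[OF d])
  moreover obtain y where "e = (\<lambda>i\<in>{1..m}. y)" "y : carrier K" by (rule imageE[OF e])
  ultimately show ?thesis by (intro image_eqI[of _ _ "x \<otimes>\<^bsub>K\<^esub> y"]) (auto intro!: restrict_ext)
 qed
qed auto

lemma comm_group_tuples_mod_diag: "comm_group (tuples_mod_diag m K)"
 unfolding tuples_mod_diag_def
 using comm_group.abelian_FactGroup[OF comm_group_product_group diag_subgroup] .

lemma diag_coset_eq: "diag_coset m K w
  = ((%x. \<lambda>i\<in>{1..m}. x) ` carrier K) #>\<^bsub>product_group {1..m} (%_. K)\<^esub> w"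
 unfolding diag_coset_def r_coset_def by (auto intro!: restrict_ext)

lemma carrier_tuples_mod_diag:
 "carrier (tuples_mod_diag m K) = diag_coset m K ` ({1..m} \<rightarrow>\<^sub>E carrier K)"
 unfolding tuples_mod_diag_def carrier_FactGroup by (simp add: diag_coset_eq)

lemma mult_diag_coset:
 assumes "v : {1..m} \<rightarrow>\<^sub>E carrier K" "w : {1..m} \<rightarrow>\<^sub>E carrier K"
 shows "diag_coset m K v \<otimes>\<^bsub>tuples_mod_diag m K\<^esub> diag_coset m K w
  = diag_coset m K (\<lambda>i\<in>{1..m}. v i \<otimes>\<^bsub>K\<^esub> w i)"
proof -
 have "normal ((%x. \<lambda>i\<in>{1..m}. x) ` carrier K) (product_group {1..m} (%_. K))"
  using comm_group.subgroup_imp_normal[OF comm_group_product_group diag_subgroup] .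
 from normal.rcos_sum[OF this, of v w] show ?thesis
  using assms unfolding tuples_mod_diag_def diag_coset_eq by simp
qed

lemma one_tuples_mod_diag: "\<one>\<^bsub>tuples_mod_diag m K\<^esub> = diag_coset m K (\<lambda>i\<in>{1..m}. \<one>\<^bsub>K\<^esub>)"
proof -
 have "(%x. \<lambda>i\<in>{1..m}. x) ` carrier K = (%z. \<lambda>i\<in>{1..m}. z \<otimes>\<^bsub>K\<^esub> (\<lambda>i\<in>{1..m}. \<one>\<^bsub>K\<^esub>) i) ` carrier K"
  by (intro image_cong refl restrict_ext) auto
 then show ?thesis unfolding tuples_mod_diag_def diag_coset_def by simp
qed

lemma diag_coset_self: "w : {1..m} \<rightarrow>\<^sub>E carrier K ==> w : diag_coset m K w"
proof -
 assume w: "w : {1..m} \<rightarrow>\<^sub>E carrier K"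
 have "w i = (\<lambda>i\<in>{1..m}. \<one>\<^bsub>K\<^esub> \<otimes>\<^bsub>K\<^esub> w i) i" for i
  using PiE_mem[OF w, of i] PiE_arb[OF w, of i] by (cases "i : {1..m}") simp_all
 then show ?thesis unfolding diag_coset_def by blast
qed

lemma diag_coset_shift:
 assumes w: "w : {1..m} \<rightarrow>\<^sub>E carrier K" and z: "z : carrier K"
 shows "diag_coset m K (\<lambda>i\<in>{1..m}. z \<otimes>\<^bsub>K\<^esub> w i) = diag_coset m K w"
proof -
 have "(\<lambda>i\<in>{1..m}. y \<otimes>\<^bsub>K\<^esub> (\<lambda>i\<in>{1..m}. z \<otimes>\<^bsub>K\<^esub> w i) i) : diag_coset m K w" if "y : carrier K" for y
  unfolding diag_coset_def
  using w z that by (intro image_eqI[of _ _ "y \<otimes>\<^bsub>K\<^esub> z"]) (auto intro!: restrict_ext simp: K.m_assoc PiE_iff)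
 moreover have "(\<lambda>i\<in>{1..m}. y \<otimes>\<^bsub>K\<^esub> w i) : diag_coset m K (\<lambda>i\<in>{1..m}. z \<otimes>\<^bsub>K\<^esub> w i)" if "y : carrier K" for y
  unfolding diag_coset_def
  using w z that by (intro image_eqI[of _ _ "y \<otimes>\<^bsub>K\<^esub> inv\<^bsub>K\<^esub> z"])
   (auto intro!: restrict_ext simp: K.m_assoc PiE_iff simp flip: K.m_assoc[of "inv\<^bsub>K\<^esub> z" z])
 ultimately show ?thesis unfolding diag_coset_def[of m K w] diag_coset_def[of m K "restrict _ _"] by blast
qed

lemma diag_coset_memD: "v : diag_coset m K w ==> \<exists>z\<in>carrier K. v = (\<lambda>i\<in>{1..m}. z \<otimes>\<^bsub>K\<^esub> w i)"
 unfolding diag_coset_def by auto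

end

section \<open>Hyperbolic pairs of indices\<close>

locale weyl_data = bicharacter_group T \<beta> for T :: "'t monoid" (structure) and \<beta> :: "'t => 't => 'f::field" +
 fixes q s :: nat and \<tau> :: "nat => 't"
 assumes tau: "i : {1..q} ==> \<tau> i : \<T>"
  and qs: "~ (q = 0 & s = 0)"
begin

text \<open>
 The label \<open>(i, t, j)\<close> stands for \<open>E i j \<otimes> X t\<close>; up to a scalar \<open>\<phi>\<close> maps it to the label
 \<open>bphi (i, t, j)\<close>, where \<open>star\<close> exchanges the two members of a hyperbolic pair of indices.
\<close>

definition "K = {1..q + 2 * s}"
text \<open>Coordinates on the indices beyond \<open>q\<close>: the pair \<open>j\<close>, and
  whether the second member is meant. \<open>pr\<close> and \<open>sec\<close> recover them.\<close>

definition "hyp j c = q + 2 * j - 1 + (if c then 1 else 0)" for j and c :: bool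
definition "star i = (if i <= q then i else if odd (i - q) then i + 1 else i - 1)"
definition "sec i \<longleftrightarrow> q < i & even (i - q)"
definition "pr i = (i - q + 1) div 2"
text \<open>Both members of a pair share a class. The classes are the q + s positions of the tuples
  in T^(q+s) and Z_2^(q+s).\<close>

definition "cl i = (if i <= q then i else q + pr i)"
definition "tt i = (if i <= q then \<tau> i else \<one>)"
definition "B = K \<times> \<T> \<times> K"
abbreviation "idB == \<one>\<^bsub>BijGroup B\<^esub>"
definition "bphi = (%(i, t, j). (star j, t \<otimes> tt i \<otimes> tt j, star i))"
text \<open>What alpha on the degrees of D, followed by conjugation with a monomial matrix whose
  entries are multiples of X_{u_i}, does to labels. No inverse appears because T has exponent
  two.\<close>

definition "Fm P au u = (\<lambda>(i, t, j)\<in>B. (P i, u i \<otimes> au t \<otimes> u j, P j))"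

lemma hyp_simps [simp]:
 assumes "1 <= j"
 shows "star (hyp j c) = hyp j (~ c)" "sec (hyp j c) = c" "pr (hyp j c) = j" "cl (hyp j c) = q + j"
  "~ hyp j c <= q" "tt (hyp j c) = \<one>" "hyp j c ~= 0" "hyp j c : K \<longleftrightarrow> j <= s"
proof -
 obtain k where "j = Suc k" using assms by (cases j) auto
 then have h: "hyp j c = q + (2 * k + (if c then 2 else 1))" and j: "j = Suc k" by (simp_all add: hyp_def)
 show "star (hyp j c) = hyp j (~ c)"
  by (simp add: star_def h) (simp add: hyp_def j)
 show "sec (hyp j c) = c" by (simp add: sec_def h)
 show pr: "pr (hyp j c) = j" unfolding pr_def h by (cases c) (simp_all add: j)
 show "cl (hyp j c) = q + j" using pr by (simp add: cl_def h)
 show "~ hyp j c <= q" by (simp add: h)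
 then show "tt (hyp j c) = \<one>" by (simp add: tt_def)
 show "hyp j c ~= 0" by (simp add: h)
 show "hyp j c : K \<longleftrightarrow> j <= s" unfolding K_def h by (cases c) (auto simp: j)
qed

lemma hyp_inject: "1 <= j ==> 1 <= k ==> hyp j c = hyp k d \<longleftrightarrow> j = k & c = d"
proof
 assume jk: "1 <= j" "1 <= k" and eq: "hyp j c = hyp k d"
 have "pr (hyp j c) = pr (hyp k d)" "sec (hyp j c) = sec (hyp k d)" by (simp_all only: eq)
 then show "j = k & c = d" using jk by simp
qed simp

lemma low_simps [simp]:
 assumes "i <= q"
 shows "star i = i" "~ sec i" "cl i = i" "tt i = \<tau> i"
 using assms by (auto simp: star_def sec_def cl_def tt_def)

lemma K_cases:
 assumes "i : K"
 obtains (low) "i : {1..q}" | (hyp) j c where "j : {1..s}" "i = hyp j c"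
proof (cases "i <= q")
 case True
 then show ?thesis using assms low by (auto simp: K_def)
next
 case False
 then obtain k where k: "i = q + Suc k" by (auto simp: not_le dest: less_imp_Suc_add)
 define j where "j = Suc (k div 2)"
 have "k < 2 * s" using assms k by (simp add: K_def)
 then have "j : {1..s}" by (simp add: j_def)
 moreover have "i = hyp j (odd k)"
  using odd_two_times_div_two_succ[of k] even_two_times_div_two[of k] by (cases "odd k") (simp_all add: hyp_def j_def k)
 ultimately show ?thesis using hyp by blast
qed

lemma low_K: "i : {1..q} ==> i : K"
 by (auto simp: K_def)

lemma star_K [simp]: "i : K ==> star i : K"
 by (erule K_cases) (auto simp: low_K)

lemma star_star [simp]: "i : K ==> star (star i) = i"
 by (erule K_cases) auto

lemma cl_star [simp]: "i : K ==> cl (star i) = cl i"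
 by (erule K_cases) auto

lemma tt_star [simp]: "i : K ==> tt (star i) = tt i"
 by (erule K_cases) auto

lemma tt_T [simp]: "i : K ==> tt i : \<T>"
 by (erule K_cases) (auto simp: tau)

lemma cl_range: "i : K ==> cl i : {1..q + s}"
 by (erule K_cases) auto

lemma cl_eq: "i : K ==> j : K ==> cl i = cl j \<longleftrightarrow> j = i | j = star i"
 by (erule K_cases; erule K_cases) (auto simp: hyp_inject)

lemma cl_surj: "m : {1..q + s} ==> \<exists>i\<in>K. cl i = m & ~ sec i"
proof (cases "m <= q")
 case True
 then show "m : {1..q + s} ==> ?thesis" using low_K by (intro bexI[of _ m]) auto
next
 case False
 then show "m : {1..q + s} ==> ?thesis" by (intro bexI[of _ "hyp (m - q) False"]) auto
qed

lemma K_nonempty: "K ~= {}" using qs by (auto simp: K_def)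

lemma fin_K: "finite K" by (simp add: K_def)

lemma fin_B: "finite B" using fin_T by (simp add: B_def fin_K)

lemma B_iff [simp]: "(i, t, j) : B \<longleftrightarrow> i : K & t : \<T> & j : K"
 by (simp add: B_def)

lemma bphi_B: "b : B ==> bphi b : B"
 by (auto simp: bphi_def B_def)

lemma bphi_bphi: "b : B ==> bphi (bphi b) = b"
 by (auto simp: bphi_def B_def ac)

lemma Fm_app [simp]: "i : K ==> t : \<T> ==> j : K ==> Fm P au u (i, t, j) = (P i, u i \<otimes> au t \<otimes> u j, P j)"
 by (simp add: Fm_def)

text \<open>The slack \<open>z\<close> is the diagonal copy of T: it enters each middle entry twice
  and cancels. Hence T^(q+s) acts through its quotient by T.\<close>

lemma Fm_cong:
 assumes "!!i. i : K ==> P i = P' i" "!!t. t : \<T> ==> au t = au' t" "!!t. t : \<T> ==> au' t : \<T>"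
  "z : \<T>" "!!i. i : K ==> u' i : \<T>" "!!i. i : K ==> u i = z \<otimes> u' i"
 shows "Fm P au u = Fm P' au' u'"
 unfolding Fm_def
proof (rule restrict_ext)
 fix b assume "b : B"
 then obtain i t j where b: "b = (i, t, j)" "i : K" "t : \<T>" "j : K" by (auto simp: B_def)
 have "(z \<otimes> u' i) \<otimes> au' t \<otimes> (z \<otimes> u' j) = u' i \<otimes> au' t \<otimes> u' j"
  using b assms(3-5) by (simp add: ac)
 then show "(case b of (i, t, j) => (P i, u i \<otimes> au t \<otimes> u j, P j)) = (case b of (i, t, j) => (P' i, u' i \<otimes> au' t \<otimes> u' j, P' j))"
  using b assms by simp
qed

lemma Fm_Bij:
 assumes P: "bij_betw P K K" and au: "au : carrier (Aut_T T \<beta>)" and u: "!!i. i : K ==> u i : \<T>"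
 shows "Fm P au u : Bij B"
proof -
 have PK: "P i : K" if "i : K" for i using P that by (auto simp: bij_betw_def)
 have Pinj: "P i = P j \<longleftrightarrow> i = j" if "i : K" "j : K" for i j
  using P that by (auto simp: bij_betw_def inj_on_def)
 have can: "x \<otimes> y = x \<otimes> z \<longleftrightarrow> y = z" "y \<otimes> x = z \<otimes> x \<longleftrightarrow> y = z"
  if "x : \<T>" "y : \<T>" "z : \<T>" for x y z using that by simp_all
 have "inj_on (Fm P au u) B"
  using Aut_T_D(1)[OF au] u by (auto simp: inj_on_def B_def Pinj can Aut_T_inj[OF au])
 moreover have "Fm P au u ` B <= B"
  using PK u Aut_T_D(1)[OF au] by (auto simp: B_def)
 ultimately have "bij_betw (Fm P au u) B B"
  using fin_B by (simp add: bij_betw_def endo_inj_surj)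
 then show ?thesis by (simp add: Bij_def Fm_def)
qed

lemma Fm_compose:
 assumes "!!i. i : K ==> P' i : K" "au : carrier (Aut_T T \<beta>)" "au' : carrier (Aut_T T \<beta>)"
  "!!i. i : K ==> u i : \<T>" "!!i. i : K ==> u' i : \<T>"
 shows "compose B (Fm P au u) (Fm P' au' u') = Fm (P \<circ> P') (compose \<T> au au') (%i. u (P' i) \<otimes> au (u' i))"
 unfolding compose_def[of B] Fm_def[of "P \<circ> P'"]
 using assms Aut_T_D[OF assms(2)] Aut_T_D[OF assms(3)]
 by (intro restrict_ext) (auto simp: B_def compose_def m_assoc m_comm m_lcomm)

section \<open>The restriction homomorphism\<close>

definition "restr_spec te p \<longleftrightarrow> p permutes {1..q} &
  (\<forall>i\<in>{1..q}. \<tau> (p i) = te (\<tau> i)) &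
  (\<forall>i\<in>{1..q}. \<forall>j\<in>{1..q}. \<tau> i = \<tau> j & i < j --> p i < p j)"

text \<open>Position inside the block of equal entries, counted from 0. Value and rank together
  determine an index.\<close>

definition "rank i = card {j : {1..q}. \<tau> j = \<tau> i & j < i}"

lemma rank_less: "i : {1..q} ==> \<tau> i = \<tau> j ==> i < j ==> rank i < rank j"
 unfolding rank_def by (rule psubset_card_mono) auto

lemma rank_eq:
 assumes "i : {1..q}" "j : {1..q}" "\<tau> i = \<tau> j" "rank i = rank j"
 shows "i = j"
 using rank_less[of i j] rank_less[of j i] assms by (metis less_irrefl linorder_neqE_nat)

text \<open>The earlier members of the block of \<open>p i\<close> are exactly the images of the
  earlier members of the block of \<open>i\<close>, since \<open>p\<close> is increasing on blocks
  and \<open>te\<close> keeps distinct values apart.\<close>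

lemma rank_restr:
 assumes p: "restr_spec te p" and te: "inj_on te \<T>" and i: "i : {1..q}"
 shows "rank (p i) = rank i"
proof -
 have perm: "p permutes {1..q}" using p by (simp add: restr_spec_def)
 have spec: "\<tau> (p j) = te (\<tau> j)" if "j : {1..q}" for j using p that by (simp add: restr_spec_def)
 have mono: "p j < p k" if "j : {1..q}" "k : {1..q}" "\<tau> j = \<tau> k" "j < k" for j k
  using p that by (simp add: restr_spec_def)
 have "{j : {1..q}. \<tau> j = \<tau> (p i) & j < p i} = p ` {j : {1..q}. \<tau> j = \<tau> i & j < i}"
 proof (intro equalityI subsetI)
  fix k assume k: "k : {j : {1..q}. \<tau> j = \<tau> (p i) & j < p i}"
  define j where "j = inv' p k"
  have j: "p j = k" "j : {1..q}"
   using k perm permutes_inverses(1)[OF perm] permutes_in_image[OF permutes_inv[OF perm]] by (auto simp: j_def)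
  have "te (\<tau> j) = te (\<tau> i)" using k spec[OF i] spec[OF j(2)] j(1) by simp
  then have eq: "\<tau> j = \<tau> i" using te tau[OF i] tau[OF j(2)] by (auto dest: inj_onD)
  have "j < i"
  proof (rule ccontr)
   assume "~ j < i"
   then consider "i = j" | "i < j" by linarith
   then have "p i <= p j" using mono[OF i j(2) eq[symmetric]] by cases simp_all
   then show False using k j by simp
  qed
  then show "k : p ` {j : {1..q}. \<tau> j = \<tau> i & j < i}" using j eq by (intro image_eqI[of _ _ j]) auto
 next
  fix k assume "k : p ` {j : {1..q}. \<tau> j = \<tau> i & j < i}"
  then obtain j where j: "k = p j" "j : {1..q}" "\<tau> j = \<tau> i" "j < i" by auto
  have "p j : {1..q}" using permutes_in_image[OF perm, of j] j(2) by simp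
  then show "k : {j : {1..q}. \<tau> j = \<tau> (p i) & j < p i}"
   using j mono[OF j(2) i] spec[OF j(2)] spec[OF i] by simp
 qed
 then show ?thesis unfolding rank_def
  by (simp add: card_image inj_on_subset[OF permutes_inj[OF perm]])
qed

text \<open>Value and rank of \<open>p i\<close> are both prescribed, so the definite description in
  \<open>restriction\<close> has no second candidate.\<close>

lemma restriction_eq:
 assumes p: "restr_spec te p" and te: "inj_on te \<T>"
 shows "restriction q \<tau> te = p"
 unfolding restriction_def
proof (rule the_equality)
 fix p' assume "p' permutes {1..q} & (\<forall>i\<in>{1..q}. \<tau> (p' i) = te (\<tau> i)) &
  (\<forall>i\<in>{1..q}. \<forall>j\<in>{1..q}. \<tau> i = \<tau> j & i < j --> p' i < p' j)"
 then have p': "restr_spec te p'" by (simp add: restr_spec_def)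
 have perm: "p permutes {1..q}" "p' permutes {1..q}" using p p' by (simp_all add: restr_spec_def)
 show "p' = p"
 proof
  fix i
  show "p' i = p i"
  proof (cases "i : {1..q}")
   case True
   have "rank (p' i) = rank (p i)" using rank_restr[OF p te True] rank_restr[OF p' te True] by simp
   moreover have "p' i : {1..q}" "p i : {1..q}"
    using True permutes_in_image[OF perm(1)] permutes_in_image[OF perm(2)] by blast+
   moreover have "\<tau> (p' i) = \<tau> (p i)" using p p' True by (simp add: restr_spec_def)
   ultimately show ?thesis using rank_eq by blast
  next
   case False
   then show ?thesis using perm by (simp add: permutes_def)
  qed
 qed
qed (use p in \<open>simp add: restr_spec_def\<close>)

lemma count_Sigma: "count (image_mset f (mset_set {1..q})) y = card {i : {1..q}. f i = y}"
proof -
 have "count (image_mset f (mset_set {1..q})) y = (\<Sum>i\<in>f -` {y} \<inter> {1..q}. 1)"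
  unfolding count_image_mset by (intro sum.cong) auto
 also have "... = card {i : {1..q}. f i = y}" by (simp add: vimage_def Int_def conj_commute)
 finally show ?thesis .
qed

text \<open>The ranks in a block fill an initial segment of the naturals, and stability of the
  multiset makes the blocks of x and of \<open>te\<close> x equally large. So an index with the new
  value and the old rank exists.\<close>

lemma restr_exists:
 assumes te: "inj_on te \<T>" and \<Sigma>: "image_mset te (Sigma_mset q \<tau>) = Sigma_mset q \<tau>"
 shows "\<exists>p. restr_spec te p"
proof -
 have card_eq: "card {k : {1..q}. \<tau> k = te (\<tau> i)} = card {k : {1..q}. \<tau> k = \<tau> i}" if i: "i : {1..q}" for i
 proof -
  have "card {k : {1..q}. \<tau> k = te (\<tau> i)} = count (Sigma_mset q \<tau>) (te (\<tau> i))"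
   by (simp only: Sigma_mset_def count_Sigma)
  also have "... = count (image_mset (te \<circ> \<tau>) (mset_set {1..q})) (te (\<tau> i))"
   using \<Sigma> by (simp add: Sigma_mset_def multiset.map_comp)
  also have "... = card {k : {1..q}. \<tau> k = \<tau> i}"
   unfolding count_Sigma using te tau i by (intro arg_cong[of _ _ card]) (auto simp: inj_on_def)
  finally show ?thesis .
 qed
 have "\<exists>k\<in>{1..q}. \<tau> k = te (\<tau> i) & rank k = rank i" if i: "i : {1..q}" for i
 proof -
  let ?A = "{k : {1..q}. \<tau> k = te (\<tau> i)}"
  have inj: "inj_on rank ?A" using rank_eq by (auto intro!: inj_onI)
  have rl: "rank k < card {j : {1..q}. \<tau> j = \<tau> k}" if "k : {1..q}" for k
   unfolding rank_def by (rule psubset_card_mono) (use that in auto)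
  have "rank ` ?A <= {..<card ?A}"
  proof
   fix x assume "x : rank ` ?A"
   then obtain k where "k : {1..q}" "\<tau> k = te (\<tau> i)" "x = rank k" by auto
   then show "x : {..<card ?A}" using rl[of k] by simp
  qed
  then have "rank ` ?A = {..<card ?A}"
   using card_image[OF inj] by (intro card_subset_eq) (simp_all only: finite_lessThan card_lessThan)
  moreover have "rank i < card ?A" using rl[OF i] card_eq[OF i] by simp
  ultimately have "rank i : rank ` ?A" by simp
  then show ?thesis by auto
 qed
 then obtain f where f: "!!i. i : {1..q} ==> f i : {1..q}" "!!i. i : {1..q} ==> \<tau> (f i) = te (\<tau> i)"
  "!!i. i : {1..q} ==> rank (f i) = rank i" by metis
 define p where "p i = (if i : {1..q} then f i else i)" for i
 have finj: "inj_on f {1..q}"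
 proof (rule inj_onI)
  fix i j assume ij: "i : {1..q}" "j : {1..q}" "f i = f j"
  then have "te (\<tau> i) = te (\<tau> j)" using f(2) by metis
  then have "\<tau> i = \<tau> j" using te tau ij by (auto dest: inj_onD)
  then show "i = j" using rank_eq ij f(3) by metis
 qed
 have "f ` {1..q} = {1..q}" using f(1) finj by (intro endo_inj_surj) auto
 then have "bij_betw f {1..q} {1..q}" using finj by (simp add: bij_betw_def)
 then have "bij_betw p {1..q} {1..q}" by (rule bij_betw_cong[THEN iffD1, rotated]) (simp add: p_def)
 then have "p permutes {1..q}" by (rule bij_imp_permutes) (auto simp: p_def)
 moreover have "p i < p j" if "i : {1..q}" "j : {1..q}" "\<tau> i = \<tau> j" "i < j" for i j
 proof (rule ccontr)
  assume "~ p i < p j"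
  then have "f j <= f i" using that by (simp add: p_def)
  moreover have "rank (f i) < rank (f j)" using f(3) that rank_less by simp
  moreover have "\<tau> (f j) = \<tau> (f i)" using f(2) that by simp
  ultimately show False using rank_less[of "f j" "f i"] f(1) that by (cases "f j = f i") auto
 qed
 ultimately have "restr_spec te p" using f by (simp add: restr_spec_def p_def)
 then show ?thesis by blast
qed

lemma nat_act_inj: "u : \<T> ==> au : carrier (Aut_T T \<beta>) ==> inj_on (nat_act T (u, au)) \<T>"
 using Aut_T_D(1)[of au] by (auto simp: inj_on_def nat_act_def Aut_T_inj)

abbreviation "rst c \<equiv> restriction q \<tau> (nat_act T c)"

lemma carrier_Aut_star_Sigma: "(u, au) : carrier (Aut_star_Sigma T \<beta> q \<tau>) \<longleftrightarrow>
  u : \<T> & au : carrier (Aut_T T \<beta>) & image_mset (nat_act T (u, au)) (Sigma_mset q \<tau>) = Sigma_mset q \<tau>"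
 by (simp add: Aut_star_Sigma_def semidirect_def)

lemma rst_spec:
 assumes "(u, au) : carrier (Aut_star_Sigma T \<beta> q \<tau>)"
 shows "restr_spec (nat_act T (u, au)) (rst (u, au))"
 using restr_exists[OF nat_act_inj, of u au] restriction_eq[OF _ nat_act_inj, of u au] assms
 by (auto simp: carrier_Aut_star_Sigma)

lemma Sigma_stableI:
 assumes p: "p permutes {1..q}" and te: "!!i. i : {1..q} ==> \<tau> (p i) = te (\<tau> i)"
 shows "image_mset te (Sigma_mset q \<tau>) = Sigma_mset q \<tau>"
proof -
 have "image_mset te (Sigma_mset q \<tau>) = image_mset (%i. te (\<tau> i)) (mset_set {1..q})"
  by (simp add: Sigma_mset_def multiset.map_comp comp_def)
 also have "... = image_mset (%i. \<tau> (p i)) (mset_set {1..q})"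
  using te by (intro image_mset_cong) auto
 also have "... = image_mset \<tau> (image_mset p (mset_set {1..q}))"
  by (simp add: multiset.map_comp comp_def)
 also have "image_mset p (mset_set {1..q}) = mset_set {1..q}"
  using image_mset_mset_set[OF permutes_inj_on[OF p, of "{1..q}"]] permutes_image[OF p] by simp
 finally show ?thesis by (simp add: Sigma_mset_def)
qed

end

text \<open>The reparametrisation \<open>ga\<close> admits maps that move the diagonal within
  itself, as alpha does.\<close>

lemma diag_coset_image:
 assumes "ga ` carrier K = carrier K"
  and "!!z. z : carrier K ==> h (\<lambda>i\<in>{1..m}. z \<otimes>\<^bsub>K\<^esub> w i) = (\<lambda>i\<in>{1..m}. ga z \<otimes>\<^bsub>K\<^esub> v i)"
 shows "h ` diag_coset m K w = diag_coset m K v"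
proof -
 have "h ` diag_coset m K w = (%z. \<lambda>i\<in>{1..m}. z \<otimes>\<^bsub>K\<^esub> v i) ` (ga ` carrier K)"
  unfolding diag_coset_def image_image by (intro image_cong refl assms(2))
 then show ?thesis unfolding assms(1) diag_coset_def .
qed

section \<open>The group of index permutations\<close>

context weyl_data
begin

text \<open>The inequality of truth values is an exclusive or: the member is switched when the entry
  of \<open>x\<close> is 1. That entry is read at the image pair, since in the product of (C, x),
  (p, sigma) and c the vector acts last.\<close>

definition "PP rh si x i = (if i <= q then rh i else hyp (si (pr i)) (sec i ~= (x (si (pr i)) = (1::int))))"

lemma PP_low [simp]: "i <= q ==> PP rh si x i = rh i" by (simp add: PP_def)

lemma PP_hyp [simp]: "1 <= j ==> PP rh si x (hyp j c) = hyp (si j) (c ~= (x (si j) = 1))" by (simp add: PP_def)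

lemma perm_range: "p permutes {1..m} ==> i : {1..m} ==> p i : {1..m}" for m :: nat
 using permutes_in_image[of p "{1..m}" i] by blast

lemma PP_K:
 assumes "rh permutes {1..q}" "si permutes {1..s}" "i : K"
 shows "PP rh si x i : K"
 using assms(3)
proof (cases rule: K_cases)
 case low
 then show ?thesis using perm_range[OF assms(1) low] low_K by simp
next
 case (hyp j c)
 then show ?thesis using perm_range[OF assms(2) hyp(1)] by simp
qed

lemma PP_star:
 assumes "rh permutes {1..q}" "si permutes {1..s}" "i : K"
 shows "PP rh si x (star i) = star (PP rh si x i)"
 using assms(3)
proof (cases rule: K_cases)
 case low
 then show ?thesis using perm_range[OF assms(1) low] by simp
next
 case (hyp j c)
 then show ?thesis using perm_range[OF assms(2) hyp(1)] by auto
qed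

lemma PP_bij:
 assumes rh: "rh permutes {1..q}" and si: "si permutes {1..s}"
 shows "bij_betw (PP rh si x) K K"
proof -
 have "inj_on (PP rh si x) K"
 proof (rule inj_onI)
  fix i k assume i: "i : K" and k: "k : K" and eq: "PP rh si x i = PP rh si x k"
  show "i = k" using i
  proof (cases rule: K_cases)
   case low
   note i_low = low
   show ?thesis using k
   proof (cases rule: K_cases)
    case low
    then show ?thesis using eq i_low permutes_inj[OF rh] by (auto dest: injD)
   next
    case (hyp j c)
    then show ?thesis using eq i_low perm_range[OF si hyp(1)] perm_range[OF rh i_low]
     by (metis PP_hyp PP_low atLeastAtMost_iff hyp_simps(5))
   qed
  next
   case (hyp j c)
   note i_hyp = hyp
   show ?thesis using k
   proof (cases rule: K_cases)
    case low
    then show ?thesis using eq i_hyp perm_range[OF si i_hyp(1)] perm_range[OF rh low]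
     by (metis PP_hyp PP_low atLeastAtMost_iff hyp_simps(5))
   next
    case (hyp j' c')
    then have e: "hyp (si j) (c ~= (x (si j) = 1)) = hyp (si j') (c' ~= (x (si j') = 1))"
     using eq i_hyp by simp
    have r: "1 <= si j" "1 <= si j'"
     using perm_range[OF si hyp(1)] perm_range[OF si i_hyp(1)] by auto
    have d: "si j = si j'" "(c ~= (x (si j) = 1)) = (c' ~= (x (si j') = 1))"
     by (rule conjunct1[OF iffD1[OF hyp_inject[OF r] e]], rule conjunct2[OF iffD1[OF hyp_inject[OF r] e]])
    then have "j = j'" using permutes_inj[OF si] by (simp add: inj_eq)
    moreover from this have "c = c'" using d(2) by (cases "x (si j') = 1") simp_all
    ultimately show ?thesis using i_hyp(2) hyp(2) by simp
   qed
  qed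
 qed
 moreover have "PP rh si x ` K <= K" using PP_K[OF rh si] by auto
 ultimately show ?thesis by (simp add: bij_betw_def endo_inj_surj fin_K)
qed

section \<open>Coordinates on the iterated semidirect product and its action on labels\<close>

definition "wel w x p si u au = (((diag_coset (q + s) T w, x), (p, si)), (u, au))"

text \<open>Admissible coordinates. The tuple \<open>w\<close> stays a representative and
  \<open>wel\<close> passes to its coset, so products can be computed entry by entry.\<close>

definition "wok w x p si u au \<longleftrightarrow> w : {1..q + s} \<rightarrow>\<^sub>E \<T> & x : {1..s} \<rightarrow>\<^sub>E {0, 1::int} &
  p permutes {1..q} & (\<forall>i\<in>{1..q}. \<tau> (p i) = \<tau> i) & si permutes {1..s} &
  (u, au) : carrier (Aut_star_Sigma T \<beta> q \<tau>)"

lemma comm_T: "comm_group T" by (rule comm_group_axioms)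

lemma Z2_carrier: "carrier (integer_mod_group 2) = {0, 1}"
 by (auto simp: carrier_integer_mod_group)

lemma inner_group_carrier: "carrier (inner_group T q s \<tau>) = {((diag_coset (q + s) T w, x), (p, si)) | w x p si.
  w : {1..q + s} \<rightarrow>\<^sub>E \<T> & x : {1..s} \<rightarrow>\<^sub>E {0, 1::int} &
  p permutes {1..q} & (\<forall>i\<in>{1..q}. \<tau> (p i) = \<tau> i) & si permutes {1..s}}"
 unfolding inner_group_def semidirect_def
 by (auto simp: carrier_tuples_mod_diag[OF comm_T] Z2_carrier Sym_Sigma_def sym_group_carrier)

lemma Weyl_carrier: "y : carrier (Weyl_star_group T \<beta> q s \<tau>) \<longleftrightarrow>
  (\<exists>w x p si u au. y = wel w x p si u au & wok w x p si u au)"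
 unfolding Weyl_star_group_def semidirect_def[of "inner_group _ _ _ _"] inner_group_carrier wel_def wok_def
 by (cases y) auto

text \<open>The tuple is read at the class of the image index because (C, x) acts last. The factor u
  is placed on second members: the two translations at a pair then multiply to u, as commutation
  with phi demands.\<close>

definition "theta y = (case y of (((C, x), (p, si)), c) =>
  let w = (SOME w. w : C); P = PP (p \<circ> rst c) si x in
   Fm P (snd c) (%i. w (cl (P i)) \<otimes> (if sec i then fst c else \<one>)))"

lemma wokD:
 assumes "wok w x p si u au"
 shows "m : {1..q + s} ==> w m : \<T>" "j : {1..s} ==> x j = 0 | x j = 1"
  "p permutes {1..q}" "i : {1..q} ==> \<tau> (p i) = \<tau> i" "si permutes {1..s}" "u : \<T>"
  "au : carrier (Aut_T T \<beta>)" "rst (u, au) permutes {1..q}"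
  "i : {1..q} ==> \<tau> (rst (u, au) i) = au (\<tau> i) \<otimes> u" "restr_spec (nat_act T (u, au)) (rst (u, au))"
  "(p \<circ> rst (u, au)) permutes {1..q}"
proof -
 have c: "(u, au) : carrier (Aut_star_Sigma T \<beta> q \<tau>)" using assms by (simp add: wok_def)
 from rst_spec[OF c] show rs: "restr_spec (nat_act T (u, au)) (rst (u, au))" .
 then show r: "rst (u, au) permutes {1..q}" "i : {1..q} ==> \<tau> (rst (u, au) i) = au (\<tau> i) \<otimes> u"
  by (auto simp: restr_spec_def nat_act_def)
 show p: "p permutes {1..q}" using assms by (simp add: wok_def)
 show "(p \<circ> rst (u, au)) permutes {1..q}" using permutes_compose[OF r(1) p] .
 show "m : {1..q + s} ==> w m : \<T>" "j : {1..s} ==> x j = 0 | x j = 1"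
  "i : {1..q} ==> \<tau> (p i) = \<tau> i" "si permutes {1..s}"
  using assms by (auto simp: wok_def PiE_iff)
 show "u : \<T>" "au : carrier (Aut_T T \<beta>)" using c by (auto simp: carrier_Aut_star_Sigma)
qed

abbreviation "Pw x p si u au \<equiv> PP (p \<circ> rst (u, au)) si x"
abbreviation "Uw w x p si u au \<equiv> (%i. w (cl (Pw x p si u au i)) \<otimes> (if sec i then u else \<one>))"

lemma Pw_K: "wok w x p si u au ==> i : K ==> Pw x p si u au i : K"
 using PP_K wokD(5,11) by blast

lemma Uw_T: "wok w x p si u au ==> i : K ==> Uw w x p si u au i : \<T>"
 using wokD(1)[OF _ cl_range[OF Pw_K]] wokD(6) by auto

text \<open>The representative chosen in \<open>theta\<close> differs from \<open>w\<close> by a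
  common factor, which \<open>Fm_cong\<close> absorbs.\<close>

lemma theta_wel:
 assumes ok: "wok w x p si u au"
 shows "theta (wel w x p si u au) = Fm (Pw x p si u au) au (Uw w x p si u au)"
proof -
 define v where "v = (SOME v. v : diag_coset (q + s) T w)"
 have wE: "w : {1..q + s} \<rightarrow>\<^sub>E \<T>" using ok by (simp add: wok_def)
 have "v : diag_coset (q + s) T w"
  unfolding v_def using someI[of "%v. v : diag_coset (q + s) T w", OF diag_coset_self[OF comm_T wE]] .
 then obtain z where z: "z : \<T>" "v = (\<lambda>i\<in>{1..q + s}. z \<otimes> w i)"
  using diag_coset_memD[OF comm_T] by blast
 have "Fm (Pw x p si u au) au (%i. v (cl (Pw x p si u au i)) \<otimes> (if sec i then u else \<one>))
   = Fm (Pw x p si u au) au (Uw w x p si u au)"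
 proof (rule Fm_cong[where z = z])
  fix i assume i: "i : K"
  then have "cl (Pw x p si u au i) : {1..q + s}" using cl_range[OF Pw_K[OF ok]] by blast
  then show "v (cl (Pw x p si u au i)) \<otimes> (if sec i then u else \<one>) = z \<otimes> Uw w x p si u au i"
   using z wokD(1,6)[OF ok] by (auto simp: m_assoc)
  show "Uw w x p si u au i : \<T>" using Uw_T[OF ok i] .
 qed (use z Aut_T_D(1)[OF wokD(7)[OF ok]] in auto)
 then show ?thesis unfolding theta_def wel_def v_def Let_def by (simp cong: if_cong)
qed

lemma theta_Bij: "wok w x p si u au ==> theta (wel w x p si u au) : Bij B"
 unfolding theta_wel using wokD Uw_T by (intro Fm_Bij PP_bij) auto

lemma upow: "u : \<T> ==> k = 0 | k = 1 ==> u [^] (k::int) = (if k = 1 then u else \<one>)"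
 by auto

text \<open>The joint effect on tuples of (u, alpha) followed by (p, sigma). With identities for
  \<open>p\<close> and \<open>si\<close> it is the effect of \<open>star_act\<close>.\<close>

definition "act_w p si u au w' x' = (\<lambda>m\<in>{1..q + s}. if m <= q then au (w' (inv' (rst (u, au)) (inv' p m)))
  else au (w' (q + inv' si (m - q))) \<otimes> (if x' (inv' si (m - q)) = (1::int) then u else \<one>))"

lemma inv_perm: "p permutes {1..m} ==> i : {1..m} ==> inv' p i : {1..m}" for m :: nat
 using perm_range permutes_inv by blast

lemma inv_perm_hyp: "si permutes {1..s} ==> m : {1..q + s} ==> ~ m <= q ==> inv' si (m - q) : {1..s}"
 by (rule inv_perm) auto

lemma star_act_wel:
 assumes ok: "wok w x p si u au" and w': "w' : {1..q + s} \<rightarrow>\<^sub>E \<T>" and x': "x' : {1..s} \<rightarrow>\<^sub>E {0, 1}"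
 shows "star_act T q s \<tau> (u, au) ((diag_coset (q + s) T w', x'), (p', si'))
  = ((diag_coset (q + s) T (act_w id id u au w' x'), x'), (rst (u, au) \<circ> p' \<circ> inv' (rst (u, au)), si'))"
proof -
 let ?f = "%w. \<lambda>i\<in>{1..q+s}. if i <= q then au (w (inv' (rst (u, au)) i))
              else au (w i) \<otimes> u [^] x' (i - q)"
 note au = wokD(7)[OF ok]
 have "?f ` diag_coset (q + s) T w' = diag_coset (q + s) T (act_w id id u au w' x')"
 proof (rule diag_coset_image[where ga = au])
  show "au ` \<T> = \<T>" using Aut_T_D(3)[OF au] by (simp add: bij_betw_def)
  fix z assume z: "z : \<T>"
  show "?f (\<lambda>i\<in>{1..q + s}. z \<otimes> w' i) = (\<lambda>i\<in>{1..q + s}. au z \<otimes> act_w id id u au w' x' i)"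
  proof (rule restrict_ext)
   fix i assume i: "i : {1..q + s}"
   show "(if i <= q then au ((\<lambda>i\<in>{1..q + s}. z \<otimes> w' i) (inv' (rst (u, au)) i))
     else au ((\<lambda>i\<in>{1..q + s}. z \<otimes> w' i) i) \<otimes> u [^] x' (i - q)) = au z \<otimes> act_w id id u au w' x' i"
   proof (cases "i <= q")
    case True
    then have "inv' (rst (u, au)) i : {1..q}" using inv_perm[OF wokD(8)[OF ok]] i by simp
    then have 1: "inv' (rst (u, au)) i : {1..q + s}" by simp
    then have "w' (inv' (rst (u, au)) i) : \<T>" using w' by (rule PiE_mem[rotated])
    then show ?thesis using True i z 1 Aut_T_D(2)[OF au] by (simp add: act_w_def)
   next
    case False
    then have j: "i - q : {1..s}" using i by auto
    then have 0: "x' (i - q) = 0 | x' (i - q) = 1" using x' by (auto simp: PiE_iff)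
    have "w' i : \<T>" using w' i by (rule PiE_mem)
    then show ?thesis using False i z Aut_T_D(1,2)[OF au] wokD(6)[OF ok]
     by (simp add: act_w_def upow[OF _ 0] m_assoc)
   qed
  qed
 qed
 then show ?thesis by (simp add: star_act_def Let_def cong: if_cong)
qed

lemma act_w_T:
 assumes ok: "wok w x p si u au" and ok': "wok w' x' p' si' u' au'" and m: "m : {1..q + s}"
 shows "act_w p si u au w' x' m : \<T>"
proof (cases "m <= q")
 case True
 then have "inv' (rst (u, au)) (inv' p m) : {1..q}"
  using inv_perm[OF wokD(8)[OF ok]] inv_perm[OF wokD(3)[OF ok]] m by simp
 then show ?thesis using m True wokD(1)[OF ok'] Aut_T_D(1)[OF wokD(7)[OF ok]] by (simp add: act_w_def)
next
 case False
 then have "inv' si (m - q) : {1..s}" using inv_perm_hyp[OF wokD(5)[OF ok] m] by simp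
 then show ?thesis using m False wokD(1)[OF ok'] Aut_T_D(1)[OF wokD(7)[OF ok]] wokD(6)[OF ok] by (simp add: act_w_def)
qed

lemma permute_diag:
 fixes L :: "('x, 'm) monoid_scheme"
 assumes p: "p permutes {1..q}" and si: "si permutes {1..s}"
 shows "permute_tuple q s p si ` diag_coset (q + s) L w = diag_coset (q + s) L (permute_tuple q s p si w)"
proof (rule diag_coset_image[where ga = "%z. z"])
 fix z assume "z : carrier L"
 show "permute_tuple q s p si (\<lambda>i\<in>{1..q + s}. z \<otimes>\<^bsub>L\<^esub> w i) = (\<lambda>i\<in>{1..q + s}. z \<otimes>\<^bsub>L\<^esub> permute_tuple q s p si w i)"
  unfolding permute_tuple_def
 proof (rule restrict_ext)
  fix i assume i: "i : {1..q + s}"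
  have 1: "i <= q ==> inv' p i : {1..q}" using inv_perm[OF p, of i] i by auto
  have 2: "~ i <= q ==> inv' si (i - q) : {1..s}" using inv_perm_hyp[OF si i] by simp
  show "(if i <= q then (\<lambda>i\<in>{1..q + s}. z \<otimes>\<^bsub>L\<^esub> w i) (inv' p i) else (\<lambda>i\<in>{1..q + s}. z \<otimes>\<^bsub>L\<^esub> w i) (q + inv' si (i - q)))
   = z \<otimes>\<^bsub>L\<^esub> (\<lambda>i\<in>{1..q + s}. if i <= q then w (inv' p i) else w (q + inv' si (i - q))) i"
   using i 1 2 by (cases "i <= q") auto
 qed
qed simp

text \<open>Equal entries go to equal entries, so monotonicity inside blocks survives composition.
  With uniqueness of the restriction this makes it a homomorphism.\<close>

lemma rst_compose:
 assumes ok: "wok w x p si u au" and ok': "wok w' x' p' si' u' au'"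
 shows "restr_spec (nat_act T (u \<otimes> au u', compose \<T> au au')) (rst (u, au) \<circ> rst (u', au'))"
 unfolding restr_spec_def
proof (intro conjI ballI impI)
 show "rst (u, au) \<circ> rst (u', au') permutes {1..q}"
  using permutes_compose[OF wokD(8)[OF ok'] wokD(8)[OF ok]] .
 fix i assume i: "i : {1..q}"
 have i': "rst (u', au') i : {1..q}" using perm_range[OF wokD(8)[OF ok'] i] .
 show "\<tau> ((rst (u, au) \<circ> rst (u', au')) i) = nat_act T (u \<otimes> au u', compose \<T> au au') (\<tau> i)"
  using wokD(9)[OF ok i'] wokD(9)[OF ok' i] tau[OF i] wokD(6)[OF ok'] wokD(6)[OF ok]
   Aut_T_D(1,2)[OF wokD(7)[OF ok]] Aut_T_D(1)[OF wokD(7)[OF ok']]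
  by (simp add: nat_act_def compose_def m_assoc m_comm m_lcomm)
 fix j assume j: "j : {1..q}" and ij: "\<tau> i = \<tau> j & i < j"
 have j': "rst (u', au') j : {1..q}" using perm_range[OF wokD(8)[OF ok'] j] .
 have "rst (u', au') i < rst (u', au') j" using wokD(10)[OF ok'] i j ij by (simp add: restr_spec_def)
 moreover have "\<tau> (rst (u', au') i) = \<tau> (rst (u', au') j)"
  using wokD(9)[OF ok' i] wokD(9)[OF ok' j] ij by simp
 ultimately show "(rst (u, au) \<circ> rst (u', au')) i < (rst (u, au) \<circ> rst (u', au')) j"
  using wokD(10)[OF ok] i' j' by (simp add: restr_spec_def)
qed

lemma rst_mult:
 assumes ok: "wok w x p si u au" and ok': "wok w' x' p' si' u' au'"
 shows "rst (u \<otimes> au u', compose \<T> au au') = rst (u, au) \<circ> rst (u', au')"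
 using rst_compose[OF ok ok']
 by (rule restriction_eq)
   (use nat_act_inj Aut_T_compose[OF wokD(7)[OF ok] wokD(7)[OF ok']] wokD(6)[OF ok] wokD(6)[OF ok'] Aut_T_D(1)[OF wokD(7)[OF ok]] in auto)

text \<open>The second claim is closure under the product, which is needed before the record is
  known to be a group.\<close>

lemma wel_mult:
 assumes ok: "wok w x p si u au" and ok': "wok w' x' p' si' u' au'"
 defines "w'' \<equiv> (\<lambda>m\<in>{1..q + s}. w m \<otimes> act_w p si u au w' x' m)"
  and "x'' \<equiv> (\<lambda>j\<in>{1..s}. (x j + x' (inv' si j)) mod 2)"
  and "p'' \<equiv> p \<circ> (rst (u, au) \<circ> p' \<circ> inv' (rst (u, au)))"
 shows "wel w x p si u au \<otimes>\<^bsub>Weyl_star_group T \<beta> q s \<tau>\<^esub> wel w' x' p' si' u' au'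
   = wel w'' x'' p'' (si \<circ> si') (u \<otimes> au u') (compose \<T> au au')" (is ?eq)
  and "wok w'' x'' p'' (si \<circ> si') (u \<otimes> au u') (compose \<T> au au')" (is ?ok)
proof -
 have wE: "w : {1..q + s} \<rightarrow>\<^sub>E \<T>" "w' : {1..q + s} \<rightarrow>\<^sub>E \<T>"
  and xE: "x : {1..s} \<rightarrow>\<^sub>E {0, 1}" "x' : {1..s} \<rightarrow>\<^sub>E {0, 1}" using ok ok' by (auto simp: wok_def)
 have pt: "permute_tuple q s p si (act_w id id u au w' x') = (\<lambda>m\<in>{1..q+s}. act_w p si u au w' x' m)"
  unfolding permute_tuple_def
 proof (rule restrict_ext)
  fix i assume i: "i : {1..q + s}"
  have 1: "i <= q ==> inv' p i : {1..q}" using inv_perm[OF wokD(3)[OF ok], of i] i by auto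
  have 2: "~ i <= q ==> inv' si (i - q) : {1..s}" using inv_perm_hyp[OF wokD(5)[OF ok] i] by simp
  show "(if i <= q then act_w id id u au w' x' (inv' p i) else act_w id id u au w' x' (q + inv' si (i - q)))
   = act_w p si u au w' x' i"
   using i 1 2 by (cases "i <= q") (auto simp: act_w_def)
 qed
 have aE: "(\<lambda>m\<in>{1..q+s}. act_w p si u au w' x' m) : {1..q + s} \<rightarrow>\<^sub>E \<T>"
  using act_w_T[OF ok ok'] by auto
 have cos: "diag_coset (q + s) T w \<otimes>\<^bsub>tuples_mod_diag (q + s) T\<^esub>
   permute_tuple q s p si ` diag_coset (q + s) T (act_w id id u au w' x') = diag_coset (q + s) T w''"
  unfolding permute_diag[OF wokD(3)[OF ok] wokD(5)[OF ok]] pt mult_diag_coset[OF comm_T wE(1) aE] w''_def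
  by (intro arg_cong[of _ _ "diag_coset (q + s) T"] restrict_ext) auto
 have x: "x \<otimes>\<^bsub>Z2_power s\<^esub> (\<lambda>j\<in>{1..s}. x' (inv' si j)) = x''"
  unfolding x''_def by (auto intro!: restrict_ext)
 have "(u', au') : carrier (Aut_star_Sigma T \<beta> q \<tau>)" "(u, au) : carrier (Aut_star_Sigma T \<beta> q \<tau>)"
  using ok ok' by (auto simp: wok_def)
 then have c: "(u, au) \<otimes>\<^bsub>Aut_star_Sigma T \<beta> q \<tau>\<^esub> (u', au') = (u \<otimes> au u', compose \<T> au au')"
  using Aut_T_mult[OF wokD(7)[OF ok] wokD(7)[OF ok']] by (simp add: Aut_star_Sigma_def semidirect_def)
 show ?eq
  unfolding wel_def Weyl_star_group_def semidirect_def[of "inner_group _ _ _ _"]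
  using c cos x star_act_wel[OF ok wE(2) xE(2), of p' si']
  by (simp add: inner_group_def semidirect_def sym_act_def Sym_Sigma_def sym_group_mult p''_def o_assoc del: mult_product_group)
 have rp: "rst (u, au) permutes {1..q}" using wokD(8)[OF ok] .
 have perm: "rst (u, au) \<circ> p' \<circ> inv' (rst (u, au)) permutes {1..q}"
  using permutes_compose[OF permutes_inv[OF rp] permutes_compose[OF wokD(3)[OF ok'] rp]] by (simp add: o_assoc)
 have "\<tau> (p'' i) = \<tau> i" if i: "i : {1..q}" for i
 proof -
  let ?i = "inv' (rst (u, au)) i"
  have i': "?i : {1..q}" using inv_perm[OF rp i] .
  have pi: "p' ?i : {1..q}" using perm_range[OF wokD(3)[OF ok'] i'] .
  have "\<tau> (p'' i) = \<tau> (rst (u, au) (p' ?i))"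
   using wokD(4)[OF ok perm_range[OF rp pi]] by (simp add: p''_def)
  also have "... = \<tau> (rst (u, au) ?i)" using wokD(9)[OF ok] pi i' wokD(4)[OF ok' i'] by simp
  also have "... = \<tau> i" using permutes_inverses(1)[OF rp] by simp
  finally show ?thesis .
 qed
 moreover have "(u \<otimes> au u', compose \<T> au au') : carrier (Aut_star_Sigma T \<beta> q \<tau>)"
  unfolding carrier_Aut_star_Sigma
 proof (intro conjI)
  show "image_mset (nat_act T (u \<otimes> au u', compose \<T> au au')) (Sigma_mset q \<tau>) = Sigma_mset q \<tau>"
   using rst_compose[OF ok ok'] by (intro Sigma_stableI) (auto simp: restr_spec_def)
  show "u \<otimes> au u' : \<T>" using wokD(6)[OF ok] wokD(6)[OF ok'] Aut_T_D(1)[OF wokD(7)[OF ok]] by simp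
  show "compose \<T> au au' : carrier (Aut_T T \<beta>)" using Aut_T_compose wokD(7)[OF ok] wokD(7)[OF ok'] .
 qed
 moreover have "x'' : {1..s} \<rightarrow>\<^sub>E {0, 1}"
 proof -
  have "(a + b) mod 2 = 0 | (a + b) mod 2 = 1" for a b :: int by presburger
  then show ?thesis unfolding x''_def by auto
 qed
 moreover have "w'' : {1..q + s} \<rightarrow>\<^sub>E \<T>"
  unfolding w''_def using act_w_T[OF ok ok'] wokD(1)[OF ok] by auto
 ultimately show ?ok
  using permutes_compose[OF perm wokD(3)[OF ok]] permutes_compose[OF wokD(5)[OF ok'] wokD(5)[OF ok]]
  by (simp add: wok_def p''_def)
qed

text \<open>Checked separately on diagonal indices and on pairs. The pairs account for the factor
  u^(x_j) of the action: when the inner element switches a pair, the factor u of the outer element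
  meets the other member, and the correction in \<open>act_w\<close> compensates for that.\<close>

lemma theta_mult:
 assumes ok: "wok w x p si u au" and ok': "wok w' x' p' si' u' au'"
 shows "theta (wel w x p si u au \<otimes>\<^bsub>Weyl_star_group T \<beta> q s \<tau>\<^esub> wel w' x' p' si' u' au')
  = compose B (theta (wel w x p si u au)) (theta (wel w' x' p' si' u' au'))"
proof -
 let ?pp = "rst (u, au)" and ?pp' = "rst (u', au')"
 let ?u = "u \<otimes> au u'" and ?au = "compose \<T> au au'" and ?si = "si \<circ> si'"
 define w'' where "w'' = (\<lambda>m\<in>{1..q + s}. w m \<otimes> act_w p si u au w' x' m)"
 define x'' where "x'' = (\<lambda>j\<in>{1..s}. (x j + x' (inv' si j)) mod 2)"
 define p'' where "p'' = p \<circ> (?pp \<circ> p' \<circ> inv' ?pp)"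
 have mult: "wel w x p si u au \<otimes>\<^bsub>Weyl_star_group T \<beta> q s \<tau>\<^esub> wel w' x' p' si' u' au' = wel w'' x'' p'' ?si ?u ?au"
  and ok'': "wok w'' x'' p'' ?si ?u ?au"
  using wel_mult[OF ok ok'] by (simp_all add: w''_def x''_def p''_def)
 note au = wokD(7)[OF ok] and au' = wokD(7)[OF ok'] and uT = wokD(6)[OF ok] and uT' = wokD(6)[OF ok']
 note si = wokD(5)[OF ok] and si' = wokD(5)[OF ok']
 have r: "rst (?u, ?au) = ?pp \<circ> ?pp'" by (rule rst_mult[OF ok ok'])
 have P_low: "(p'' \<circ> rst (?u, ?au)) i = p (?pp (p' (?pp' i)))" for i
  using permutes_inverses(2)[OF wokD(8)[OF ok]] by (simp add: p''_def r)
 have "Fm (Pw x'' p'' ?si ?u ?au) ?au (Uw w'' x'' p'' ?si ?u ?au)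
   = Fm (Pw x p si u au \<circ> Pw x' p' si' u' au') ?au
     (%i. Uw w x p si u au (Pw x' p' si' u' au' i) \<otimes> au (Uw w' x' p' si' u' au' i))"
 proof (rule Fm_cong[where z = "\<one>"])
  show "?au t : \<T>" if "t : \<T>" for t
   using that Aut_T_D(1)[OF au] Aut_T_D(1)[OF au'] by (simp add: compose_def)
  fix i assume i: "i : K"
  have PK': "Pw x' p' si' u' au' i : K" using Pw_K[OF ok' i] .
  show "Uw w x p si u au (Pw x' p' si' u' au' i) \<otimes> au (Uw w' x' p' si' u' au' i) : \<T>"
   using Uw_T[OF ok PK'] Aut_T_D(1)[OF au, OF Uw_T[OF ok' i]] by blast
  have main: "Pw x'' p'' ?si ?u ?au i = Pw x p si u au (Pw x' p' si' u' au' i) &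
   Uw w'' x'' p'' ?si ?u ?au i = Uw w x p si u au (Pw x' p' si' u' au' i) \<otimes> au (Uw w' x' p' si' u' au' i)"
   using i
  proof (cases rule: K_cases)
   case low
   define k where "k = p' (?pp' i)"
   have k: "k : {1..q}" using perm_range[OF wokD(3)[OF ok']] perm_range[OF wokD(8)[OF ok']] low by (simp add: k_def)
   define l where "l = ?pp k"
   have l: "l : {1..q}" using perm_range[OF wokD(8)[OF ok] k] by (simp add: l_def)
   have pl: "p l : {1..q}" using perm_range[OF wokD(3)[OF ok] l] .
   have wk: "w (p l) : \<T>" "w' k : \<T>" using wokD(1)[OF ok] wokD(1)[OF ok'] pl k by simp_all
   have P'': "Pw x'' p'' ?si ?u ?au i = p l" using low P_low by (simp add: l_def k_def)
   have P': "Pw x' p' si' u' au' i = k" using low by (simp add: k_def)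
   have P: "Pw x p si u au k = p l" using k by (simp add: l_def)
   have "inv' ?pp (inv' p (p l)) = k"
    using permutes_inverses(2)[OF wokD(3)[OF ok]] permutes_inverses(2)[OF wokD(8)[OF ok]] by (simp add: l_def)
   then have "w'' (p l) = w (p l) \<otimes> au (w' k)" using pl by (simp add: w''_def act_w_def)
   then show ?thesis using P'' P' P low k pl wk Aut_T_D(1)[OF au] by simp
  next
   case (hyp j c)
   define k where "k = si' j"
   define l where "l = si k"
   have k: "k : {1..s}" using perm_range[OF si' hyp(1)] by (simp add: k_def)
   have l: "l : {1..s}" using perm_range[OF si k] by (simp add: l_def)
   have wk: "w (q + l) : \<T>" "w' (q + k) : \<T>" using wokD(1)[OF ok] wokD(1)[OF ok'] l k by simp_all
   have il: "inv' si l = k" using permutes_inverses(2)[OF si] by (simp add: l_def)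
   have xl: "x l = 0 | x l = 1" "x' k = 0 | x' k = 1" using wokD(2)[OF ok l] wokD(2)[OF ok' k] by auto
   have x''l: "x'' l = 1 \<longleftrightarrow> (x l = 1) ~= (x' k = 1)"
    using l xl by (auto simp: x''_def il)
   have w''l: "w'' (q + l) = w (q + l) \<otimes> (au (w' (q + k)) \<otimes> (if x' k = 1 then u else \<one>))"
    using l by (simp add: w''_def act_w_def il)
   have P'': "Pw x'' p'' ?si ?u ?au i = hyp l (c ~= (x'' l = 1))" using hyp by (simp add: l_def k_def)
   have P': "Pw x' p' si' u' au' i = hyp k (c ~= (x' k = 1))" using hyp by (simp add: k_def)
   have P: "Pw x p si u au (hyp k d) = hyp l (d ~= (x l = 1))" for d using k by (simp add: l_def)
   have "(c ~= (x'' l = 1)) = ((c ~= (x' k = 1)) ~= (x l = 1))" unfolding x''l by blast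
   then have 1: "Pw x'' p'' ?si ?u ?au i = Pw x p si u au (Pw x' p' si' u' au' i)"
    unfolding P' P P'' by (rule arg_cong)
   have sc: "sec i = c" "sec (hyp k d) = d" "cl (hyp l d) = q + l" "cl (hyp k d) = q + k" for d using hyp k l by simp_all
   \<comment> \<open>Both sides agree because u squares to \<one>: if \<open>c\<close> holds and the
     inner switch is on, u occurs twice on the left and not at all on the right.\<close>
   have 2: "w'' (q + l) \<otimes> (if c then ?u else \<one>)
    = (w (q + l) \<otimes> (if c ~= (x' k = 1) then u else \<one>)) \<otimes> au (w' (q + k) \<otimes> (if c then u' else \<one>))"
    using wk uT uT' Aut_T_D(1,2)[OF au] Aut_T_one[OF au]
    by (cases c; cases "x' k = 1") (simp_all add: w''l ac)
   show ?thesis using 1 2 unfolding P'' P' P sc by blast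
  qed
  show "Pw x'' p'' ?si ?u ?au i = (Pw x p si u au \<circ> Pw x' p' si' u' au') i"
   using conjunct1[OF main] by (simp only: o_apply)
  show "Uw w'' x'' p'' ?si ?u ?au i = \<one> \<otimes> (Uw w x p si u au (Pw x' p' si' u' au' i) \<otimes> au (Uw w' x' p' si' u' au' i))"
   unfolding conjunct2[OF main]
   by (rule l_one[symmetric, OF m_closed[OF Uw_T[OF ok PK'] Aut_T_D(1)[OF au, OF Uw_T[OF ok' i]]]])
 qed auto
 also have "... = compose B (Fm (Pw x p si u au) au (Uw w x p si u au)) (Fm (Pw x' p' si' u' au') au' (Uw w' x' p' si' u' au'))"
  by (rule Fm_compose[OF Pw_K[OF ok'] au au' Uw_T[OF ok] Uw_T[OF ok'], symmetric])
 finally show ?thesis unfolding mult theta_wel[OF ok] theta_wel[OF ok'] theta_wel[OF ok''] .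
qed

lemma theta_hom: "theta : hom (Weyl_star_group T \<beta> q s \<tau>) (BijGroup B)"
proof (rule homI)
 fix y assume "y : carrier (Weyl_star_group T \<beta> q s \<tau>)"
 then show "theta y : carrier (BijGroup B)"
  using theta_Bij by (auto simp: Weyl_carrier BijGroup_def)
next
 fix y z assume "y : carrier (Weyl_star_group T \<beta> q s \<tau>)" "z : carrier (Weyl_star_group T \<beta> q s \<tau>)"
 then show "theta (y \<otimes>\<^bsub>Weyl_star_group T \<beta> q s \<tau>\<^esub> z) = theta y \<otimes>\<^bsub>BijGroup B\<^esub> theta z"
  using theta_Bij by (auto simp: Weyl_carrier BijGroup_def theta_mult)
qed

lemma Weyl_mult_closed:
 assumes "y : carrier (Weyl_star_group T \<beta> q s \<tau>)" "z : carrier (Weyl_star_group T \<beta> q s \<tau>)"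
 shows "y \<otimes>\<^bsub>Weyl_star_group T \<beta> q s \<tau>\<^esub> z : carrier (Weyl_star_group T \<beta> q s \<tau>)"
proof -
 obtain w x p si u au where y: "y = wel w x p si u au" and ok: "wok w x p si u au"
  using assms(1) unfolding Weyl_carrier by blast
 obtain w' x' p' si' u' au' where z: "z = wel w' x' p' si' u' au'" and ok': "wok w' x' p' si' u' au'"
  using assms(2) unfolding Weyl_carrier by blast
 show ?thesis unfolding y z wel_mult(1)[OF ok ok'] Weyl_carrier using wel_mult(2)[OF ok ok'] by blast
qed

lemma Fm_eqD:
 assumes "Fm P au u = Fm P' au' u'" "i : K" "j : K" "t : \<T>"
 shows "P i = P' i" "u i \<otimes> au t \<otimes> u j = u' i \<otimes> au' t \<otimes> u' j"
 using fun_cong[OF assms(1), of "(i, t, j)"] assms(2-4) by simp_all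

text \<open>All coordinates can be read off: alpha from labels (i, t, i), sigma and x from the
  pairs, p from the diagonal indices once u and alpha are known, and w up to a common factor because
  its entries occur in products of two.\<close>

lemma theta_inj: "inj_on theta (carrier (Weyl_star_group T \<beta> q s \<tau>))"
proof (rule inj_onI)
 fix y y' assume yc: "y : carrier (Weyl_star_group T \<beta> q s \<tau>)" "y' : carrier (Weyl_star_group T \<beta> q s \<tau>)"
  and eq0: "theta y = theta y'"
 obtain w x p si u au where y: "y = wel w x p si u au" and ok: "wok w x p si u au"
  using yc(1) unfolding Weyl_carrier by blast
 obtain w' x' p' si' u' au' where y': "y' = wel w' x' p' si' u' au'" and ok': "wok w' x' p' si' u' au'"
  using yc(2) unfolding Weyl_carrier by blast
 note au = wokD(7)[OF ok] and au' = wokD(7)[OF ok'] and uT = wokD(6)[OF ok] and uT' = wokD(6)[OF ok']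
 note si = wokD(5)[OF ok] and si' = wokD(5)[OF ok']
 have eq: "Fm (Pw x p si u au) au (Uw w x p si u au) = Fm (Pw x' p' si' u' au') au' (Uw w' x' p' si' u' au')"
  using eq0 unfolding y y' theta_wel[OF ok] theta_wel[OF ok'] .
 have P: "Pw x p si u au i = Pw x' p' si' u' au' i" if "i : K" for i using Fm_eqD(1)[OF eq that that one_closed] .
 have U: "Uw w x p si u au i \<otimes> au t \<otimes> Uw w x p si u au j = Uw w' x' p' si' u' au' i \<otimes> au' t \<otimes> Uw w' x' p' si' u' au' j"
  if "i : K" "j : K" "t : \<T>" for i j t using Fm_eqD(2)[OF eq that] .
 obtain i0 where i0: "i0 : K" using K_nonempty by blast
 have al: "au t = au' t" if t: "t : \<T>" for t
  using U[OF i0 i0 t] Uw_T[OF ok i0] Uw_T[OF ok' i0] Aut_T_D(1)[OF au t] Aut_T_D(1)[OF au' t] by (simp add: ac)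
 have "au = au'" by (rule extensionalityI[OF Aut_T_D(4)[OF au] Aut_T_D(4)[OF au'] al])
 have U1: "Uw w x p si u au i \<otimes> Uw w x p si u au j = Uw w' x' p' si' u' au' i \<otimes> Uw w' x' p' si' u' au' j"
  if "i : K" "j : K" for i j
  using U[OF that one_closed] Uw_T[OF ok that(1)] Uw_T[OF ok' that(1)] Uw_T[OF ok that(2)] Uw_T[OF ok' that(2)]
  by (simp only: Aut_T_one[OF au] Aut_T_one[OF au'] r_one)
 have Phyp: "si j = si' j & (c ~= (x (si j) = 1)) = (c ~= (x' (si' j) = 1))" if j: "j : {1..s}" for j c
 proof -
  have e: "hyp (si j) (c ~= (x (si j) = 1)) = hyp (si' j) (c ~= (x' (si' j) = 1))"
   using P[of "hyp j c"] j by simp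
  have r: "1 <= si j" "1 <= si' j" using perm_range[OF si j] perm_range[OF si' j] by auto
  show ?thesis by (rule iffD1[OF hyp_inject[OF r] e])
 qed
 have "si = si'"
 proof
  fix j show "si j = si' j"
  proof (cases "j : {1..s}")
   case False
   then show ?thesis using si si' by (simp add: permutes_def)
  qed (use Phyp in blast)
 qed
 have "x = x'"
 proof (rule extensionalityI)
  show "x : extensional {1..s}" "x' : extensional {1..s}" using ok ok' by (auto simp: wok_def PiE_iff)
  fix m assume m: "m : {1..s}"
  define j where "j = inv' si m"
  have j: "j : {1..s}" "si j = m" using inv_perm[OF si m] permutes_inverses(1)[OF si] by (auto simp: j_def)
  have "(x m = 1) = (x' m = 1)" using Phyp[OF j(1), of False] j(2) by auto
  then show "x m = x' m" using wokD(2)[OF ok m] wokD(2)[OF ok' m] by auto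
 qed
 \<comment> \<open>Without diagonal indices, u is the product of the translations at the two members
   of a pair. Otherwise it is found from t_{P 1} = alpha(t_1) u.\<close>
 have "u = u'"
 proof (cases "q = 0")
  case True
  then have "1 <= s" using qs by simp
  then have j: "hyp 1 c : K" for c using hyp_simps(8)[of 1 c] by simp
  have P1: "Pw x p si u au (hyp 1 c) = hyp (si 1) (c ~= (x (si 1) = 1))" for c by simp
  have P1': "Pw x' p' si' u' au' (hyp 1 c) = hyp (si' 1) (c ~= (x' (si' 1) = 1))" for c by simp
  have s1: "si 1 : {1..s}" "si' 1 : {1..s}" using perm_range[OF si] perm_range[OF si'] True qs by simp_all
  have wT: "w (q + si 1) : \<T>" "w' (q + si' 1) : \<T>" using wokD(1)[OF ok] wokD(1)[OF ok'] s1 by simp_all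
  have cls: "cl (hyp (si 1) c) = q + si 1" "cl (hyp (si' 1) c) = q + si' 1" "sec (hyp 1 c) = c" for c using s1 by simp_all
  show ?thesis using U1[OF j j, of False True] wT uT uT' unfolding P1 P1' cls by (simp add: ac)
 next
  case False
  then have i: "1 : {1..q}" by simp
  have 1: "\<tau> ((p \<circ> rst (u, au)) 1) = au (\<tau> 1) \<otimes> u"
   using wokD(4)[OF ok perm_range[OF wokD(8)[OF ok] i]] wokD(9)[OF ok i] by simp
  have 2: "\<tau> ((p' \<circ> rst (u', au')) 1) = au' (\<tau> 1) \<otimes> u'"
   using wokD(4)[OF ok' perm_range[OF wokD(8)[OF ok'] i]] wokD(9)[OF ok' i] by simp
  have "(p \<circ> rst (u, au)) 1 = (p' \<circ> rst (u', au')) 1" using P[OF low_K[OF i]] i by simp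
  then have "au (\<tau> 1) \<otimes> u = au' (\<tau> 1) \<otimes> u'" using 1 2 by metis
  then have "au (\<tau> 1) \<otimes> u = au (\<tau> 1) \<otimes> u'" using al tau[OF i] by metis
  then show ?thesis using Aut_T_D(1)[OF au tau[OF i]] uT uT' by simp
 qed
 have "p = p'"
 proof
  fix m
  show "p m = p' m"
  proof (cases "m : {1..q}")
   case True
   define i where "i = inv' (rst (u, au)) m"
   have i: "i : {1..q}" "rst (u, au) i = m"
    using inv_perm[OF wokD(8)[OF ok] True] permutes_inverses(1)[OF wokD(8)[OF ok]] by (auto simp: i_def)
   show ?thesis using P[OF low_K[OF i(1)]] i \<open>u = u'\<close> \<open>au = au'\<close> by simp
  next
   case False
   then show ?thesis using wokD(3)[OF ok] wokD(3)[OF ok'] by (simp add: permutes_def)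
  qed
 qed
 have ww: "w a \<otimes> w b = w' a \<otimes> w' b" if ab: "a : {1..q + s}" "b : {1..q + s}" for a b
 proof -
  \<comment> \<open>Each class is the image of an index that is not a second member, where no factor
    u intervenes: a second member can be exchanged for its partner.\<close>
  have pre: "\<exists>i\<in>K. cl (Pw x p si u au i) = a & ~ sec i" if a: "a : {1..q + s}" for a
  proof -
   obtain k where k: "k : K" "cl k = a" using cl_surj[OF a] by blast
   have "k : Pw x p si u au ` K"
    using bij_betw_imp_surj_on[OF PP_bij[OF wokD(11)[OF ok] si, of x]] k(1) by blast
   then obtain i where i: "i : K" "Pw x p si u au i = k" by blast
   show ?thesis
   proof (cases "sec i")
    case True
    have "~ sec (star i)" using i(1) True by (elim K_cases) auto
    moreover have "cl (Pw x p si u au (star i)) = a"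
     using PP_star[OF wokD(11)[OF ok] si i(1), of x] i k by simp
    ultimately show ?thesis using i(1) star_K by blast
   qed (use i k in blast)
  qed
  obtain i j where ij: "i : K" "j : K" "cl (Pw x p si u au i) = a" "cl (Pw x p si u au j) = b" "~ sec i" "~ sec j"
   using pre[OF ab(1)] pre[OF ab(2)] by blast
  have "cl (Pw x' p' si' u' au' i) = a" "cl (Pw x' p' si' u' au' j) = b"
   using ij P[OF ij(1)] P[OF ij(2)] by simp_all
  then show ?thesis using U1[OF ij(1,2)] ij(3-6) wokD(1)[OF ok] wokD(1)[OF ok'] ab by simp
 qed
 have "diag_coset (q + s) T w = diag_coset (q + s) T w'"
 proof -
  have q1: "1 : {1..q + s}" using qs by (cases q) auto
  define z where "z = w 1 \<otimes> w' 1"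
  have wT: "w m : \<T>" "w' m : \<T>" if "m : {1..q + s}" for m
   using wokD(1)[OF ok that] wokD(1)[OF ok' that] by auto
  have z: "z : \<T>" using wT[OF q1] by (simp add: z_def)
  have w'E: "w' : {1..q + s} \<rightarrow>\<^sub>E \<T>" using ok' by (simp add: wok_def)
  have "w m = z \<otimes> w' m" if m: "m : {1..q + s}" for m
  proof -
   have "w 1 \<otimes> (w 1 \<otimes> w m) = w 1 \<otimes> (w' 1 \<otimes> w' m)" using ww[OF q1 m] by simp
   then show ?thesis using wT[OF q1] wT[OF m] by (simp add: z_def m_assoc)
  qed
  moreover have "w : extensional {1..q + s}" using ok by (auto simp: wok_def PiE_iff)
  ultimately have "w = (\<lambda>m\<in>{1..q + s}. z \<otimes> w' m)" by (intro extensionalityI[of w "{1..q + s}"]) auto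
  then show ?thesis using diag_coset_shift[OF comm_T w'E z] by simp
 qed
 then show "y = y'"
  unfolding y y' wel_def using \<open>x = x'\<close> \<open>p = p'\<close> \<open>si = si'\<close> \<open>u = u'\<close> \<open>au = au'\<close> by simp
qed

section \<open>Label permutations commuting with the one induced by phi\<close>

definition "WW = {F : Bij B. (\<exists>P au u. bij_betw P K K & au : carrier (Aut_T T \<beta>) & (\<forall>i\<in>K. u i : \<T>) & F = Fm P au u)
  & (\<forall>b\<in>B. F (bphi b) = bphi (F b))}"

text \<open>Constancy of this value in i expresses commutation with \<open>bphi\<close>. On a
  diagonal index the translations cancel and it is t_{P i} alpha(t_i); on a pair that goes to a pair
  it is u_i u_{i*}. The constant is the translation part of the element of Aut* Sigma.\<close>

definition "cc P au u i = tt (P i) \<otimes> u i \<otimes> u (star i) \<otimes> au (tt i)"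

text \<open>On the left \<open>t\<close> occurs twice and cancels. The other factors are grouped in
  four blocks to keep the rewriting modulo commutativity small.\<close>

lemma shuffle:
 assumes "a : \<T>" "b : \<T>" "c : \<T>" "d : \<T>" "e : \<T>" "f : \<T>"
  "g : \<T>" "h : \<T>" "t : \<T>"
 shows "(a \<otimes> (t \<otimes> c \<otimes> d) \<otimes> b) \<otimes> ((e \<otimes> t \<otimes> f) \<otimes> g \<otimes> h) = (g \<otimes> e \<otimes> b \<otimes> c) \<otimes> (h \<otimes> f \<otimes> a \<otimes> d)"
proof -
 define X Y Z W where "X = b \<otimes> c" and "Y = a \<otimes> d" and "Z = g \<otimes> e" and "W = h \<otimes> f"
 have T: "X : \<T>" "Y : \<T>" "Z : \<T>" "W : \<T>" using assms by (simp_all add: X_def Y_def Z_def W_def)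
 have 1: "a \<otimes> (t \<otimes> c \<otimes> d) \<otimes> b = t \<otimes> (X \<otimes> Y)" using assms by (simp add: X_def Y_def m_assoc m_comm m_lcomm)
 have 2: "(e \<otimes> t \<otimes> f) \<otimes> g \<otimes> h = t \<otimes> (Z \<otimes> W)" using assms by (simp add: Z_def W_def m_assoc m_comm m_lcomm)
 have 3: "(g \<otimes> e \<otimes> b \<otimes> c) \<otimes> (h \<otimes> f \<otimes> a \<otimes> d) = (Z \<otimes> X) \<otimes> (W \<otimes> Y)"
  using assms by (simp add: X_def Y_def Z_def W_def m_assoc)
 show ?thesis unfolding 1 2 3 using T assms(9) by (simp add: ac)
qed

text \<open>The middle entries of the two sides multiply to
  \<open>cc P au u i \<otimes> cc P au u j\<close>, whatever t is. In a group of exponent two they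
  agree exactly when these two values do.\<close>

lemma Fm_bphi_iff:
 assumes P: "bij_betw P K K" and au: "au : carrier (Aut_T T \<beta>)" and u: "!!i. i : K ==> u i : \<T>"
 shows "(\<forall>b\<in>B. Fm P au u (bphi b) = bphi (Fm P au u b)) \<longleftrightarrow>
  (\<forall>i\<in>K. P (star i) = star (P i)) & (\<forall>i\<in>K. \<forall>j\<in>K. cc P au u i = cc P au u j)" (is "?L \<longleftrightarrow> ?R")
proof -
 have PK: "P i : K" if "i : K" for i using P that by (auto simp: bij_betw_def)
 have L: "Fm P au u (bphi (i, t, j)) = (P (star j), u (star j) \<otimes> (au t \<otimes> au (tt i) \<otimes> au (tt j)) \<otimes> u (star i), P (star i))"
  if "i : K" "t : \<T>" "j : K" for i t j
  using that Aut_T_D(2)[OF au] by (simp add: bphi_def)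
 have R: "bphi (Fm P au u (i, t, j)) = (star (P j), (u i \<otimes> au t \<otimes> u j) \<otimes> tt (P i) \<otimes> tt (P j), star (P i))"
  if "i : K" "t : \<T>" "j : K" for i t j
  using that by (simp add: bphi_def)
 have M: "u (star j) \<otimes> (au t \<otimes> au (tt i) \<otimes> au (tt j)) \<otimes> u (star i) = (u i \<otimes> au t \<otimes> u j) \<otimes> tt (P i) \<otimes> tt (P j)
   \<longleftrightarrow> cc P au u i = cc P au u j" if ij: "i : K" "t : \<T>" "j : K" for i t j
 proof -
  have T: "u i : \<T>" "u j : \<T>" "u (star i) : \<T>" "u (star j) : \<T>"
   "au t : \<T>" "au (tt i) : \<T>" "au (tt j) : \<T>" "tt (P i) : \<T>" "tt (P j) : \<T>"
   using ij u PK Aut_T_D(1)[OF au] by simp_all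
  have "(u (star j) \<otimes> (au t \<otimes> au (tt i) \<otimes> au (tt j)) \<otimes> u (star i)) \<otimes> ((u i \<otimes> au t \<otimes> u j) \<otimes> tt (P i) \<otimes> tt (P j))
    = cc P au u i \<otimes> cc P au u j"
   unfolding cc_def using T by (intro shuffle)
  moreover have "cc P au u i : \<T>" "cc P au u j : \<T>" unfolding cc_def using T by simp_all
  moreover have "u (star j) \<otimes> (au t \<otimes> au (tt i) \<otimes> au (tt j)) \<otimes> u (star i) = (u i \<otimes> au t \<otimes> u j) \<otimes> tt (P i) \<otimes> tt (P j)
   \<longleftrightarrow> (u (star j) \<otimes> (au t \<otimes> au (tt i) \<otimes> au (tt j)) \<otimes> u (star i)) \<otimes> ((u i \<otimes> au t \<otimes> u j) \<otimes> tt (P i) \<otimes> tt (P j)) = \<one>"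
   using T by (intro mult_eq_one[symmetric]) simp_all
  ultimately show ?thesis using mult_eq_one[of "cc P au u i" "cc P au u j"] by simp
 qed
 show ?thesis
 proof
  assume L0: ?L
  have "P (star i) = star (P i)" if i: "i : K" for i
   using bspec[OF L0, of "(i, \<one>, i)"] L[OF i one_closed i] R[OF i one_closed i] i by simp
  moreover have "cc P au u i = cc P au u j" if ij: "i : K" "j : K" for i j
   using bspec[OF L0, of "(i, \<one>, j)"] L[OF ij(1) one_closed ij(2)] R[OF ij(1) one_closed ij(2)]
    M[OF ij(1) one_closed ij(2)] ij by simp
  ultimately show ?R by blast
 next
  assume R0: ?R
  show ?L
  proof
   fix b assume "b : B"
   then obtain i t j where b: "b = (i, t, j)" "i : K" "t : \<T>" "j : K" by (auto simp: B_def)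
   have "P (star i) = star (P i)" "P (star j) = star (P j)" "cc P au u i = cc P au u j"
    using R0 b(2,4) by blast+
   then show "Fm P au u (bphi b) = bphi (Fm P au u b)"
    unfolding b(1) L[OF b(2-4)] R[OF b(2-4)] prod.inject using M[OF b(2-4)] by blast
  qed
 qed
qed

lemma cc_T:
 assumes "bij_betw P K K" "au : carrier (Aut_T T \<beta>)" "!!i. i : K ==> u i : \<T>" "i : K"
 shows "cc P au u i : \<T>"
proof -
 have "P i : K" using assms(1,4) by (auto simp: bij_betw_def)
 then show ?thesis using assms(3)[OF assms(4)] assms(3)[OF star_K[OF assms(4)]] Aut_T_D(1)[OF assms(2) tt_T[OF assms(4)]]
  unfolding cc_def by simp
qed

text \<open>For a diagonal index this is t_{P i} = alpha(t_i) u; for a pair, \<open>theta\<close>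
  puts the factor u on exactly one member.\<close>

lemma cc_wel:
 assumes ok: "wok w x p si u au" and i: "i : K"
 shows "cc (Pw x p si u au) au (Uw w x p si u au) i = u"
 using i
proof (cases rule: K_cases)
 case low
 have 1: "\<tau> ((p \<circ> rst (u, au)) i) = au (\<tau> i) \<otimes> u"
  using wokD(4)[OF ok perm_range[OF wokD(8)[OF ok] low]] wokD(9)[OF ok low] by simp
 have r: "(p \<circ> rst (u, au)) i : {1..q}" using perm_range[OF wokD(11)[OF ok] low] .
 then have wT: "w ((p \<circ> rst (u, au)) i) : \<T>" using wokD(1)[OF ok] by simp
 have "cc (Pw x p si u au) au (Uw w x p si u au) i
   = au (\<tau> i) \<otimes> u \<otimes> w ((p \<circ> rst (u, au)) i) \<otimes> w ((p \<circ> rst (u, au)) i) \<otimes> au (\<tau> i)"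
  using low r wT 1 by (simp add: cc_def)
 then show ?thesis using wT wokD(6)[OF ok] Aut_T_D(1)[OF wokD(7)[OF ok] tau[OF low]] by (simp add: ac)
next
 case (hyp j c)
 have r: "si j : {1..s}" using perm_range[OF wokD(5)[OF ok] hyp(1)] .
 then have wT: "w (q + si j) : \<T>" using wokD(1)[OF ok] by simp
 have e: "Uw w x p si u au (hyp j d) = w (q + si j) \<otimes> (if d then u else \<one>)" "tt (Pw x p si u au (hyp j d)) = \<one>"
  "tt (hyp j d) = \<one>" "star (hyp j d) = hyp j (~ d)" for d
  using hyp r by simp_all
 show ?thesis unfolding hyp(2) cc_def e
  using wT wokD(6)[OF ok] Aut_T_one[OF wokD(7)[OF ok]] by (cases c) (simp_all add: ac)
qed

lemma WW_I:
 assumes P: "bij_betw P K K" and au: "au : carrier (Aut_T T \<beta>)" and u: "!!i. i : K ==> u i : \<T>"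
  and star: "!!i. i : K ==> P (star i) = star (P i)"
  and cc: "!!i. i : K ==> cc P au u i = c"
 shows "Fm P au u : WW"
proof -
 have "\<forall>b\<in>B. Fm P au u (bphi b) = bphi (Fm P au u b)"
  by (rule iffD2[OF Fm_bphi_iff[OF P au]]) (simp_all add: u star cc)
 moreover have "Fm P au u : Bij B" by (rule Fm_Bij[OF P au u])
 ultimately show ?thesis
  unfolding WW_def mem_Collect_eq using P au u
  by (intro conjI exI[of _ P] exI[of _ au] exI[of _ u] ballI refl) simp_all
qed

lemma WW_E:
 assumes F: "F : WW"
 obtains P au u c where "bij_betw P K K" "au : carrier (Aut_T T \<beta>)" "!!i. i : K ==> u i : \<T>"
  "!!i. i : K ==> P (star i) = star (P i)" "!!i. i : K ==> cc P au u i = c" "c : \<T>" "F = Fm P au u"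
proof -
 from F obtain P au u where P: "bij_betw P K K" and au: "au : carrier (Aut_T T \<beta>)" and u0: "\<forall>i\<in>K. u i : \<T>"
  and FF: "F = Fm P au u" and com: "\<forall>b\<in>B. F (bphi b) = bphi (F b)"
  unfolding WW_def mem_Collect_eq by (elim conjE exE)
 have u: "!!i. i : K ==> u i : \<T>" using u0 by blast
 obtain i0 where i0: "i0 : K" using K_nonempty by blast
 have *: "(\<forall>i\<in>K. P (star i) = star (P i)) & (\<forall>i\<in>K. \<forall>j\<in>K. cc P au u i = cc P au u j)"
  by (rule iffD1[OF Fm_bphi_iff[OF P au]]) (use u com FF in simp_all)
 have s: "!!i. i : K ==> P (star i) = star (P i)" using conjunct1[OF *] by blast
 have c: "!!i. i : K ==> cc P au u i = cc P au u i0" using conjunct2[OF *] i0 by blast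
 have "cc P au u i0 : \<T>" by (rule cc_T[OF P au]) (simp_all add: u i0)
 then show thesis using that[OF P au u s c _ FF] by simp
qed

lemma theta_WW:
 assumes ok: "wok w x p si u au"
 shows "theta (wel w x p si u au) : WW"
 unfolding theta_wel[OF ok]
proof (rule WW_I[OF PP_bij[OF wokD(11)[OF ok] wokD(5)[OF ok]] wokD(7)[OF ok]])
 show "!!i. i : K ==> Uw w x p si u au i : \<T>" by (rule Uw_T[OF ok])
 show "!!i. i : K ==> Pw x p si u au (star i) = star (Pw x p si u au i)"
  by (rule PP_star[OF wokD(11)[OF ok] wokD(5)[OF ok]])
 show "!!i. i : K ==> cc (Pw x p si u au) au (Uw w x p si u au) i = u" by (rule cc_wel[OF ok])
qed

lemma endo_bij: "finite A ==> inj_on f A ==> (!!x. x : A ==> f x : A) ==> bij_betw f A A"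
 unfolding bij_betw_def using endo_inj_surj[of A f] by blast

text \<open>The translation part has to be \<open>c\<close>. On the diagonal indices P itself shows
  that (c, alpha) stabilises Sigma; what is left of P after removing the restriction of (c, alpha)
  lies in Sym Sigma. Switches and translations are read off at first members of pairs.\<close>

lemma WW_surj:
 assumes P: "bij_betw P K K" and au: "au : carrier (Aut_T T \<beta>)" and uT: "!!i. i : K ==> u i : \<T>"
  and star: "!!i. i : K ==> P (star i) = star (P i)" and cc: "!!i. i : K ==> cc P au u i = c"
 obtains w x p si where "wok w x p si c au" "theta (wel w x p si c au) = Fm P au u"
proof -
 have PK: "P i : K" if "i : K" for i using P that by (auto simp: bij_betw_def)
 have Pinj: "i = j" if "P i = P j" "i : K" "j : K" for i j
  using P that by (auto simp: bij_betw_def dest: inj_onD)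
 obtain i0 where i0: "i0 : K" using K_nonempty by blast
 have cT: "c : \<T>" unfolding cc[OF i0, symmetric] by (rule cc_T[OF P au]) (simp_all add: uT i0)
 \<comment> \<open>Diagonal indices are the fixed points of \<open>star\<close>, so a permutation
   commuting with \<open>star\<close> preserves them.\<close>
 have low_iff: "i : {1..q} \<longleftrightarrow> star i = i" if "i : K" for i
  using that by (elim K_cases) (auto simp: hyp_inject)
 have Plow: "P i : {1..q}" if "i : {1..q}" for i
  unfolding low_iff[OF PK[OF low_K[OF that]]] star[OF low_K[OF that], symmetric] using that by simp
 have Phyp: "\<exists>k\<in>{1..s}. \<exists>d. P (hyp j e) = hyp k d" if j: "j : {1..s}" for j e
 proof -
  have h: "hyp j e : K" using j by simp
  show ?thesis using PK[OF h]
  proof (cases rule: K_cases)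
   case low
   then have "star (P (hyp j e)) = P (hyp j e)" using low_iff[OF PK[OF h]] by blast
   then have "P (star (hyp j e)) = P (hyp j e)" unfolding star[OF h] .
   then have "star (hyp j e) = hyp j e" by (rule Pinj[OF _ star_K[OF h] h])
   then show ?thesis using j by (simp add: hyp_inject)
  qed auto
 qed
 define p0 where "p0 i = (if i : {1..q} then P i else i)" for i
 have p0: "p0 permutes {1..q}"
 proof (rule bij_imp_permutes)
  have "inj_on P {1..q}" by (rule inj_onI) (use Pinj low_K in blast)
  then have "bij_betw P {1..q} {1..q}" using Plow by (intro endo_bij finite_atLeastAtMost)
  then show "bij_betw p0 {1..q} {1..q}" by (rule bij_betw_cong[THEN iffD1, rotated]) (simp add: p0_def)
 qed (auto simp: p0_def)
 have tauP: "\<tau> (P i) = au (\<tau> i) \<otimes> c" if i: "i : {1..q}" for i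
 proof -
  have T: "\<tau> (P i) : \<T>" "u i : \<T>" "au (\<tau> i) : \<T>"
   using tau[OF Plow[OF i]] uT[OF low_K[OF i]] Aut_T_D(1)[OF au tau[OF i]] by auto
  have "c = \<tau> (P i) \<otimes> u i \<otimes> u i \<otimes> au (\<tau> i)"
   using cc[OF low_K[OF i]] i Plow[OF i] by (simp add: cc_def)
  then show ?thesis using T by (simp add: ac)
 qed
 have cS: "(c, au) : carrier (Aut_star_Sigma T \<beta> q \<tau>)"
  unfolding carrier_Aut_star_Sigma
  using cT au Sigma_stableI[OF p0, of "nat_act T (c, au)"] tauP by (simp add: nat_act_def p0_def)
 have rs: "restr_spec (nat_act T (c, au)) (rst (c, au))" by (rule rst_spec[OF cS])
 have r: "rst (c, au) permutes {1..q}" and rt: "!!i. i : {1..q} ==> \<tau> (rst (c, au) i) = au (\<tau> i) \<otimes> c"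
  using rs by (auto simp: restr_spec_def nat_act_def)
 \<comment> \<open>Both \<open>p0\<close> and the restriction carry the block of x to the block of
   alpha(x) c, so their quotient preserves every block.\<close>
 define p where "p = p0 \<circ> inv' (rst (c, au))"
 have p: "p permutes {1..q}" unfolding p_def using permutes_compose[OF permutes_inv[OF r] p0] .
 have pS: "\<tau> (p i) = \<tau> i" if i: "i : {1..q}" for i
 proof -
  define k where "k = inv' (rst (c, au)) i"
  have k: "k : {1..q}" "rst (c, au) k = i" using inv_perm[OF r i] permutes_inverses(1)[OF r] by (auto simp: k_def)
  have "\<tau> (p i) = \<tau> (P k)" using k by (simp add: p_def p0_def k_def[symmetric])
  then show ?thesis using tauP[OF k(1)] rt[OF k(1)] k(2) by simp
 qed
 have ppi: "(p \<circ> rst (c, au)) i = P i" if "i : {1..q}" for i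
  using that permutes_inverses(2)[OF r] by (simp add: p_def p0_def)
 define si where "si j = (if j : {1..s} then pr (P (hyp j False)) else j)" for j
 have siP: "P (hyp j False) = hyp (si j) (sec (P (hyp j False)))" "si j : {1..s}" if j: "j : {1..s}" for j
 proof -
  obtain k d where "k : {1..s}" "P (hyp j False) = hyp k d" using Phyp[OF j] by blast
  then show "P (hyp j False) = hyp (si j) (sec (P (hyp j False)))" "si j : {1..s}" using j by (simp_all add: si_def)
 qed
 have si: "si permutes {1..s}"
 proof (rule bij_imp_permutes)
  have "inj_on si {1..s}"
  proof (rule inj_onI)
   fix j k assume jk: "j : {1..s}" "k : {1..s}" "si j = si k"
   have h: "hyp j False : K" "hyp k False : K" "hyp k True : K" using jk by simp_all
   have "cl (P (hyp j False)) = cl (P (hyp k False))"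
    using siP[OF jk(1)] siP[OF jk(2)] jk(3) hyp_simps(4) by (metis atLeastAtMost_iff)
   then have "P (hyp k False) = P (hyp j False) | P (hyp k False) = P (star (hyp j False))"
    using cl_eq[OF PK[OF h(1)] PK[OF h(2)]] star[OF h(1)] by simp
   then have "hyp k False = hyp j False | hyp k False = star (hyp j False)"
    using Pinj h star_K by blast
   then show "j = k" using jk by (auto simp: hyp_inject)
  qed
  then show "bij_betw si {1..s} {1..s}" using siP(2) by (intro endo_bij finite_atLeastAtMost)
 qed (auto simp: si_def)
 \<comment> \<open>Here \<open>m\<close> is an image pair, in agreement with \<open>PP\<close>;
   hence the inverse of \<open>si\<close>.\<close>
 define x where "x = (\<lambda>m\<in>{1..s}. if sec (P (hyp (inv' si m) False)) then 1 else (0::int))"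
 have xP: "(x (si j) = 1) = sec (P (hyp j False))" if "j : {1..s}" for j
  using siP(2)[OF that] permutes_inverses(2)[OF si] by (simp add: x_def)
 have PPeq: "PP (p \<circ> rst (c, au)) si x i = P i" if "i : K" for i
  using that
 proof (cases rule: K_cases)
  case low
  then show ?thesis using ppi by simp
 next
  case (hyp j d)
  have F: "P (hyp j False) = hyp (si j) (x (si j) = 1)" using siP(1)[OF hyp(1)] xP[OF hyp(1)] by simp
  show ?thesis
  proof (cases d)
   case False
   then show ?thesis using F hyp by simp
  next
   case True
   have "P (hyp j True) = star (P (hyp j False))" using star[of "hyp j False"] hyp by simp
   then show ?thesis using F hyp True siP(2)[OF hyp(1)] by simp
  qed
 qed
 \<comment> \<open>Second members are avoided, so the factor that \<open>theta\<close> adds there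
   does not enter the tuple \<open>w\<close>.\<close>
 define rep where "rep m = (SOME i. i : K & ~ sec i & cl (P i) = m)" for m
 have rep: "rep m : K" "~ sec (rep m)" "cl (P (rep m)) = m" if m: "m : {1..q + s}" for m
 proof -
  obtain k where k: "k : K" "cl k = m" using cl_surj[OF m] by blast
  have "k : P ` K" unfolding bij_betw_imp_surj_on[OF P] by (rule k(1))
  then obtain i where i: "i : K" "P i = k" by blast
  have "\<exists>i. i : K & ~ sec i & cl (P i) = m"
  proof (cases "sec i")
   case True
   have "~ sec (star i)" using i(1) True by (elim K_cases) auto
   moreover have "cl (P (star i)) = m" using star[OF i(1)] i k by simp
   ultimately show ?thesis using i(1) star_K by blast
  qed (use i k in blast)
  then have "rep m : K & ~ sec (rep m) & cl (P (rep m)) = m" unfolding rep_def by (rule someI_ex)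
  then show "rep m : K" "~ sec (rep m)" "cl (P (rep m)) = m" by auto
 qed
 define w where "w = (\<lambda>m\<in>{1..q + s}. u (rep m))"
 have ok: "wok w x p si c au"
  unfolding wok_def using p pS si cS rep(1) uT by (auto simp: w_def x_def)
 have wu: "w (cl (P i)) = u i" if i: "i : K" "~ sec i" for i
 proof -
  have m: "cl (P i) : {1..q + s}" using cl_range[OF PK[OF i(1)]] .
  have "P (rep (cl (P i))) = P i | P (rep (cl (P i))) = star (P i)"
   using cl_eq[OF PK[OF i(1)] PK[OF rep(1)[OF m]]] rep(3)[OF m] by simp
  then have "rep (cl (P i)) = i | rep (cl (P i)) = star i"
   using Pinj[OF _ rep(1)[OF m]] star[OF i(1)] star_K[OF i(1)] i(1) by metis
  moreover have "star i = i | sec (star i)" using i by (elim K_cases) auto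
  ultimately have "rep (cl (P i)) = i" using rep(2)[OF m] by auto
  then show ?thesis using m by (simp add: w_def)
 qed
 have U: "w (cl (P i)) \<otimes> (if sec i then c else \<one>) = u i" if i: "i : K" for i
 proof (cases "sec i")
  case False
  then show ?thesis using wu[OF i] uT[OF i] by simp
 next
  case True
  have ns: "~ sec (star i)" using i True by (elim K_cases) auto
  have "cl (P (star i)) = cl (P i)" using star[OF i] PK[OF i] by simp
  then have "w (cl (P i)) = u (star i)" using wu[OF star_K[OF i] ns] by simp
  \<comment> \<open>On a pair, \<open>cc\<close> determines the translation at the second member
    from the one at the first.\<close>
  moreover have "c = u i \<otimes> u (star i)"
  proof -
   obtain j d where j: "j : {1..s}" "i = hyp j d" using i True by (elim K_cases) auto
   then obtain k e where "k : {1..s}" "P i = hyp k e" using Phyp by blast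
   then show ?thesis using cc[OF i] j uT[OF i] uT[OF star_K[OF i]] Aut_T_one[OF au] by (simp add: cc_def)
  qed
  ultimately show ?thesis using True uT[OF i] uT[OF star_K[OF i]] by (simp add: ac)
 qed
 have "theta (wel w x p si c au) = Fm P au u"
  unfolding theta_wel[OF ok]
 proof (rule Fm_cong[where z = "\<one>"])
  fix i assume i: "i : K"
  show "Pw x p si c au i = P i" using PPeq[OF i] .
  show "Uw w x p si c au i = \<one> \<otimes> u i" unfolding PPeq[OF i] U[OF i] using uT[OF i] by simp
 qed (use uT Aut_T_D(1)[OF au] in auto)
 then show ?thesis using that ok by blast
qed

lemma theta_image: "theta ` carrier (Weyl_star_group T \<beta> q s \<tau>) = WW"
proof (intro equalityI subsetI)
 fix F assume "F : theta ` carrier (Weyl_star_group T \<beta> q s \<tau>)"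
 then show "F : WW" using theta_WW by (auto simp: Weyl_carrier)
next
 fix F assume "F : WW"
 then show "F : theta ` carrier (Weyl_star_group T \<beta> q s \<tau>)"
 proof (rule WW_E)
  fix P au u c
  assume *: "bij_betw P K K" "au : carrier (Aut_T T \<beta>)" "!!i. i : K ==> u i : \<T>"
   "!!i. i : K ==> P (star i) = star (P i)" "!!i. i : K ==> cc P au u i = c" "F = Fm P au u"
  show ?thesis
  proof (rule WW_surj[OF *(1-5)])
   fix w x p si assume "wok w x p si c au" "theta (wel w x p si c au) = Fm P au u"
   moreover from this have "wel w x p si c au : carrier (Weyl_star_group T \<beta> q s \<tau>)"
    unfolding Weyl_carrier by blast
   ultimately show ?thesis unfolding *(6) by (intro image_eqI[of _ _ "wel w x p si c au"]) simp_all
  qed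
 qed
qed

end

text \<open>Right multiplication by x is injective on the finite set H, hence onto, and what it
  sends to \<one> is the inverse of x.\<close>

lemma (in group) finite_subgroupI:
 assumes fin: "finite (carrier G)" and H: "H <= carrier G" "\<one> : H"
  and mult: "!!x y. x : H ==> y : H ==> x \<otimes> y : H"
 shows "subgroup H G"
proof (rule subgroupI)
 fix x assume x: "x : H"
 then have xG: "x : carrier G" using H by blast
 have "(%y. y \<otimes> x) ` H = H"
 proof (rule endo_inj_surj)
  show "finite H" by (rule finite_subset[OF H(1) fin])
  show "inj_on (%y. y \<otimes> x) H" using xG H by (auto simp: inj_on_def subset_iff)
 qed (use mult x in blast)
 then have "\<one> : (%y. y \<otimes> x) ` H" using H(2) by simp
 then obtain y where y: "y : H" "y \<otimes> x = \<one>" by auto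
 have "inv x = y" using inv_equality[OF y(2) xG] y(1) H(1) by blast
 then show "inv x : H" using y(1) by simp
qed (use H mult in auto)

section \<open>Group structure on the commuting label permutations and on the semidirect
  product\<close>

context weyl_data
begin

lemma finite_BijGroup_B: "finite (carrier (BijGroup B))"
proof (rule finite_subset)
 show "carrier (BijGroup B) <= (B \<rightarrow>\<^sub>E B)"
  by (auto simp: BijGroup_def Bij_def PiE_def dest: bij_betw_imp_funcset)
 show "finite (B \<rightarrow>\<^sub>E B)" using fin_B by (intro finite_PiE)
qed

lemma WW_Bij: "F : WW ==> F : Bij B" by (simp add: WW_def)

lemma Fm_id: "Fm (%i. i) (\<lambda>t\<in>\<T>. t) (%i. \<one>) = idB"
 unfolding Fm_def BijGroup_def by (auto intro!: restrict_ext)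

lemma bij_id_K: "bij_betw (%i. i) K K" by (simp add: bij_betw_def)

lemma one_WW: "idB : WW"
 unfolding Fm_id[symmetric]
 by (rule WW_I[OF bij_id_K one_Aut_T(2), where c = \<one>]) (simp_all add: cc_def sq)

lemma compose_WW:
 assumes F: "F : WW" and F': "F' : WW"
 shows "compose B F F' : WW"
proof (rule WW_E[OF F], rule WW_E[OF F'])
 fix P au u c P' au' u' c'
 assume *: "bij_betw P K K" "au : carrier (Aut_T T \<beta>)" "!!i. i : K ==> u i : \<T>"
  "F = Fm P au u" "bij_betw P' K K" "au' : carrier (Aut_T T \<beta>)" "!!i. i : K ==> u' i : \<T>" "F' = Fm P' au' u'"
 have PK': "!!i. i : K ==> P' i : K" using *(5) by (auto simp: bij_betw_def)
 have c: "compose B F F' = Fm (P \<circ> P') (compose \<T> au au') (%i. u (P' i) \<otimes> au (u' i))"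
  unfolding *(4,8) by (rule Fm_compose[OF PK' *(2,6,3,7)])
 have com: "!!b. b : B ==> F (bphi b) = bphi (F b)" "!!b. b : B ==> F' (bphi b) = bphi (F' b)"
  using F F' by (simp_all add: WW_def)
 have FB: "F' b : B" if "b : B" for b using WW_Bij[OF F'] that by (auto simp: Bij_def bij_betw_def)
 have "\<forall>b\<in>B. compose B F F' (bphi b) = bphi (compose B F F' b)"
  using com FB bphi_B by (simp add: compose_def)
 moreover have "compose B F F' : Bij B" using compose_Bij WW_Bij F F' by blast
 moreover have "bij_betw (P \<circ> P') K K" using bij_betw_trans[OF *(5,1)] .
 moreover have "compose \<T> au au' : carrier (Aut_T T \<beta>)" using Aut_T_compose[OF *(2,6)] .
 moreover have "\<forall>i\<in>K. u (P' i) \<otimes> au (u' i) : \<T>" using *(3,7) PK' Aut_T_D(1)[OF *(2)] by simp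
 ultimately show "compose B F F' : WW" unfolding WW_def mem_Collect_eq
  by (intro conjI exI[of _ "P \<circ> P'"] exI[of _ "compose \<T> au au'"] exI[of _ "%i. u (P' i) \<otimes> au (u' i)"] c)
qed

lemma subgroup_WW: "subgroup WW (BijGroup B)"
proof (rule group.finite_subgroupI[OF group_BijGroup finite_BijGroup_B])
 show "WW <= carrier (BijGroup B)" using WW_Bij by (auto simp: BijGroup_def)
 show "x \<otimes>\<^bsub>BijGroup B\<^esub> y : WW" if "x : WW" "y : WW" for x y
  using compose_WW[OF that] WW_Bij that by (simp add: BijGroup_def)
qed (rule one_WW)

lemma one_Aut_star_Sigma: "(\<one>, \<lambda>t\<in>\<T>. t) : carrier (Aut_star_Sigma T \<beta> q \<tau>)"
 "rst (\<one>, \<lambda>t\<in>\<T>. t) = id"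
proof -
 have s: "restr_spec (nat_act T (\<one>, \<lambda>t\<in>\<T>. t)) id"
  unfolding restr_spec_def by (auto simp: permutes_id nat_act_def tau)
 then show "(\<one>, \<lambda>t\<in>\<T>. t) : carrier (Aut_star_Sigma T \<beta> q \<tau>)"
  unfolding carrier_Aut_star_Sigma using one_Aut_T(2)
  by (auto simp: restr_spec_def intro!: Sigma_stableI[where p = id])
 show "rst (\<one>, \<lambda>t\<in>\<T>. t) = id"
  by (rule restriction_eq[OF s nat_act_inj[OF one_closed one_Aut_T(2)]])
qed

lemma one_Weyl: "\<one>\<^bsub>Weyl_star_group T \<beta> q s \<tau>\<^esub>
  = wel (\<lambda>i\<in>{1..q + s}. \<one>) (\<lambda>j\<in>{1..s}. 0) id id \<one> (\<lambda>t\<in>\<T>. t)"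
 unfolding wel_def Weyl_star_group_def semidirect_def inner_group_def Aut_star_Sigma_def
 by (simp add: one_Aut_T one_tuples_mod_diag[OF comm_T] Sym_Sigma_def sym_group_one)

lemma wok_one: "wok (\<lambda>i\<in>{1..q + s}. \<one>) (\<lambda>j\<in>{1..s}. 0) id id \<one> (\<lambda>t\<in>\<T>. t)"
 unfolding wok_def using one_Aut_star_Sigma(1) by (auto simp: permutes_id)

lemma theta_one: "theta \<one>\<^bsub>Weyl_star_group T \<beta> q s \<tau>\<^esub> = idB"
 unfolding one_Weyl theta_wel[OF wok_one] Fm_id[symmetric]
proof (rule Fm_cong[where z = \<one>])
 fix i assume i: "i : K"
 show P: "Pw (\<lambda>j\<in>{1..s}. 0) id id \<one> (\<lambda>t\<in>\<T>. t) i = i"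
  using i by (elim K_cases) (auto simp: one_Aut_star_Sigma(2) hyp_inject)
 show "Uw (\<lambda>i\<in>{1..q + s}. \<one>) (\<lambda>j\<in>{1..s}. 0) id id \<one> (\<lambda>t\<in>\<T>. t) i = \<one> \<otimes> \<one>"
  unfolding P using cl_range[OF i] by simp
qed auto

text \<open>The axioms are transported from the permutations of labels, among which the image of
  \<open>theta\<close> is a subgroup.\<close>

lemma group_Weyl_star: "group (Weyl_star_group T \<beta> q s \<tau>)"
proof (rule group_embedding[OF group_BijGroup _ theta_hom theta_inj])
 show "subgroup (theta ` carrier (Weyl_star_group T \<beta> q s \<tau>)) (BijGroup B)"
  unfolding theta_image by (rule subgroup_WW)
 show "\<one>\<^bsub>Weyl_star_group T \<beta> q s \<tau>\<^esub> : carrier (Weyl_star_group T \<beta> q s \<tau>)"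
  unfolding Weyl_carrier one_Weyl using wok_one by blast
qed (rule Weyl_mult_closed theta_one; assumption?)+

text \<open>Isolates the property of the action that is used later: signs attached to classes travel
  with the index permutation, while switches and translations leave them alone.\<close>

lemma Z2_act_wel:
 assumes ok: "wok w x p si u au" and z: "z : {1..q + s} \<rightarrow>\<^sub>E {0, 1}"
 obtains z' where "z' : {1..q + s} \<rightarrow>\<^sub>E {0, 1}"
  "Z2_act T q s \<tau> (wel w x p si u au) (diag_coset (q + s) (integer_mod_group 2) z) = diag_coset (q + s) (integer_mod_group 2) z'"
  "!!i. i : K ==> z' (cl (Pw x p si u au i)) = z (cl i)"
proof
 let ?z = "permute_tuple q s p si (permute_tuple q s (rst (u, au)) id z)"
 note p = wokD(3)[OF ok] and r = wokD(8)[OF ok] and si = wokD(5)[OF ok]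
 show "Z2_act T q s \<tau> (wel w x p si u au) (diag_coset (q + s) (integer_mod_group 2) z) = diag_coset (q + s) (integer_mod_group 2) ?z"
  unfolding Z2_act_def wel_def by (simp add: permute_diag[OF r permutes_id] permute_diag[OF p si] del: mult_integer_mod_group)
 have low: "?z (p (rst (u, au) i)) = z i" if i: "i : {1..q}" for i
 proof -
  have 1: "rst (u, au) i : {1..q}" using perm_range[OF r i] .
  have 2: "p (rst (u, au) i) : {1..q}" using perm_range[OF p 1] .
  show ?thesis using 1 2 permutes_inverses(2)[OF p] permutes_inverses(2)[OF r] by (simp add: permute_tuple_def)
 qed
 have hi: "?z (q + si j) = z (q + j)" if j: "j : {1..s}" for j
  using perm_range[OF si j] j permutes_inverses(2)[OF si] by (simp add: permute_tuple_def)
 show "?z (cl (Pw x p si u au i)) = z (cl i)" if "i : K" for i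
  using that
 proof (cases rule: K_cases)
  case l: low
  have "p (rst (u, au) i) : {1..q}" using perm_range[OF p perm_range[OF r l]] .
  then show ?thesis using low[OF l] l by simp
 next
  case h: (hyp j c)
  then show ?thesis using hi[OF h(1)] perm_range[OF si h(1)] by simp
 qed
 have "?z m : {0, 1}" if m: "m : {1..q + s}" for m
 proof (cases "m <= q")
  case True
  define k where "k = inv' (rst (u, au)) (inv' p m)"
  have "inv' p m : {1..q}" using inv_perm[OF p] m True by simp
  then have "k : {1..q}" "p (rst (u, au) k) = m"
   using inv_perm[OF r] permutes_inverses(1)[OF r] permutes_inverses(1)[OF p] by (simp_all add: k_def)
  then show ?thesis using low[of k] PiE_mem[OF z, of k] by simp
 next
  case False
  define k where "k = inv' si (m - q)"
  have "k : {1..s}" "si k = m - q" using inv_perm_hyp[OF si m False] permutes_inverses(1)[OF si] by (simp_all add: k_def)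
  then show ?thesis using hi[of k] PiE_mem[OF z, of "q + k"] False by simp
 qed
 moreover have "?z : extensional {1..q + s}" by (simp add: permute_tuple_def)
 ultimately show "?z : {1..q + s} \<rightarrow>\<^sub>E {0, 1}" by (simp add: PiE_iff)
qed

end

section \<open>The subgroup with translation part t_alpha\<close>

locale weyl_quad = weyl_data T \<beta> q s \<tau> + quadratic_group T \<beta> "quad_form T r a b"
 for T :: "'t monoid" (structure) and \<beta> :: "'t => 't => 'f::field" and q s \<tau> r a b
begin

lemma t_elem_tw: "t_elem T \<beta> r a b au = tw au"
 by (simp add: t_elem_def tw_def)

text \<open>Inclusion of \<open>Weyl_group\<close> into \<open>Weyl_star_group\<close> along alpha
  -> (t_alpha, alpha), by which statements on the smaller group become restrictions of those on the
  larger.\<close>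

definition "JJ = (%(x, au). (x, (tw au, au)))"

lemma carrier_Aut_Sigma: "au : carrier (Aut_Sigma T \<beta> r a b q \<tau>) \<longleftrightarrow>
  au : carrier (Aut_T T \<beta>) & (tw au, au) : carrier (Aut_star_Sigma T \<beta> q \<tau>)"
proof -
 have "nat_act T (tw au, au) = (%t. au t \<otimes> tw au)" by (rule ext) (simp add: nat_act_def)
 then show ?thesis using tw(1) by (auto simp: Aut_Sigma_def t_elem_tw carrier_Aut_star_Sigma)
qed

lemma carrier_Weyl_group: "y : carrier (Weyl_group T \<beta> r a b q s \<tau>) \<longleftrightarrow>
  JJ y : carrier (Weyl_star_group T \<beta> q s \<tau>)"
 unfolding Weyl_group_def Weyl_star_group_def semidirect_def[of "inner_group _ _ _ _"] JJ_def
 using carrier_Aut_Sigma by (cases y) (auto simp: carrier_Aut_star_Sigma)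

lemma JJ_mult:
 assumes "y : carrier (Weyl_group T \<beta> r a b q s \<tau>)" "z : carrier (Weyl_group T \<beta> r a b q s \<tau>)"
 shows "JJ (y \<otimes>\<^bsub>Weyl_group T \<beta> r a b q s \<tau>\<^esub> z) = JJ y \<otimes>\<^bsub>Weyl_star_group T \<beta> q s \<tau>\<^esub> JJ z"
proof -
 obtain x au x' au' where y: "y = (x, au)" "z = (x', au')" by (cases y; cases z)
 have "au : carrier (Aut_Sigma T \<beta> r a b q \<tau>)" "au' : carrier (Aut_Sigma T \<beta> r a b q \<tau>)"
  using assms unfolding y Weyl_group_def semidirect_def[of "inner_group _ _ _ _"] by auto
 then have au: "au : carrier (Aut_T T \<beta>)" "au' : carrier (Aut_T T \<beta>)" by (simp_all add: carrier_Aut_Sigma)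
 have "au \<otimes>\<^bsub>Aut_Sigma T \<beta> r a b q \<tau>\<^esub> au' = compose \<T> au au'"
  using Aut_T_mult[OF au] by (simp add: Aut_Sigma_def)
 moreover have "(tw au, au) \<otimes>\<^bsub>Aut_star_Sigma T \<beta> q \<tau>\<^esub> (tw au', au') = (tw au \<otimes> au (tw au'), compose \<T> au au')"
  using Aut_T_mult[OF au] by (simp add: Aut_star_Sigma_def semidirect_def)
 ultimately show ?thesis
  unfolding y Weyl_group_def Weyl_star_group_def semidirect_def[of "inner_group _ _ _ _"] JJ_def
  by (simp add: twisted_embed_def t_elem_tw tw_compose[OF au])
qed

text \<open>For an involution phi these turn out to be the label permutations of the automorphisms
  that commute with phi.\<close>

definition "WW3 = {Fm P au u | P au u. bij_betw P K K & au : carrier (Aut_T T \<beta>) & (\<forall>i\<in>K. u i : \<T>) &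
 (\<forall>i\<in>K. P (star i) = star (P i)) & (\<forall>i\<in>K. cc P au u i = tw au)}"

lemma theta_JJ_image: "(%y. theta (JJ y)) ` carrier (Weyl_group T \<beta> r a b q s \<tau>) = WW3"
proof (intro equalityI subsetI)
 fix F assume "F : (%y. theta (JJ y)) ` carrier (Weyl_group T \<beta> r a b q s \<tau>)"
 then obtain y where y: "JJ y : carrier (Weyl_star_group T \<beta> q s \<tau>)" "F = theta (JJ y)"
  by (auto simp: carrier_Weyl_group)
 then obtain w x p si u au where w: "JJ y = wel w x p si u au" and ok: "wok w x p si u au"
  unfolding Weyl_carrier by blast
 have "u = tw au" using w by (cases y) (simp add: JJ_def wel_def)
 then have c: "!!i. i : K ==> cc (Pw x p si u au) au (Uw w x p si u au) i = tw au" using cc_wel[OF ok] by (simp only:)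
 show "F : WW3"
  unfolding WW3_def mem_Collect_eq y(2) w theta_wel[OF ok]
  by (intro exI[of _ "Pw x p si u au"] exI[of _ au] exI[of _ "Uw w x p si u au"] conjI ballI refl
    PP_bij[OF wokD(11)[OF ok] wokD(5)[OF ok]] wokD(7)[OF ok] Uw_T[OF ok]
    PP_star[OF wokD(11)[OF ok] wokD(5)[OF ok]] c)
next
 fix F assume "F : WW3"
 then obtain P au u where P: "bij_betw P K K" and au: "au : carrier (Aut_T T \<beta>)" and u0: "\<forall>i\<in>K. u i : \<T>"
  and s0: "\<forall>i\<in>K. P (star i) = star (P i)" and c0: "\<forall>i\<in>K. cc P au u i = tw au" and F: "F = Fm P au u"
  unfolding WW3_def mem_Collect_eq by (elim exE conjE)
 have 1: "!!i. i : K ==> u i : \<T>" "!!i. i : K ==> P (star i) = star (P i)" "!!i. i : K ==> cc P au u i = tw au"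
  using u0 s0 c0 by blast+
 show "F : (%y. theta (JJ y)) ` carrier (Weyl_group T \<beta> r a b q s \<tau>)"
 proof (rule WW_surj[OF P au 1])
  fix w x p si assume ok: "wok w x p si (tw au) au" and th: "theta (wel w x p si (tw au) au) = Fm P au u"
  define y where "y = (((diag_coset (q + s) T w, x), (p, si)), au)"
  have y: "JJ y = wel w x p si (tw au) au" by (simp add: y_def JJ_def wel_def)
  have "y : carrier (Weyl_group T \<beta> r a b q s \<tau>)"
   unfolding carrier_Weyl_group y Weyl_carrier using ok by blast
  then show ?thesis unfolding F th[symmetric] y[symmetric] by (rule imageI)
 qed
qed

lemma theta_JJ_hom: "(%y. theta (JJ y)) : hom (Weyl_group T \<beta> r a b q s \<tau>) (BijGroup B)"
 using theta_hom JJ_mult by (auto simp: hom_def carrier_Weyl_group)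

lemma theta_JJ_inj: "inj_on (%y. theta (JJ y)) (carrier (Weyl_group T \<beta> r a b q s \<tau>))"
proof (rule inj_onI)
 fix y z assume "y : carrier (Weyl_group T \<beta> r a b q s \<tau>)" "z : carrier (Weyl_group T \<beta> r a b q s \<tau>)" "theta (JJ y) = theta (JJ z)"
 then have "JJ y = JJ z" using theta_inj by (auto simp: carrier_Weyl_group dest: inj_onD)
 then show "y = z" by (auto simp: JJ_def split: prod.splits)
qed

end

section \<open>Automorphisms of the grading are monomial\<close>

lemma automorphismsD:
 assumes "ps : automorphisms n"
 shows "ps : Bij (carrier_mat n n)" "lin_map n ps"
  "X : carrier_mat n n ==> Y : carrier_mat n n ==> ps (X * Y) = ps X * ps Y"
  "X : carrier_mat n n ==> ps X : carrier_mat n n"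
 using assms by (auto simp: automorphisms_def lin_map_def Bij_def bij_betw_def)

lemma Bij_inj: "ps : Bij S ==> x : S ==> y : S ==> ps x = ps y ==> x = y"
 by (auto simp: Bij_def bij_betw_def dest: inj_onD)

lemma Bij_surj: "ps : Bij S ==> y : S ==> \<exists>x\<in>S. ps x = y"
proof -
 assume "ps : Bij S" "y : S"
 then have "y : ps ` S" by (simp add: Bij_def bij_betw_def)
 then show ?thesis by blast
qed

lemma automorphism_one:
 assumes "ps : automorphisms n"
 shows "ps (1\<^sub>m n) = 1\<^sub>m n"
proof -
 note a = automorphismsD[OF assms]
 obtain X where X: "X : carrier_mat n n" "ps X = 1\<^sub>m n" using Bij_surj[OF a(1), of "1\<^sub>m n"] by auto
 have "ps (1\<^sub>m n) * ps X = ps X" using a(3)[of "1\<^sub>m n" X] X(1) by simp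
 then show ?thesis using a(4)[of "1\<^sub>m n"] X by simp
qed

lemma subgroup_automorphisms: "subgroup (automorphisms n) (mat_bij_group n :: ('f::field mat => 'f mat) monoid)"
proof (rule group.subgroupI[OF group_BijGroup])
 let ?C = "carrier_mat n n :: 'f mat set"
 show "automorphisms n <= carrier (mat_bij_group n :: ('f mat => 'f mat) monoid)"
  by (auto simp: BijGroup_def automorphisms_def)
 have "(\<lambda>X\<in>?C. X) : automorphisms n" by (simp add: automorphisms_def id_Bij mat_linear_def)
 then show "(automorphisms n :: ('f mat => 'f mat) set) ~= {}" by blast
 fix ps :: "'f mat => 'f mat" assume ps: "ps : automorphisms n"
 note a = automorphismsD[OF ps]
 define rh where "rh = (\<lambda>X\<in>?C. inv_into ?C ps X)"
 have rh: "rh X : ?C" "ps (rh X) = X" if "X : ?C" for X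
  using that a(1) Bij_inv_into_mem[OF a(1) that] by (auto simp: rh_def Bij_def bij_betw_def f_inv_into_f)
 have eq: "rh X = Y" if "Y : ?C" "X : ?C" "ps Y = X" for X Y
  by (rule Bij_inj[OF a(1) rh(1)[OF that(2)] that(1)]) (simp add: rh(2)[OF that(2)] that(3))
 have "rh (X + Y) = rh X + rh Y" if "X : ?C" "Y : ?C" for X Y
  by (rule eq) (simp_all add: that rh lin_mapD(2)[OF a(2)])
 moreover have "rh (X * Y) = rh X * rh Y" if "X : ?C" "Y : ?C" for X Y
  by (rule eq) (simp_all add: that rh a(3) mult_carrier_mat[of _ n n _ n])
 moreover have "rh (c \<star> X) = c \<star> rh X" if "X : ?C" for X c
  by (rule eq) (simp_all add: that rh lin_mapD(3)[OF a(2)])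
 moreover have "rh : Bij ?C" unfolding rh_def by (rule restrict_inv_into_Bij[OF a(1)])
 ultimately have "rh : automorphisms n" unfolding automorphisms_def mat_linear_def by blast
 then show "inv\<^bsub>mat_bij_group n\<^esub> ps : automorphisms n" unfolding inv_BijGroup[OF a(1)] rh_def .
 fix ka :: "'f mat => 'f mat" assume ka: "ka : automorphisms n"
 note b = automorphismsD[OF ka]
 have "compose ?C ps ka (X * Y) = compose ?C ps ka X * compose ?C ps ka Y" if "X : ?C" "Y : ?C" for X Y
  using b(3)[OF that] a(3)[OF b(4)[OF that(1)] b(4)[OF that(2)]] that mult_carrier_mat[OF that] by (simp add: compose_def)
 moreover have "compose ?C ps ka (X + Y) = compose ?C ps ka X + compose ?C ps ka Y" if "X : ?C" "Y : ?C" for X Y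
  using lin_mapD(2)[OF b(2) that] lin_mapD(2)[OF a(2) b(4)[OF that(1)] b(4)[OF that(2)]] that by (simp add: compose_def)
 moreover have "compose ?C ps ka (c \<star> X) = c \<star> compose ?C ps ka X" if "X : ?C" for X c
  using lin_mapD(3)[OF b(2) that, of c] lin_mapD(3)[OF a(2) b(4)[OF that], of c] that by (simp add: compose_def)
 ultimately have "compose ?C ps ka : automorphisms n"
  using compose_Bij[OF a(1) b(1)] unfolding automorphisms_def mat_linear_def by blast
 then show "ps \<otimes>\<^bsub>mat_bij_group n\<^esub> ka : automorphisms n" using a(1) b(1) by (simp add: BijGroup_def)
qed

lemma anti_automorphismsD:
 assumes "ps : anti_automorphisms n"
 shows "ps : Bij (carrier_mat n n)" "lin_map n ps"
  "X : carrier_mat n n ==> Y : carrier_mat n n ==> ps (X * Y) = ps Y * ps X"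
  "X : carrier_mat n n ==> ps X : carrier_mat n n"
 using assms by (auto simp: anti_automorphisms_def lin_map_def Bij_def bij_betw_def)

context weyl_data
begin

text \<open>Equality of degrees, described on labels alone. That the grading group identifies
  exactly these labels is \<open>deg_iff\<close>; the structural argument uses the relation without
  looking at the group.\<close>

definition "RR b b' \<longleftrightarrow> (\<exists>i\<in>K. \<exists>j\<in>K. \<exists>t. b = (i, t, i) & b' = (j, t, j)) | b' = b | b' = bphi b"

lemma bphi_diag: "i : K ==> t : \<T> ==> bphi (i, t, i) = (star i, t, star i)"
 by (simp add: bphi_def ac)

lemma RR_refl: "RR b b" by (simp add: RR_def)

lemma RR_sym: "b : B ==> RR b b' ==> RR b' b"
 unfolding RR_def using bphi_bphi by metis

lemma RR_trans:
 assumes b: "b : B" and r: "RR b b'" "RR b' b''"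
 shows "RR b b''"
proof -
 have d: "RR c c''" if "c : B" "c = (i, t, i)" "i : K" "c' = (j, t, j)" "j : K" "c'' = bphi c'" for c c' c'' i j t
  using that bphi_diag[of j t] unfolding RR_def by (auto intro!: bexI[of _ i] bexI[of _ "star j"])
 have d2: "RR c c''" if "c : B" "c' = bphi c" "c' = (i, t, i)" "i : K" "c'' = (j, t, j)" "j : K" for c c' c'' i j t
 proof -
  have tT: "t : \<T>" using bphi_B[OF that(1)] unfolding that(2)[symmetric] that(3) by simp
  have "c = (star i, t, star i)" using bphi_bphi[OF that(1)] that(2,3) bphi_diag[OF that(4) tT] by simp
  then show ?thesis using that unfolding RR_def by (auto intro!: bexI[of _ "star i"] bexI[of _ j])
 qed
 consider "b' = b | b'' = b'" | i j t k l u where "b = (i, t, i)" "b' = (j, t, j)" "b' = (k, u, k)" "b'' = (l, u, l)" "i : K" "j : K" "k : K" "l : K"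
  | i j t where "b = (i, t, i)" "b' = (j, t, j)" "i : K" "j : K" "b'' = bphi b'"
  | i j t where "b' = bphi b" "b' = (i, t, i)" "b'' = (j, t, j)" "i : K" "j : K"
  | "b' = bphi b" "b'' = bphi b'"
  using r unfolding RR_def by metis
 then show ?thesis
 proof cases
  case 1 then show ?thesis using r by auto
 next
  case 2 then show ?thesis unfolding RR_def by auto
 next
  case 3 then show ?thesis using d[OF b] by blast
 next
  case 4 then show ?thesis using d2[OF b] by blast
 next
  case 5 then show ?thesis using bphi_bphi[OF b] by (simp add: RR_refl)
 qed
qed

text \<open>Degree and outer indices determine the middle entry. The case to check is a label whose
  \<open>bphi\<close> image has the same outer indices: then j* = i, and the factors t_i and t_j
  cancel.\<close>

lemma RR_mid:
 assumes "(i, t, j) : B" "RR (i, t, j) (i, t', j)"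
 shows "t' = t"
proof -
 have ij: "i : K" "j : K" "t : \<T>" using assms(1) by simp_all
 have "t \<otimes> tt i \<otimes> tt j = t" if "star j = i"
 proof -
  have "tt i = tt j" using tt_star[OF ij(2)] that by simp
  then show ?thesis using ij by (simp add: ac)
 qed
 then show ?thesis using assms(2) by (auto simp: RR_def bphi_def)
qed

end

text \<open>The interface between the concrete matrices and the structural argument:
  \<open>sg\<close> is the cocycle of the products X_t X_u, \<open>\<eta>\<close> holds the weights
  of phi, and \<open>m\<close> the scalars of Phi on hyperbolic rows. The values of
  \<open>\<eta>\<close> are prescribed on labels (i, t, i) and between hyperbolic indices.\<close>

locale graded_matrix_algebra = weyl_quad T \<beta> q s \<tau> r ax bx + mat_basis n "weyl_data.B T q s" e N
 for T :: "'t monoid" (structure) and \<beta> :: "'t => 't => 'f::alg_closed_field" and q s \<tau> r ax bx n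
  and e :: "nat \<times> 't \<times> nat => 'f mat" and N +
 fixes sg :: "'t => 't => 'f" and \<eta> :: "nat \<times> 't \<times> nat => 'f" and m :: "nat => 'f" and \<phi>
  and G :: "'g monoid" and \<Gamma> :: "'g => 'f mat set"
 assumes e_mult: "[|i : K; j : K; k : K; l : K; t : \<T>; u : \<T>|] ==>
   e (i, t, j) * e (k, u, l) = (if j = k then sg t u \<star> e (i, t \<otimes> u, l) else 0\<^sub>m n n)"
  and sg_nz: "t : \<T> ==> u : \<T> ==> sg t u ~= 0"
  and sg_one: "t : \<T> ==> sg \<one> t = 1" "t : \<T> ==> sg t \<one> = 1"
  and sg_assoc: "[|t : \<T>; u : \<T>; v : \<T>|] ==>
   sg t u * sg (t \<otimes> u) v = sg t (u \<otimes> v) * sg u v"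
  and sg_comm: "t : \<T> ==> u : \<T> ==> sg t u = \<beta> t u * sg u t"
  and comps: "components n G \<Gamma> = (%b. {X : carrier_mat n n. \<forall>b'\<in>B. ~ RR b b' --> coef X b' = 0}) ` B"
  and phi_anti: "\<phi> : anti_automorphisms n"
  and phi_e: "b : B ==> \<phi> (e b) = \<eta> b \<star> e (bphi b)"
  and eta_nz: "b : B ==> \<eta> b ~= 0"
  and eta_diag: "i : K ==> t : \<T> ==> \<eta> (i, t, i) = quad_form T r ax bx t * \<beta> (tt i) t"
  and eta_pair: "i : K ==> j : K ==> ~ i <= q ==> ~ j <= q ==> t : \<T> ==>
   \<eta> (i, t, j) = m i / m j * quad_form T r ax bx t"
  and m_nz: "i : K ==> m i ~= 0"
  and not_bad: "~ (q = 2 & s = 0 & \<tau> 1 = \<tau> 2)"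
begin

definition "CC b = {X : carrier_mat n n. \<forall>b'\<in>B. ~ RR b b' --> coef X b' = 0}"

lemma comps_CC: "components n G \<Gamma> = CC ` B" unfolding comps CC_def ..

lemma e_in_CC: "b : B ==> e b : CC b"
 using e_carrier RR_refl by (auto simp: CC_def coef_e)

lemma CC_eq: "b : B ==> b' : B ==> RR b b' ==> CC b = CC b'"
proof -
 assume b: "b : B" and b': "b' : B" and r: "RR b b'"
 have "RR b c \<longleftrightarrow> RR b' c" for c
  using RR_trans[OF b r, of c] RR_trans[OF b' RR_sym[OF b r], of c] by blast
 then show ?thesis by (simp add: CC_def)
qed

lemma CC_carrier: "X : CC b ==> X : carrier_mat n n" by (simp add: CC_def)

lemma CC_coef: "X : CC b ==> b' : B ==> coef X b' ~= 0 ==> RR b b'" by (auto simp: CC_def)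

lemma smult_e_inj:
 assumes "b : B" "b' : B" "c \<star> e b = d \<star> e b'" "c ~= 0"
 shows "b = b'" "c = d"
proof -
 have *: "coef (c \<star> e b) b = coef (d \<star> e b') b" using assms(3) by simp
 have ec: "e b : carrier_mat n n" "e b' : carrier_mat n n" using assms(1,2) by (auto intro: e_carrier)
 show bb: "b = b'"
 proof (rule ccontr)
  assume "b ~= b'"
  then show False using * assms(1,2,4) ec by (simp add: coef_smult coef_e)
 qed
 show "c = d" using * assms(1,2) ec unfolding bb by (simp add: coef_smult coef_e)
qed

lemma smult_e_nz: "b : B ==> c ~= 0 ==> c \<star> e b ~= 0\<^sub>m n n"
 using coef_smult[OF e_carrier, of b c b] coef_e[of b b] coef_0[of b] by auto

lemma coef_ex:
 assumes "X : carrier_mat n n" "X ~= 0\<^sub>m n n"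
 shows "\<exists>b\<in>B. coef X b ~= 0"
 using mat_coef_eqI[OF assms(1), of "0\<^sub>m n n"] assms(2) coef_0 by auto

text \<open>The Peirce decomposition in coordinates: the two idempotents cut out the block (i,
  j).\<close>

lemma coef_proj:
 assumes i: "i : K" and j: "j : K" and b: "(k, t, l) : B" and X: "X : carrier_mat n n"
 shows "coef (e (i, \<one>, i) * X * e (j, \<one>, j)) (k, t, l) = (if k = i & l = j then coef X (k, t, l) else 0)"
proof -
 let ?f = "%X. coef (e (i, \<one>, i) * X * e (j, \<one>, j)) (k, t, l) - (if k = i & l = j then coef X (k, t, l) else 0)"
 have ei: "e (i, \<one>, i) : carrier_mat n n" "e (j, \<one>, j) : carrier_mat n n" using i j by (simp_all add: e_carrier)
 have "X : {X : carrier_mat n n. ?f X = 0}"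
 proof (rule span_induct[OF mat_subspace_zero_of _ X])
  fix Y Z :: "'f mat" assume YZ: "Y : carrier_mat n n" "Z : carrier_mat n n"
  have "e (i, \<one>, i) * (Y + Z) * e (j, \<one>, j) = e (i, \<one>, i) * Y * e (j, \<one>, j) + e (i, \<one>, i) * Z * e (j, \<one>, j)"
   using ei YZ by (simp add: mult_add_distrib_mat[of _ n n _ n] add_mult_distrib_mat[of _ n n])
  then show "?f (Y + Z) = ?f Y + ?f Z" using ei YZ by (simp add: coef_add)
 next
  fix c and Y :: "'f mat" assume Y: "Y : carrier_mat n n"
  have "e (i, \<one>, i) * (c \<star> Y) * e (j, \<one>, j) = c \<star> (e (i, \<one>, i) * Y * e (j, \<one>, j))"
   using ei Y by (simp add: mult_smult_distrib[of _ n n _ n] mult_smult_assoc_mat[of _ n n])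
  then show "?f (c \<star> Y) = c * ?f Y" using ei Y by (simp add: coef_smult algebra_simps)
 next
  fix d assume d: "d : B"
  then obtain k' t' l' where d': "d = (k', t', l')" "k' : K" "t' : \<T>" "l' : K" by (auto simp: B_def)
  have ed: "e d : carrier_mat n n" using d by (rule e_carrier)
  have one: "1 \<star> e d = e d" using ed by (auto intro!: eq_matI)
  have "e (i, \<one>, i) * e d * e (j, \<one>, j) = (if k' = i & l' = j then e d else 0\<^sub>m n n)"
   using d' i j ei one by (auto simp: e_mult sg_one)
  then show "e d : {X : carrier_mat n n. ?f X = 0}"
   using ed d' b by (auto simp: coef_e coef_0)
 qed
 then show ?thesis by simp
qed

lemma coef_one: "(i, t, j) : B ==> coef (1\<^sub>m n) (i, t, j) = (if i = j & t = \<one> then 1 else 0)"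
proof -
 assume b: "(i, t, j) : B"
 then have ij: "i : K" "j : K" "t : \<T>" by simp_all
 have ei: "e (i, \<one>, i) : carrier_mat n n" "e (j, \<one>, j) : carrier_mat n n" using ij by (simp_all add: e_carrier)
 have one: "1 \<star> e (i, \<one>, i) = e (i, \<one>, i)" "1 \<star> e (j, \<one>, j) = e (j, \<one>, j)" using ei by (auto intro!: eq_matI)
 have "coef (1\<^sub>m n) (i, t, j) = coef (e (i, \<one>, i) * 1\<^sub>m n * e (j, \<one>, j)) (i, t, j)"
  using coef_proj[OF ij(1,2) b, of "1\<^sub>m n"] by simp
 also have "... = coef (if i = j then e (i, \<one>, i) else 0\<^sub>m n n) (i, t, j)"
  using ei ij one by (simp add: e_mult sg_one)
 also have "... = (if i = j & t = \<one> then 1 else 0)" using ij by (auto simp: coef_e coef_0)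
 finally show ?thesis .
qed

lemma one_CC: "i : K ==> 1\<^sub>m n : CC (i, \<one>, i)"
 unfolding CC_def using coef_one by (auto simp: RR_def B_def)

lemma RR_one: "i : K ==> RR (i, \<one>, i) b \<longleftrightarrow> (\<exists>l\<in>K. b = (l, \<one>, l))"
 by (auto simp: RR_def bphi_diag)

lemma Aut_gr_D:
 assumes "ps : Aut_gr n G \<Gamma>"
 shows "ps : automorphisms n" "x : B ==> \<exists>b'\<in>B. ps ` CC x = CC b'"
proof -
 show "ps : automorphisms n" using assms by (simp add: Aut_gr_def)
 assume x: "x : B"
 have "(`) ps ` CC ` B = CC ` B" using assms unfolding Aut_gr_def comps_CC bij_betw_def by simp
 then have "ps ` CC x : CC ` B" using x by blast
 then show "\<exists>b'\<in>B. ps ` CC x = CC b'" by blast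
qed

text \<open>The identity component is spanned by the orthogonal idempotents e(l, \<one>, l), so it
  is a product of copies of the field, with the coordinates as projections.\<close>

lemma CC_one_mult:
 assumes i: "i : K" and X: "X : CC (i, \<one>, i)" and l: "l : K"
 shows "X * e (l, \<one>, l) = coef X (l, \<one>, l) \<star> e (l, \<one>, l)"
proof (rule mat_coef_eqI)
 have XC: "X : carrier_mat n n" using CC_carrier[OF X] .
 have el: "e (l, \<one>, l) : carrier_mat n n" using l by (simp add: e_carrier)
 show "X * e (l, \<one>, l) : carrier_mat n n" "coef X (l, \<one>, l) \<star> e (l, \<one>, l) : carrier_mat n n" using XC el by simp_all
 have "X = lin_comb B (coef X) (%b. b)" using expansion[OF XC] ..
 have "mat_subspace n {X : carrier_mat n n. X * e (l, \<one>, l) = coef X (l, \<one>, l) \<star> e (l, \<one>, l)}"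
  by (rule mat_subspaceI)
   (use el in \<open>auto simp: coef_add coef_smult coef_0 add_mult_distrib_mat[of _ n n] mult_smult_assoc_mat[of _ n n] add_smult_distrib_right_mat[of _ n n] intro!: eq_matI\<close>)
 then have "lin_comb B (coef X) (%b. b) : {X : carrier_mat n n. X * e (l, \<one>, l) = coef X (l, \<one>, l) \<star> e (l, \<one>, l)}"
 proof (rule lin_comb_in_subspace[OF _ fin])
  fix b assume b: "b : B" "coef X b ~= 0"
  then have "RR (i, \<one>, i) b" using CC_coef[OF X] by blast
  then obtain k where k: "k : K" "b = (k, \<one>, k)" using RR_one[OF i] by blast
  have z: "0 \<star> e (l, \<one>, l) = 0\<^sub>m n n" "1 \<star> e (l, \<one>, l) = e (l, \<one>, l)" using el by (auto intro!: eq_matI)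
  show "e b : {X : carrier_mat n n. X * e (l, \<one>, l) = coef X (l, \<one>, l) \<star> e (l, \<one>, l)}"
   using k l z e_carrier[OF b(1)] by (auto simp: e_mult sg_one coef_e)
 qed simp
 then have "X * e (l, \<one>, l) = coef X (l, \<one>, l) \<star> e (l, \<one>, l)" using expansion[OF XC] by simp
 then show "!!b. b : B ==> coef (X * e (l, \<one>, l)) b = coef (coef X (l, \<one>, l) \<star> e (l, \<one>, l)) b" by simp
qed

lemma CC_one_coef_mult:
 assumes i: "i : K" and X: "X : CC (i, \<one>, i)" and Y: "Y : CC (i, \<one>, i)" and l: "l : K"
 shows "coef (X * Y) (l, \<one>, l) = coef X (l, \<one>, l) * coef Y (l, \<one>, l)"
proof -
 have XC: "X : carrier_mat n n" "Y : carrier_mat n n" using CC_carrier X Y by blast+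
 have b: "(l, \<one>, l) : B" using l by simp
 have el: "e (l, \<one>, l) : carrier_mat n n" using e_carrier[OF b] .
 have "e (l, \<one>, l) * (X * Y) * e (l, \<one>, l) = e (l, \<one>, l) * (X * (Y * e (l, \<one>, l)))"
  using XC el by (simp add: assoc_mult_mat[of _ n n _ n _ n])
 also have "... = coef Y (l, \<one>, l) \<star> (coef X (l, \<one>, l) \<star> (e (l, \<one>, l) * e (l, \<one>, l)))"
  unfolding CC_one_mult[OF i Y l] using XC el
  by (simp add: mult_smult_distrib[of _ n n _ n] CC_one_mult[OF i X l])
 also have "e (l, \<one>, l) * e (l, \<one>, l) = e (l, \<one>, l)"
  using l el by (auto simp: e_mult sg_one intro!: eq_matI)
 finally have "coef (e (l, \<one>, l) * (X * Y) * e (l, \<one>, l)) (l, \<one>, l) = coef Y (l, \<one>, l) * (coef X (l, \<one>, l) * 1)"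
  using el b by (simp add: coef_smult coef_e)
 then show ?thesis using coef_proj[OF l l b, of "X * Y"] XC by (simp add: mult.commute)
qed

definition "monomial ps F w \<longleftrightarrow> (\<forall>x\<in>B. F x : B & w x ~= (0::'f) & ps (e x) = w x \<star> e (F x))"

lemma monomialD: "monomial ps F w ==> x : B ==> F x : B" "monomial ps F w ==> x : B ==> w x ~= 0"
 "monomial ps F w ==> x : B ==> ps (e x) = w x \<star> e (F x)"
 by (auto simp: monomial_def)

lemma one_smult: "X : carrier_mat n n ==> 1 \<star> X = (X :: 'f mat)"
 by (auto intro!: eq_matI)

lemma smult_smult: "c \<star> (d \<star> X) = (c * d) \<star> (X :: 'f mat)"
 by (auto intro!: eq_matI)

lemma smult_mult:
 assumes "X : carrier_mat n n" "Y : carrier_mat n n"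
 shows "(c \<star> X) * (d \<star> Y) = (c * d) \<star> (X * (Y :: 'f mat))"
proof -
 have "(c \<star> X) * (d \<star> Y) = c \<star> (X * (d \<star> Y))"
  using assms by (intro mult_smult_assoc_mat[of _ n n _ n]) auto
 also have "X * (d \<star> Y) = d \<star> (X * Y)" using assms by (intro mult_smult_distrib[of _ n n _ n])
 finally show ?thesis by (simp add: smult_smult)
qed

text \<open>The identity component contains the identity matrix, so \<open>ps\<close> preserves it.
  The images of the idempotents are nonzero and mutually orthogonal in a product of equally many
  copies of the field; their supports are disjoint and nonempty, hence single points.\<close>

lemma idempotents_permuted:
 assumes ps: "ps : Aut_gr n G \<Gamma>"
 obtains p where "bij_betw p K K" "!!i. i : K ==> ps (e (i, \<one>, i)) = e (p i, \<one>, p i)"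
proof -
 note a = automorphismsD[OF Aut_gr_D(1)[OF ps]]
 obtain i0 where i0: "i0 : K" using K_nonempty by blast
 define x where "x i l = coef (ps (e (i, \<one>, i))) (l, \<one>, l)" for i l
 have eB: "(i, \<one>, i) : B" if "i : K" for i using that by simp
 have CC1: "CC (i, \<one>, i) = CC (i0, \<one>, i0)" if "i : K" for i
  using CC_eq[OF eB[OF i0] eB[OF that]] RR_one[OF i0] that by blast
 have in_CC: "ps (e (i, \<one>, i)) : CC (i0, \<one>, i0)" if i: "i : K" for i
 proof -
  obtain c where c: "c : B" "ps ` CC (i, \<one>, i) = CC c" using Aut_gr_D(2)[OF ps eB[OF i]] by blast
  have "ps (1\<^sub>m n) : CC c" using c(2) one_CC[OF i] by blast
  then have "1\<^sub>m n : CC c" by (simp add: automorphism_one[OF Aut_gr_D(1)[OF ps]])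
  moreover have "coef (1\<^sub>m n) (i0, \<one>, i0) ~= 0" using coef_one[OF eB[OF i0]] by simp
  ultimately have "RR c (i0, \<one>, i0)" using CC_coef[OF _ eB[OF i0]] by blast
  then have "CC c = CC (i0, \<one>, i0)" by (rule CC_eq[OF c(1) eB[OF i0]])
  then show ?thesis using c(2) e_in_CC[OF eB[OF i]] by blast
 qed
 have expand: "coef (ps (e (i, \<one>, i))) y = 0" if "i : K" "y : B" "!!l. l : K ==> y ~= (l, \<one>, l)" for i y
  using CC_coef[OF in_CC[OF that(1)] that(2)] RR_one[OF i0] that(3) by blast
 \<comment> \<open>Coordinates of orthogonal idempotents: each is 0 or 1, and at a given
   \<open>l\<close> at most one of them is nonzero.\<close>
 have prod: "x i l * x j l = (if i = j then x i l else 0)" if ij: "i : K" "j : K" "l : K" for i j l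
 proof -
  have ec: "e (i, \<one>, i) : carrier_mat n n" "e (j, \<one>, j) : carrier_mat n n" using ij by (simp_all add: e_carrier)
  have "x i l * x j l = coef (ps (e (i, \<one>, i)) * ps (e (j, \<one>, j))) (l, \<one>, l)"
   unfolding x_def by (rule CC_one_coef_mult[OF i0 in_CC[OF ij(1)] in_CC[OF ij(2)] ij(3), symmetric])
  also have "ps (e (i, \<one>, i)) * ps (e (j, \<one>, j)) = ps (e (i, \<one>, i) * e (j, \<one>, j))" using a(3)[OF ec] ..
  also have "e (i, \<one>, i) * e (j, \<one>, j) = (if i = j then e (i, \<one>, i) else 0\<^sub>m n n)"
   using ij ec by (auto simp: e_mult sg_one one_smult)
  finally show ?thesis by (simp add: x_def lin_map_zero[OF a(2)] coef_0 split: if_splits)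
 qed
 have ex: "\<exists>l\<in>K. x i l ~= 0" if i: "i : K" for i
 proof -
  have ec: "e (i, \<one>, i) : carrier_mat n n" using i by (simp add: e_carrier)
  have "ps (e (i, \<one>, i)) ~= 0\<^sub>m n n"
  proof
   assume "ps (e (i, \<one>, i)) = 0\<^sub>m n n"
   then have "e (i, \<one>, i) = 0\<^sub>m n n" using Bij_inj[OF a(1) ec, of "0\<^sub>m n n"] lin_map_zero[OF a(2)] by simp
   then show False using smult_e_nz[OF eB[OF i], of 1] ec by (simp add: one_smult)
  qed
  then obtain y where "y : B" "coef (ps (e (i, \<one>, i))) y ~= 0" using coef_ex a(4)[OF ec] by blast
  then show ?thesis using expand[OF i] unfolding x_def by metis
 qed
 define p where "p i = (SOME l. l : K & x i l ~= 0)" for i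
 have p: "p i : K" "x i (p i) ~= 0" if "i : K" for i
  using someI_ex[of "%l. l : K & x i l ~= 0"] ex[OF that] unfolding p_def by auto
 have uniq: "i = j" if "i : K" "j : K" "l : K" "x i l ~= 0" "x j l ~= 0" for i j l
  using prod[OF that(1,2,3)] that(4,5) by (auto split: if_splits)
 have bij: "bij_betw p K K"
 proof (rule endo_bij[OF fin_K _ p(1)])
  show "inj_on p K"
  proof (rule inj_onI)
   fix i j assume ij: "i : K" "j : K" "p i = p j"
   then show "i = j" using uniq[OF ij(1,2) p(1)[OF ij(2)]] p(2)[OF ij(1)] p(2)[OF ij(2)] by simp
  qed
 qed
 have "ps (e (i, \<one>, i)) = e (p i, \<one>, p i)" if i: "i : K" for i
 proof -
  have ec: "e (i, \<one>, i) : carrier_mat n n" using i by (simp add: e_carrier)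
  have "x i l = 0" if l: "l : K" "l ~= p i" for l
  proof (rule ccontr)
   assume nz: "x i l ~= 0"
   have "l : p ` K" using bij_betw_imp_surj_on[OF bij] l(1) by simp
   then obtain j where j: "j : K" "l = p j" by blast
   then have "i = j" using uniq[OF i j(1) l(1) nz] p(2)[OF j(1)] by simp
   then show False using j l(2) by simp
  qed
  then have "coef (ps (e (i, \<one>, i))) y = 0" if "y : B" "y ~= (p i, \<one>, p i)" for y
   using expand[OF i that(1)] that(2) unfolding x_def by metis
  then have "ps (e (i, \<one>, i)) = x i (p i) \<star> e (p i, \<one>, p i)"
   unfolding x_def using coef_single[OF a(4)[OF ec] eB[OF p(1)[OF i]]] by blast
  moreover have "x i (p i) = 1" using prod[OF i i p(1)[OF i]] p(2)[OF i] by simp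
  ultimately show ?thesis using p(1)[OF i] by (simp add: one_smult e_carrier)
 qed
 then show ?thesis using that bij by blast
qed

text \<open>Peirce projections confine the image of e(i, t, j) to the block (P i, P j), and by
  \<open>RR_mid\<close> a component meets a block in at most one label. So the automorphism is
  monomial, and multiplicativity forces the shape \<open>Fm\<close>.\<close>

lemma Aut_gr_monomial:
 assumes ps: "ps : Aut_gr n G \<Gamma>"
 obtains P au u w where "bij_betw P K K" "au : carrier (Aut_T T \<beta>)" "!!i. i : K ==> u i : \<T>"
  "monomial ps (Fm P au u) w"
proof -
 note a = automorphismsD[OF Aut_gr_D(1)[OF ps]]
 obtain p where bij: "bij_betw p K K" and pe: "!!i. i : K ==> ps (e (i, \<one>, i)) = e (p i, \<one>, p i)"
  using idempotents_permuted[OF ps] by blast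
 have pK: "p i : K" if "i : K" for i using bij that by (auto simp: bij_betw_def)
 have step: "\<exists>t'\<in>\<T>. \<exists>c. c ~= 0 & ps (e (i, t, j)) = c \<star> e (p i, t', p j)"
  if ij: "i : K" "t : \<T>" "j : K" for i t j
 proof -
  have xB: "(i, t, j) : B" using ij by simp
  have ec: "e (i, t, j) : carrier_mat n n" "e (i, \<one>, i) : carrier_mat n n" "e (j, \<one>, j) : carrier_mat n n"
   using ij by (simp_all add: e_carrier)
  have "e (i, \<one>, i) * e (i, t, j) * e (j, \<one>, j) = e (i, t, j)"
   using ij ec by (simp add: e_mult sg_one one_smult)
  then have pr: "ps (e (i, t, j)) = e (p i, \<one>, p i) * ps (e (i, t, j)) * e (p j, \<one>, p j)"
   using a(3)[OF ec(2,1)] a(3)[OF mult_carrier_mat[OF ec(2,1)] ec(3)] pe ij by metis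
  have supp: "coef (ps (e (i, t, j))) (k, v, l) = 0" if "(k, v, l) : B" "~ (k = p i & l = p j)" for k v l
   using coef_proj[OF pK[OF ij(1)] pK[OF ij(3)] that(1) a(4)[OF ec(1)]] pr that(2) by metis
  have nz: "ps (e (i, t, j)) ~= 0\<^sub>m n n"
  proof
   assume "ps (e (i, t, j)) = 0\<^sub>m n n"
   then have "e (i, t, j) = 0\<^sub>m n n" using Bij_inj[OF a(1) ec(1), of "0\<^sub>m n n"] lin_map_zero[OF a(2)] by simp
   then show False using smult_e_nz[OF xB, of 1] ec by (simp add: one_smult)
  qed
  obtain y where y: "y : B" "coef (ps (e (i, t, j))) y ~= 0" using coef_ex[OF a(4)[OF ec(1)] nz] by blast
  then obtain t' where t': "y = (p i, t', p j)" "t' : \<T>"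
   using supp by (cases y) (auto simp: B_def)
  obtain c where c: "c : B" "ps ` CC (i, t, j) = CC c" using Aut_gr_D(2)[OF ps xB] by blast
  have inc: "ps (e (i, t, j)) : CC c" using c e_in_CC[OF xB] by blast
  have "coef (ps (e (i, t, j))) z = 0" if z: "z : B" "z ~= y" for z
  proof (rule ccontr)
   assume n0: "coef (ps (e (i, t, j))) z ~= 0"
   obtain k v l where zz: "z = (k, v, l)" by (cases z)
   then have kl: "k = p i" "l = p j" using supp[of k v l] n0 z(1) by blast+
   have "RR c y" "RR c z" using CC_coef[OF inc] y z(1) n0 by blast+
   then have "RR y z" using RR_trans[OF y(1) RR_sym[OF c(1)]] by blast
   then have "v = t'" using RR_mid[of "p i" t' "p j" v] y(1) t' zz kl by simp
   then show False using z(2) zz kl t' by simp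
  qed
  then have "ps (e (i, t, j)) = coef (ps (e (i, t, j))) y \<star> e y"
   using coef_single[OF a(4)[OF ec(1)] y(1)] by blast
  then show ?thesis using y(2) t' by metis
 qed
 define f where "f i t j = (SOME t'. t' : \<T> & (\<exists>c. c ~= 0 & ps (e (i, t, j)) = c \<star> e (p i, t', p j)))" for i t j
 have f: "f i t j : \<T>" "\<exists>c. c ~= 0 & ps (e (i, t, j)) = c \<star> e (p i, f i t j, p j)"
  if "i : K" "t : \<T>" "j : K" for i t j
 proof -
  have "\<exists>t'. t' : \<T> & (\<exists>c. c ~= 0 & ps (e (i, t, j)) = c \<star> e (p i, t', p j))"
   using step[OF that] by blast
  from someI_ex[OF this]
  show "f i t j : \<T>" "\<exists>c. c ~= 0 & ps (e (i, t, j)) = c \<star> e (p i, f i t j, p j)"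
   unfolding f_def by blast+
 qed
 define w where "w i t j = (SOME c. c ~= 0 & ps (e (i, t, j)) = c \<star> e (p i, f i t j, p j))" for i t j
 have w: "w i t j ~= 0" "ps (e (i, t, j)) = w i t j \<star> e (p i, f i t j, p j)"
  if "i : K" "t : \<T>" "j : K" for i t j
  using someI_ex[OF f(2)[OF that]] unfolding w_def by blast+
 \<comment> \<open>Comparing labels and scalars in the image of a product separates the
   multiplicativity of \<open>f\<close> from a twisted one of the weights.\<close>
 have mult: "f i (t \<otimes> v) l = f i t j \<otimes> f j v l &
   w i t j * w j v l * sg (f i t j) (f j v l) = sg t v * w i (t \<otimes> v) l"
  if ij: "i : K" "t : \<T>" "j : K" "v : \<T>" "l : K" for i t j v l
 proof -
  have tv: "t \<otimes> v : \<T>" using ij by simp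
  have ec: "e (i, t, j) : carrier_mat n n" "e (j, v, l) : carrier_mat n n" "e (i, t \<otimes> v, l) : carrier_mat n n"
   "e (p i, f i t j, p j) : carrier_mat n n" "e (p j, f j v l, p l) : carrier_mat n n"
   using ij f(1) pK by (simp_all add: e_carrier)
  have 1: "ps (e (i, t, j)) * ps (e (j, v, l)) = (sg t v * w i (t \<otimes> v) l) \<star> e (p i, f i (t \<otimes> v) l, p l)"
   using a(3)[OF ec(1,2)] ij lin_mapD(3)[OF a(2) ec(3), of "sg t v"] w(2)[OF ij(1) tv ij(5)]
   by (simp add: e_mult smult_smult)
  have 2: "ps (e (i, t, j)) * ps (e (j, v, l)) = (w i t j * w j v l * sg (f i t j) (f j v l)) \<star> e (p i, f i t j \<otimes> f j v l, p l)"
   unfolding w(2)[OF ij(1-3)] w(2)[OF ij(3-5)] smult_mult[OF ec(4,5)]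
   using ij pK f(1) by (simp add: e_mult smult_smult)
  have nz: "sg t v * w i (t \<otimes> v) l ~= 0" using sg_nz ij w(1)[OF ij(1) tv ij(5)] by simp
  have B1: "(p i, f i (t \<otimes> v) l, p l) : B" "(p i, f i t j \<otimes> f j v l, p l) : B" using ij pK f(1) by simp_all
  have "(p i, f i (t \<otimes> v) l, p l) = (p i, f i t j \<otimes> f j v l, p l)"
   "sg t v * w i (t \<otimes> v) l = w i t j * w j v l * sg (f i t j) (f j v l)"
   using smult_e_inj[OF B1 _ nz] 1 2 by metis+
  then show ?thesis by simp
 qed
 obtain k where k: "k : K" using K_nonempty by blast
 \<comment> \<open>The base index \<open>k\<close> normalises the translations to be trivial at
   \<open>k\<close>.\<close>
 define au where "au = (\<lambda>t\<in>\<T>. f k t k)"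
 have fk1: "f k \<one> k = \<one>"
  using mult[OF k one_closed k one_closed k] f(1)[OF k one_closed k] by (simp add: sq)
 have au: "au : carrier (Aut_T T \<beta>)"
 proof (rule Aut_T_I)
  fix t v assume tv: "t : \<T>" "v : \<T>"
  show "au (t \<otimes> v) = au t \<otimes> au v" using mult[OF k tv(1) k tv(2) k] tv by (simp add: au_def)
  have ft: "f k t k : \<T>" "f k v k : \<T>" using f(1) k tv by blast+
  \<comment> \<open>The products in both orders carry the same weights, so the commutation factor of
    (t, v) equals that of the images.\<close>
  have "w k t k * w k v k * sg (f k t k) (f k v k) = sg t v * w k (t \<otimes> v) k"
   "w k v k * w k t k * sg (f k v k) (f k t k) = sg v t * w k (t \<otimes> v) k"
   using mult[OF k tv(1) k tv(2) k] mult[OF k tv(2) k tv(1) k] m_comm[OF tv] by simp_all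
  then have h0: "w k t k * w k v k * sg (f k t k) (f k v k) = sg t v * w k (t \<otimes> v) k"
   and h2: "w k t k * w k v k * sg (f k v k) (f k t k) = sg v t * w k (t \<otimes> v) k"
   by (simp_all add: mult.commute mult.left_commute)
  have "(w k t k * w k v k * sg (f k v k) (f k t k)) * \<beta> (f k t k) (f k v k) = w k t k * w k v k * sg (f k t k) (f k v k)"
   unfolding sg_comm[OF ft] by (simp only: mult_ac)
  also have "... = (sg v t * w k (t \<otimes> v) k) * \<beta> t v" unfolding h0 sg_comm[OF tv] by (simp only: mult_ac)
  finally have h1: "(w k t k * w k v k * sg (f k v k) (f k t k)) * \<beta> (f k t k) (f k v k) = (sg v t * w k (t \<otimes> v) k) * \<beta> t v" .
  have "(w k t k * w k v k * sg (f k v k) (f k t k)) * \<beta> (f k t k) (f k v k) = (w k t k * w k v k * sg (f k v k) (f k t k)) * \<beta> t v"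
   using h1 unfolding h2[symmetric] .
  moreover have "w k t k * w k v k * sg (f k v k) (f k t k) ~= 0" using w(1)[OF k tv(1) k] w(1)[OF k tv(2) k] sg_nz[OF ft(2,1)] by simp
  ultimately show "\<beta> (au t) (au v) = \<beta> t v" using tv unfolding au_def by (simp only: mult_left_cancel restrict_apply' simp_thms) 
 next
  show "inj_on au \<T>"
  proof (rule inj_onI)
   fix t v assume tv: "t : \<T>" "v : \<T>" "au t = au v"
   then have fe: "f k t k = f k v k" by (simp add: au_def)
   have ec: "e (k, t, k) : carrier_mat n n" "e (k, v, k) : carrier_mat n n" using k tv by (simp_all add: e_carrier)
   have "ps (w k v k \<star> e (k, t, k)) = ps (w k t k \<star> e (k, v, k))"
    using lin_mapD(3)[OF a(2) ec(1)] lin_mapD(3)[OF a(2) ec(2)] w(2)[OF k tv(1) k] w(2)[OF k tv(2) k] fe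
    by (simp add: smult_smult mult.commute)
   then have "w k v k \<star> e (k, t, k) = w k t k \<star> e (k, v, k)"
    using Bij_inj[OF a(1)] ec by (meson smult_carrier_mat)
   then have "(k, t, k) = (k, v, k)" using smult_e_inj(1)[of "(k, t, k)" "(k, v, k)"] k tv w(1)[OF k tv(2) k] by simp
   then show "t = v" by simp
  qed
 qed (use f(1) k in \<open>auto simp: au_def\<close>)
 define u where "u i = f i \<one> k" for i
 have uT: "u i : \<T>" if "i : K" for i using f(1) that k by (simp add: u_def)
 have ui: "f k \<one> i = u i" if i: "i : K" for i
 proof -
  have "u i \<otimes> f k \<one> i = \<one>"
   using mult[OF k one_closed i one_closed k] fk1 f(1)[OF k one_closed i] uT[OF i] by (simp add: u_def m_comm)
  then show ?thesis using mult_eq_one[OF uT[OF i] f(1)[OF k one_closed i]] by simp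
 qed
 have fF: "f i t j = u i \<otimes> au t \<otimes> u j" if ij: "i : K" "t : \<T>" "j : K" for i t j
 proof -
  have "f i t k = u i \<otimes> au t" using mult[OF ij(1) one_closed k ij(2) k] ij by (simp add: u_def au_def)
  moreover have "f i t j = f i t k \<otimes> f k \<one> j" using mult[OF ij(1,2) k one_closed ij(3)] ij by simp
  ultimately show ?thesis using ui[OF ij(3)] by simp
 qed
 have "monomial ps (Fm p au u) (%(i, t, j). w i t j)"
  unfolding monomial_def
 proof
  fix x assume "x : B"
  then obtain i t j where x: "x = (i, t, j)" "i : K" "t : \<T>" "j : K" by (auto simp: B_def)
  show "Fm p au u x : B & (case x of (i, t, j) => w i t j) ~= 0 & ps (e x) = (case x of (i, t, j) => w i t j) \<star> e (Fm p au u x)"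
   unfolding x(1) Fm_app[OF x(2-4)] using w[OF x(2-4)] fF[OF x(2-4)] pK x f(1)[OF x(2-4)] by simp
 qed
 then show ?thesis using that bij au uT by blast
qed

end

section \<open>Monomial automorphisms and the anti-automorphism\<close>

context graded_matrix_algebra
begin

lemma monomial_unique:
 assumes "monomial ps F w" "monomial ps F' w'" "x : B"
 shows "F x = F' x" "w x = w' x"
 using smult_e_inj[OF monomialD(1)[OF assms(1,3)] monomialD(1)[OF assms(2,3)], of "w x" "w' x"]
  monomialD(3)[OF assms(1,3)] monomialD(3)[OF assms(2,3)] monomialD(2)[OF assms(1,3)] by simp_all

lemma Bij_B: "F : Bij B ==> x : B ==> F x : B"
 by (auto simp: Bij_def bij_betw_def)

lemma monomial_coef:
 assumes lin: "lin_map n ps" and mon: "monomial ps F w" and F: "F : Bij B" and x: "x : B"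
  and X: "X : carrier_mat n n"
 shows "coef (ps X) (F x) = w x * coef X x"
proof -
 have "X : {X : carrier_mat n n. coef (ps X) (F x) - w x * coef X x = 0}"
 proof (rule span_induct[OF mat_subspace_zero_of _ X])
  fix y assume y: "y : B"
  have "F y = F x \<longleftrightarrow> y = x" using Bij_inj[OF F y x] by auto
  then show "e y : {X : carrier_mat n n. coef (ps X) (F x) - w x * coef X x = 0}"
   using y x e_carrier[OF y] monomialD[OF mon y] e_carrier[OF monomialD(1)[OF mon y]] monomialD(1)[OF mon x]
   by (simp add: coef_e coef_smult)
 qed (auto simp: lin_mapD[OF lin] coef_add coef_smult algebra_simps)
 then show ?thesis by simp
qed

text \<open>The failure of a monomial map with weights \<open>w\<close> to commute with \<open>\<phi>\<close>.\<close>

definition "zeta F w x = \<eta> x * w (bphi x) / (w x * \<eta> (F x))"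

lemma phiD:
 "\<phi> : Bij (carrier_mat n n)" "lin_map n \<phi>"
 "X : carrier_mat n n ==> Y : carrier_mat n n ==> \<phi> (X * Y) = \<phi> Y * \<phi> X"
 "X : carrier_mat n n ==> \<phi> X : carrier_mat n n"
 using anti_automorphismsD[OF phi_anti] by auto

lemma WW_com: "F : WW ==> x : B ==> F (bphi x) = bphi (F x)" by (simp add: WW_def)

lemma WW_B: "F : WW ==> x : B ==> F x : B" using Bij_B WW_Bij by blast

context
 fixes ps F w
 assumes aut: "ps : automorphisms n" and F: "F : WW" and mon: "monomial ps F w"
begin

lemma psi_phi_e: "x : B ==> ps (\<phi> (e x)) = (\<eta> x * w (bphi x)) \<star> e (bphi (F x))"
 using phi_e[of x] lin_mapD(3)[OF automorphismsD(2)[OF aut] e_carrier[OF bphi_B], of x "\<eta> x"]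
  monomialD(3)[OF mon bphi_B, of x] WW_com[OF F] by (simp add: smult_smult)

lemma phi_psi_e: "x : B ==> \<phi> (ps (e x)) = (w x * \<eta> (F x)) \<star> e (bphi (F x))"
 using monomialD(3)[OF mon, of x] lin_mapD(3)[OF phiD(2) e_carrier[OF WW_B[OF F]], of x "w x"] phi_e[OF WW_B[OF F], of x]
 by (simp add: smult_smult)

lemma zeta_e: "x : B ==> ps (\<phi> (e x)) = zeta F w x \<star> \<phi> (ps (e x))"
 using monomialD(2)[OF mon, of x] eta_nz[OF WW_B[OF F], of x]
 by (simp add: psi_phi_e phi_psi_e smult_smult zeta_def)

lemma zeta_nz: "x : B ==> zeta F w x ~= 0"
 using monomialD(2)[OF mon, of x] monomialD(2)[OF mon bphi_B, of x] eta_nz[of x] eta_nz[OF WW_B[OF F], of x]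
 by (simp add: zeta_def)

text \<open>psi phi and phi psi both reverse products and differ by the scalars \<open>zeta\<close>
  on basis matrices, so these scalars multiply along composable labels.\<close>

lemma zeta_mult:
 assumes ij: "i : K" "t : \<T>" "j : K" "v : \<T>" "l : K"
 shows "zeta F w (i, t \<otimes> v, l) = zeta F w (i, t, j) * zeta F w (j, v, l)"
proof -
 let ?x = "(i, t, j)" and ?y = "(j, v, l)" and ?z = "(i, t \<otimes> v, l)"
 have xyz: "?x : B" "?y : B" "?z : B" using ij by simp_all
 have ec: "e ?x : carrier_mat n n" "e ?y : carrier_mat n n" "e ?z : carrier_mat n n" using e_carrier xyz by blast+
 note a = automorphismsD[OF aut]
 have lin: "lin_map n (%X. ps (\<phi> X))" "lin_map n (%X. \<phi> (ps X))"
  using lin_map_comp[OF a(2) phiD(2)] lin_map_comp[OF phiD(2) a(2)] .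
 have D: "\<phi> (ps (e ?x)) : carrier_mat n n" "\<phi> (ps (e ?y)) : carrier_mat n n" using ec a(4) phiD(4) by blast+
 have prod: "e ?x * e ?y = sg t v \<star> e ?z" using ij by (simp add: e_mult)
 have "ps (\<phi> (e ?x * e ?y)) = ps (\<phi> (e ?y)) * ps (\<phi> (e ?x))"
  using phiD(3)[OF ec(1,2)] a(3)[OF phiD(4)[OF ec(2)] phiD(4)[OF ec(1)]] by simp
 also have "... = (zeta F w ?y * zeta F w ?x) \<star> (\<phi> (ps (e ?y)) * \<phi> (ps (e ?x)))"
  unfolding zeta_e[OF xyz(1)] zeta_e[OF xyz(2)] using D by (simp add: smult_mult)
 also have "\<phi> (ps (e ?y)) * \<phi> (ps (e ?x)) = \<phi> (ps (e ?x * e ?y))"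
  using a(3)[OF ec(1,2)] phiD(3)[OF a(4)[OF ec(1)] a(4)[OF ec(2)]] by simp
 finally have "ps (\<phi> (e ?x * e ?y)) = (zeta F w ?y * zeta F w ?x) \<star> \<phi> (ps (e ?x * e ?y))" .
 then have "(sg t v * zeta F w ?z * (w ?z * \<eta> (F ?z))) \<star> e (bphi (F ?z))
   = (zeta F w ?y * zeta F w ?x * sg t v * (w ?z * \<eta> (F ?z))) \<star> e (bphi (F ?z))"
  unfolding prod lin_mapD(3)[OF lin(1) ec(3)] lin_mapD(3)[OF lin(2) ec(3)] zeta_e[OF xyz(3)] phi_psi_e[OF xyz(3)]
  by (simp add: smult_smult mult_ac)
 then have "sg t v * zeta F w ?z * (w ?z * \<eta> (F ?z)) = zeta F w ?y * zeta F w ?x * sg t v * (w ?z * \<eta> (F ?z))"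
  by (rule smult_e_inj(2)[OF bphi_B[OF WW_B[OF F xyz(3)]] bphi_B[OF WW_B[OF F xyz(3)]]])
   (use zeta_nz[OF xyz(3)] monomialD(2)[OF mon xyz(3)] eta_nz[OF WW_B[OF F xyz(3)]] sg_nz[OF ij(2,4)] in simp)
 then have "zeta F w ?z = zeta F w ?y * zeta F w ?x"
  using monomialD(2)[OF mon xyz(3)] eta_nz[OF WW_B[OF F xyz(3)]] sg_nz[OF ij(2,4)] by simp
 then show ?thesis by (simp add: mult.commute)
qed

lemma zeta_diag1: "i : K ==> zeta F w (i, \<one>, i) = 1"
 using zeta_mult[of i \<one> i \<one> i] zeta_nz[of "(i, \<one>, i)"] by simp

lemma zeta_inv: "i : K ==> j : K ==> zeta F w (i, \<one>, j) * zeta F w (j, \<one>, i) = 1"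
 using zeta_mult[of i \<one> j \<one> i] zeta_diag1[of i] by simp

lemma zeta_split:
 assumes "i : K" "t : \<T>" "j : K" "k : K"
 shows "zeta F w (i, t, j) = zeta F w (i, \<one>, k) * zeta F w (k, t, k) * zeta F w (k, \<one>, j)"
 using zeta_mult[of i \<one> k t k] zeta_mult[of i t k \<one> j] assms by simp

text \<open>Passing from i to j introduces two factors that cancel. The labels (i, t, i) therefore
  carry one character of T for all i.\<close>

lemma zeta_diag: "i : K ==> j : K ==> t : \<T> ==> zeta F w (i, t, i) = zeta F w (j, t, j)"
 using zeta_split[of i t i j] zeta_inv[of i j] by (simp add: mult_ac)

lemma zeta_diag_sq: "i : K ==> t : \<T> ==> zeta F w (i, t, i) * zeta F w (i, t, i) = 1"
 using zeta_mult[of i t i t i] zeta_diag1[of i] by (simp add: sq)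

end

text \<open>Automorphisms whose label permutation commutes with that of phi. The chosen data
  \<open>perm\<close> and \<open>wt\<close> are unique on labels by \<open>monomial_unique\<close>;
  \<open>ze\<close> measures the failure to commute with phi.\<close>

definition "SS = {ps : automorphisms n. \<exists>F\<in>WW. \<exists>w. monomial ps F w}"
definition "perm ps = (SOME F. F : WW & (\<exists>w. monomial ps F w))"
definition "wt ps = (SOME w. monomial ps (perm ps) w)"
definition "ze ps = zeta (perm ps) (wt ps)"

lemma SS_D:
 assumes "ps : SS"
 shows "ps : automorphisms n" "perm ps : WW" "monomial ps (perm ps) (wt ps)"
proof -
 show "ps : automorphisms n" using assms by (simp add: SS_def)
 have "\<exists>F. F : WW & (\<exists>w. monomial ps F w)" using assms unfolding SS_def by blast
 from someI_ex[OF this] have *: "perm ps : WW & (\<exists>w. monomial ps (perm ps) w)" unfolding perm_def .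
 then show "perm ps : WW" by blast
 show "monomial ps (perm ps) (wt ps)" unfolding wt_def by (rule someI_ex[OF conjunct2[OF *]])
qed

lemma SS_I:
 assumes "ps : automorphisms n" "F : WW" "monomial ps F w"
 shows "ps : SS" "perm ps = F" "x : B ==> wt ps x = w x" "x : B ==> ze ps x = zeta F w x"
proof -
 show S: "ps : SS" using assms unfolding SS_def by blast
 note d = SS_D[OF S]
 have "perm ps : extensional B" "F : extensional B" using WW_Bij[OF d(2)] WW_Bij[OF assms(2)] by (simp_all add: Bij_def)
 then show p: "perm ps = F" by (rule extensionalityI) (rule monomial_unique(1)[OF d(3) assms(3)])
 show w: "x : B ==> wt ps x = w x" for x by (rule monomial_unique(2)[OF d(3) assms(3)])
 show "x : B ==> ze ps x = zeta F w x" using w[of x] w[OF bphi_B, of x] by (simp add: ze_def zeta_def p)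
qed

lemma monomial_compose:
 assumes lin: "lin_map n ps" and "monomial ps F w" "monomial ka F' w'"
 shows "monomial (compose (carrier_mat n n) ps ka) (compose B F F') (%x. w' x * w (F' x))"
 unfolding monomial_def
proof
 fix x assume x: "x : B"
 note 1 = monomialD[OF assms(3) x]
 note 2 = monomialD[OF assms(2) 1(1)]
 show "compose B F F' x : B & w' x * w (F' x) ~= 0 &
   compose (carrier_mat n n) ps ka (e x) = (w' x * w (F' x)) \<star> e (compose B F F' x)"
  using x e_carrier[OF x] 1 2 lin_mapD(3)[OF lin e_carrier[OF 1(1)]] by (simp add: compose_def smult_smult)
qed

abbreviation "AG \<equiv> mat_bij_group n :: ('f mat => 'f mat) monoid"
abbreviation AG_mult (infixl "\<odot>" 70) where "f \<odot> g == f \<otimes>\<^bsub>AG\<^esub> g"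

lemma mult_AG: "ps : Bij (carrier_mat n n) ==> ka : Bij (carrier_mat n n) ==> ps \<odot> ka = compose (carrier_mat n n) ps ka"
 by (simp add: BijGroup_def)

lemma mult_BG: "F : Bij B ==> F' : Bij B ==> F \<otimes>\<^bsub>BijGroup B\<^esub> F' = compose B F F'"
 by (simp add: BijGroup_def)

text \<open>\<open>ze\<close> is a crossed homomorphism, so the conditions imposed on it later pass
  to products and inverses.\<close>

lemma SS_mult:
 assumes "ps : SS" "ka : SS"
 shows "ps \<odot> ka : SS" "perm (ps \<odot> ka) = perm ps \<otimes>\<^bsub>BijGroup B\<^esub> perm ka"
  "x : B ==> wt (ps \<odot> ka) x = wt ka x * wt ps (perm ka x)"
  "x : B ==> ze (ps \<odot> ka) x = ze ka x * ze ps (perm ka x)"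
proof -
 note d = SS_D[OF assms(1)] and d' = SS_D[OF assms(2)]
 note a = automorphismsD[OF d(1)] and a' = automorphismsD[OF d'(1)]
 have aut: "ps \<odot> ka : automorphisms n" using subgroup.m_closed[OF subgroup_automorphisms d(1) d'(1)] .
 have mon: "monomial (ps \<odot> ka) (compose B (perm ps) (perm ka)) (%x. wt ka x * wt ps (perm ka x))"
  unfolding mult_AG[OF a(1) a'(1)] by (rule monomial_compose[OF a(2) d(3) d'(3)])
 note I = SS_I[OF aut compose_WW[OF d(2) d'(2)] mon]
 show "ps \<odot> ka : SS" by (rule I(1))
 show "perm (ps \<odot> ka) = perm ps \<otimes>\<^bsub>BijGroup B\<^esub> perm ka"
  unfolding I(2) mult_BG[OF WW_Bij[OF d(2)] WW_Bij[OF d'(2)]] ..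
 show "x : B ==> wt (ps \<odot> ka) x = wt ka x * wt ps (perm ka x)" by (rule I(3))
 assume x: "x : B"
 have px: "perm ka x : B" using WW_B[OF d'(2) x] .
 show "ze (ps \<odot> ka) x = ze ka x * ze ps (perm ka x)"
  unfolding I(4)[OF x] unfolding ze_def zeta_def using x px bphi_B[OF x] WW_com[OF d'(2) x] eta_nz[OF px]
  by (simp add: compose_def)
qed

lemma one_AG: "\<one>\<^bsub>AG\<^esub> = (\<lambda>X\<in>carrier_mat n n. X)" by (simp add: BijGroup_def)

lemma one_BG: "idB = (\<lambda>x\<in>B. x)" by (simp add: BijGroup_def)

lemma SS_one: "\<one>\<^bsub>AG\<^esub> : SS" "perm \<one>\<^bsub>AG\<^esub> = idB" "x : B ==> wt \<one>\<^bsub>AG\<^esub> x = 1" "x : B ==> ze \<one>\<^bsub>AG\<^esub> x = 1"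
proof -
 have mon: "monomial \<one>\<^bsub>AG\<^esub> idB (%x. 1)"
  unfolding monomial_def one_AG one_BG using e_carrier by (simp add: one_smult)
 note I = SS_I[OF subgroup.one_closed[OF subgroup_automorphisms] one_WW mon]
 show "\<one>\<^bsub>AG\<^esub> : SS" "perm \<one>\<^bsub>AG\<^esub> = idB" "x : B ==> wt \<one>\<^bsub>AG\<^esub> x = 1" using I by blast+
 assume x: "x : B"
 show "ze \<one>\<^bsub>AG\<^esub> x = 1" unfolding I(4)[OF x] zeta_def using x eta_nz[OF x] by (simp add: one_BG)
qed

lemma SS_inv:
 assumes "ps : SS"
 shows "inv\<^bsub>AG\<^esub> ps : SS"
proof -
 note d = SS_D[OF assms]
 note a = automorphismsD[OF d(1)]
 let ?F = "perm ps" and ?w = "wt ps"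
 define F' where "F' = inv\<^bsub>BijGroup B\<^esub> ?F"
 have F': "F' : WW" unfolding F'_def by (rule subgroup.m_inv_closed[OF subgroup_WW d(2)])
 have FF': "?F (F' x) = x" if x: "x : B" for x
 proof -
  have "?F \<otimes>\<^bsub>BijGroup B\<^esub> F' = idB"
   unfolding F'_def using WW_Bij[OF d(2)] by (intro group.r_inv[OF group_BijGroup]) (simp add: BijGroup_def)
  then have "compose B ?F F' x = (\<lambda>x\<in>B. x) x" unfolding mult_BG[OF WW_Bij[OF d(2)] WW_Bij[OF F']] one_BG by simp
  then show ?thesis using x by (simp add: compose_def)
 qed
 define ps' where "ps' = inv\<^bsub>AG\<^esub> ps"
 have aut: "ps' : automorphisms n" unfolding ps'_def by (rule subgroup.m_inv_closed[OF subgroup_automorphisms d(1)])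
 note a' = automorphismsD[OF aut]
 have inv: "ps' (ps X) = X" if X: "X : carrier_mat n n" for X
  unfolding ps'_def inv_BijGroup[OF a(1)] using a(1) a(4)[OF X] X by (simp add: Bij_def bij_betw_def inv_into_f_f)
 have "monomial ps' F' (%x. inverse (?w (F' x)))"
  unfolding monomial_def
 proof
  fix x assume x: "x : B"
  let ?y = "F' x"
  have y: "?y : B" using WW_B[OF F' x] .
  have "e ?y = ps' (?w ?y \<star> e x)" using inv[OF e_carrier[OF y]] monomialD(3)[OF d(3) y] FF'[OF x] by simp
  then have "e ?y = ?w ?y \<star> ps' (e x)" using lin_mapD(3)[OF a'(2) e_carrier[OF x]] by simp
  then have "inverse (?w ?y) \<star> e ?y = ps' (e x)"
   using monomialD(2)[OF d(3) y] a'(4)[OF e_carrier[OF x]] by (simp add: smult_smult one_smult)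
  then show "F' x : B & inverse (?w ?y) ~= 0 & ps' (e x) = inverse (?w ?y) \<star> e ?y"
   using y monomialD(2)[OF d(3) y] by simp
 qed
 from SS_I(1)[OF aut F' this] show ?thesis unfolding ps'_def .
qed

lemma subgroup_SS: "subgroup SS AG"
proof (rule group.subgroupI[OF group_BijGroup])
 show "SS <= carrier AG" using automorphismsD(1)[OF SS_D(1)] by (auto simp: BijGroup_def)
 show "SS ~= {}" using SS_one(1) by blast
qed (use SS_mult(1) SS_inv in auto)

lemma ze_inv:
 assumes "ps : SS" "x : B"
 shows "ze (inv\<^bsub>AG\<^esub> ps) (perm ps x) * ze ps x = 1"
proof -
 have "inv\<^bsub>AG\<^esub> ps \<odot> ps = \<one>\<^bsub>AG\<^esub>"
  using automorphismsD(1)[OF SS_D(1)[OF assms(1)]] by (intro group.l_inv[OF group_BijGroup]) (simp add: BijGroup_def)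
 then have "ze (inv\<^bsub>AG\<^esub> ps \<odot> ps) x = 1" using SS_one(4)[OF assms(2)] by simp
 then show ?thesis using SS_mult(4)[OF SS_inv[OF assms(1)] assms(1,2)] by (simp add: mult.commute)
qed

lemma perm_surj: "ps : SS ==> y : B ==> \<exists>x\<in>B. perm ps x = y"
 using Bij_surj[OF WW_Bij[OF SS_D(2)]] by blast

text \<open>Translations cancel on labels (i, t, i), which go to (P i, alpha(t), P i), and F
  commutes with \<open>bphi\<close>. Both ways of being related are preserved and reflected.\<close>

lemma WW_RR:
 assumes F: "F : WW" and xy: "x : B" "y : B"
 shows "RR (F x) (F y) \<longleftrightarrow> RR x y"
proof (rule WW_E[OF F])
 fix P au u c
 assume *: "bij_betw P K K" "au : carrier (Aut_T T \<beta>)" "!!i. i : K ==> u i : \<T>" "F = Fm P au u"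
 have PK: "P i : K" if "i : K" for i using *(1) that by (auto simp: bij_betw_def)
 have Pinj: "P i = P j \<longleftrightarrow> i = j" if "i : K" "j : K" for i j
  using *(1) that by (auto simp: bij_betw_def inj_on_def)
 have dg: "F (i, t, i) = (P i, au t, P i)" if "i : K" "t : \<T>" for i t
  using that *(3)[OF that(1)] Aut_T_D(1)[OF *(2) that(2)] by (simp add: *(4) ac)
 have eq: "F x = F y \<longleftrightarrow> x = y" if "x : B" "y : B" for x y using Bij_inj[OF WW_Bij[OF F] that] by auto
 obtain i t j k v l where x: "x = (i, t, j)" "i : K" "t : \<T>" "j : K" and y: "y = (k, v, l)" "k : K" "v : \<T>" "l : K"
  using xy by (cases x; cases y) auto
 have D: "(\<exists>i\<in>K. \<exists>j\<in>K. \<exists>t. F x = (i, t, i) & F y = (j, t, j)) \<longleftrightarrow> (\<exists>i\<in>K. \<exists>j\<in>K. \<exists>t. x = (i, t, i) & y = (j, t, j))"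
 proof
  assume "\<exists>i\<in>K. \<exists>j\<in>K. \<exists>t. F x = (i, t, i) & F y = (j, t, j)"
  then obtain i' j' t' where h: "F x = (i', t', i')" "F y = (j', t', j')" by blast
  then have "P i = P j" "P k = P l" using x y by (simp_all add: *(4))
  then have ij: "j = i" "l = k" using Pinj x y by simp_all
  then have "au t = au v" using h dg x y by simp
  then have "t = v" using Aut_T_inj[OF *(2)] x y by simp
  then show "\<exists>i\<in>K. \<exists>j\<in>K. \<exists>t. x = (i, t, i) & y = (j, t, j)" using x y ij by blast
 next
  assume "\<exists>i\<in>K. \<exists>j\<in>K. \<exists>t. x = (i, t, i) & y = (j, t, j)"
  then have "j = i" "l = k" "v = t" using x y by auto
  then show "\<exists>i\<in>K. \<exists>j\<in>K. \<exists>t. F x = (i, t, i) & F y = (j, t, j)" using dg x y PK by simp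
 qed
 have E1: "F y = F x \<longleftrightarrow> y = x" using eq[OF xy(2,1)] .
 have E2: "F y = bphi (F x) \<longleftrightarrow> y = bphi x"
  using eq[OF xy(2) bphi_B[OF xy(1)]] WW_com[OF F xy(1)] by simp
 show ?thesis unfolding RR_def D E1 E2 ..
qed

lemma SS_CC:
 assumes S: "ps : SS" and x: "x : B"
 shows "ps ` CC x = CC (perm ps x)"
proof -
 note d = SS_D[OF S]
 note a = automorphismsD[OF d(1)]
 have iff: "ps X : CC (perm ps x) \<longleftrightarrow> X : CC x" if X: "X : carrier_mat n n" for X
 proof -
  have "ps X : CC (perm ps x) \<longleftrightarrow> (\<forall>y\<in>B. ~ RR (perm ps x) (perm ps y) --> coef (ps X) (perm ps y) = 0)"
  proof
   assume h: "ps X : CC (perm ps x)"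
   show "\<forall>y\<in>B. ~ RR (perm ps x) (perm ps y) --> coef (ps X) (perm ps y) = 0"
    using h WW_B[OF d(2)] unfolding CC_def by blast
  next
   assume h: "\<forall>y\<in>B. ~ RR (perm ps x) (perm ps y) --> coef (ps X) (perm ps y) = 0"
   have "coef (ps X) z = 0" if z: "z : B" "~ RR (perm ps x) z" for z
    using perm_surj[OF S z(1)] h z(2) by blast
   then show "ps X : CC (perm ps x)" unfolding CC_def using a(4)[OF X] by blast
  qed
  also have "... \<longleftrightarrow> (\<forall>y\<in>B. ~ RR x y --> coef X y = 0)"
   using WW_RR[OF d(2) x] monomial_coef[OF a(2) d(3) WW_Bij[OF d(2)] _ X] monomialD(2)[OF d(3)] by simp
  finally show ?thesis using X by (simp add: CC_def)
 qed
 show ?thesis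
 proof (intro equalityI subsetI)
  fix Y assume "Y : ps ` CC x"
  then show "Y : CC (perm ps x)" using iff CC_carrier by blast
 next
  fix Y assume Y: "Y : CC (perm ps x)"
  obtain X where "X : carrier_mat n n" "ps X = Y" using Bij_surj[OF a(1) CC_carrier[OF Y]] by blast
  then show "Y : ps ` CC x" using iff Y by blast
 qed
qed

lemma SS_Aut_gr: "ps : SS ==> ps : Aut_gr n G \<Gamma>"
proof -
 assume S: "ps : SS"
 note d = SS_D[OF S]
 note a = automorphismsD[OF d(1)]
 have "(`) ps ` CC ` B = CC ` B"
 proof (intro equalityI subsetI)
  fix V assume "V : (`) ps ` CC ` B"
  then show "V : CC ` B" using SS_CC[OF S] WW_B[OF d(2)] by auto
 next
  fix V assume "V : CC ` B"
  then obtain y where y: "y : B" "V = CC y" by blast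
  obtain x where "x : B" "perm ps x = y" using perm_surj[OF S y(1)] by blast
  then show "V : (`) ps ` CC ` B" using SS_CC[OF S, of x] y by blast
 qed
 moreover have "inj_on ((`) ps) (CC ` B)"
 proof (rule inj_on_image)
  show "inj_on ps (\<Union> (CC ` B))"
   using a(1) CC_carrier by (auto simp: Bij_def bij_betw_def intro: inj_on_subset)
 qed
 ultimately show ?thesis unfolding Aut_gr_def comps_CC bij_betw_def using d(1) by simp
qed

lemma conj_phi_iff:
 assumes "ps : Bij (carrier_mat n n)" "xx : Bij (carrier_mat n n)"
 shows "ps \<odot> \<phi> \<odot> inv\<^bsub>AG\<^esub> ps = xx \<odot> \<phi> \<longleftrightarrow> (\<forall>X\<in>carrier_mat n n. ps (\<phi> X) = xx (\<phi> (ps X)))"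
proof -
 interpret AG: group AG by (rule group_BijGroup)
 have c: "ps : carrier AG" "xx : carrier AG" "\<phi> : carrier AG" using assms phiD(1) by (simp_all add: BijGroup_def)
 have "ps \<odot> \<phi> \<odot> inv\<^bsub>AG\<^esub> ps = xx \<odot> \<phi> \<longleftrightarrow> ps \<odot> \<phi> = xx \<odot> \<phi> \<odot> ps"
  using c by (metis AG.inv_closed AG.inv_solve_right AG.m_closed)
 also have "... \<longleftrightarrow> compose (carrier_mat n n) ps \<phi> = compose (carrier_mat n n) (compose (carrier_mat n n) xx \<phi>) ps"
  using assms phiD(1) by (simp add: mult_AG compose_Bij)
 also have "... \<longleftrightarrow> (\<forall>X\<in>carrier_mat n n. ps (\<phi> X) = xx (\<phi> (ps X)))"
 proof
  assume h: "compose (carrier_mat n n) ps \<phi> = compose (carrier_mat n n) (compose (carrier_mat n n) xx \<phi>) ps"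
  show "\<forall>X\<in>carrier_mat n n. ps (\<phi> X) = xx (\<phi> (ps X))"
  proof
   fix X :: "'f mat" assume X: "X : carrier_mat n n"
   have "ps X : carrier_mat n n" using assms(1) X by (auto simp: Bij_def bij_betw_def)
   then show "ps (\<phi> X) = xx (\<phi> (ps X))" using fun_cong[OF h, of X] X by (simp add: compose_def)
  qed
 next
  assume h: "\<forall>X\<in>carrier_mat n n. ps (\<phi> X) = xx (\<phi> (ps X))"
  show "compose (carrier_mat n n) ps \<phi> = compose (carrier_mat n n) (compose (carrier_mat n n) xx \<phi>) ps"
  proof (rule extensionalityI[of _ "carrier_mat n n"])
   fix X :: "'f mat" assume X: "X : carrier_mat n n"
   have "ps X : carrier_mat n n" using assms(1) X by (auto simp: Bij_def bij_betw_def)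
   then show "compose (carrier_mat n n) ps \<phi> X = compose (carrier_mat n n) (compose (carrier_mat n n) xx \<phi>) ps X"
    using h X by (simp add: compose_def)
  qed auto
 qed
 finally show ?thesis .
qed

lemma Diag_D:
 assumes "ps : Diag_gr n G \<Gamma>"
 obtains c where "monomial ps (\<lambda>x\<in>B. x) c" "!!x y. x : B ==> y : B ==> RR x y ==> c x = c y"
proof -
 have "\<forall>V\<in>CC ` B. \<exists>c. c ~= 0 & (\<forall>X\<in>V. ps X = c \<star> X)" using assms by (simp add: Diag_gr_def comps_CC)
 then obtain d where d: "!!V. V : CC ` B ==> d V ~= 0" "!!V X. V : CC ` B ==> X : V ==> ps X = d V \<star> X" by metis
 have "monomial ps (\<lambda>x\<in>B. x) (%x. d (CC x))" unfolding monomial_def using d e_in_CC by simp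
 moreover have "d (CC x) = d (CC y)" if "x : B" "y : B" "RR x y" for x y using CC_eq[OF that] by simp
 ultimately show ?thesis using that by blast
qed

lemma Diag_I:
 assumes aut: "ps : automorphisms n" and mon: "monomial ps (\<lambda>x\<in>B. x) c"
  and c: "!!x y. x : B ==> y : B ==> RR x y ==> c x = c y"
 shows "ps : Diag_gr n G \<Gamma>"
proof -
 note a = automorphismsD[OF aut]
 have "ps X = c x \<star> X" if x: "x : B" and X: "X : CC x" for x X
 proof (rule mat_coef_eqI)
  have XC: "X : carrier_mat n n" using CC_carrier[OF X] .
  show "ps X : carrier_mat n n" "c x \<star> X : carrier_mat n n" using XC a(4) by simp_all
  fix y assume y: "y : B"
  have "coef (ps X) y = c y * coef X y" using monomial_coef[OF a(2) mon id_Bij y XC] y by simp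
  also have "... = c x * coef X y" using CC_coef[OF X y] c[OF x y] by (cases "coef X y = 0") simp_all
  finally show "coef (ps X) y = coef (c x \<star> X) y" using XC by (simp add: coef_smult)
 qed
 then have "\<exists>d. d ~= 0 & (\<forall>X\<in>V. ps X = d \<star> X)" if V: "V : CC ` B" for V
 proof -
  obtain x where x: "x : B" "V = CC x" using V by blast
  show ?thesis using monomialD(2)[OF mon x(1)] \<open>!!x X. x : B ==> X : CC x ==> ps X = c x \<star> X\<close>[OF x(1)] x(2)
   by (intro exI[of _ "c x"]) simp
 qed
 then show ?thesis unfolding Diag_gr_def comps_CC using aut by simp
qed

lemma Id_WW: "(\<lambda>x\<in>B. x) : WW" using one_WW unfolding one_BG .

text \<open>If \<open>ze\<close> is 1 and labels are fixed, the weights are invariant under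
  \<open>bphi\<close>; multiplicativity makes them equal on (i, t, i) and (j, t, j). So they are
  constant on components.\<close>

lemma Diag_iff: "ps : Diag_gr n G \<Gamma> \<longleftrightarrow> ps : SS & perm ps = idB & (\<forall>x\<in>B. ze ps x = 1)"
proof
 assume D: "ps : Diag_gr n G \<Gamma>"
 then have aut: "ps : automorphisms n" by (simp add: Diag_gr_def)
 obtain c where c: "monomial ps (\<lambda>x\<in>B. x) c" "!!x y. x : B ==> y : B ==> RR x y ==> c x = c y" using Diag_D[OF D] by blast
 note I = SS_I[OF aut Id_WW c(1)]
 have "ze ps x = 1" if x: "x : B" for x
  unfolding I(4)[OF x] zeta_def using x eta_nz[OF x] monomialD(2)[OF c(1) x] c(2)[OF x bphi_B[OF x]] by (simp add: RR_def)
 then show "ps : SS & perm ps = idB & (\<forall>x\<in>B. ze ps x = 1)" using I(1,2) by (simp add: one_BG)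
next
 assume h: "ps : SS & perm ps = idB & (\<forall>x\<in>B. ze ps x = 1)"
 then have S: "ps : SS" and p: "perm ps = (\<lambda>x\<in>B. x)" and z: "!!x. x : B ==> ze ps x = 1" by (simp_all add: one_BG)
 note d = SS_D[OF S]
 note a = automorphismsD[OF d(1)]
 have mon: "monomial ps (\<lambda>x\<in>B. x) (wt ps)" using d(3) unfolding p .
 have w_phi: "wt ps (bphi x) = wt ps x" if x: "x : B" for x
  using z[OF x] x eta_nz[OF x] monomialD(2)[OF mon x] by (simp add: ze_def zeta_def p field_simps)
 have w_mult: "wt ps (i, t, j) * wt ps (j, v, l) = wt ps (i, t \<otimes> v, l)"
  if ij: "i : K" "t : \<T>" "j : K" "v : \<T>" "l : K" for i t j v l
 proof -
  let ?x = "(i, t, j)" and ?y = "(j, v, l)" and ?z = "(i, t \<otimes> v, l)"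
  have B3: "?x : B" "?y : B" "?z : B" using ij by simp_all
  have ec: "e ?x : carrier_mat n n" "e ?y : carrier_mat n n" "e ?z : carrier_mat n n" using e_carrier B3 by blast+
  have "(wt ps ?x * wt ps ?y * sg t v) \<star> e ?z = (sg t v * wt ps ?z) \<star> e ?z"
   using a(3)[OF ec(1,2)] monomialD(3)[OF mon B3(1)] monomialD(3)[OF mon B3(2)] monomialD(3)[OF mon B3(3)] B3 ij
    smult_mult[OF ec(1,2)] lin_mapD(3)[OF a(2) ec(3)] by (simp add: e_mult smult_smult)
  then have "wt ps ?x * wt ps ?y * sg t v = sg t v * wt ps ?z"
   using smult_e_inj(2)[OF B3(3,3)] monomialD(2)[OF mon B3(1)] monomialD(2)[OF mon B3(2)] sg_nz[OF ij(2,4)] by simp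
  then show ?thesis using sg_nz[OF ij(2,4)] by simp
 qed
 have w_diag: "wt ps (i, t, i) = wt ps (j, t, j)" if ij: "i : K" "j : K" "t : \<T>" for i j t
 proof -
  have "wt ps (i, \<one>, j) * wt ps (j, t, j) = wt ps (i, t, i) * wt ps (i, \<one>, j)"
   using w_mult[OF ij(1) one_closed ij(2) ij(3) ij(2)] w_mult[OF ij(1) ij(3) ij(1) one_closed ij(2)] ij by simp
  then show ?thesis using monomialD(2)[OF mon, of "(i, \<one>, j)"] ij by simp
 qed
 show "ps : Diag_gr n G \<Gamma>"
 proof (rule Diag_I[OF d(1) mon])
  fix x y assume xy: "x : B" "y : B" "RR x y"
  then show "wt ps x = wt ps y" using w_phi[OF xy(1)] w_diag unfolding RR_def by (auto simp: B_def)
 qed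
qed

text \<open>Evaluation on basis matrices shows at once that the label permutation commutes with
  \<open>bphi\<close> and that \<open>ze\<close> is read off \<open>xx\<close>. Taking the identity
  for \<open>xx\<close> covers exact commutation with phi.\<close>

lemma twisted_commute_SS:
 assumes gr: "ps : Aut_gr n G \<Gamma>" and lin: "lin_map n xx" and xi: "monomial xx (\<lambda>x\<in>B. x) c"
  and com: "!!X. X : carrier_mat n n ==> ps (\<phi> X) = xx (\<phi> (ps X))"
 shows "ps : SS" "x : B ==> ze ps x = c (bphi (perm ps x))"
proof -
 note aut = Aut_gr_D(1)[OF gr]
 note a = automorphismsD[OF aut]
 obtain P au u w where P: "bij_betw P K K" "au : carrier (Aut_T T \<beta>)" "!!i. i : K ==> u i : \<T>"
  and mon: "monomial ps (Fm P au u) w"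
  using Aut_gr_monomial[OF gr] by blast
 define F where "F = Fm P au u"
 note mon = mon[folded F_def]
 have key: "F (bphi y) = bphi (F y) & \<eta> y * w (bphi y) = w y * \<eta> (F y) * c (bphi (F y))" if y: "y : B" for y
 proof -
  note bB = bphi_B[OF y]
  note Fy = monomialD(1)[OF mon y]
  note bFy = bphi_B[OF Fy]
  have 1: "ps (\<phi> (e y)) = (\<eta> y * w (bphi y)) \<star> e (F (bphi y))"
   using phi_e[OF y] lin_mapD(3)[OF a(2) e_carrier[OF bB]] monomialD(3)[OF mon bB] by (simp add: smult_smult)
  have "\<phi> (ps (e y)) = (w y * \<eta> (F y)) \<star> e (bphi (F y))"
   using monomialD(3)[OF mon y] lin_mapD(3)[OF phiD(2) e_carrier[OF Fy]] phi_e[OF Fy] by (simp add: smult_smult)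
  then have 2: "xx (\<phi> (ps (e y))) = (w y * \<eta> (F y) * c (bphi (F y))) \<star> e (bphi (F y))"
   using lin_mapD(3)[OF lin e_carrier[OF bFy]] monomialD(3)[OF xi bFy] bFy by (simp add: smult_smult)
  have eq: "(\<eta> y * w (bphi y)) \<star> e (F (bphi y)) = (w y * \<eta> (F y) * c (bphi (F y))) \<star> e (bphi (F y))"
   using com[OF e_carrier[OF y]] unfolding 1 2 .
  have nz: "\<eta> y * w (bphi y) ~= 0" using eta_nz[OF y] monomialD(2)[OF mon bB] by simp
  show ?thesis using smult_e_inj[OF monomialD(1)[OF mon bB] bFy eq nz] by blast
 qed
 have "F : Bij B" unfolding F_def by (rule Fm_Bij[OF P])
 then have F: "F : WW" unfolding WW_def mem_Collect_eq using key P
  by (intro conjI exI[of _ P] exI[of _ au] exI[of _ u] F_def ballI) auto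
 note I = SS_I[OF aut F mon]
 show "ps : SS" by (rule I(1))
 assume x: "x : B"
 show "ze ps x = c (bphi (perm ps x))"
  unfolding I(2) I(4)[OF x] zeta_def using key[OF x] monomialD(2)[OF mon x] eta_nz[OF monomialD(1)[OF mon x]] by simp
qed

lemma SS_ze_RR:
 assumes S: "ps : SS" and z: "!!x. x : B ==> ze ps (bphi x) = ze ps x" and xy: "x : B" "y : B" "RR x y"
 shows "ze ps x = ze ps y"
proof -
 note d = SS_D[OF S]
 have dg: "ze ps (i, t, i) = ze ps (j, t, j)" if "i : K" "j : K" "t : \<T>" for i j t
  unfolding ze_def by (rule zeta_diag[OF d that])
 show ?thesis using xy dg z[OF xy(1)] unfolding RR_def by (auto simp: B_def)
qed

text \<open>The witness is psi phi psi^-1 phi^-1, built as psi phi after the inverse of phi psi. It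
  multiplies the basis matrix at \<open>bphi (perm ps x)\<close> by \<open>ze ps x\<close>.\<close>

lemma conjugation_Diag:
 assumes S: "ps : SS" and z: "!!x. x : B ==> ze ps (bphi x) = ze ps x"
 obtains xx where "xx : Diag_gr n G \<Gamma>" "!!X. X : carrier_mat n n ==> ps (\<phi> X) = xx (\<phi> (ps X))"
proof -
 note d = SS_D[OF S]
 note a = automorphismsD[OF d(1)]
 let ?C = "carrier_mat n n :: 'f mat set"
 define D where "D = compose ?C \<phi> ps"
 define xx where "xx = compose ?C (compose ?C ps \<phi>) (\<lambda>Y\<in>?C. inv_into ?C D Y)"
 have DB: "D : Bij ?C" unfolding D_def by (rule compose_Bij[OF phiD(1) a(1)])
 have D: "D X = \<phi> (ps X)" if "X : ?C" for X using that by (simp add: D_def compose_def)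
 have xB: "xx : Bij ?C" unfolding xx_def
  by (intro compose_Bij a(1) phiD(1) restrict_inv_into_Bij[OF DB])
 have xD: "xx (D X) = ps (\<phi> X)" if X: "X : ?C" for X
 proof -
  have "D X : ?C" using D[OF X] a(4)[OF X] phiD(4) by simp
  moreover have "inv_into ?C D (D X) = X" using DB X by (simp add: Bij_def bij_betw_def inv_into_f_f)
  ultimately show ?thesis using X by (simp add: xx_def compose_def)
 qed
 have surj: "\<exists>X\<in>?C. Y = D X" if "Y : ?C" for Y using Bij_surj[OF DB that] by metis
 have Dadd: "D (X + Y) = D X + D Y" if "X : ?C" "Y : ?C" for X Y
  using that a(4) lin_mapD(2)[OF a(2) that] lin_mapD(2)[OF phiD(2) a(4)[OF that(1)] a(4)[OF that(2)]] by (simp add: D)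
 have Dsm: "D (k \<star> X) = k \<star> D X" if "X : ?C" for X k
  using that lin_mapD(3)[OF a(2) that, of k] lin_mapD(3)[OF phiD(2) a(4)[OF that], of k] by (simp add: D)
 have Dmul: "D X * D Y = D (Y * X)" if "X : ?C" "Y : ?C" for X Y
  using that mult_carrier_mat[OF that(2,1)] a(3)[OF that(2,1)] phiD(3)[OF a(4)[OF that(2)] a(4)[OF that(1)]] by (simp add: D)
 have "xx (Y + Z) = xx Y + xx Z" if YZ: "Y : ?C" "Z : ?C" for Y Z
 proof -
  obtain X X' where X: "X : ?C" "Y = D X" "X' : ?C" "Z = D X'" using surj YZ by metis
  have "xx (Y + Z) = ps (\<phi> (X + X'))" using Dadd[OF X(1,3)] xD[of "X + X'"] X by simp
  also have "... = ps (\<phi> X) + ps (\<phi> X')"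
   using lin_mapD(2)[OF phiD(2) X(1,3)] lin_mapD(2)[OF a(2) phiD(4)[OF X(1)] phiD(4)[OF X(3)]] by simp
  finally show ?thesis using xD X by simp
 qed
 moreover have "xx (k \<star> Y) = k \<star> xx Y" if Y: "Y : ?C" for Y k
 proof -
  obtain X where X: "X : ?C" "Y = D X" using surj Y by metis
  have "xx (k \<star> Y) = ps (\<phi> (k \<star> X))" using Dsm[OF X(1), of k] xD[of "k \<star> X"] X by simp
  also have "... = k \<star> ps (\<phi> X)"
   using lin_mapD(3)[OF phiD(2) X(1), of k] lin_mapD(3)[OF a(2) phiD(4)[OF X(1)], of k] by simp
  finally show ?thesis using xD X by simp
 qed
 moreover have "xx (Y * Z) = xx Y * xx Z" if YZ: "Y : ?C" "Z : ?C" for Y Z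
 proof -
  obtain X X' where X: "X : ?C" "Y = D X" "X' : ?C" "Z = D X'" using surj YZ by metis
  have "xx (Y * Z) = ps (\<phi> (X' * X))" using Dmul[OF X(1,3)] xD[OF mult_carrier_mat[OF X(3,1)]] X by simp
  also have "... = ps (\<phi> X) * ps (\<phi> X')"
   using phiD(3)[OF X(3,1)] a(3)[OF phiD(4)[OF X(1)] phiD(4)[OF X(3)]] by simp
  finally show ?thesis using xD X by simp
 qed
 ultimately have aut: "xx : automorphisms n" using xB unfolding automorphisms_def mat_linear_def by blast
 note b = automorphismsD[OF aut]
 have ex: "\<exists>x\<in>B. y = bphi (perm ps x)" if y: "y : B" for y
 proof -
  obtain x where "x : B" "perm ps x = bphi y" using perm_surj[OF S bphi_B[OF y]] by blast
  then show ?thesis using bphi_bphi[OF y] by (intro bexI[of _ x]) simp_all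
 qed
 have xi_e: "xx (e (bphi (perm ps x))) = ze ps x \<star> e (bphi (perm ps x))" if x: "x : B" for x
 proof -
  let ?k = "wt ps x * \<eta> (perm ps x)" and ?y = "bphi (perm ps x)"
  have yB: "?y : B" using bphi_B[OF WW_B[OF d(2) x]] .
  have k: "?k ~= 0" using monomialD(2)[OF d(3) x] eta_nz[OF WW_B[OF d(2) x]] by simp
  have "?k \<star> xx (e ?y) = xx (\<phi> (ps (e x)))"
   unfolding phi_psi_e[OF d x] using lin_mapD(3)[OF b(2) e_carrier[OF yB]] by simp
  also have "... = ps (\<phi> (e x))" using xD[OF e_carrier[OF x]] D[OF e_carrier[OF x]] by simp
  also have "... = ?k \<star> (ze ps x \<star> e ?y)"
   unfolding zeta_e[OF d x] phi_psi_e[OF d x] ze_def by (simp add: smult_smult mult_ac)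
  finally have h: "inverse ?k \<star> (?k \<star> xx (e ?y)) = inverse ?k \<star> (?k \<star> (ze ps x \<star> e ?y))" by simp
  have k1: "inverse ?k * ?k = 1" by (rule left_inverse[OF k])
  have "1 \<star> xx (e ?y) = 1 \<star> (ze ps x \<star> e ?y)"
   using h unfolding smult_smult[of "inverse ?k" ?k] k1 .
  then show ?thesis using one_smult b(4)[OF e_carrier[OF yB]] e_carrier[OF yB] by simp
 qed
 define c where "c y = coef (xx (e y)) y" for y
 have c: "c (bphi (perm ps x)) = ze ps x" if x: "x : B" for x
  using xi_e[OF x] bphi_B[OF WW_B[OF d(2) x]] e_carrier by (simp add: c_def coef_smult coef_e)
 have mon: "monomial xx (\<lambda>x\<in>B. x) c"
  unfolding monomial_def
 proof
  fix y assume y: "y : B"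
  obtain x where x: "x : B" "y = bphi (perm ps x)" using ex[OF y] by blast
  show "(\<lambda>x\<in>B. x) y : B & c y ~= 0 & xx (e y) = c y \<star> e ((\<lambda>x\<in>B. x) y)"
   using y c[OF x(1)] xi_e[OF x(1)] x(2) zeta_nz[OF d x(1)] by (simp add: ze_def)
 qed
 have "xx : Diag_gr n G \<Gamma>"
 proof (rule Diag_I[OF aut mon])
  fix y y' assume yy: "y : B" "y' : B" "RR y y'"
  obtain x x' where x: "x : B" "y = bphi (perm ps x)" "x' : B" "y' = bphi (perm ps x')" using ex yy by metis
  have F: "perm ps x : B" "perm ps x' : B" using WW_B[OF d(2)] x by blast+
  have "RR (perm ps x) y" "RR y' (perm ps x')" using x bphi_bphi F unfolding RR_def by simp_all
  then have "RR (perm ps x) (perm ps x')" using RR_trans F(1) yy by meson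
  then have rr: "RR x x'" using WW_RR[OF d(2) x(1,3)] by blast
  have "ze ps x = ze ps x'" by (rule SS_ze_RR[OF S _ x(1,3) rr]) (rule z)
  then show "c y = c y'" using c x by simp
 qed
 then show ?thesis using that[of xx] xD D by simp
qed

text \<open>The automorphism psi phi psi^-1 phi^-1 acts by the scalars \<open>ze\<close>, which
  therefore have to be constant on components. On labels (i, t, i) this is automatic by
  \<open>zeta_diag\<close>; invariance under \<open>bphi\<close> remains as the condition.\<close>

lemma Aut_star_iff: "ps : Aut_star n G \<Gamma> \<phi> \<longleftrightarrow> ps : SS & (\<forall>x\<in>B. ze ps (bphi x) = ze ps x)"
proof
 assume A: "ps : Aut_star n G \<Gamma> \<phi>"
 then obtain xx where gr: "ps : Aut_gr n G \<Gamma>" and xi: "xx : Diag_gr n G \<Gamma>"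
  and eq: "ps \<odot> \<phi> \<odot> inv\<^bsub>AG\<^esub> ps = xx \<odot> \<phi>"
  by (auto simp: Aut_star_def)
 have xa: "xx : automorphisms n" using xi by (simp add: Diag_gr_def)
 note a = automorphismsD[OF Aut_gr_D(1)[OF gr]]
 obtain c where c: "monomial xx (\<lambda>x\<in>B. x) c" "!!x y. x : B ==> y : B ==> RR x y ==> c x = c y" using Diag_D[OF xi] by blast
 have com: "!!X. X : carrier_mat n n ==> ps (\<phi> X) = xx (\<phi> (ps X))"
  using eq conj_phi_iff[OF a(1) automorphismsD(1)[OF xa]] by blast
 have S: "ps : SS" "!!x. x : B ==> ze ps x = c (bphi (perm ps x))"
  by (rule twisted_commute_SS[OF gr automorphismsD(2)[OF xa] c(1)], rule com, assumption+)+
 have "ze ps (bphi x) = ze ps x" if x: "x : B" for x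
 proof -
  have F: "perm ps x : B" using WW_B[OF SS_D(2)[OF S(1)] x] .
  have "ze ps (bphi x) = c (perm ps x)"
   using S(2)[OF bphi_B[OF x]] WW_com[OF SS_D(2)[OF S(1)] x] bphi_bphi[OF F] by simp
  also have "... = c (bphi (perm ps x))" by (rule c(2)[OF F bphi_B[OF F]]) (simp add: RR_def)
  finally show ?thesis using S(2)[OF x] by simp
 qed
 then show "ps : SS & (\<forall>x\<in>B. ze ps (bphi x) = ze ps x)" using S(1) by blast
next
 assume h: "ps : SS & (\<forall>x\<in>B. ze ps (bphi x) = ze ps x)"
 then have S: "ps : SS" by blast
 note a = automorphismsD[OF SS_D(1)[OF S]]
 obtain xx where xi: "xx : Diag_gr n G \<Gamma>" and com: "!!X. X : carrier_mat n n ==> ps (\<phi> X) = xx (\<phi> (ps X))"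
  using conjugation_Diag[OF S] h by blast
 have xa: "xx : automorphisms n" using xi by (simp add: Diag_gr_def)
 show "ps : Aut_star n G \<Gamma> \<phi>" unfolding Aut_star_def
  using SS_Aut_gr[OF S] xi conj_phi_iff[OF a(1) automorphismsD(1)[OF xa]] com by blast
qed

lemma commute_iff:
 assumes gr: "ps : Aut_gr n G \<Gamma>"
 shows "ps \<odot> \<phi> \<odot> inv\<^bsub>AG\<^esub> ps = \<phi> \<longleftrightarrow> ps : SS & (\<forall>x\<in>B. ze ps x = 1)"
proof -
 note a = automorphismsD[OF Aut_gr_D(1)[OF gr]]
 interpret AG: group AG by (rule group_BijGroup)
 have one: "\<one>\<^bsub>AG\<^esub> : Bij (carrier_mat n n)" using AG.one_closed by (simp add: BijGroup_def)
 have "\<one>\<^bsub>AG\<^esub> \<odot> \<phi> = \<phi>" using phiD(1) by (intro AG.l_one) (simp add: BijGroup_def)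
 then have "ps \<odot> \<phi> \<odot> inv\<^bsub>AG\<^esub> ps = \<phi> \<longleftrightarrow> (\<forall>X\<in>carrier_mat n n. ps (\<phi> X) = \<one>\<^bsub>AG\<^esub> (\<phi> (ps X)))"
  using conj_phi_iff[OF a(1) one] by simp
 also have "... \<longleftrightarrow> ps : SS & (\<forall>x\<in>B. ze ps x = 1)"
 proof
  assume h: "\<forall>X\<in>carrier_mat n n. ps (\<phi> X) = \<one>\<^bsub>AG\<^esub> (\<phi> (ps X))"
  have lin: "lin_map n (%X. X :: 'f mat)" by (rule lin_map_id)
  have mon: "monomial (%X. X) (\<lambda>x\<in>B. x) (%_. 1)" unfolding monomial_def using e_carrier by (simp add: one_smult)
  have com: "ps (\<phi> X) = \<phi> (ps X)" if "X : carrier_mat n n" for X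
   using h that phiD(4) a(4) by (simp add: one_AG)
  show "ps : SS & (\<forall>x\<in>B. ze ps x = 1)" using twisted_commute_SS[OF gr lin mon com] by simp
 next
  assume h: "ps : SS & (\<forall>x\<in>B. ze ps x = 1)"
  then have S: "ps : SS" by blast
  note d = SS_D[OF S]
  have "ps (\<phi> X) = \<phi> (ps X)" if X: "X : carrier_mat n n" for X
  proof (rule lin_map_ext[OF lin_map_comp[OF a(2) phiD(2)] lin_map_comp[OF phiD(2) a(2)] _ X])
   fix x assume x: "x : B"
   have "\<phi> (ps (e x)) : carrier_mat n n" using phiD(4)[OF a(4)[OF e_carrier[OF x]]] .
   then show "ps (\<phi> (e x)) = \<phi> (ps (e x))"
    using zeta_e[OF d x] h x by (simp add: ze_def[symmetric] one_smult)
  qed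
  then show "\<forall>X\<in>carrier_mat n n. ps (\<phi> X) = \<one>\<^bsub>AG\<^esub> (\<phi> (ps X))"
   using phiD(4) a(4) by (simp add: one_AG)
 qed
 finally show ?thesis .
qed

lemma Aut_phi_iff: "ps : Aut_phi n G \<Gamma> \<phi> \<longleftrightarrow> ps : SS & (\<forall>x\<in>B. ze ps x = 1)"
 unfolding Aut_phi_def using commute_iff SS_Aut_gr by blast

section \<open>Weights of monomial automorphisms\<close>

lemma wt_mult:
 assumes aut: "ps : automorphisms n" and mon: "monomial ps (Fm P au u) w"
  and P: "!!i. i : K ==> P i : K" and au: "au : carrier (Aut_T T \<beta>)" and u: "!!i. i : K ==> u i : \<T>"
  and ij: "i : K" "t : \<T>" "j : K" "v : \<T>" "l : K"
 shows "w (i, t, j) * w (j, v, l) * sg (u i \<otimes> au t \<otimes> u j) (u j \<otimes> au v \<otimes> u l) = sg t v * w (i, t \<otimes> v, l)"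
proof -
 note a = automorphismsD[OF aut]
 let ?x = "(i, t, j)" and ?y = "(j, v, l)" and ?z = "(i, t \<otimes> v, l)"
 let ?f = "u i \<otimes> au t \<otimes> u j" and ?g = "u j \<otimes> au v \<otimes> u l" and ?h = "u i \<otimes> au (t \<otimes> v) \<otimes> u l"
 have B3: "?x : B" "?y : B" "?z : B" using ij by simp_all
 have fg: "?f : \<T>" "?g : \<T>" "?h : \<T>" using ij u Aut_T_D(1)[OF au] by simp_all
 have h: "?f \<otimes> ?g = ?h" using ij u Aut_T_D(1,2)[OF au] by (simp add: ac)
 have PB: "(P i, ?f, P j) : B" "(P j, ?g, P l) : B" "(P i, ?h, P l) : B" using P ij fg by simp_all
 have ec: "e ?x : carrier_mat n n" "e ?y : carrier_mat n n" "e ?z : carrier_mat n n"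
  "e (P i, ?f, P j) : carrier_mat n n" "e (P j, ?g, P l) : carrier_mat n n"
  using e_carrier B3 PB by blast+
 have 1: "ps (e ?x) = w ?x \<star> e (P i, ?f, P j)" "ps (e ?y) = w ?y \<star> e (P j, ?g, P l)" "ps (e ?z) = w ?z \<star> e (P i, ?h, P l)"
  using monomialD(3)[OF mon B3(1)] monomialD(3)[OF mon B3(2)] monomialD(3)[OF mon B3(3)] ij by simp_all
 have 2: "ps (e ?x) * ps (e ?y) = (w ?x * w ?y * sg ?f ?g) \<star> e (P i, ?h, P l)"
  unfolding 1 smult_mult[OF ec(4,5)] using e_mult[OF P[OF ij(1)] P[OF ij(3)] P[OF ij(3)] P[OF ij(5)] fg(1,2)] h
  by (simp add: smult_smult)
 have 3: "ps (e ?x) * ps (e ?y) = (sg t v * w ?z) \<star> e (P i, ?h, P l)"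
  using a(3)[OF ec(1,2)] e_mult[OF ij(1,3,3,5,2,4)] lin_mapD(3)[OF a(2) ec(3)] 1(3) by (simp add: smult_smult)
 have nz: "w ?x * w ?y * sg ?f ?g ~= 0"
  using monomialD(2)[OF mon B3(1)] monomialD(2)[OF mon B3(2)] sg_nz[OF fg(1,2)] by simp
 show ?thesis by (rule smult_e_inj(2)[OF PB(3) PB(3) _ nz]) (use 2 3 in simp)
qed

lemma zeta_diag_formula:
 assumes aut: "ps : automorphisms n" and mon: "monomial ps (Fm P au u) w"
  and P: "!!i. i : K ==> P i : K" and au: "au : carrier (Aut_T T \<beta>)" and u: "!!i. i : K ==> u i : \<T>"
  and i: "i : K" and t: "t : \<T>"
 shows "zeta (Fm P au u) w (i, t, i) = \<beta> (tw au \<otimes> cc P au u i) (au t)"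
proof -
 let ?Q = "quad_form T r ax bx :: 't => 'f"
 let ?s = "star i" and ?d = "u (star i) \<otimes> u i"
 have W: "w (i, t, j) * w (j, v, l) * sg (u i \<otimes> au t \<otimes> u j) (u j \<otimes> au v \<otimes> u l) = sg t v * w (i, t \<otimes> v, l)"
  if "i : K" "t : \<T>" "j : K" "v : \<T>" "l : K" for i t j v l
  by (rule wt_mult[OF aut mon _ au _ that]) (erule P u)+
 have s: "?s : K" using i by simp
 have T: "u i : \<T>" "u ?s : \<T>" "au t : \<T>" "?d : \<T>" "tt (P i) : \<T>" "au (tt i) : \<T>" "tw au : \<T>"
  using u[OF i] u[OF s] Aut_T_D(1)[OF au] t tt_T[OF i] tt_T[OF P[OF i]] tw(1)[OF au] by simp_all
 have 1: "w (?s, \<one>, i) * w (i, t, i) * sg ?d (au t) = w (?s, t, i)"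
  using W[OF s one_closed i t i] T t Aut_T_one[OF au] by (simp add: sg_one ac)
 have 2: "w (?s, t, ?s) * w (?s, \<one>, i) * sg (au t) ?d = w (?s, t, i)"
  using W[OF s t s one_closed i] T t Aut_T_one[OF au] by (simp add: sg_one ac)
 have nz: "w (?s, \<one>, i) ~= 0" "w (i, t, i) ~= 0" "sg (au t) ?d ~= 0"
  using monomialD(2)[OF mon] i s t sg_nz T by simp_all
 have "w (?s, \<one>, i) * sg (au t) ?d * w (?s, t, ?s) = w (?s, \<one>, i) * sg (au t) ?d * (w (i, t, i) * \<beta> ?d (au t))"
  using 1 2 unfolding sg_comm[OF T(4,3)] by (simp add: mult_ac)
 then have w: "w (?s, t, ?s) = w (i, t, i) * \<beta> ?d (au t)" using nz by simp
 have F: "Fm P au u (i, t, i) = (P i, au t, P i)" using i t T by (simp add: ac)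
 have b1: "\<beta> (tt i) t = \<beta> (au (tt i)) (au t)" using Aut_T_D(5)[OF au tt_T[OF i] t] by simp
 have inv: "1 / \<beta> (tt (P i)) (au t) = \<beta> (tt (P i)) (au t)" "1 / ?Q (au t) = ?Q (au t)"
  using beta_pm[OF T(5,3)] Q_pm[OF T(3)] by auto
 have "zeta (Fm P au u) w (i, t, i) = \<eta> (i, t, i) * w (?s, t, ?s) / (w (i, t, i) * \<eta> (P i, au t, P i))"
  using bphi_diag[OF i t] by (simp only: zeta_def F)
 also have "... = ?Q t * \<beta> (au (tt i)) (au t) * \<beta> ?d (au t) * (1 / ?Q (au t)) * (1 / \<beta> (tt (P i)) (au t))"
  unfolding w eta_diag[OF i t] eta_diag[OF P[OF i] T(3)] b1 using nz by simp
 also have "... = (?Q t * ?Q (au t)) * (\<beta> (au (tt i)) (au t) * \<beta> ?d (au t) * \<beta> (tt (P i)) (au t))"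
  unfolding inv by (simp add: mult_ac)
 also have "?Q t * ?Q (au t) = \<beta> (tw au) (au t)" using tw(2)[OF au t] ..
 also have "\<beta> (au (tt i)) (au t) * \<beta> ?d (au t) * \<beta> (tt (P i)) (au t) = \<beta> (cc P au u i) (au t)"
  unfolding cc_def using T by (simp add: beta_mult_l mult_ac)
 finally show ?thesis using T cc_def by (simp add: beta_mult_l)
qed

text \<open>The character beta(t_alpha c, -) is trivial, so c = t_alpha by nondegeneracy.\<close>

lemma ze_one_WW3:
 assumes S: "ps : SS" and z: "!!i t. i : K ==> t : \<T> ==> ze ps (i, t, i) = 1"
 shows "perm ps : WW3"
proof (rule WW_E[OF SS_D(2)[OF S]])
 note d = SS_D[OF S]
 fix P au u c
 assume P: "bij_betw P K K" and au: "au : carrier (Aut_T T \<beta>)" and u: "!!i. i : K ==> u i : \<T>"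
  and s: "!!i. i : K ==> P (star i) = star (P i)" and c: "!!i. i : K ==> cc P au u i = c" and cT: "c : \<T>"
  and F: "perm ps = Fm P au u"
 have PK: "P i : K" if "i : K" for i using P that by (auto simp: bij_betw_def)
 obtain k where k: "k : K" using K_nonempty by blast
 have "tw au \<otimes> c = \<one>"
 proof (rule beta_nondeg)
  show "tw au \<otimes> c : \<T>" using tw(1)[OF au] cT by simp
  fix v assume "v : \<T>"
  then obtain t where t: "t : \<T>" "v = au t" using Aut_T_D(3)[OF au] by (auto simp: bij_betw_def)
  show "\<beta> (tw au \<otimes> c) v = 1"
   using zeta_diag_formula[OF d(1) d(3)[unfolded F] PK au u k t(1)] z[OF k t(1)] c[OF k] t(2) by (simp add: ze_def F)
 qed
 then have "tw au = c" using mult_eq_one[OF tw(1)[OF au] cT] by simp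
 then show "perm ps : WW3"
  unfolding WW3_def mem_Collect_eq using P au u s c F by (intro exI[of _ P] exI[of _ au] exI[of _ u] conjI ballI) auto
qed

section \<open>Lifting index permutations to automorphisms\<close>

text \<open>The converse of \<open>wt_mult\<close>: twisted multiplicativity of nonzero weights is
  sufficient.\<close>

lemma monomial_automorphism:
 assumes P: "bij_betw P K K" and au: "au : carrier (Aut_T T \<beta>)" and u: "!!i. i : K ==> u i : \<T>"
  and w0: "!!x. x : B ==> w x ~= 0"
  and w: "!!i t j v l. [|i : K; t : \<T>; j : K; v : \<T>; l : K|] ==>
   w (i, t, j) * w (j, v, l) * sg (u i \<otimes> au t \<otimes> u j) (u j \<otimes> au v \<otimes> u l) = sg t v * w (i, t \<otimes> v, l)"
 shows "mono_map (Fm P au u) w : automorphisms n" "monomial (mono_map (Fm P au u) w) (Fm P au u) w"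
proof -
 let ?F = "Fm P au u" and ?ps = "mono_map (Fm P au u) w"
 have PK: "P i : K" if "i : K" for i using P that by (auto simp: bij_betw_def)
 have Pinj: "P i = P j \<longleftrightarrow> i = j" if "i : K" "j : K" for i j
  using P that by (auto simp: bij_betw_def inj_on_def)
 have FB: "?F : Bij B" by (rule Fm_Bij[OF P au u])
 have bij: "bij_betw ?F B B" using FB by (simp add: Bij_def)
 have F: "?F x : B" if "x : B" for x using Bij_B[OF FB that] .
 have me: "?ps (e x) = w x \<star> e (?F x)" if "x : B" for x using that F[OF that] by (rule mono_map_e)
 show "monomial ?ps ?F w" unfolding monomial_def using F w0 me by blast
 note lin = lin_map_mono_map[of ?F w]
 show "?ps : automorphisms n"
 proof (rule mono_map_automorphism[OF bij w0])
  fix x y assume xy: "x : B" "y : B"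
  obtain i t j k v l where x: "x = (i, t, j)" "i : K" "t : \<T>" "j : K" and y: "y = (k, v, l)" "k : K" "v : \<T>" "l : K"
   using xy by (cases x; cases y) auto
  let ?f = "u i \<otimes> au t \<otimes> u j" and ?g = "u k \<otimes> au v \<otimes> u l"
  have fg: "?f : \<T>" "?g : \<T>" using x y u Aut_T_D(1)[OF au] by simp_all
  have ec: "e (P i, ?f, P j) : carrier_mat n n" "e (P k, ?g, P l) : carrier_mat n n"
   using e_carrier x y PK fg by simp_all
  have "?ps (e x) * ?ps (e y) = (w x * w y) \<star> (e (P i, ?f, P j) * e (P k, ?g, P l))"
   unfolding me[OF xy(1)] me[OF xy(2)] using smult_mult[OF ec] x y by simp
  also have "... = (if j = k then (w x * w y * sg ?f ?g) \<star> e (P i, ?f \<otimes> ?g, P l) else 0\<^sub>m n n)"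
   using e_mult[OF PK[OF x(2)] PK[OF x(4)] PK[OF y(2)] PK[OF y(4)] fg] Pinj[OF x(4) y(2)]
   by (auto simp: smult_smult intro!: eq_matI)
  also have "... = ?ps (e x * e y)"
  proof (cases "j = k")
   case True
   have zB: "(i, t \<otimes> v, l) : B" using x y by simp
   have "?f \<otimes> ?g = u i \<otimes> au (t \<otimes> v) \<otimes> u l"
    using x y u Aut_T_D(1,2)[OF au] True by (simp add: ac)
   moreover have "w x * w y * sg ?f ?g = sg t v * w (i, t \<otimes> v, l)" using w[OF x(2-4) y(3,4)] x(1) y(1) True by simp
   moreover have "?ps (e x * e y) = (sg t v * w (i, t \<otimes> v, l)) \<star> e (P i, u i \<otimes> au (t \<otimes> v) \<otimes> u l, P l)"
    using e_mult[OF x(2,4) y(2,4) x(3) y(3)] True x y lin_mapD(3)[OF lin e_carrier[OF zB], of "sg t v"] me[OF zB]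
    by (simp add: smult_smult)
   ultimately show ?thesis using True by simp
  next
   case False
   then show ?thesis using e_mult[OF x(2,4) y(2,4) x(3) y(3)] x(1) y(1) lin_map_zero[OF lin] by simp
  qed
  finally show "?ps (e x * e y) = ?ps (e x) * ?ps (e y)" ..
 qed
qed

text \<open>Conjugation by the block scalar matrix with entries lam_i. It fixes all labels and
  changes \<open>ze\<close> through the products lam_i lam_{i*}.\<close>

lemma torus:
 assumes lam: "!!i. i : K ==> lam i ~= (0::'f)"
 obtains de where "de : SS" "perm de = idB"
  "!!i t j. i : K ==> t : \<T> ==> j : K ==>
   ze de (i, t, j) = lam j * lam (star j) / (lam i * lam (star i))"
proof -
 define w :: "nat \<times> 't \<times> nat => 'f" where "w = (%(i, t, j). lam i / lam j)"
 note F = bij_id_K one_Aut_T(2)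
 have w0: "w x ~= 0" if "x : B" for x using that lam by (cases x) (simp add: w_def)
 have one: "!!i. i : K ==> (%i. \<one>) i : \<T>" by simp
 have mult: "w (i, t, j) * w (j, v, l) * sg (\<one> \<otimes> (\<lambda>t\<in>\<T>. t) t \<otimes> \<one>) (\<one> \<otimes> (\<lambda>t\<in>\<T>. t) v \<otimes> \<one>) = sg t v * w (i, t \<otimes> v, l)"
  if "i : K" "t : \<T>" "j : K" "v : \<T>" "l : K" for i t j v l
  using that lam[of j] by (simp add: w_def)
 let ?de = "mono_map (Fm (%i. i) (\<lambda>t\<in>\<T>. t) (%i. \<one>)) w"
 have FW: "Fm (%i. i) (\<lambda>t\<in>\<T>. t) (%i. \<one>) : WW" unfolding Fm_id by (rule one_WW)
 have aut: "?de : automorphisms n" and mon: "monomial ?de (Fm (%i. i) (\<lambda>t\<in>\<T>. t) (%i. \<one>)) w"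
  by (rule monomial_automorphism[OF F]; (simp; fail)?; (erule w0)?; (rule mult; assumption)?)+
 note I = SS_I[OF aut FW mon]
 have "ze ?de (i, t, j) = lam j * lam (star j) / (lam i * lam (star i))" if ij: "i : K" "t : \<T>" "j : K" for i t j
 proof -
  have x: "(i, t, j) : B" using ij by simp
  have nz: "lam i ~= 0" "lam j ~= 0" "lam (star i) ~= 0" "lam (star j) ~= 0" using lam ij by simp_all
  show ?thesis unfolding I(4)[OF x] zeta_def using ij nz eta_nz[OF x]
   by (simp add: w_def bphi_def field_simps)
 qed
 then show ?thesis using that[of ?de] I(1,2) by (simp add: Fm_id)
qed

lemma rescale:
 assumes S: "ps : SS" and lam: "!!i. i : K ==> lam i ~= (0::'f)"
 obtains ka where "ka : SS" "perm ka = perm ps"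
  "!!i t j. i : K ==> t : \<T> ==> j : K ==>
   ze ka (i, t, j) = ze ps (i, t, j) * (lam j * lam (star j)) / (lam i * lam (star i))"
proof -
 obtain de where d: "de : SS" "perm de = idB"
  "!!i t j. i : K ==> t : \<T> ==> j : K ==> ze de (i, t, j) = lam j * lam (star j) / (lam i * lam (star i))"
  by (rule torus[of lam]) (use lam in blast)+
 interpret BG: group "BijGroup B" by (rule group_BijGroup)
 note M = SS_mult[OF S d(1)]
 have p: "perm ps : carrier (BijGroup B)" using WW_Bij[OF SS_D(2)[OF S]] by (simp add: BijGroup_def)
 have z: "ze (ps \<odot> de) (i, t, j) = ze ps (i, t, j) * (lam j * lam (star j)) / (lam i * lam (star i))"
  if ij: "i : K" "t : \<T>" "j : K" for i t j
 proof -
  have x: "(i, t, j) : B" using ij by simp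
  show ?thesis using M(4)[OF x] d(3)[OF ij] x unfolding d(2) one_BG by simp
 qed
 show ?thesis by (rule that[OF M(1) _ z]) (simp_all add: M(2) d(2) p)
qed

text \<open>The cocycle form of the identity that (X_u X_x X_v)(X_v X_y X_z) is sg(v, v) times X_u
  X_x X_y X_z.\<close>

lemma sg_shuffle:
 assumes T: "u : \<T>" "x : \<T>" "v : \<T>" "y : \<T>" "z : \<T>"
 shows "sg u x * sg (u \<otimes> x) v * sg v y * sg (v \<otimes> y) z * sg (u \<otimes> x \<otimes> v) (v \<otimes> y \<otimes> z)
  = sg v v * sg x y * sg u (x \<otimes> y) * sg (u \<otimes> (x \<otimes> y)) z"
proof -
 have 1: "sg (u \<otimes> x \<otimes> v) (v \<otimes> y) * sg (u \<otimes> (x \<otimes> y)) z = sg (u \<otimes> x \<otimes> v) (v \<otimes> y \<otimes> z) * sg (v \<otimes> y) z"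
  using sg_assoc[of "u \<otimes> x \<otimes> v" "v \<otimes> y" z] T by (simp add: ac)
 have 2: "sg (u \<otimes> x \<otimes> v) v * sg (u \<otimes> x) y = sg (u \<otimes> x \<otimes> v) (v \<otimes> y) * sg v y"
  using sg_assoc[of "u \<otimes> x \<otimes> v" v y] T by (simp add: ac)
 have 3: "sg (u \<otimes> x) v * sg (u \<otimes> x \<otimes> v) v = sg v v"
  using sg_assoc[of "u \<otimes> x" v v] T sg_one(2)[of "u \<otimes> x"] by (simp add: sq)
 have 4: "sg u x * sg (u \<otimes> x) y = sg u (x \<otimes> y) * sg x y" using sg_assoc[of u x y] T by simp
 have "sg u x * sg (u \<otimes> x) v * sg v y * sg (v \<otimes> y) z * sg (u \<otimes> x \<otimes> v) (v \<otimes> y \<otimes> z)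
   = sg u x * sg (u \<otimes> x) v * (sg (u \<otimes> x \<otimes> v) (v \<otimes> y) * sg v y) * sg (u \<otimes> (x \<otimes> y)) z"
  using 1 by (simp add: mult_ac)
 also have "... = sg u x * sg (u \<otimes> x) y * (sg (u \<otimes> x) v * sg (u \<otimes> x \<otimes> v) v) * sg (u \<otimes> (x \<otimes> y)) z"
  unfolding 2[symmetric] by (simp add: mult_ac)
 finally show ?thesis unfolding 3 4 by (simp add: mult_ac)
qed

text \<open>X_t -> d(t) X_{alpha(t)} is an automorphism of D when d splits the quotient of
  \<open>sg\<close> by its pullback along alpha, and this cocycle is symmetric because alpha
  preserves beta. Conjugation by X_{u_i} and the index permutation are composed with it.\<close>

lemma lift_exists:
 assumes F: "F : WW"
 obtains ps where "ps : SS" "perm ps = F"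
proof (rule WW_E[OF F])
 fix P au u c
 assume P: "bij_betw P K K" and au: "au : carrier (Aut_T T \<beta>)" and u: "!!i. i : K ==> u i : \<T>"
  and FF: "F = Fm P au u"
 define c where "c x y = sg x y / sg (au x) (au y)" for x y
 have aT: "au t : \<T>" if "t : \<T>" for t using Aut_T_D(1)[OF au that] .
 obtain d where d0: "!!t. t : \<T> ==> d t ~= 0"
  and d: "!!x y. x : \<T> ==> y : \<T> ==> c x y * d (x \<otimes> y) = d x * d y"
 proof (rule symmetric_cocycle_split[of c])
  fix x y assume xy: "x : \<T>" "y : \<T>"
  show "c x y ~= 0" using sg_nz xy aT by (simp add: c_def)
  show "c x y = c y x"
   unfolding c_def sg_comm[OF xy] sg_comm[OF aT[OF xy(1)] aT[OF xy(2)]]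
   using Aut_T_D(5)[OF au xy] beta_nz[OF xy] by simp
  fix z assume z: "z : \<T>"
  have "sg x y * sg (x \<otimes> y) z = sg x (y \<otimes> z) * sg y z" by (rule sg_assoc[OF xy z])
  moreover have "sg (au x) (au y) * sg (au x \<otimes> au y) (au z) = sg (au x) (au y \<otimes> au z) * sg (au y) (au z)"
   using sg_assoc aT xy z by blast
  ultimately show "c x y * c (x \<otimes> y) z = c x (y \<otimes> z) * c y z"
   using xy z by (simp add: c_def Aut_T_D(2)[OF au])
 qed blast
 \<comment> \<open>The scalar of d(t) X_{u_i} X_{alpha(t)} X_{u_j}^-1; the denominator comes from
   X_u^-1 = X_u / sg(u, u).\<close>
 define w where "w = (%(i, t, j). d t * sg (u i) (au t) * sg (u i \<otimes> au t) (u j) / sg (u j) (u j))"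
 have w0: "w x ~= 0" if "x : B" for x using that d0 sg_nz u aT by (cases x) (simp add: w_def)
 have mult: "w (i, t, j) * w (j, v, l) * sg (u i \<otimes> au t \<otimes> u j) (u j \<otimes> au v \<otimes> u l) = sg t v * w (i, t \<otimes> v, l)"
  if ij: "i : K" "t : \<T>" "j : K" "v : \<T>" "l : K" for i t j v l
 proof -
  note sh = sg_shuffle[OF u[OF ij(1)] aT[OF ij(2)] u[OF ij(3)] aT[OF ij(4)] u[OF ij(5)]]
  have nz: "sg (u j) (u j) ~= 0" "sg (u l) (u l) ~= 0" "sg (au t) (au v) ~= 0" using sg_nz u aT ij by simp_all
  have "w (i, t, j) * w (j, v, l) * sg (u i \<otimes> au t \<otimes> u j) (u j \<otimes> au v \<otimes> u l)
   = d t * d v * (sg (u i) (au t) * sg (u i \<otimes> au t) (u j) * sg (u j) (au v) * sg (u j \<otimes> au v) (u l)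
    * sg (u i \<otimes> au t \<otimes> u j) (u j \<otimes> au v \<otimes> u l)) / (sg (u j) (u j) * sg (u l) (u l))"
   by (simp add: w_def mult_ac)
  also have "... = (d t * d v) * sg (au t) (au v) * sg (u i) (au t \<otimes> au v) * sg (u i \<otimes> (au t \<otimes> au v)) (u l) / sg (u l) (u l)"
   unfolding sh using nz by simp
  also have "d t * d v = sg t v / sg (au t) (au v) * d (t \<otimes> v)" using d[OF ij(2,4)] by (simp add: c_def)
  also have "sg t v / sg (au t) (au v) * d (t \<otimes> v) * sg (au t) (au v) * sg (u i) (au t \<otimes> au v) * sg (u i \<otimes> (au t \<otimes> au v)) (u l) / sg (u l) (u l)
   = sg t v * w (i, t \<otimes> v, l)"
   using nz ij by (simp add: w_def Aut_T_D(2)[OF au])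
  finally show ?thesis .
 qed
 have aut: "mono_map F w : automorphisms n" and mon: "monomial (mono_map F w) F w"
  unfolding FF by (rule monomial_automorphism[OF P au]; (erule u)?; (erule w0)?; (rule mult; assumption)?)+
 show ?thesis using that SS_I[OF aut F mon] by blast
qed

text \<open>A root function on the whole field, so that equal arguments receive equal roots; this
  keeps the scalars at i and i* equal.\<close>

lemma roots:
 assumes "k > 0"
 shows "\<exists>g :: 'f => 'f. \<forall>y. g y ^ k = y"
 using nth_root_exists[OF assms] by metis

text \<open>Any lift has \<open>ze\<close> of the form l_i ch(t) / l_j with a character ch.
  Rescaling with lam_i = lam_{i*} divides this by (lam_i / lam_j)^2, and invariance under
  \<open>bphi\<close> becomes lam_i^4 = l_i l_{i*} ch(t_i) up to a common factor. Hence fourth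
  roots.\<close>

lemma lift_star:
 assumes F: "F : WW"
 obtains ps where "ps : Aut_star n G \<Gamma> \<phi>" "perm ps = F"
proof -
 obtain ps0 where S: "ps0 : SS" and pF: "perm ps0 = F" using lift_exists[OF F] by blast
 note d = SS_D[OF S]
 define z where "z = ze ps0"
 have split: "z (i, t, j) = z (i, \<one>, k) * z (k, t, k) * z (k, \<one>, j)" if "i : K" "t : \<T>" "j : K" "k : K" for i t j k
  unfolding z_def ze_def by (rule zeta_split[OF d that])
 have inv: "z (i, \<one>, j) * z (j, \<one>, i) = 1" if "i : K" "j : K" for i j
  unfolding z_def ze_def by (rule zeta_inv[OF d that])
 have nz: "z x ~= 0" if "x : B" for x unfolding z_def ze_def by (rule zeta_nz[OF d that])
 obtain k where k: "k : K" using K_nonempty by blast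
 define ch where "ch t = z (k, t, k)" for t
 have ch_sq: "ch t * ch t = 1" if "t : \<T>" for t
  unfolding ch_def z_def ze_def by (rule zeta_diag_sq[OF d k that])
 have ch_mult: "ch (t \<otimes> v) = ch t * ch v" if "t : \<T>" "v : \<T>" for t v
  unfolding ch_def z_def ze_def by (rule zeta_mult[OF d k that(1) k that(2) k])
 define l where "l i = z (i, \<one>, k)" for i
 have l0: "l i ~= 0" if "i : K" for i using nz that k by (simp add: l_def)
 have zl: "z (i, t, j) = l i * ch t / l j" if "i : K" "t : \<T>" "j : K" for i t j
  using split[OF that k] inv[OF that(3) k] l0[OF that(3)] by (simp add: l_def ch_def field_simps)
 define y where "y i = l i * l (star i) * ch (tt i)" for i
 have y0: "y i ~= 0" if "i : K" for i
  using l0 that ch_sq[OF tt_T[OF that]] by (auto simp: y_def)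
 have ys: "y (star i) = y i" if "i : K" for i using that by (simp add: y_def mult_ac)
 obtain g :: "'f => 'f" where g: "!!y. g y ^ 4 = y" using roots[of 4] by auto
 define lam where "lam i = g (y i)" for i
 have lam0: "lam i ~= 0" if "i : K" for i using g[of "y i"] y0[OF that] by (auto simp: lam_def)
 have lams: "lam (star i) = lam i" if "i : K" for i using ys[OF that] by (simp add: lam_def)
 have lam4: "lam i * lam i * (lam i * lam i) = y i" for i
  using g[of "y i"] by (simp add: lam_def power4_eq_xxxx mult_ac)
 obtain ka where X: "ka : SS" "perm ka = perm ps0"
  "!!i t j. i : K ==> t : \<T> ==> j : K ==> ze ka (i, t, j) = z (i, t, j) * (lam j * lam (star j)) / (lam i * lam (star i))"
  unfolding z_def by (rule rescale[OF S, of lam]) (use lam0 in blast)+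
 have "ze ka (bphi x) = ze ka x" if x: "x : B" for x
 proof -
  obtain i t j where ij: "x = (i, t, j)" "i : K" "t : \<T>" "j : K" using x by (cases x) auto
  let ?t = "t \<otimes> tt i \<otimes> tt j"
  define Li Lj where "Li = lam i * lam i" and "Lj = lam j * lam j"
  have L: "Li * Li = y i" "Lj * Lj = y j" using lam4 by (simp_all add: Li_def Lj_def)
  have L0: "Li ~= 0" "Lj ~= 0" using lam0 ij by (simp_all add: Li_def Lj_def)
  have tT: "?t : \<T>" using ij by simp
  have 1: "ze ka (bphi x) = l (star j) * (ch t * ch (tt i) * ch (tt j)) / l (star i) * Li / Lj"
   using X(3)[OF star_K[OF ij(4)] tT star_K[OF ij(2)]] zl[OF star_K[OF ij(4)] tT star_K[OF ij(2)]] ij lams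
   by (simp add: bphi_def ch_mult Li_def Lj_def)
  have 2: "ze ka x = l i * ch t / l j * Lj / Li"
   using X(3)[OF ij(2-4)] zl[OF ij(2-4)] ij lams by (simp add: Li_def Lj_def)
  have l4: "l i ~= 0" "l j ~= 0" "l (star i) ~= 0" "l (star j) ~= 0" using l0 ij by simp_all
  have c: "ch (tt i) * ch (tt i) = 1" using ch_sq ij by simp
  have "l (star j) * (ch t * ch (tt i) * ch (tt j)) * l j * (Li * Li) = l i * ch t * l (star i) * (Lj * Lj)"
   unfolding L y_def using c by (simp add: mult_ac)
  then show ?thesis unfolding 1 2 using l4 L0 by (simp add: field_simps)
 qed
 then have "ka : Aut_star n G \<Gamma> \<phi>" unfolding Aut_star_iff using X(1) by blast
 then show ?thesis using that X(2) pF by simp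
qed

lemma tw_id: "tw (\<lambda>t\<in>\<T>. t) = \<one>"
 by (rule tw_unique[OF one_Aut_T(2)]) auto

lemma WW3_WW: "F : WW3 ==> F : WW"
proof -
 assume "F : WW3"
 then obtain P au u where P: "bij_betw P K K" and au: "au : carrier (Aut_T T \<beta>)" and u0: "\<forall>i\<in>K. u i : \<T>"
  and s0: "\<forall>i\<in>K. P (star i) = star (P i)" and c0: "\<forall>i\<in>K. cc P au u i = tw au" and F: "F = Fm P au u"
  unfolding WW3_def mem_Collect_eq by (elim exE conjE)
 show ?thesis unfolding F by (rule WW_I[OF P au, where c = "tw au"]) (use u0 s0 c0 in blast)+
qed

text \<open>With c = t_alpha the diagonal formula gives 1, so \<open>ze\<close> has the form l_i /
  l_j. A torus element with lam_i lam_{i*} = l_i removes it, provided that l_i = l_{i*}; the proof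
  turns on this proviso.\<close>

lemma lift_phi:
 assumes inv_phi: "!!X. X : carrier_mat n n ==> \<phi> (\<phi> X) = X" and F3: "F : WW3"
 obtains ps where "ps : Aut_phi n G \<Gamma> \<phi>" "perm ps = F"
proof -
 let ?Q = "quad_form T r ax bx :: 't => 'f"
 from F3 obtain P au u where P: "bij_betw P K K" and au: "au : carrier (Aut_T T \<beta>)" and u0: "\<forall>i\<in>K. u i : \<T>"
  and s0: "\<forall>i\<in>K. P (star i) = star (P i)" and c0: "\<forall>i\<in>K. cc P au u i = tw au" and F: "F = Fm P au u"
  unfolding WW3_def mem_Collect_eq by (elim exE conjE)
 have u: "!!i. i : K ==> u i : \<T>" using u0 by blast
 have PK: "P i : K" if "i : K" for i using P that by (auto simp: bij_betw_def)
 obtain ps0 where S: "ps0 : SS" and pF: "perm ps0 = F" using lift_exists[OF WW3_WW[OF F3]] by blast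
 note d = SS_D[OF S]
 define z where "z = ze ps0"
 have split: "z (i, t, j) = z (i, \<one>, k) * z (k, t, k) * z (k, \<one>, j)" if "i : K" "t : \<T>" "j : K" "k : K" for i t j k
  unfolding z_def ze_def by (rule zeta_split[OF d that])
 have inv: "z (i, \<one>, j) * z (j, \<one>, i) = 1" if "i : K" "j : K" for i j
  unfolding z_def ze_def by (rule zeta_inv[OF d that])
 have mul: "z (i, \<one>, k) = z (i, \<one>, j) * z (j, \<one>, k)" if "i : K" "j : K" "k : K" for i j k
  using zeta_mult[OF d that(1) one_closed that(2) one_closed that(3)] by (simp add: z_def ze_def)
 have nz: "z x ~= 0" if "x : B" for x unfolding z_def ze_def by (rule zeta_nz[OF d that])
 have dg: "z (i, t, i) = 1" if i: "i : K" and t: "t : \<T>" for i t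
 proof -
  have "z (i, t, i) = \<beta> (tw au \<otimes> tw au) (au t)"
   using zeta_diag_formula[OF d(1) d(3)[unfolded pF F] PK au u i t] c0 i by (simp add: z_def ze_def pF F)
  then show ?thesis using tw(1)[OF au] Aut_T_D(1)[OF au t] by (simp add: sq)
 qed
 have eta2: "\<eta> x * \<eta> (bphi x) = 1" if x: "x : B" for x
 proof -
  have "\<phi> (\<phi> (e x)) = (\<eta> x * \<eta> (bphi x)) \<star> e x"
   using phi_e[OF x] phi_e[OF bphi_B[OF x]] lin_mapD(3)[OF phiD(2) e_carrier[OF bphi_B[OF x]]] bphi_bphi[OF x]
   by (simp add: smult_smult)
  then have "1 \<star> e x = (\<eta> x * \<eta> (bphi x)) \<star> e x" using inv_phi[OF e_carrier[OF x]] e_carrier[OF x] by (simp add: one_smult)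
  then show ?thesis using smult_e_inj(2)[OF x x] by force
 qed
 have starz: "z (i, \<one>, star i) = 1" if i: "i : K" for i
  using i
 proof (cases rule: K_cases)
  case low
  then show ?thesis using dg[OF i one_closed] by simp
 next
  case h: (hyp j c)
  have s: "star i : K" using i by simp
  have ni: "~ i <= q" "~ star i <= q" using h by simp_all
  have nP: "~ P i <= q" "~ P (star i) <= q"
  proof -
   have *: "~ P k <= q" if k: "k : K" "~ k <= q" for k
   proof
    assume "P k <= q"
    then have "P (star k) = P k" using s0 k(1) by simp
    then have "star k = k" using P k(1) star_K[OF k(1)] by (auto simp: bij_betw_def dest: inj_onD)
    moreover have "star k ~= k" using k by (elim K_cases) (auto simp: hyp_inject)
    ultimately show False by simp
   qed
   show "~ P i <= q" "~ P (star i) <= q" using * i s ni by blast+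
  qed
  have x: "(i, \<one>, star i) : B" using i s by simp
  have tt1: "tt i = \<one>" "tt (star i) = \<one>" "tt (P i) = \<one>" "tt (P (star i)) = \<one>" using ni nP by (simp_all add: tt_def)
  have bx: "bphi (i, \<one>, star i) = (i, \<one>, star i)" using i s by (simp add: bphi_def tt1)
  have uT: "u i : \<T>" "u (star i) : \<T>" using u i s by blast+
  have ci: "cc P au u i = tw au" using c0 i by blast
  have cu: "u i \<otimes> u (star i) = tw au" using ci[unfolded cc_def] uT tt1 Aut_T_one[OF au] by simp
  have Fx: "Fm P au u (i, \<one>, star i) = (P i, tw au, P (star i))" using i s uT cu Aut_T_one[OF au] by simp
  have Qtw: "?Q (tw au) = 1" by (rule Q_tw[OF au])
  have "z (i, \<one>, star i) = \<eta> (i, \<one>, star i) / \<eta> (P i, tw au, P (star i))"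
   unfolding z_def ze_def zeta_def pF F bx Fx using monomialD(2)[OF d(3) x] by simp
  also have "... = (m i / m (star i)) / (m (P i) / m (P (star i)))"
   unfolding eta_pair[OF i s ni one_closed] eta_pair[OF PK[OF i] PK[OF s] nP tw(1)[OF au]] Qtw by simp
  also have "... = 1"
  proof -
   \<comment> \<open>The involution condition at this label equates the ratio of \<open>m\<close> at
     i and i* with the ratio at P i and P i*.\<close>
   let ?y = "(i, \<one>, P i)"
   have y: "?y : B" using i PK by simp
   have sP: "star (P i) = P (star i)" using s0 i by simp
   have "bphi ?y = (star (P i), \<one>, star i)" using tt1 by (simp add: bphi_def)
   then have "m i / m (P i) * (m (P (star i)) / m (star i)) = 1"
    using eta2[OF y] eta_pair[OF i PK[OF i] ni(1) nP(1) one_closed] eta_pair[OF PK[OF s] s nP(2) ni(2) one_closed]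
    by (simp add: sP)
   then show ?thesis using m_nz i s PK by (simp add: field_simps)
  qed
  finally show ?thesis .
 qed
 obtain k where k: "k : K" using K_nonempty by blast
 define l where "l i = z (i, \<one>, k)" for i
 have l0: "l i ~= 0" if "i : K" for i using nz that k by (simp add: l_def)
 have zl: "z (i, t, j) = l i / l j" if "i : K" "t : \<T>" "j : K" for i t j
  using split[OF that k] inv[OF that(3) k] l0[OF that(3)] dg[OF k that(2)] by (simp add: l_def field_simps)
 have ls: "l (star i) = l i" if "i : K" for i
  using mul[OF that star_K[OF that] k] starz[OF that] by (simp add: l_def)
 obtain g :: "'f => 'f" where g: "!!y. g y ^ 2 = y" using roots[of 2] by auto
 define lam where "lam i = g (l i)" for i
 have lam0: "lam i ~= 0" if "i : K" for i using g[of "l i"] l0[OF that] by (auto simp: lam_def)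
 have lam2: "lam i * lam (star i) = l i" if "i : K" for i
  using g[of "l i"] ls[OF that] by (simp add: lam_def power2_eq_square)
 obtain ka where X: "ka : SS" "perm ka = perm ps0"
  "!!i t j. i : K ==> t : \<T> ==> j : K ==> ze ka (i, t, j) = z (i, t, j) * (lam j * lam (star j)) / (lam i * lam (star i))"
  unfolding z_def by (rule rescale[OF S, of lam]) (use lam0 in blast)+
 have "ze ka x = 1" if x: "x : B" for x
 proof -
  obtain i t j where ij: "x = (i, t, j)" "i : K" "t : \<T>" "j : K" using x by (cases x) auto
  show ?thesis using X(3)[OF ij(2-4)] zl[OF ij(2-4)] lam2 l0 ij by simp
 qed
 then have "ka : Aut_phi n G \<Gamma> \<phi>" unfolding Aut_phi_iff using X(1) by blast
 then show ?thesis using that X(2) pF by simp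
qed

section \<open>The stabilizer\<close>

text \<open>Fixing components relates every label to its image. Labels (i, t, i) give alpha = 1, a
  moved index would lead to the excluded configuration, and labels (i, \<one>, k) make all
  translations equal.\<close>

lemma Stab_phi_perm:
 assumes st: "ps : Stab_phi n G \<Gamma> \<phi>"
 shows "ps : SS" "perm ps = idB" "x : B ==> ze ps x = 1"
proof -
 have aut: "ps : automorphisms n" and fix_comp: "!!V. V : CC ` B ==> ps ` V = V"
  and com: "ps \<odot> \<phi> \<odot> inv\<^bsub>AG\<^esub> ps = \<phi>"
  using st by (auto simp: Stab_phi_def Stab_gr_def comps_CC)
 have "bij_betw (%V. ps ` V) (components n G \<Gamma>) (components n G \<Gamma>)"
  unfolding comps_CC by (rule bij_betw_cong[THEN iffD1, OF _ bij_betw_id]) (use fix_comp in auto)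
 then have gr: "ps : Aut_gr n G \<Gamma>" using aut by (simp add: Aut_gr_def)
 have S: "ps : SS" and z: "!!x. x : B ==> ze ps x = 1" using com commute_iff[OF gr] by blast+
 show "ps : SS" "x : B ==> ze ps x = 1" by (rule S, rule z)
 note d = SS_D[OF S]
 have rr: "RR x (perm ps x)" if x: "x : B" for x
 proof -
  have Fx: "perm ps x : B" using WW_B[OF d(2) x] .
  have "ps (e x) : CC x" using fix_comp[of "CC x"] x e_in_CC[OF x] by blast
  then have "wt ps x \<star> e (perm ps x) : CC x" using monomialD(3)[OF d(3) x] by simp
  moreover have "coef (wt ps x \<star> e (perm ps x)) (perm ps x) ~= 0"
   using monomialD(2)[OF d(3) x] Fx e_carrier[OF Fx] by (simp add: coef_smult coef_e)
  ultimately show ?thesis using CC_coef Fx by blast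
 qed
 have "perm ps : WW3" by (rule ze_one_WW3[OF S]) (rule z, simp)
 then obtain P au u where P: "bij_betw P K K" and au: "au : carrier (Aut_T T \<beta>)" and u0: "\<forall>i\<in>K. u i : \<T>"
  and s0: "\<forall>i\<in>K. P (star i) = star (P i)" and c0: "\<forall>i\<in>K. cc P au u i = tw au" and F: "perm ps = Fm P au u"
  unfolding WW3_def mem_Collect_eq by (elim exE conjE)
 have u: "!!i. i : K ==> u i : \<T>" using u0 by blast
 have PK: "P i : K" if "i : K" for i using P that by (auto simp: bij_betw_def)
 obtain k where k: "k : K" using K_nonempty by blast
 have al: "au t = t" if t: "t : \<T>" for t
 proof -
  have "Fm P au u (k, t, k) = (P k, au t, P k)" using k t u[OF k] Aut_T_D(1)[OF au t] by (simp add: ac)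
  then have "RR (k, t, k) (P k, au t, P k)" using rr[of "(k, t, k)"] k t F by simp
  then show ?thesis unfolding RR_def bphi_diag[OF k t] by auto
 qed
 have "au = (\<lambda>t\<in>\<T>. t)" by (rule extensionalityI[OF Aut_T_D(4)[OF au]]) (auto simp: al)
 then have tw1: "tw au = \<one>" using tw_id by simp
 have Pid: "P i = i" if i: "i : K" for i
 proof (rule ccontr)
  assume ne: "P i ~= i"
  \<comment> \<open>The label (i, \<one>, j) is not of the form (i, t, i) and is moved, so its image
    is its \<open>bphi\<close> image. As j is arbitrary, there are just two indices.\<close>
  have only: "star j = P i" if j: "j : K" "j ~= i" for j
  proof -
   have "RR (i, \<one>, j) (P i, u i \<otimes> au \<one> \<otimes> u j, P j)" using rr[of "(i, \<one>, j)"] i j F by simp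
   then show ?thesis using ne j(2) unfolding RR_def bphi_def by auto
  qed
  have low: "i : {1..q}"
   using i
  proof (cases rule: K_cases)
   case (hyp j c)
   then have "star i ~= i" by (simp add: hyp_inject)
   then have "star (star i) = P i" using only[OF star_K[OF i]] by blast
   then show ?thesis using ne i by simp
  qed
  then have sP: "star (P i) = P i" using s0 i by (metis atLeastAtMost_iff low_simps(1))
  have KK: "K = {i, P i}"
  proof (intro equalityI subsetI)
   fix j assume j: "j : K"
   show "j : {i, P i}"
   proof (cases "j = i")
    case False
    then have "star j = P i" by (rule only[OF j])
    then have "j = star (P i)" using star_star[OF j] by simp
    then show ?thesis using sP by simp
   qed simp
  qed (use i PK in auto)
  have "card K = 2" unfolding KK using ne by simp
  then have q2: "q + 2 * s = 2" by (simp add: K_def)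
  moreover have "1 <= q" using low by simp
  ultimately have q: "q = 2" "s = 0" by presburger+
  have PiK: "P i : {1..q}" using PK[OF i] unfolding K_def using q(2) by simp
  have T: "u i : \<T>" "\<tau> i : \<T>" "\<tau> (P i) : \<T>" using u[OF i] tau[OF low] tau[OF PiK] by auto
  \<comment> \<open>The value \<open>cc\<close> for alpha = 1 and t_alpha = \<one>.\<close>
  have "\<tau> (P i) \<otimes> u i \<otimes> u i \<otimes> \<tau> i = \<one>"
   using bspec[OF c0 i, unfolded tw1 cc_def] low PiK T al by simp
  then have "\<tau> (P i) = \<tau> i" using T mult_eq_one[of "\<tau> (P i)" "\<tau> i"] by (simp add: ac)
  moreover have "(i = 1 & P i = 2) | (i = 2 & P i = 1)" using low PiK ne q by auto
  ultimately have "\<tau> 1 = \<tau> 2" by auto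
  then show False using not_bad q by simp
 qed
 have "perm ps = Fm (%i. i) (\<lambda>t\<in>\<T>. t) (%i. \<one>)"
  unfolding F
 proof (rule Fm_cong[where z = "u k"])
  fix i assume i: "i : K"
  show "P i = i" by (rule Pid[OF i])
  have T: "u i : \<T>" "u k : \<T>" using u i k by blast+
  have "RR (i, \<one>, k) (i, u i \<otimes> \<one> \<otimes> u k, k)" using rr[of "(i, \<one>, k)"] i k F Pid al by simp
  then have "u i \<otimes> \<one> \<otimes> u k = \<one>" using RR_mid[of i \<one> k] i k by simp
  then show "u i = u k \<otimes> \<one>" using T mult_eq_one[of "u i" "u k"] by simp
 qed (use al u k in auto)
 then show "perm ps = idB" by (simp add: Fm_id)
qed

lemma Stab_phi_eq: "Stab_phi n G \<Gamma> \<phi> = Diag_gr n G \<Gamma>"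
proof (intro equalityI subsetI)
 fix ps assume "ps : Stab_phi n G \<Gamma> \<phi>"
 then show "ps : Diag_gr n G \<Gamma>" unfolding Diag_iff using Stab_phi_perm by blast
next
 fix ps assume "ps : Diag_gr n G \<Gamma>"
 then have S: "ps : SS" and p: "perm ps = idB" and z: "\<forall>x\<in>B. ze ps x = 1" unfolding Diag_iff by auto
 have "ps ` V = V" if V: "V : CC ` B" for V
 proof -
  obtain x where "x : B" "V = CC x" using V by blast
  then show ?thesis using SS_CC[OF S, of x] p by (simp add: one_BG)
 qed
 then have "ps : Stab_gr n G \<Gamma>" using SS_D(1)[OF S] by (simp add: Stab_gr_def comps_CC)
 moreover have "ps \<odot> \<phi> \<odot> inv\<^bsub>AG\<^esub> ps = \<phi>" using commute_iff[OF SS_Aut_gr[OF S]] S z by blast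
 ultimately show "ps : Stab_phi n G \<Gamma> \<phi>" by (simp add: Stab_phi_def)
qed

section \<open>Signs of automorphisms that fix the index set\<close>

definition ez :: "int => 'f" where "ez k = (if k = 1 then -1 else 1)"

text \<open>All sign vectors on classes that produce the scalars at labels (i, \<one>, j). Once
  there is one they form a coset of the diagonal, so no vector has to be chosen.\<close>

definition "sign_coset ps = {z : {1..q + s} \<rightarrow>\<^sub>E {0, 1}. \<forall>i\<in>K. \<forall>j\<in>K. ze ps (i, \<one>, j) = ez (z (cl i)) * ez (z (cl j))}"

lemma ez_add: "k : {0, 1} ==> l : {0, 1} ==> ez ((k + l) mod 2) = ez k * ez l"
 by (auto simp: ez_def)

lemma ez_inj: "k : {0, 1} ==> l : {0, 1} ==> ez k = ez l ==> k = l"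
 using one_neq_minus by (auto simp: ez_def)

lemma ez_sq: "ez k * ez k = 1" by (simp add: ez_def)

text \<open>The diagonal formula for alpha = 1 with trivial translations.\<close>

lemma ker_ze:
 assumes S: "ps : SS" and p: "perm ps = idB" and i: "i : K" and t: "t : \<T>"
 shows "ze ps (i, t, i) = 1"
proof -
 note d = SS_D[OF S]
 have F: "perm ps = Fm (%i. i) (\<lambda>t\<in>\<T>. t) (%i. \<one>)" unfolding p Fm_id ..
 have "zeta (Fm (%i. i) (\<lambda>t\<in>\<T>. t) (%i. \<one>)) (wt ps) (i, t, i) = \<beta> (tw (\<lambda>t\<in>\<T>. t) \<otimes> cc (%i. i) (\<lambda>t\<in>\<T>. t) (%i. \<one>) i) ((\<lambda>t\<in>\<T>. t) t)"
  by (rule zeta_diag_formula[OF d(1) d(3)[unfolded F] _ one_Aut_T(2) _ i t]) auto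
 then show ?thesis using i t by (simp add: ze_def F tw_id cc_def sq)
qed

lemma ker_ze_all:
 assumes S: "ps : SS" and p: "perm ps = idB" and ij: "i : K" "t : \<T>" "j : K"
 shows "ze ps (i, t, j) = ze ps (i, \<one>, j)"
 using zeta_mult[OF SS_D[OF S] ij(1,2) ij(1) one_closed ij(3)] ker_ze[OF S p ij(1,2)] ij by (simp add: ze_def)

text \<open>With trivial permutation ze(x) ze(bphi x) = 1, and invariance turns this into ze(x)^2 =
  1. The sign at i is \<open>ze\<close> at (i, \<one>, k). It depends on the class of i because (i*,
  \<one>, i) is fixed by \<open>bphi\<close> and has \<open>ze\<close> equal to 1.\<close>

lemma sign_coset_ex:
 assumes A: "ps : Aut_star n G \<Gamma> \<phi>" and p: "perm ps = idB"
 shows "\<exists>z. z : sign_coset ps"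
proof -
 have S: "ps : SS" and zz: "!!x. x : B ==> ze ps (bphi x) = ze ps x" using A unfolding Aut_star_iff by auto
 note d = SS_D[OF S]
 have ze: "ze ps x = wt ps (bphi x) / wt ps x" if x: "x : B" for x
  unfolding ze_def zeta_def using x eta_nz[OF x] by (simp add: p one_BG)
 have pm: "ze ps x = 1 | ze ps x = -1" if x: "x : B" for x
 proof -
  have "ze ps x * ze ps (bphi x) = 1"
   using ze[OF x] ze[OF bphi_B[OF x]] bphi_bphi[OF x] monomialD(2)[OF d(3) x] monomialD(2)[OF d(3) bphi_B[OF x]] by simp
  then have "ze ps x * ze ps x = 1" using zz[OF x] by simp
  then show ?thesis by (simp add: square_eq_1_iff)
 qed
 have mul: "ze ps (i, \<one>, k) = ze ps (i, \<one>, j) * ze ps (j, \<one>, k)" if "i : K" "j : K" "k : K" for i j k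
  using zeta_mult[OF d that(1) one_closed that(2) one_closed that(3)] by (simp add: ze_def)
 have st: "ze ps (star i, \<one>, i) = 1" if i: "i : K" for i
 proof -
  have x: "(star i, \<one>, i) : B" using i by simp
  have "bphi (star i, \<one>, i) = (star i, \<one>, i)" using i by (simp add: bphi_def sq)
  then show ?thesis using ze[OF x] monomialD(2)[OF d(3) x] by simp
 qed
 obtain k where k: "k : K" using K_nonempty by blast
 define rep where "rep m = (SOME i. i : K & cl i = m)" for m
 have rep: "rep m : K" "cl (rep m) = m" if "m : {1..q + s}" for m
 proof -
  have "\<exists>i. i : K & cl i = m" using cl_surj[OF that] by blast
  from someI_ex[OF this] show "rep m : K" "cl (rep m) = m" unfolding rep_def by blast+
 qed
 define z where "z = (\<lambda>m\<in>{1..q + s}. if ze ps (rep m, \<one>, k) = 1 then 0 else (1::int))"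
 have zK: "ez (z (cl i)) = ze ps (i, \<one>, k)" if i: "i : K" for i
 proof -
  have m: "cl i : {1..q + s}" using cl_range[OF i] .
  have r: "rep (cl i) : K" using rep(1)[OF m] .
  have "rep (cl i) = i | rep (cl i) = star i" using cl_eq[OF i r] rep(2)[OF m] by simp
  then have "ze ps (rep (cl i), \<one>, k) = ze ps (i, \<one>, k)"
   using mul[OF star_K[OF i] i k] st[OF i] by auto
  moreover have "ze ps (i, \<one>, k) = 1 | ze ps (i, \<one>, k) = -1" using pm i k by simp
  ultimately show ?thesis using m by (auto simp: z_def ez_def)
 qed
 have "ze ps (i, \<one>, j) = ez (z (cl i)) * ez (z (cl j))" if ij: "i : K" "j : K" for i j
 proof -
  have "ze ps (k, \<one>, j) * ze ps (j, \<one>, k) = 1" unfolding ze_def by (rule zeta_inv[OF d k ij(2)])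
  then have "ze ps (k, \<one>, j) = ze ps (j, \<one>, k)" using pm[of "(j, \<one>, k)"] ij k minus_equation_iff[of "ze ps (k, \<one>, j)" 1] by auto
  then show ?thesis unfolding zK[OF ij(1)] zK[OF ij(2)] using mul[OF ij(1) k ij(2)] by simp
 qed
 moreover have "z : {1..q + s} \<rightarrow>\<^sub>E {0, 1}" by (auto simp: z_def)
 ultimately show ?thesis unfolding sign_coset_def by blast
qed

abbreviation "Z2 \<equiv> integer_mod_group 2"

lemma comm_Z2: "comm_group Z2" by simp

lemma sign_coset_coset:
 assumes z: "z : sign_coset ps"
 shows "sign_coset ps = diag_coset (q + s) Z2 z"
proof -
 have zE: "z : {1..q + s} \<rightarrow>\<^sub>E {0, 1}" and zz: "!!i j. i : K ==> j : K ==> ze ps (i, \<one>, j) = ez (z (cl i)) * ez (z (cl j))"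
  using z unfolding sign_coset_def by blast+
 have zm: "z m : {0, 1}" if "m : {1..q + s}" for m using PiE_mem[OF zE that] .
 show ?thesis
 proof (intro equalityI subsetI)
  fix v assume v: "v : sign_coset ps"
  then have vE: "v : {1..q + s} \<rightarrow>\<^sub>E {0, 1}" and vv: "!!i j. i : K ==> j : K ==> ze ps (i, \<one>, j) = ez (v (cl i)) * ez (v (cl j))"
   unfolding sign_coset_def by blast+
  have vm: "v m : {0, 1}" if "m : {1..q + s}" for m using PiE_mem[OF vE that] .
  obtain k where k: "k : K" using K_nonempty by blast
  define c where "c = (z (cl k) + v (cl k)) mod 2"
  have c: "c : {0, 1}" unfolding c_def by auto
  have "v m = (c + z m) mod 2" if m: "m : {1..q + s}" for m
  proof (rule ez_inj[OF vm[OF m]])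
   show "(c + z m) mod 2 : {0, 1}" by auto
   obtain i where i: "i : K" "cl i = m" using cl_surj[OF m] by blast
   have "ez (v (cl i)) * ez (v (cl k)) = ez (z (cl i)) * ez (z (cl k))" using zz[OF i(1) k] vv[OF i(1) k] by simp
   then have "ez (v m) * (ez (v (cl k)) * ez (v (cl k))) = ez (z m) * ez (z (cl k)) * ez (v (cl k))" using i by (simp add: mult_ac)
   then have "ez (v m) = ez (z m) * (ez (z (cl k)) * ez (v (cl k)))" by (simp add: ez_sq mult_ac)
   also have "... = ez ((c + z m) mod 2)"
    using ez_add[OF c zm[OF m]] ez_add[OF zm[OF cl_range[OF k]] vm[OF cl_range[OF k]]] by (simp add: c_def mult_ac)
   finally show "ez (v m) = ez ((c + z m) mod 2)" .
  qed
  note vm' = this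
  have "v m = (\<lambda>m\<in>{1..q + s}. (c + z m) mod 2) m" for m
  proof (cases "m : {1..q + s}")
   case True then show ?thesis by (simp only: restrict_apply if_True vm'[OF True])
  next
   case False then show ?thesis by (simp only: restrict_apply if_False PiE_arb[OF vE False])
  qed
  then have v: "v = (\<lambda>m\<in>{1..q + s}. (c + z m) mod 2)" by blast
  show "v : diag_coset (q + s) Z2 z"
   unfolding diag_coset_def
  proof (rule image_eqI[where x = c])
   show "v = (\<lambda>i\<in>{1..q + s}. c \<otimes>\<^bsub>Z2\<^esub> z i)" unfolding v by simp
   show "c : carrier Z2" unfolding Z2_carrier by (rule c)
  qed
 next
  fix v assume "v : diag_coset (q + s) Z2 z"
  then obtain c where c: "c : carrier Z2" "v = (\<lambda>m\<in>{1..q + s}. c \<otimes>\<^bsub>Z2\<^esub> z m)"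
   using diag_coset_memD[OF comm_Z2] by metis
  have c: "c : {0, 1}" "v = (\<lambda>m\<in>{1..q + s}. (c + z m) mod 2)" using c unfolding Z2_carrier by simp_all
  have vm: "ez (v m) = ez c * ez (z m)" if "m : {1..q + s}" for m
   using ez_add[OF c(1) zm[OF that]] that c(2) by simp
  have "ze ps (i, \<one>, j) = ez (v (cl i)) * ez (v (cl j))" if ij: "i : K" "j : K" for i j
  proof -
   have "ez (v (cl i)) * ez (v (cl j)) = (ez c * ez c) * (ez (z (cl i)) * ez (z (cl j)))"
    unfolding vm[OF cl_range[OF ij(1)]] vm[OF cl_range[OF ij(2)]] by (simp add: mult_ac)
   then show ?thesis using zz[OF ij] by (simp add: ez_sq)
  qed
  moreover have "v : {1..q + s} \<rightarrow>\<^sub>E {0, 1}" unfolding c(2) by auto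
  ultimately show "v : sign_coset ps" unfolding sign_coset_def by blast
 qed
qed

text \<open>A torus element whose lam_i are square roots of the signs: the members of a pair get the
  same root, so lam_i lam_{i*} is the sign.\<close>

lemma sign_coset_realized:
 assumes z: "z : {1..q + s} \<rightarrow>\<^sub>E {0, 1}"
 obtains ps where "ps : Aut_star n G \<Gamma> \<phi>" "perm ps = idB" "z : sign_coset ps"
proof -
 obtain g :: "'f => 'f" where g: "!!y. g y ^ 2 = y" using roots[of 2] by auto
 define lam where "lam i = g (ez (z (cl i)))" for i
 have lam2: "lam i * lam (star i) = ez (z (cl i))" if "i : K" for i
  using g[of "ez (z (cl i))"] that by (simp add: lam_def power2_eq_square)
 have e0: "ez c ~= 0" for c using ez_sq[of c] by auto
 have lam0: "lam i ~= 0" if "i : K" for i using g[of "ez (z (cl i))"] e0 by (auto simp: lam_def)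
 have ei: "1 / ez c = ez c" for c by (simp add: ez_def)
 obtain de where D: "de : SS" "perm de = idB"
  "!!i t j. i : K ==> t : \<T> ==> j : K ==> ze de (i, t, j) = lam j * lam (star j) / (lam i * lam (star i))"
  by (rule torus[of lam]) (use lam0 in blast)+
 have ze: "ze de (i, t, j) = ez (z (cl i)) * ez (z (cl j))" if ij: "i : K" "t : \<T>" "j : K" for i t j
  using D(3)[OF ij] lam2[OF ij(1)] lam2[OF ij(3)] ei[of "z (cl i)"] by (simp add: divide_inverse mult.commute)
 have "ze de (bphi x) = ze de x" if x: "x : B" for x
 proof -
  obtain i t j where ij: "x = (i, t, j)" "i : K" "t : \<T>" "j : K" using x by (cases x) auto
  then show ?thesis by (simp add: bphi_def ze mult.commute)
 qed
 then have "de : Aut_star n G \<Gamma> \<phi>" unfolding Aut_star_iff using D(1) by blast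
 moreover have "z : sign_coset de" unfolding sign_coset_def using z ze by simp
 ultimately show ?thesis using that D(2) by blast
qed

end

text \<open>Both maps into \<open>H\<close> have the same image, so \<open>p\<close> factors through
  the embedding \<open>f\<close>. This turns \<open>perm\<close> into a map onto a semidirect
  product.\<close>

lemma epi_through_embedding:
 assumes f: "f : hom S H" and inj: "inj_on f (carrier S)" and p: "p : hom E H" and im: "p ` carrier E = f ` carrier S"
  and mult: "!!x y. x : carrier S ==> y : carrier S ==> x \<otimes>\<^bsub>S\<^esub> y : carrier S"
  and Em: "!!x y. x : carrier E ==> y : carrier E ==> x \<otimes>\<^bsub>E\<^esub> y : carrier E"
 shows "inv_into (carrier S) f \<circ> p : epi E S"
  and "x : carrier E ==> f ((inv_into (carrier S) f \<circ> p) x) = p x"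
  and "x : carrier E ==> (inv_into (carrier S) f \<circ> p) x : carrier S"
proof -
 let ?h = "inv_into (carrier S) f \<circ> p"
 have h: "f (?h x) = p x" "?h x : carrier S" if "x : carrier E" for x
 proof -
  have "p x : f ` carrier S" using im that by blast
  then show "f (?h x) = p x" "?h x : carrier S" using f_inv_into_f inv_into_into by simp_all
 qed
 show "x : carrier E ==> f (?h x) = p x" "x : carrier E ==> ?h x : carrier S" by (rule h, assumption)+
 have "?h (x \<otimes>\<^bsub>E\<^esub> y) = ?h x \<otimes>\<^bsub>S\<^esub> ?h y" if xy: "x : carrier E" "y : carrier E" for x y
 proof (rule inj_onD[OF inj])
  show "f (?h (x \<otimes>\<^bsub>E\<^esub> y)) = f (?h x \<otimes>\<^bsub>S\<^esub> ?h y)"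
   unfolding h(1)[OF Em[OF xy]] hom_mult[OF f h(2)[OF xy(1)] h(2)[OF xy(2)]] h(1)[OF xy(1)] h(1)[OF xy(2)]
   by (rule hom_mult[OF p xy])
 qed (use h(2) mult Em xy in blast)+
 then have "?h : hom E S" using h(2) by (intro homI) auto
 moreover have "?h ` carrier E = carrier S"
 proof (intro equalityI subsetI)
  fix y assume y: "y : carrier S"
  then obtain x where x: "x : carrier E" "p x = f y" using im by (metis imageE imageI)
  then have "?h x = y" using inv_into_f_f[OF inj y] by simp
  then show "y : ?h ` carrier E" using x(1) by blast
 qed (use h(2) in blast)
 ultimately show "?h : epi E S" by (simp add: epi_def)
qed

section \<open>Subgroups of automorphisms and conjugation\<close>

context graded_matrix_algebra begin

lemma perm_Bij: "ps : SS ==> perm ps : carrier (BijGroup B)"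
 using subgroup.mem_carrier[OF subgroup_WW SS_D(2)] .

lemma SS_carrier: "ps : SS ==> ps : carrier AG"
 using subgroup.mem_carrier[OF subgroup_SS] .

text \<open>For the conjugate c one has c f = f d, and the crossed product rule for
  \<open>ze\<close> is applied to both sides. As d fixes labels, the scalar of f cancels.\<close>

lemma perm_conj:
 assumes e: "f : SS" and d: "d : SS" and p: "perm d = idB"
 shows "f \<odot> d \<odot> inv\<^bsub>AG\<^esub> f : SS" "perm (f \<odot> d \<odot> inv\<^bsub>AG\<^esub> f) = idB"
  "x : B ==> ze (f \<odot> d \<odot> inv\<^bsub>AG\<^esub> f) (perm f x) = ze d x"
proof -
 interpret AG: group AG by (rule group_BijGroup)
 interpret BG: group "BijGroup B" by (rule group_BijGroup)
 let ?c = "f \<odot> d \<odot> inv\<^bsub>AG\<^esub> f"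
 show c: "?c : SS" by (intro subgroup.m_closed[OF subgroup_SS] SS_inv e d)
 have ce: "?c \<odot> f = f \<odot> d" using SS_carrier[OF e] SS_carrier[OF d] by (simp add: AG.m_assoc)
 have "perm ?c \<otimes>\<^bsub>BijGroup B\<^esub> perm f = perm f" using ce SS_mult(2)[OF c e] SS_mult(2)[OF e d] p perm_Bij[OF e] by simp
 then show "perm ?c = idB" using BG.r_cancel_one perm_Bij[OF e] perm_Bij[OF c] by blast
 assume x: "x : B"
 have "ze f x * ze ?c (perm f x) = ze (f \<odot> d) x" by (simp only: SS_mult(4)[OF c e x, symmetric] ce)
 also have "... = ze d x * ze f x" unfolding SS_mult(4)[OF e d x] p one_BG using x by simp
 finally have "ze f x * ze ?c (perm f x) = ze d x * ze f x" .
 moreover have "ze f x ~= 0" using ze_inv[OF e x] by auto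
 ultimately show "ze ?c (perm f x) = ze d x" by (metis mult.commute mult_cancel_left)
qed

lemma SS_surj:
 assumes "ps : SS" "y : B" obtains x where "x : B" "perm ps x = y"
 using perm_surj[OF assms] by blast

lemma SS_perm_B: "ps : SS ==> x : B ==> perm ps x : B"
 using WW_B[OF SS_D(2)] .

lemma subgroup_Aut_star: "subgroup (Aut_star n G \<Gamma> \<phi>) AG"
proof (rule group.subgroupI[OF group_BijGroup])
 show "Aut_star n G \<Gamma> \<phi> <= carrier AG" using SS_carrier by (auto simp: Aut_star_iff)
 show "Aut_star n G \<Gamma> \<phi> ~= {}" using SS_one(1,4) bphi_B unfolding ex_in_conv[symmetric] Aut_star_iff by metis
next
 fix ps assume "ps : Aut_star n G \<Gamma> \<phi>"
 then have S: "ps : SS" and z: "!!x. x : B ==> ze ps (bphi x) = ze ps x" by (auto simp: Aut_star_iff)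
 have "ze (inv\<^bsub>AG\<^esub> ps) (bphi y) = ze (inv\<^bsub>AG\<^esub> ps) y" if y: "y : B" for y
 proof (rule SS_surj[OF S y])
  fix x assume x: "x : B" "perm ps x = y"
  have "ze (inv\<^bsub>AG\<^esub> ps) (bphi y) * ze ps x = 1"
   using ze_inv[OF S bphi_B[OF x(1)]] z[OF x(1)] WW_com[OF SS_D(2)[OF S] x(1)] x(2) by simp
  then have "ze (inv\<^bsub>AG\<^esub> ps) (bphi y) * ze ps x = ze (inv\<^bsub>AG\<^esub> ps) y * ze ps x" using ze_inv[OF S x(1)] x(2) by simp
  moreover have "ze ps x ~= 0" using ze_inv[OF S x(1)] by auto
  ultimately show ?thesis by simp
 qed
 then show "inv\<^bsub>AG\<^esub> ps : Aut_star n G \<Gamma> \<phi>" unfolding Aut_star_iff using SS_inv[OF S] by blast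
next
 fix ps ka assume "ps : Aut_star n G \<Gamma> \<phi>" "ka : Aut_star n G \<Gamma> \<phi>"
 then have S: "ps : SS" "ka : SS" and z: "!!x. x : B ==> ze ps (bphi x) = ze ps x" "!!x. x : B ==> ze ka (bphi x) = ze ka x"
  by (auto simp: Aut_star_iff)
 have "ze (ps \<odot> ka) (bphi x) = ze (ps \<odot> ka) x" if x: "x : B" for x
  unfolding SS_mult(4)[OF S x] SS_mult(4)[OF S bphi_B[OF x]] WW_com[OF SS_D(2)[OF S(2)] x]
  using z(2)[OF x] z(1)[OF SS_perm_B[OF S(2) x]] by simp
 then show "ps \<odot> ka : Aut_star n G \<Gamma> \<phi>" unfolding Aut_star_iff using SS_mult(1)[OF S] by blast
qed

lemma subgroup_Aut_phi: "subgroup (Aut_phi n G \<Gamma> \<phi>) AG"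
proof (rule group.subgroupI[OF group_BijGroup])
 show "Aut_phi n G \<Gamma> \<phi> <= carrier AG" using SS_carrier by (auto simp: Aut_phi_iff)
 show "Aut_phi n G \<Gamma> \<phi> ~= {}" using SS_one(1,4) unfolding ex_in_conv[symmetric] Aut_phi_iff by metis
next
 fix ps assume "ps : Aut_phi n G \<Gamma> \<phi>"
 then have S: "ps : SS" and z: "!!x. x : B ==> ze ps x = 1" by (auto simp: Aut_phi_iff)
 have "ze (inv\<^bsub>AG\<^esub> ps) y = 1" if y: "y : B" for y
  by (rule SS_surj[OF S y]) (use ze_inv[OF S] z in fastforce)
 then show "inv\<^bsub>AG\<^esub> ps : Aut_phi n G \<Gamma> \<phi>" unfolding Aut_phi_iff using SS_inv[OF S] by blast
next
 fix ps ka assume "ps : Aut_phi n G \<Gamma> \<phi>" "ka : Aut_phi n G \<Gamma> \<phi>"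
 then have S: "ps : SS" "ka : SS" and z: "!!x. x : B ==> ze ps x = 1" "!!x. x : B ==> ze ka x = 1"
  by (auto simp: Aut_phi_iff)
 have "ze (ps \<odot> ka) x = 1" if x: "x : B" for x
  unfolding SS_mult(4)[OF S x] using z(2)[OF x] z(1)[OF SS_perm_B[OF S(2) x]] by simp
 then show "ps \<odot> ka : Aut_phi n G \<Gamma> \<phi>" unfolding Aut_phi_iff using SS_mult(1)[OF S] by blast
qed

lemma Diag_Aut_phi: "Diag_gr n G \<Gamma> = {ps : Aut_phi n G \<Gamma> \<phi>. perm ps = idB}"
 by (auto simp: Diag_iff Aut_phi_iff)

lemma Aut_phi_subset: "Aut_phi n G \<Gamma> \<phi> <= Aut_star n G \<Gamma> \<phi>"
 using bphi_B by (auto simp: Aut_phi_iff Aut_star_iff)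

lemma perm_hom: "H <= SS ==> perm : hom (AG\<lparr>carrier := H\<rparr>) (BijGroup B)"
 by (rule homI) (simp_all add: SS_mult(2) perm_Bij subsetD)

text \<open>As the kernel of \<open>perm\<close> on the smaller automorphism group it is a subgroup;
  normality in the larger group is \<open>perm_conj\<close>.\<close>

lemma Diag_normal: "Diag_gr n G \<Gamma> \<lhd> AG\<lparr>carrier := Aut_star n G \<Gamma> \<phi>\<rparr>" (is "?D \<lhd> ?E")
proof -
 interpret AG: group AG by (rule group_BijGroup)
 interpret E: group ?E by (rule AG.subgroup_imp_group[OF subgroup_Aut_star])
 interpret P: group_hom "AG\<lparr>carrier := Aut_phi n G \<Gamma> \<phi>\<rparr>" "BijGroup B" perm
  by (intro group_hom.intro group_hom_axioms.intro group_BijGroup AG.subgroup_imp_group[OF subgroup_Aut_phi] perm_hom)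
   (auto simp: Aut_phi_iff)
 have "kernel (AG\<lparr>carrier := Aut_phi n G \<Gamma> \<phi>\<rparr>) (BijGroup B) perm = ?D" unfolding Diag_Aut_phi by (simp add: kernel_def)
 then have "subgroup ?D (AG\<lparr>carrier := Aut_phi n G \<Gamma> \<phi>\<rparr>)" using P.subgroup_kernel by simp
 then have "subgroup ?D AG" by (rule AG.incl_subgroup[OF subgroup_Aut_phi])
 then have "subgroup ?D ?E" by (rule AG.subgroup_incl[OF _ subgroup_Aut_star]) (use Diag_Aut_phi Aut_phi_subset in blast)
 moreover have "e \<otimes>\<^bsub>?E\<^esub> d \<otimes>\<^bsub>?E\<^esub> inv\<^bsub>?E\<^esub> e : ?D" if e: "e : carrier ?E" and d: "d : ?D" for e d
 proof -
  have eA: "e : Aut_star n G \<Gamma> \<phi>" using e by simp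
  then have S: "e : SS" by (simp add: Aut_star_iff)
  have D: "d : SS" "perm d = idB" "!!x. x : B ==> ze d x = 1" using d unfolding Diag_iff by auto
  note c = perm_conj[OF S D(1,2)]
  have "ze (e \<odot> d \<odot> inv\<^bsub>AG\<^esub> e) y = 1" if y: "y : B" for y
   by (rule SS_surj[OF S y]) (use c(3) D(3) in fastforce)
  then show ?thesis using c(1,2) AG.m_inv_consistent[OF subgroup_Aut_star eA] by (simp add: Diag_iff)
 qed
 ultimately show ?thesis unfolding E.normal_inv_iff by blast
qed

section \<open>The groups of automorphisms modulo the diagonal group\<close>

lemma kernel_sign:
 assumes S: "ps : SS" and p: "perm ps = idB" and z: "z : {1..q + s} \<rightarrow>\<^sub>E {0, 1}"
  and zz: "!!i j. i : K ==> j : K ==> ze ps (i, \<one>, j) = ez (z (cl i)) * ez (z (cl j))"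
 shows "sign_coset ps = diag_coset (q + s) Z2 z"
 by (rule sign_coset_coset) (use z zz in \<open>simp add: sign_coset_def\<close>)

lemma sign_coset_one_iff:
 assumes A: "ps : Aut_star n G \<Gamma> \<phi>" and p: "perm ps = idB"
 shows "sign_coset ps = \<one>\<^bsub>tuples_mod_diag (q + s) Z2\<^esub> \<longleftrightarrow> ps : Diag_gr n G \<Gamma>"
proof
 have S: "ps : SS" using A by (simp add: Aut_star_iff)
 have o: "\<one>\<^bsub>tuples_mod_diag (q + s) Z2\<^esub> = diag_coset (q + s) Z2 (\<lambda>i\<in>{1..q + s}. 0)"
  using one_tuples_mod_diag[OF comm_Z2] by simp
 have e: "(\<lambda>i\<in>{1..q + s}. 0) : {1..q + s} \<rightarrow>\<^sub>E {0, 1::int}" by auto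
 have e0: "ez 0 = 1" by (simp add: ez_def)
 {
  assume "sign_coset ps = \<one>\<^bsub>tuples_mod_diag (q + s) Z2\<^esub>"
  then have "(\<lambda>i\<in>{1..q + s}. 0) : sign_coset ps"
   unfolding o using diag_coset_self[OF comm_Z2, unfolded Z2_carrier, OF e] by simp
  then have "ze ps (i, \<one>, j) = 1" if "i : K" "j : K" for i j
   using that cl_range e0 unfolding sign_coset_def by simp
  note z1 = this
  have "ze ps x = 1" if "x : B" for x
  proof -
   obtain i t j where x: "x = (i, t, j)" by (cases x)
   then have ij: "i : K" "t : \<T>" "j : K" using that by auto
   show ?thesis unfolding x ker_ze_all[OF S p ij] by (rule z1[OF ij(1,3)])
  qed
  then show "ps : Diag_gr n G \<Gamma>" unfolding Diag_iff using S p by blast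
 next
  assume "ps : Diag_gr n G \<Gamma>"
  then have "ze ps x = 1" if "x : B" for x using that unfolding Diag_iff by blast
  then have "ze ps (i, \<one>, j) = ez ((\<lambda>i\<in>{1..q + s}. 0) (cl i)) * ez ((\<lambda>i\<in>{1..q + s}. 0) (cl j))" if "i : K" "j : K" for i j
   using that cl_range e0 by simp
  then show "sign_coset ps = \<one>\<^bsub>tuples_mod_diag (q + s) Z2\<^esub>" unfolding o by (rule kernel_sign[OF S p e])
 }
qed

lemma sign_coset_mult:
 assumes A: "ps : Aut_star n G \<Gamma> \<phi>" and p: "perm ps = idB"
  and A': "ka : Aut_star n G \<Gamma> \<phi>" and p': "perm ka = idB"
 shows "sign_coset (ps \<odot> ka) = sign_coset ps \<otimes>\<^bsub>tuples_mod_diag (q + s) Z2\<^esub> sign_coset ka"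
proof -
 interpret BG: group "BijGroup B" by (rule group_BijGroup)
 have S: "ps : SS" "ka : SS" using A A' by (simp_all add: Aut_star_iff)
 obtain z v where z: "z : sign_coset ps" and v: "v : sign_coset ka" using sign_coset_ex[OF A p] sign_coset_ex[OF A' p'] by blast
 have E: "z : {1..q + s} \<rightarrow>\<^sub>E {0, 1}" "v : {1..q + s} \<rightarrow>\<^sub>E {0, 1}" using z v by (auto simp: sign_coset_def)
 have zz: "ze ps (i, \<one>, j) = ez (z (cl i)) * ez (z (cl j))" "ze ka (i, \<one>, j) = ez (v (cl i)) * ez (v (cl j))"
  if "i : K" "j : K" for i j using z v that by (auto simp: sign_coset_def)
 let ?w = "\<lambda>i\<in>{1..q + s}. z i \<otimes>\<^bsub>Z2\<^esub> v i"
 have w: "ez (?w (cl i)) = ez (z (cl i)) * ez (v (cl i))" if "i : K" for i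
  using ez_add[OF PiE_mem[OF E(1) cl_range[OF that]] PiE_mem[OF E(2) cl_range[OF that]]] cl_range[OF that] by simp
 have "sign_coset (ps \<odot> ka) = diag_coset (q + s) Z2 ?w"
 proof (rule kernel_sign)
  show "ps \<odot> ka : SS" by (rule SS_mult(1)[OF S])
  show "perm (ps \<odot> ka) = idB" unfolding SS_mult(2)[OF S] p p' by simp
  show "?w : {1..q + s} \<rightarrow>\<^sub>E {0, 1}" by auto
  fix i j assume ij: "i : K" "j : K"
  then have x: "(i, \<one>, j) : B" by simp
  show "ze (ps \<odot> ka) (i, \<one>, j) = ez (?w (cl i)) * ez (?w (cl j))"
   unfolding SS_mult(4)[OF S x] w[OF ij(1)] w[OF ij(2)] p' one_BG using x zz[OF ij] by (simp add: mult_ac)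
 qed
 also have "... = diag_coset (q + s) Z2 z \<otimes>\<^bsub>tuples_mod_diag (q + s) Z2\<^esub> diag_coset (q + s) Z2 v"
  by (rule mult_diag_coset[OF comm_Z2, symmetric]) (use E in \<open>simp_all add: Z2_carrier\<close>)
 finally show ?thesis unfolding sign_coset_coset[OF z] sign_coset_coset[OF v] .
qed

text \<open>Conjugation moves the scalars from a label to its image. They do not depend on the
  middle entry here, so the index permutation decides, and it carries classes as in
  \<open>Z2_act_wel\<close>.\<close>

lemma sign_coset_conj:
 assumes e: "f : Aut_star n G \<Gamma> \<phi>" and A: "ps : Aut_star n G \<Gamma> \<phi>" and p: "perm ps = idB"
  and y: "y : carrier (Weyl_star_group T \<beta> q s \<tau>)" "theta y = perm f"
 shows "sign_coset (f \<odot> ps \<odot> inv\<^bsub>AG\<^esub> f) = Z2_act T q s \<tau> y (sign_coset ps)"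
proof -
 have S: "f : SS" "ps : SS" using e A by (simp_all add: Aut_star_iff)
 note c = perm_conj[OF S p]
 obtain w x p' si u au where yw: "y = wel w x p' si u au" and ok: "wok w x p' si u au" using y(1) unfolding Weyl_carrier by blast
 obtain z where z: "z : sign_coset ps" using sign_coset_ex[OF A p] by blast
 have zE: "z : {1..q + s} \<rightarrow>\<^sub>E {0, 1}" using z by (simp add: sign_coset_def)
 have zz: "ze ps (i, \<one>, j) = ez (z (cl i)) * ez (z (cl j))" if "i : K" "j : K" for i j using z that by (auto simp: sign_coset_def)
 obtain z' where z': "z' : {1..q + s} \<rightarrow>\<^sub>E {0, 1}" "Z2_act T q s \<tau> y (diag_coset (q + s) Z2 z) = diag_coset (q + s) Z2 z'"
  "!!i. i : K ==> z' (cl (Pw x p' si u au i)) = z (cl i)"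
  unfolding yw using Z2_act_wel[OF ok zE] by metis
 let ?P = "Pw x p' si u au" and ?U = "Uw w x p' si u au"
 have P: "bij_betw ?P K K" by (rule PP_bij[OF wokD(11)[OF ok] wokD(5)[OF ok]])
 have F: "perm f = Fm ?P au ?U" using y(2) unfolding yw theta_wel[OF ok] by simp
 have "sign_coset (f \<odot> ps \<odot> inv\<^bsub>AG\<^esub> f) = diag_coset (q + s) Z2 z'"
 proof (rule kernel_sign[OF c(1,2) z'(1)])
  fix i j assume ij: "i : K" "j : K"
  have PK: "?P ` K = K" by (rule bij_betw_imp_surj_on[OF P])
  have im: "i : ?P ` K" "j : ?P ` K" unfolding PK by (rule ij)+
  obtain k where k: "?P k = i" "k : K" using im(1) by (metis imageE)
  obtain l where l: "?P l = j" "l : K" using im(2) by (metis imageE)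
  note kl = k(2) l(2) k(1) l(1)
  have x: "(k, \<one>, l) : B" using kl by simp
  have "perm f (k, \<one>, l) = (i, ?U k \<otimes> au \<one> \<otimes> ?U l, j)" using kl unfolding F by simp
  moreover have "perm f (k, \<one>, l) : B" by (rule SS_perm_B[OF S(1) x])
  ultimately obtain t where t: "perm f (k, \<one>, l) = (i, t, j)" "t : \<T>" by (metis B_iff)
  have "ze (f \<odot> ps \<odot> inv\<^bsub>AG\<^esub> f) (i, \<one>, j) = ze (f \<odot> ps \<odot> inv\<^bsub>AG\<^esub> f) (perm f (k, \<one>, l))"
   unfolding t(1) ker_ze_all[OF c(1,2) ij(1) t(2) ij(2)] ..
  also have "... = ez (z (cl k)) * ez (z (cl l))" unfolding c(3)[OF x] by (rule zz[OF kl(1,2)])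
  also have "... = ez (z' (cl i)) * ez (z' (cl j))" using z'(3)[OF kl(1)] z'(3)[OF kl(2)] kl(3,4) by simp
  finally show "ze (f \<odot> ps \<odot> inv\<^bsub>AG\<^esub> f) (i, \<one>, j) = ez (z' (cl i)) * ez (z' (cl j))" .
 qed
 then show ?thesis using z'(2) unfolding sign_coset_coset[OF z] by simp
qed

text \<open>The projection is \<open>perm\<close> read through the inverse of \<open>theta\<close>.
  Its kernel consists of the automorphisms fixing all labels, and \<open>sign_coset\<close>
  identifies that kernel modulo the diagonal group with Z_2^(q+s)/Z_2.\<close>

theorem Aut_star_extension: "is_extension_of_by (AG\<lparr>carrier := Aut_star n G \<Gamma> \<phi>\<rparr> Mod Stab_phi n G \<Gamma> \<phi>)
  (Weyl_star_group T \<beta> q s \<tau>) (tuples_mod_diag (q + s) Z2) (Z2_act T q s \<tau>)"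
proof -
 let ?E = "AG\<lparr>carrier := Aut_star n G \<Gamma> \<phi>\<rparr>" and ?W = "Weyl_star_group T \<beta> q s \<tau>"
 let ?h = "inv_into (carrier ?W) theta \<circ> perm" and ?N = "tuples_mod_diag (q + s) Z2"
 interpret AG: group AG by (rule group_BijGroup)
 interpret W: group ?W by (rule group_Weyl_star)
 have im: "perm ` carrier ?E = theta ` carrier ?W"
  unfolding theta_image
 proof (intro equalityI subsetI)
  fix F assume "F : WW"
  then show "F : perm ` carrier ?E" by (rule lift_star) force
 qed (auto simp: Aut_star_iff SS_D(2))
 note h = epi_through_embedding[OF theta_hom theta_inj perm_hom[of "Aut_star n G \<Gamma> \<phi>"] im W.m_closed]
 have sub: "Aut_star n G \<Gamma> \<phi> <= SS" by (auto simp: Aut_star_iff)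
 have Em: "x \<otimes>\<^bsub>?E\<^esub> y : carrier ?E" if "x : carrier ?E" "y : carrier ?E" for x y
  using subgroup.m_closed[OF subgroup_Aut_star] that by simp
 have h1: "?h : epi ?E ?W" by (rule h(1)[OF sub]) (use Em in auto)
 have h2: "theta (?h x) = perm x" if "x : carrier ?E" for x by (rule h(2)[OF sub]) (use Em that in auto)
 have h3: "?h x : carrier ?W" if "x : carrier ?E" for x by (rule h(3)[OF sub]) (use Em that in auto)
 have ker: "kernel ?E ?W ?h = {ps : Aut_star n G \<Gamma> \<phi>. perm ps = idB}"
 proof -
  have "?h ps = \<one>\<^bsub>?W\<^esub> \<longleftrightarrow> perm ps = idB" if "ps : Aut_star n G \<Gamma> \<phi>" for ps
   using inj_on_eq_iff[OF theta_inj h3 W.one_closed, of ps] h2[of ps] theta_one that by simp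
  then show ?thesis unfolding kernel_def by auto
 qed
 show ?thesis
  unfolding Stab_phi_eq
 proof (rule is_extension_of_by_quotient[where h = ?h and sg = sign_coset])
  show "group ?E" by (rule AG.subgroup_imp_group[OF subgroup_Aut_star])
  show "Diag_gr n G \<Gamma> \<lhd> ?E" by (rule Diag_normal)
  show "?h : epi ?E ?W" by (rule h1)
  show "group ?W" by (rule group_Weyl_star)
  show "comm_group ?N" by (rule comm_group_tuples_mod_diag[OF comm_Z2])
  show "Diag_gr n G \<Gamma> <= kernel ?E ?W ?h" unfolding ker Diag_Aut_phi using Aut_phi_subset by blast
  show onto: "sign_coset ` kernel ?E ?W ?h = carrier ?N"
   unfolding ker carrier_tuples_mod_diag[OF comm_Z2] Z2_carrier
  proof (intro equalityI subsetI)
   fix y assume "y : sign_coset ` {ps : Aut_star n G \<Gamma> \<phi>. perm ps = idB}"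
   then obtain ps z where "y = sign_coset ps" and z: "z : sign_coset ps" using sign_coset_ex by blast
   then show "y : diag_coset (q + s) Z2 ` ({1..q + s} \<rightarrow>\<^sub>E {0, 1})"
    using sign_coset_coset[OF z] by (auto simp: sign_coset_def)
  next
   fix y assume "y : diag_coset (q + s) Z2 ` ({1..q + s} \<rightarrow>\<^sub>E {0, 1})"
   then obtain z where y: "y = diag_coset (q + s) Z2 z" and z: "z : {1..q + s} \<rightarrow>\<^sub>E {0, 1}" by blast
   show "y : sign_coset ` {ps : Aut_star n G \<Gamma> \<phi>. perm ps = idB}"
    by (rule sign_coset_realized[OF z]) (use sign_coset_coset y in blast)
  qed
  show "sign_coset : hom (?E\<lparr>carrier := kernel ?E ?W ?h\<rparr>) ?N"
   by (rule homI) (use onto sign_coset_mult in \<open>auto simp: ker\<close>)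
  show "sign_coset x = \<one>\<^bsub>?N\<^esub> \<longleftrightarrow> x : Diag_gr n G \<Gamma>" if "x : kernel ?E ?W ?h" for x
   using that unfolding ker by (intro sign_coset_one_iff) auto
  show "sign_coset (e \<otimes>\<^bsub>?E\<^esub> x \<otimes>\<^bsub>?E\<^esub> inv\<^bsub>?E\<^esub> e) = Z2_act T q s \<tau> (?h e) (sign_coset x)"
   if e: "e : carrier ?E" and x: "x : kernel ?E ?W ?h" for e x
  proof -
   have eA: "e : Aut_star n G \<Gamma> \<phi>" using e by simp
   show ?thesis
    unfolding AG.m_inv_consistent[OF subgroup_Aut_star eA]
    using sign_coset_conj[OF eA _ _ h3[OF e] h2[OF e], of x] x unfolding ker by simp
  qed
 qed
qed

text \<open>Here \<open>ze\<close> is 1 throughout, so an automorphism fixing all labels is already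
  diagonal by \<open>Diag_iff\<close>, and no signs survive.\<close>

theorem Aut_phi_iso:
 assumes inv_phi: "!!X. X : carrier_mat n n ==> \<phi> (\<phi> X) = X"
 shows "AG\<lparr>carrier := Aut_phi n G \<Gamma> \<phi>\<rparr> Mod Stab_phi n G \<Gamma> \<phi> \<cong> Weyl_group T \<beta> r ax bx q s \<tau>"
proof -
 let ?E = "AG\<lparr>carrier := Aut_phi n G \<Gamma> \<phi>\<rparr>" and ?W = "Weyl_group T \<beta> r ax bx q s \<tau>"
 let ?f = "%y. theta (JJ y)" and ?Ws = "Weyl_star_group T \<beta> q s \<tau>"
 let ?h = "inv_into (carrier ?W) ?f \<circ> perm"
 interpret AG: group AG by (rule group_BijGroup)
 interpret E: group ?E by (rule AG.subgroup_imp_group[OF subgroup_Aut_phi])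
 interpret Ws: group ?Ws by (rule group_Weyl_star)
 have sub: "Aut_phi n G \<Gamma> \<phi> <= SS" by (auto simp: Aut_phi_iff)
 interpret P: group_hom ?E "BijGroup B" perm
  by (intro group_hom.intro group_hom_axioms.intro group_BijGroup E.group_axioms perm_hom[OF sub])
 have im: "perm ` carrier ?E = ?f ` carrier ?W"
  unfolding theta_JJ_image
 proof (intro equalityI subsetI)
  fix F assume "F : WW3"
  then show "F : perm ` carrier ?E" by (rule lift_phi[OF inv_phi, rotated]) force+
 qed (auto simp: Aut_phi_iff intro!: ze_one_WW3)
 have Wm: "x \<otimes>\<^bsub>?W\<^esub> y : carrier ?W" if "x : carrier ?W" "y : carrier ?W" for x y
  using Ws.m_closed that unfolding carrier_Weyl_group JJ_mult[OF that] by blast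
 have J1: "JJ \<one>\<^bsub>?W\<^esub> = \<one>\<^bsub>?Ws\<^esub>"
  unfolding JJ_def Weyl_group_def Weyl_star_group_def semidirect_def[of "inner_group _ _ _ _"] Aut_Sigma_def Aut_star_Sigma_def
  by (simp add: one_Aut_T tw_id semidirect_def)
 have "group ?W"
 proof (rule group_embedding[OF group_BijGroup Wm theta_JJ_hom theta_JJ_inj])
  show "subgroup (?f ` carrier ?W) (BijGroup B)" using P.img_is_subgroup unfolding im .
  show "\<one>\<^bsub>?W\<^esub> : carrier ?W" unfolding carrier_Weyl_group J1 by simp
  show "?f \<one>\<^bsub>?W\<^esub> = idB" unfolding J1 by (rule theta_one)
 qed
 then interpret W: group ?W .
 note h = epi_through_embedding[OF theta_JJ_hom theta_JJ_inj P.homh im Wm E.m_closed]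
 have h1: "?h : epi ?E ?W" by (rule h(1))
 have h2: "?f (?h x) = perm x" if "x : carrier ?E" for x by (rule h(2)) (use that in auto)
 have h3: "?h x : carrier ?W" if "x : carrier ?E" for x by (rule h(3)) (use that in auto)
 interpret h: group_hom ?E ?W ?h
  using h1 by (intro group_hom.intro group_hom_axioms.intro E.group_axioms W.group_axioms) (simp add: epi_def)
 have "kernel ?E ?W ?h = Diag_gr n G \<Gamma>"
 proof -
  have "?h ps = \<one>\<^bsub>?W\<^esub> \<longleftrightarrow> perm ps = idB" if "ps : carrier ?E" for ps
   using inj_on_eq_iff[OF theta_JJ_inj h3[OF that] W.one_closed] h2[OF that] theta_one unfolding J1 by simp
  then show ?thesis unfolding kernel_def Diag_Aut_phi by auto
 qed
 then show ?thesis using h.FactGroup_iso h1 unfolding Stab_phi_eq by (simp add: epi_def)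
qed

end

section \<open>Kronecker products\<close>

lemma sum_div_mod:
 fixes f :: "nat => nat => 'a::comm_monoid_add"
 shows "(\<Sum>x<m * n. f (x div n) (x mod n)) = (\<Sum>i<m. \<Sum>j<n. f i j)"
proof -
 have "(\<Sum>x<m * n. f (x div n) (x mod n)) = (\<Sum>i<m. \<Sum>x = i * n..<i * n + n. f (x div n) (x mod n))"
  by (rule sum.nat_group[symmetric])
 also have "... = (\<Sum>i<m. \<Sum>j<n. f i j)"
 proof (rule sum.cong[OF refl])
  fix i
  have "(\<Sum>x = i * n..<i * n + n. f (x div n) (x mod n)) = (\<Sum>j = 0..<n. f ((i * n + j) div n) ((i * n + j) mod n))"
   using sum.atLeastLessThan_shift_0[of "%x. f (x div n) (x mod n)" "i * n" "i * n + n"] by (simp add: add.commute)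
  also have "... = (\<Sum>j = 0..<n. f i j)" by (rule sum.cong) auto
  finally show "(\<Sum>x = i * n..<i * n + n. f (x div n) (x mod n)) = (\<Sum>j<n. f i j)" by (simp add: atLeast0LessThan)
 qed
 finally show ?thesis .
qed

lemma div_mod_less: "x < m * n ==> x div n < m & x mod n < (n::nat)"
 by (cases "n = 0") (auto simp: less_mult_imp_div_less)

lemma kronecker_carrier:
 "A : carrier_mat m m' ==> B : carrier_mat n n' ==> kronecker A B : carrier_mat (m * n) (m' * n')"
 by (auto simp: kronecker_def)

lemma kronecker_index:
 assumes "A : carrier_mat m m" "B : carrier_mat n n" "x < m * n" "y < m * n"
 shows "kronecker A B $$ (x, y) = A $$ (x div n, y div n) * B $$ (x mod n, y mod n)"
 using assms by (auto simp: kronecker_def)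

lemma kronecker_mult:
 assumes A: "A : carrier_mat m m" "C : carrier_mat m m" and B: "B : carrier_mat n n" "D : carrier_mat n n"
 shows "kronecker A B * kronecker C D = kronecker (A * C) (B * D)"
proof (rule eq_matI)
 note kc = kronecker_carrier[OF A(1) B(1)] kronecker_carrier[OF A(2) B(2)]
 have AC: "A * C : carrier_mat m m" "B * D : carrier_mat n n" using A B by auto
 fix x y assume "x < dim_row (kronecker (A * C) (B * D))" "y < dim_col (kronecker (A * C) (B * D))"
 then have xy: "x < m * n" "y < m * n" using kronecker_carrier[OF AC] by auto
 note dm = div_mod_less[OF xy(1)] div_mod_less[OF xy(2)]
 have "(kronecker A B * kronecker C D) $$ (x, y) = (\<Sum>z<m * n. kronecker A B $$ (x, z) * kronecker C D $$ (z, y))"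
  using xy kc by (simp add: scalar_prod_def atLeast0LessThan)
 also have "... = (\<Sum>z<m * n. (A $$ (x div n, z div n) * C $$ (z div n, y div n)) * (B $$ (x mod n, z mod n) * D $$ (z mod n, y mod n)))"
  using xy by (intro sum.cong refl) (simp add: kronecker_index[OF A(1) B(1)] kronecker_index[OF A(2) B(2)] mult_ac)
 also have "... = (\<Sum>i<m. \<Sum>j<n. (A $$ (x div n, i) * C $$ (i, y div n)) * (B $$ (x mod n, j) * D $$ (j, y mod n)))"
  by (rule sum_div_mod)
 also have "... = (\<Sum>i<m. A $$ (x div n, i) * C $$ (i, y div n)) * (\<Sum>j<n. B $$ (x mod n, j) * D $$ (j, y mod n))"
  by (simp add: sum_product)
 also have "... = (A * C) $$ (x div n, y div n) * (B * D) $$ (x mod n, y mod n)"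
  using dm A B by (simp add: scalar_prod_def atLeast0LessThan)
 also have "... = kronecker (A * C) (B * D) $$ (x, y)" by (rule kronecker_index[OF AC xy, symmetric])
 finally show "(kronecker A B * kronecker C D) $$ (x, y) = kronecker (A * C) (B * D) $$ (x, y)" .
qed (use A B in \<open>auto simp: kronecker_def\<close>)

lemma kronecker_transpose:
 assumes "A : carrier_mat m m" "B : carrier_mat n n"
 shows "transpose_mat (kronecker A B) = kronecker (transpose_mat A) (transpose_mat B)"
proof (rule eq_matI)
 fix x y assume "x < dim_row (kronecker (transpose_mat A) (transpose_mat B))" "y < dim_col (kronecker (transpose_mat A) (transpose_mat B))"
 then have xy: "x < m * n" "y < m * n" using assms by (auto simp: kronecker_def)
 note dm = div_mod_less[OF xy(1)] div_mod_less[OF xy(2)]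
 show "transpose_mat (kronecker A B) $$ (x, y) = kronecker (transpose_mat A) (transpose_mat B) $$ (x, y)"
  using xy dm assms kronecker_carrier[OF assms] by (simp add: kronecker_index[OF assms] kronecker_index[of "transpose_mat A" m "transpose_mat B" n])
qed (use assms in \<open>auto simp: kronecker_def\<close>)

lemma kronecker_smult:
 assumes "A : carrier_mat m m" "B : carrier_mat n n"
 shows "kronecker (c \<star> A) (d \<star> B) = (c * d) \<star> kronecker A B"
proof (rule eq_matI)
 fix x y assume "x < dim_row ((c * d) \<star> kronecker A B)" "y < dim_col ((c * d) \<star> kronecker A B)"
 then have xy: "x < m * n" "y < m * n" using assms by (auto simp: kronecker_def)
 note dm = div_mod_less[OF xy(1)] div_mod_less[OF xy(2)]
 show "kronecker (c \<star> A) (d \<star> B) $$ (x, y) = ((c * d) \<star> kronecker A B) $$ (x, y)"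
  using xy dm assms kronecker_carrier[OF assms] by (simp add: kronecker_index[OF assms] kronecker_index[of "c \<star> A" m "d \<star> B" n])
qed (use assms in \<open>auto simp: kronecker_def\<close>)

lemma kronecker_zero: "B : carrier_mat n n ==> kronecker (0\<^sub>m m m) B = 0\<^sub>m (m * n) (m * n)"
 by (rule eq_matI) (auto simp: kronecker_def less_mult_imp_div_less)

lemma kronecker_add_right:
 assumes "A : carrier_mat m m" "B : carrier_mat n n" "C : carrier_mat n n"
 shows "kronecker A (B + C) = kronecker A B + kronecker A C"
proof (rule eq_matI)
 fix x y assume "x < dim_row (kronecker A B + kronecker A C)" "y < dim_col (kronecker A B + kronecker A C)"
 then have xy: "x < m * n" "y < m * n" using assms by (auto simp: kronecker_def)
 note dm = div_mod_less[OF xy(1)] div_mod_less[OF xy(2)]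
 show "kronecker A (B + C) $$ (x, y) = (kronecker A B + kronecker A C) $$ (x, y)"
  using xy dm assms kronecker_carrier[OF assms(1,2)] kronecker_carrier[OF assms(1,3)]
  by (simp add: kronecker_index[OF assms(1,2)] kronecker_index[OF assms(1,3)] kronecker_index[of A m "B + C" n] distrib_left)
qed (use assms in \<open>auto simp: kronecker_def\<close>)

lemma kronecker_add_left:
 assumes "A : carrier_mat m m" "B : carrier_mat m m" "C : carrier_mat n n"
 shows "kronecker (A + B) C = kronecker A C + kronecker B C"
proof (rule eq_matI)
 fix x y assume "x < dim_row (kronecker A C + kronecker B C)" "y < dim_col (kronecker A C + kronecker B C)"
 then have xy: "x < m * n" "y < m * n" using assms by (auto simp: kronecker_def)
 note dm = div_mod_less[OF xy(1)] div_mod_less[OF xy(2)]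
 show "kronecker (A + B) C $$ (x, y) = (kronecker A C + kronecker B C) $$ (x, y)"
  using xy dm assms kronecker_carrier[OF assms(1,3)] kronecker_carrier[OF assms(2,3)]
  by (simp add: kronecker_index[OF assms(1,3)] kronecker_index[OF assms(2,3)] kronecker_index[of "A + B" m C n] distrib_right)
qed (use assms in \<open>auto simp: kronecker_def\<close>)

text \<open>Reduces orthogonality of a tensor basis to orthogonality in the factors.\<close>

lemma mat_ip_kronecker:
 assumes "A : carrier_mat m m" "B : carrier_mat n n" "C : carrier_mat m m" "D : carrier_mat n n"
 shows "mat_ip (m * n) (kronecker A B) (kronecker C D) = mat_ip m A C * mat_ip n B D"
proof -
 let ?f = "%i i' j j'. (A $$ (i, j) * C $$ (i, j)) * (B $$ (i', j') * D $$ (i', j'))"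
 have "mat_ip (m * n) (kronecker A B) (kronecker C D)
   = (\<Sum>x<m * n. \<Sum>y<m * n. ?f (x div n) (x mod n) (y div n) (y mod n))"
  unfolding mat_ip_def
  by (intro sum.cong refl) (simp add: kronecker_index[OF assms(1,2)] kronecker_index[OF assms(3,4)] mult_ac)
 also have "... = (\<Sum>x<m * n. \<Sum>j<m. \<Sum>j'<n. ?f (x div n) (x mod n) j j')"
  by (rule sum.cong[OF refl], rule sum_div_mod)
 also have "... = (\<Sum>i<m. \<Sum>i'<n. \<Sum>j<m. \<Sum>j'<n. ?f i i' j j')" by (rule sum_div_mod)
 also have "... = mat_ip m A C * mat_ip n B D"
  unfolding mat_ip_def sum_product by (intro sum.cong refl)
 finally show ?thesis .
qed

lemma one_smult_mat: "(1 :: 'f::field) \<star> A = A" by (rule eq_matI) auto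

text \<open>Spanning as an induction principle, which suits Kronecker products: one factor at a time
  can be generalised.\<close>

definition mat_spans :: "nat => 'f::field mat set => bool"
 where "mat_spans n S \<longleftrightarrow> S <= carrier_mat n n & (\<forall>V. mat_subspace n V --> S <= V --> carrier_mat n n <= V)"

lemma mat_spansD: "mat_spans n S ==> mat_subspace n V ==> S <= V ==> carrier_mat n n <= V"
 by (simp add: mat_spans_def)

lemma mat_spans_units:
 assumes V: "mat_subspace n V" and u: "!!i j. i < n ==> j < n ==> mat n n (%(x, y). if x = i & y = j then 1 else 0) : V"
  and X: "X : carrier_mat n n"
 shows "X : V"
proof -
 have "mat n n (%p. if p : A then X $$ p else 0) : V" if "finite A" "A <= {..<n} \<times> {..<n}" for A
  using that
 proof (induction A rule: finite_induct)
  case empty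
  have "mat n n (%p. if p : {} then X $$ p else 0) = 0\<^sub>m n n" by (rule eq_matI) auto
  then show ?case using mat_subspaceD(2)[OF V] by simp
 next
  case (insert p A)
  obtain i j where p: "p = (i, j)" "i < n" "j < n" using insert.prems by auto
  have "mat n n (%q. if q : insert p A then X $$ q else 0)
    = X $$ p \<star> mat n n (%(x, y). if x = i & y = j then 1 else 0) + mat n n (%q. if q : A then X $$ q else 0)"
   using insert.hyps(2) by (intro eq_matI) (auto simp: p(1))
  then show ?case using insert u[OF p(2,3)] mat_subspaceD(3,4)[OF V] by simp
 qed
 from this[of "{..<n} \<times> {..<n}"] have "mat n n (%p. if p : {..<n} \<times> {..<n} then X $$ p else 0) : V" by simp
 moreover have "mat n n (%p. if p : {..<n} \<times> {..<n} then X $$ p else 0) = X" using X by (intro eq_matI) auto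
 ultimately show ?thesis by simp
qed

text \<open>For fixed A in S the B with \<open>kronecker A B\<close> in V form a subspace, hence are
  all matrices; then the same is done for A. The matrix units of the large algebra are Kronecker
  products of matrix units.\<close>

lemma mat_spans_kronecker:
 fixes S :: "'f::field mat set"
 assumes S: "mat_spans m S" and S': "mat_spans n S'"
 shows "mat_spans (m * n) {kronecker A B | A B. A : S & B : S'}"
 unfolding mat_spans_def
proof (intro conjI allI impI subsetI)
 fix Z assume "Z : {kronecker A B | A B. A : S & B : S'}"
 then obtain A B where Z: "Z = kronecker A B" "A : S" "B : S'" by blast
 then have "A : carrier_mat m m" "B : carrier_mat n n" using S S' by (auto simp: mat_spans_def)
 then show "Z : carrier_mat (m * n) (m * n)" unfolding Z(1) by (rule kronecker_carrier)
next
 fix V :: "'f mat set" and X :: "'f mat" assume V: "mat_subspace (m * n) V" and sub: "{kronecker A B | A B. A : S & B : S'} <= V" and X: "X : carrier_mat (m * n) (m * n)"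
 have zr: "kronecker A (0\<^sub>m n n) = 0\<^sub>m (m * n) (m * n)" if "A : carrier_mat m m" for A :: "'f mat"
 proof (rule eq_matI)
  fix x y assume "x < dim_row (0\<^sub>m (m * n) (m * n))" "y < dim_col (0\<^sub>m (m * n) (m * n))"
  then have xy: "x < m * n" "y < m * n" by simp_all
  then show "kronecker A (0\<^sub>m n n) $$ (x, y) = 0\<^sub>m (m * n) (m * n) $$ (x, y)"
   using div_mod_less[OF xy(1)] div_mod_less[OF xy(2)] by (simp add: kronecker_index[OF that zero_carrier_mat xy])
 qed (use that in \<open>auto simp: kronecker_def\<close>)
 have 1: "kronecker A B : V" if A: "A : S" and B: "B : carrier_mat n n" for A B
 proof -
  have Am: "A : carrier_mat m m" using S A by (auto simp: mat_spans_def)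
  have one: "kronecker A (c \<star> B) = c \<star> kronecker A B" if "B : carrier_mat n n" for B c
   using kronecker_smult[OF Am that, of 1 c] by (simp add: one_smult_mat)
  have "mat_subspace n {B : carrier_mat n n. kronecker A B : V}"
   using mat_subspaceD(2,3,4)[OF V] zr[OF Am] kronecker_add_right[OF Am] one by (intro mat_subspaceI) auto
  then have "carrier_mat n n <= {B : carrier_mat n n. kronecker A B : V}"
   using S' sub A unfolding mat_spans_def by blast
  then show ?thesis using B by blast
 qed
 have 2: "kronecker A B : V" if A: "A : carrier_mat m m" and B: "B : carrier_mat n n" for A B
 proof -
  have one: "kronecker (c \<star> A) B = c \<star> kronecker A B" if "A : carrier_mat m m" for A c
   using kronecker_smult[OF that B, of c 1] by (simp add: one_smult_mat)
  have "mat_subspace m {A : carrier_mat m m. kronecker A B : V}"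
   using mat_subspaceD(2,3,4)[OF V] kronecker_zero[OF B] kronecker_add_left[OF _ _ B] one by (intro mat_subspaceI) auto
  then have "carrier_mat m m <= {A : carrier_mat m m. kronecker A B : V}"
   using S 1[OF _ B] unfolding mat_spans_def by blast
  then show ?thesis using A by blast
 qed
 show "X : V"
 proof (rule mat_spans_units[OF V _ X])
  fix i j assume ij: "i < m * n" "j < m * n"
  let ?u = "%k i j. mat k k (%(x, y). if x = i & y = j then 1 else 0) :: 'f mat"
  have "?u (m * n) i j = kronecker (?u m (i div n) (j div n)) (?u n (i mod n) (j mod n))"
  proof (rule eq_matI)
   fix x y assume "x < dim_row (kronecker (?u m (i div n) (j div n)) (?u n (i mod n) (j mod n)))"
    "y < dim_col (kronecker (?u m (i div n) (j div n)) (?u n (i mod n) (j mod n)))"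
   then have xy: "x < m * n" "y < m * n" by (auto simp: kronecker_def)
   have eq: "x = i \<longleftrightarrow> x div n = i div n & x mod n = i mod n" "y = j \<longleftrightarrow> y div n = j div n & y mod n = j mod n"
    by (metis div_mult_mod_eq)+
   have "kronecker (?u m (i div n) (j div n)) (?u n (i mod n) (j mod n)) $$ (x, y)
     = ?u m (i div n) (j div n) $$ (x div n, y div n) * ?u n (i mod n) (j mod n) $$ (x mod n, y mod n)"
    by (rule kronecker_index) (use xy in auto)
   also have "... = (if (x div n = i div n & y div n = j div n) & (x mod n = i mod n & y mod n = j mod n) then 1 else 0)"
    using div_mod_less[OF xy(1)] div_mod_less[OF xy(2)] by simp
   also have "... = ?u (m * n) i j $$ (x, y)" using xy eq by (simp add: conj_ac)
   finally show "?u (m * n) i j $$ (x, y) = kronecker (?u m (i div n) (j div n)) (?u n (i mod n) (j mod n)) $$ (x, y)" ..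
  qed (auto simp: kronecker_def)
  then show "?u (m * n) i j : V" by (simp add: 2)
 qed
qed

lemma matrix_unit_carrier [simp]: "matrix_unit k i j : carrier_mat k k" by (simp add: matrix_unit_def)

lemma matrix_unit_mult:
 assumes "j : {1..k}" "l : {1..k}"
 shows "matrix_unit k i j * matrix_unit k l h = (if j = l then matrix_unit k i h else 0\<^sub>m k k :: 'f::field mat)"
proof (rule eq_matI)
 fix x y assume "x < dim_row (if j = l then matrix_unit k i h else 0\<^sub>m k k :: 'f mat)" "y < dim_col (if j = l then matrix_unit k i h else 0\<^sub>m k k :: 'f mat)"
 then have xy: "x < k" "y < k" by (auto simp: matrix_unit_def split: if_splits)
 have "(matrix_unit k i j * matrix_unit k l h :: 'f mat) $$ (x, y)
   = (\<Sum>z<k. (if x + 1 = i & z + 1 = j then 1 else 0) * (if z + 1 = l & y + 1 = h then 1 else 0))"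
  using xy by (simp add: matrix_unit_def scalar_prod_def atLeast0LessThan)
 also have "... = (\<Sum>z<k. if z = j - 1 then (if x + 1 = i & j = l & y + 1 = h then 1 else 0) else 0)"
  using assms by (intro sum.cong refl) auto
 also have "... = (if j = l then matrix_unit k i h else 0\<^sub>m k k :: 'f mat) $$ (x, y)"
  using xy assms by (auto simp: matrix_unit_def)
 finally show "(matrix_unit k i j * matrix_unit k l h :: 'f mat) $$ (x, y) = (if j = l then matrix_unit k i h else 0\<^sub>m k k) $$ (x, y)" .
qed (auto simp: matrix_unit_def)

lemma matrix_unit_transpose: "transpose_mat (matrix_unit k i j) = matrix_unit k j i"
 by (rule eq_matI) (auto simp: matrix_unit_def)

lemma matrix_unit_ip:
 assumes "i : {1..k}" "j : {1..k}" "i' : {1..k}" "j' : {1..k}"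
 shows "mat_ip k (matrix_unit k i j) (matrix_unit k i' j') = (if i = i' & j = j' then 1 else 0 :: 'f::field)"
proof -
 have lt: "i - 1 < k" "j - 1 < k" using assms(1,2) by auto
 have "mat_ip k (matrix_unit k i j) (matrix_unit k i' j')
   = (\<Sum>x<k. \<Sum>y<k. if y = j - 1 then (if x = i - 1 then (if i = i' & j = j' then 1 else 0 :: 'f) else 0) else 0)"
  unfolding mat_ip_def using assms by (intro sum.cong refl) (auto simp: matrix_unit_def)
 also have "... = (\<Sum>x<k. if x = i - 1 then (if i = i' & j = j' then 1 else 0 :: 'f) else 0)"
  using lt by (intro sum.cong refl) (simp add: sum.delta)
 finally show ?thesis using lt by (simp add: sum.delta)
qed

lemma matrix_unit_spans: "mat_spans k {matrix_unit k i j :: 'f::field mat | i j. i : {1..k} & j : {1..k}}"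
 unfolding mat_spans_def
proof (intro conjI allI impI subsetI)
 fix V :: "'f mat set" and X :: "'f mat" assume V: "mat_subspace k V" and sub: "{matrix_unit k i j | i j. i : {1..k} & j : {1..k}} <= V" and X: "X : carrier_mat k k"
 show "X : V"
 proof (rule mat_spans_units[OF V _ X])
  fix i j assume ij: "i < k" "j < k"
  have eq: "mat k k (%(x, y). if x = i & y = j then 1 else 0) = (matrix_unit k (Suc i) (Suc j) :: 'f mat)" by (simp add: matrix_unit_def)
  show "mat k k (%(x, y). if x = i & y = j then 1 else 0) : V" unfolding eq by (rule subsetD[OF sub]) (use ij in fastforce)
 qed
qed auto

section \<open>Tensor products of Pauli matrices\<close>

definition pauli :: "nat => nat => 'f::field mat"
 where "pauli i j = mat_of_rows_list 2 [[-1, 0], [0, 1]] ^\<^sub>m i * mat_of_rows_list 2 [[0, 1], [1, 0]] ^\<^sub>m j"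

lemma pauli_generators_carrier:
 fixes P Q :: "'f::field mat"
 shows "P = mat_of_rows_list 2 [[-1, 0], [0, 1]] ==> P : carrier_mat 2 2"
  "Q = mat_of_rows_list 2 [[0, 1], [1, 0]] ==> Q : carrier_mat 2 2"
 by (rule carrier_matI; simp add: mat_of_rows_list_def)+

lemma pauli_carrier [simp]: "pauli i j : carrier_mat 2 2"
 unfolding pauli_def
 by (rule mult_carrier_mat[of _ 2 2]; rule pow_carrier_mat; rule pauli_generators_carrier[OF refl])

lemma pauli_dim [simp]: "dim_row (pauli i j :: 'f::field mat) = 2" "dim_col (pauli i j :: 'f mat) = 2"
 using carrier_matD[OF pauli_carrier[of i j]] by auto

text \<open>Row x has its nonzero entry in column x + j modulo 2, and a sign can occur in row 0.
  With this the further facts become finite checks.\<close>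

lemma pauli_eq:
 assumes "i : {0, 1}" "j : {0, 1}"
 shows "pauli i j = (mat 2 2 (%(x, y). if (x + j) mod 2 = y then (if i = 1 & x = 0 then -1 else 1) else 0) :: 'f::field mat)"
proof (rule eq_matI)
 let ?P = "mat_of_rows_list 2 [[-1, 0], [0, 1]] :: 'f mat" and ?Q = "mat_of_rows_list 2 [[0, 1], [1, 0]] :: 'f mat"
 note c = pauli_generators_carrier(1)[of ?P, OF refl] pauli_generators_carrier(2)[of ?Q, OF refl]
 have PQ: "?P $$ (0, 0) = -1" "?P $$ (0, 1) = 0" "?P $$ (1, 0) = 0" "?P $$ (1, 1) = 1"
  "?Q $$ (0, 0) = 0" "?Q $$ (0, 1) = 1" "?Q $$ (1, 0) = 1" "?Q $$ (1, 1) = 0"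
  by (simp_all add: mat_of_rows_list_def)
 fix x y assume "x < dim_row (mat 2 2 (%(x, y). if (x + j) mod 2 = y then (if i = 1 & x = 0 then -1 else 1) else 0) :: 'f mat)"
  "y < dim_col (mat 2 2 (%(x, y). if (x + j) mod 2 = y then (if i = 1 & x = 0 then -1 else 1) else 0) :: 'f mat)"
 then have xy: "x : {0, 1}" "y : {0, 1}" by auto
 have p: "pauli i j = (if i = 0 then 1\<^sub>m 2 else ?P) * (if j = 0 then 1\<^sub>m 2 else ?Q)"
  using assms c unfolding pauli_def by auto
 show "pauli i j $$ (x, y) = (mat 2 2 (%(x, y). if (x + j) mod 2 = y then (if i = 1 & x = 0 then -1 else 1) else 0) :: 'f mat) $$ (x, y)"
  using assms xy c PQ unfolding p by (elim insertE emptyE) (simp_all add: scalar_prod_def numeral_2_eq_2)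
qed simp_all

lemma pauli_index:
 assumes "i : {0, 1}" "j : {0, 1}" "x < 2" "y < 2"
 shows "pauli i j $$ (x, y) = (if (x + j) mod 2 = y then (if i = 1 & x = 0 then -1 else 1) else 0 :: 'f::field)"
 unfolding pauli_eq[OF assms(1,2)] using assms(3,4) by simp

lemma pauli_mult_index:
 assumes "i : {0, 1}" "j : {0, 1}" "i' : {0, 1}" "j' : {0, 1}" and xy: "x < 2" "y < 2"
 shows "(pauli i j * pauli i' j') $$ (x, y)
  = (if j = 1 & i' = 1 then -1 else 1 :: 'f::field) * pauli ((i + i') mod 2) ((j + j') mod 2) $$ (x, y)"
proof -
 have m: "(i + i') mod 2 : {0, 1}" "(j + j') mod 2 : {0, 1}" by auto
 define z where "z = (x + j) mod 2"
 have z: "z = 0 | z = 1" "z < 2" unfolding z_def by auto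
 have s: "(if i = 1 & x = 0 then -1 else 1) * (if i' = 1 & z = 0 then -1 else 1 :: 'f)
   = (if j = 1 & i' = 1 then -1 else 1) * (if (i + i') mod 2 = 1 & x = 0 then -1 else 1)"
  using assms(1,2,3) less_2_cases[OF xy(1)] unfolding z_def by (elim insertE emptyE disjE) simp_all
 have zy: "(z + j') mod 2 = (x + (j + j') mod 2) mod 2" unfolding z_def by presburger
 have "(pauli i j * pauli i' j') $$ (x, y) = pauli i j $$ (x, 0) * pauli i' j' $$ (0, y) + pauli i j $$ (x, 1) * (pauli i' j' $$ (1, y) :: 'f)"
  using xy by (simp add: scalar_prod_def numeral_2_eq_2)
 also have "... = (if i = 1 & x = 0 then -1 else 1) * pauli i' j' $$ (z, y)"
  using z(1) pauli_index[OF assms(1,2) xy(1), of 0, where ?'f = 'f] pauli_index[OF assms(1,2) xy(1), of 1, where ?'f = 'f]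
  unfolding z_def[symmetric] by auto
 also have "... = (if j = 1 & i' = 1 then -1 else 1 :: 'f) * pauli ((i + i') mod 2) ((j + j') mod 2) $$ (x, y)"
  unfolding pauli_index[OF assms(3,4) z(2) xy(2)] pauli_index[OF m xy] zy using s by simp
 finally show ?thesis .
qed

text \<open>The sign comes from moving the second generator of the left factor past the first
  generator of the right factor.\<close>

lemma pauli_mult:
 assumes "i : {0, 1}" "j : {0, 1}" "i' : {0, 1}" "j' : {0, 1}"
 shows "pauli i j * pauli i' j' = (if j = 1 & i' = 1 then -1 else 1 :: 'f::field) \<star> pauli ((i + i') mod 2) ((j + j') mod 2)"
proof (rule eq_matI)
 fix x y assume "x < dim_row ((if j = 1 & i' = 1 then -1 else 1 :: 'f) \<star> pauli ((i + i') mod 2) ((j + j') mod 2))"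
  "y < dim_col ((if j = 1 & i' = 1 then -1 else 1 :: 'f) \<star> pauli ((i + i') mod 2) ((j + j') mod 2))"
 then have xy: "x < 2" "y < 2" by simp_all
 show "(pauli i j * pauli i' j') $$ (x, y) = ((if j = 1 & i' = 1 then -1 else 1 :: 'f) \<star> pauli ((i + i') mod 2) ((j + j') mod 2)) $$ (x, y)"
  unfolding pauli_mult_index[OF assms xy] using xy by simp
next
 show "dim_row (pauli i j * pauli i' j') = dim_row ((if j = 1 & i' = 1 then -1 else 1 :: 'f) \<star> pauli ((i + i') mod 2) ((j + j') mod 2))"
  "dim_col (pauli i j * pauli i' j') = dim_col ((if j = 1 & i' = 1 then -1 else 1 :: 'f) \<star> pauli ((i + i') mod 2) ((j + j') mod 2))"
  by simp_all
qed

lemma pauli_transpose: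
 assumes "i : {0, 1}" "j : {0, 1}"
 shows "transpose_mat (pauli i j) = (if i = 1 & j = 1 then -1 else 1 :: 'f::field) \<star> pauli i j"
 unfolding pauli_eq[OF assms]
proof (rule eq_matI)
 let ?A = "mat 2 2 (%(x, y). if (x + j) mod 2 = y then (if i = 1 & x = 0 then -1 else 1) else 0) :: 'f mat"
 fix x y assume "x < dim_row ((if i = 1 & j = 1 then -1 else 1 :: 'f) \<star> ?A)" "y < dim_col ((if i = 1 & j = 1 then -1 else 1 :: 'f) \<star> ?A)"
 then have xy: "x : {0, 1}" "y : {0, 1}" by auto
 show "transpose_mat ?A $$ (x, y) = ((if i = 1 & j = 1 then -1 else 1 :: 'f) \<star> ?A) $$ (x, y)"
  using assms xy by (elim insertE emptyE) simp_all
qed auto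

lemma pauli_ip:
 assumes "i : {0, 1}" "j : {0, 1}" "i' : {0, 1}" "j' : {0, 1}"
 shows "mat_ip 2 (pauli i j) (pauli i' j') = (if i = i' & j = j' then 2 else 0 :: 'f::field)"
proof -
 have l: "(0 :: nat) < 2" "(1 :: nat) < 2" by simp_all
 have "mat_ip 2 (pauli i j) (pauli i' j') = (pauli i j $$ (0, 0) * pauli i' j' $$ (0, 0) + pauli i j $$ (0, 1) * pauli i' j' $$ (0, 1))
   + (pauli i j $$ (1, 0) * pauli i' j' $$ (1, 0) + pauli i j $$ (1, 1) * (pauli i' j' $$ (1, 1) :: 'f))"
  by (simp add: mat_ip_def numeral_2_eq_2)
 also have "... = (if i = i' & j = j' then 2 else 0)"
  unfolding pauli_index[OF assms(1,2) l(1) l(1)] pauli_index[OF assms(1,2) l(1) l(2)] pauli_index[OF assms(1,2) l(2) l(1)] pauli_index[OF assms(1,2) l(2) l(2)]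
   pauli_index[OF assms(3,4) l(1) l(1)] pauli_index[OF assms(3,4) l(1) l(2)] pauli_index[OF assms(3,4) l(2) l(1)] pauli_index[OF assms(3,4) l(2) l(2)]
  using assms by (elim insertE emptyE) simp_all
 finally show ?thesis .
qed

lemma pauli_spans:
 assumes two: "(2 :: 'f::field) ~= 0"
 shows "mat_spans 2 {pauli i j :: 'f mat | i j. i : {0, 1} & j : {0, 1}}"
 unfolding mat_spans_def
proof (intro conjI allI impI subsetI)
 fix V :: "'f mat set" and X :: "'f mat"
 assume V: "mat_subspace 2 V" and sub: "{pauli i j | i j. i : {0, 1} & j : {0, 1}} <= V" and X: "X : carrier_mat 2 2"
 have p: "pauli 0 0 : V" "pauli 1 0 : V" "pauli 0 1 : V" "pauli 1 1 : V" using sub by blast+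
 let ?h = "inverse (2 :: 'f)"
 have hh: "?h + ?h = 1" using two by (metis mult_2 right_inverse)
 \<comment> \<open>Projection onto the four matrices: halves of sums and differences along the two
   diagonals.\<close>
 have "X = ((?h * (X $$ (0, 0) + X $$ (1, 1))) \<star> pauli 0 0 + (?h * (X $$ (1, 1) - X $$ (0, 0))) \<star> pauli 1 0)
   + ((?h * (X $$ (0, 1) + X $$ (1, 0))) \<star> pauli 0 1 + (?h * (X $$ (1, 0) - X $$ (0, 1))) \<star> pauli 1 1)" (is "X = ?Y")
 proof (rule eq_matI)
  have d: "a = h * (a + b) - h * (b - a)" "b = h * (a + b) + h * (b - a)" if "h + h = 1" for a b h :: 'f
  proof -
   have "h * (a + b) - h * (b - a) = (h + h) * a" by (simp add: algebra_simps)
   then show "a = h * (a + b) - h * (b - a)" unfolding that by simp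
   have "h * (a + b) + h * (b - a) = (h + h) * b" by (simp add: algebra_simps)
   then show "b = h * (a + b) + h * (b - a)" unfolding that by simp
  qed
  have e: "(0::nat) : {0, 1}" "(1::nat) : {0, 1}" by auto
  fix x y assume "x < dim_row ?Y" "y < dim_col ?Y"
  then have "x < 2" "y < 2" using pauli_dim[of 1 1, where ?'f = 'f] by auto
  then have xy: "x : {0, 1}" "y : {0, 1}" by auto
  then show "X $$ (x, y) = ?Y $$ (x, y)"
   using pauli_index[OF e(1) e(1), where ?'f = 'f] pauli_index[OF e(1) e(2), where ?'f = 'f] pauli_index[OF e(2) e(1), where ?'f = 'f] pauli_index[OF e(2) e(2), where ?'f = 'f] d[OF hh, where a = "X $$ (0, 0)" and b = "X $$ (1, 1)"] d[OF hh, where a = "X $$ (0, 1)" and b = "X $$ (1, 0)"] by (elim insertE emptyE) simp_all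
 qed (use X pauli_dim[of 1 1, where ?'f = 'f] in auto)
 then show "X : V" using mat_subspaceD(3,4)[OF V] p by metis
qed auto

abbreviation kron_list :: "'f::field mat list => 'f mat"
 where "kron_list Ms \<equiv> foldr kronecker Ms (1\<^sub>m 1)"

lemma kron_list_carrier: "(!!l. M l : carrier_mat 2 2) ==> kron_list (map M ls) : carrier_mat (2 ^ length ls) (2 ^ length ls)"
proof (induction ls)
 case (Cons l ls)
 then show ?case using kronecker_carrier[of "M l" 2 2] by simp
qed simp

lemma kron_list_mult:
 assumes "!!l. M l : carrier_mat 2 2" "!!l. L l : carrier_mat 2 2"
 shows "kron_list (map M ls) * kron_list (map L ls) = kron_list (map (%l. M l * L l) ls)"
proof (induction ls)
 case (Cons l ls)
 show ?case
  using kronecker_mult[OF assms(1)[of l] assms(2)[of l] kron_list_carrier[of M ls] kron_list_carrier[of L ls]] assms Cons by simp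
qed simp

lemma kron_list_transpose:
 assumes "!!l. M l : carrier_mat 2 2"
 shows "transpose_mat (kron_list (map M ls)) = kron_list (map (%l. transpose_mat (M l)) ls)"
proof (induction ls)
 case (Cons l ls)
 then show ?case using kronecker_transpose[OF assms[of l] kron_list_carrier[of M ls, OF assms]] by simp
qed simp

lemma kron_list_smult:
 assumes "!!l. M l : carrier_mat 2 2" "distinct ls"
 shows "kron_list (map (%l. c l \<star> M l) ls) = (\<Prod>l\<in>set ls. c l) \<star> kron_list (map M ls)"
 using assms(2)
proof (induction ls)
 case (Cons l ls)
 then show ?case using kronecker_smult[OF assms(1)[of l] kron_list_carrier[of M ls, OF assms(1)]] by simp
qed (simp add: one_smult_mat)

lemma kron_list_one: "kron_list (map (%l. 1\<^sub>m 2) ls) = (1\<^sub>m (2 ^ length ls) :: 'f::field mat)"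
proof (induction ls)
 case (Cons l ls)
 have "kronecker (1\<^sub>m 2) (1\<^sub>m (2 ^ length ls)) = (1\<^sub>m (2 * 2 ^ length ls) :: 'f mat)"
 proof (rule eq_matI)
  fix x y assume "x < dim_row (1\<^sub>m (2 * 2 ^ length ls) :: 'f mat)" "y < dim_col (1\<^sub>m (2 * 2 ^ length ls) :: 'f mat)"
  then have xy: "x < 2 * 2 ^ length ls" "y < 2 * 2 ^ length ls" by simp_all
  have "x = y \<longleftrightarrow> x div 2 ^ length ls = y div 2 ^ length ls & x mod 2 ^ length ls = y mod 2 ^ length ls"
   by (metis div_mult_mod_eq)
  then show "kronecker (1\<^sub>m 2) (1\<^sub>m (2 ^ length ls)) $$ (x, y) = (1\<^sub>m (2 * 2 ^ length ls) :: 'f mat) $$ (x, y)"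
   using div_mod_less[OF xy(1)] div_mod_less[OF xy(2)] xy by (simp add: kronecker_index[OF one_carrier_mat one_carrier_mat xy])
 qed (auto simp: kronecker_def)
 then show ?case using Cons by simp
qed simp

lemma kron_list_ip:
 assumes "!!l. M l : carrier_mat 2 2" "!!l. L l : carrier_mat 2 2" "distinct ls"
 shows "mat_ip (2 ^ length ls) (kron_list (map M ls)) (kron_list (map L ls)) = (\<Prod>l\<in>set ls. mat_ip 2 (M l) (L l))"
 using assms(3)
proof (induction ls)
 case (Cons l ls)
 then show ?case
  using mat_ip_kronecker[OF assms(1)[of l] kron_list_carrier[of M ls, OF assms(1)] assms(2)[of l] kron_list_carrier[of L ls, OF assms(2)]] by simp
qed (simp add: mat_ip_def)

lemma kron_list_spans:
 assumes two: "(2 :: 'f::field) ~= 0" and d: "distinct ls"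
 shows "mat_spans (2 ^ length ls) {kron_list (map (%l. pauli (i l) (j l)) ls) :: 'f mat | i j. \<forall>l. i l : {0, 1} & j l : {0, 1}}"
 using d
proof (induction ls)
 case Nil
 have "X : V" if V: "mat_subspace 1 V" "1\<^sub>m 1 : V" and X: "X : carrier_mat 1 1" for V and X :: "'f mat"
 proof -
  have "X = X $$ (0, 0) \<star> 1\<^sub>m 1" using X by (intro eq_matI) auto
  then show ?thesis using mat_subspaceD(4)[OF V(1) V(2)] by metis
 qed
 then show ?case by (auto simp: mat_spans_def intro!: exI[of _ "%_. 0"])
next
 case (Cons l ls)
 let ?S = "{kron_list (map (%l. pauli (i l) (j l)) ls) :: 'f mat | i j. \<forall>l. i l : {0, 1} & j l : {0, 1}}"
 have "mat_spans (2 * 2 ^ length ls) {kronecker A B :: 'f mat | A B. A : {pauli i j | i j. i : {0, 1} & j : {0, 1}} & B : ?S}"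
  using Cons by (intro mat_spans_kronecker pauli_spans[OF two]) simp
 moreover have "{kronecker A B :: 'f mat | A B. A : {pauli i j | i j. i : {0, 1} & j : {0, 1}} & B : ?S}
   = {kron_list (map (%l. pauli (i l) (j l)) (l # ls)) | i j. \<forall>l. i l : {0, 1} & j l : {0, 1}}" (is "?L = ?R")
 proof (intro equalityI subsetI)
  fix Z assume "Z : ?L"
  then obtain i0 j0 i j where Z: "Z = kronecker (pauli i0 j0) (kron_list (map (%l. pauli (i l) (j l)) ls))"
   and ij: "i0 : {0, 1}" "j0 : {0, 1}" "!!l. i l : {0, 1}" "!!l. j l : {0, 1}" by blast
  \<comment> \<open>Exponent functions are total, so slot \<open>l\<close> may be overwritten;
    distinctness protects the other slots.\<close>
  have m: "map (%l. pauli (i l) (j l)) ls = map (%k. pauli ((i(l := i0)) k) ((j(l := j0)) k)) ls"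
   using Cons.prems by (intro map_cong) auto
  have "Z = kron_list (map (%k. pauli ((i(l := i0)) k) ((j(l := j0)) k)) (l # ls))" unfolding Z m by simp
  moreover have "\<forall>k. (i(l := i0)) k : {0, 1} & (j(l := j0)) k : {0, 1}" using ij by auto
  ultimately show "Z : ?R" by blast
 next
  fix Z assume "Z : ?R"
  then obtain i j where Z: "Z = kronecker (pauli (i l) (j l)) (kron_list (map (%l. pauli (i l) (j l)) ls))"
   and ij: "!!l. i l : {0, 1}" "!!l. j l : {0, 1}" by auto
  then show "Z : ?L" by blast
 qed
 ultimately show ?case by simp
qed

lemma in_factor_pow:
 fixes M :: "'f::field mat"
 assumes M: "M : carrier_mat 2 2"
 shows "in_factor r M k ^\<^sub>m c = kron_list (map (%l. if l = k then M ^\<^sub>m c else 1\<^sub>m 2) [1..<r+1])"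
proof (induction c)
 case 0
 define ls where "ls = [1..<r+1]"
 have "in_factor r M k : carrier_mat (2 ^ length ls) (2 ^ length ls)"
  unfolding in_factor_def ls_def[symmetric] by (rule kron_list_carrier) (use M in auto)
 then have d: "dim_row (in_factor r M k) = 2 ^ length ls" by simp
 have e: "(%l. if l = k then 1\<^sub>m (dim_row M) else 1\<^sub>m 2) = (%l. 1\<^sub>m 2 :: 'f mat)" using M by auto
 show ?case unfolding ls_def[symmetric] pow_mat.simps e kron_list_one d ..
next
 case (Suc c)
 have "in_factor r M k ^\<^sub>m Suc c = kron_list (map (%l. if l = k then M ^\<^sub>m c else 1\<^sub>m 2) [1..<r+1]) * kron_list (map (%l. if l = k then M else 1\<^sub>m 2) [1..<r+1])"
  unfolding pow_mat.simps Suc unfolding in_factor_def ..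
 also have "... = kron_list (map (%l. (if l = k then M ^\<^sub>m c else 1\<^sub>m 2) * (if l = k then M else 1\<^sub>m 2)) [1..<r+1])"
  by (rule kron_list_mult) (use M in auto)
 also have "(%l. (if l = k then M ^\<^sub>m c else 1\<^sub>m 2) * (if l = k then M else 1\<^sub>m 2)) = (%l. if l = k then M ^\<^sub>m Suc c else 1\<^sub>m 2)"
  by auto
 finally show ?case .
qed

lemma foldr_in_factor:
 assumes M: "!!k. M k : carrier_mat 2 (2 :: nat)" and d: "distinct ks"
 shows "foldr (*) (map (%k. kron_list (map (%l. if l = k then M k else 1\<^sub>m 2) ls)) ks) (1\<^sub>m (2 ^ length ls))
  = kron_list (map (%l. if l : set ks then M l else (1\<^sub>m 2 :: 'f::field mat)) ls)"
 using d
proof (induction ks)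
 case Nil
 show ?case using kron_list_one[of ls, where ?'f = 'f] by simp
next
 case (Cons k ks)
 have "kron_list (map (%l. if l = k then M k else 1\<^sub>m 2) ls) * kron_list (map (%l. if l : set ks then M l else 1\<^sub>m 2) ls)
   = kron_list (map (%l. (if l = k then M k else 1\<^sub>m 2) * (if l : set ks then M l else 1\<^sub>m 2)) ls)"
  by (rule kron_list_mult) (use M in auto)
 moreover have "(%l. (if l = k then M k else 1\<^sub>m 2) * (if l : set ks then M l else 1\<^sub>m 2))
   = (%l. if l : set (k # ks) then M l else (1\<^sub>m 2 :: 'f mat))"
  using Cons.prems M by (auto simp: fun_eq_iff left_mult_one_mat[OF M] right_mult_one_mat[OF M])
 ultimately show ?case using Cons by simp
qed

text \<open>The ordered product defining X_t becomes a single Kronecker product of Pauli matrices,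
  because every factor acts in its own slot. Facts about X_t thereby reduce to single slots.\<close>

lemma X_mat_eq:
 assumes ij: "the_inv_into (exponents r) (basis_product T r a b) t = (i, j)"
 shows "X_mat T r a b t = (kron_list (map (%l. pauli (i l) (j l)) [1..<r+1]) :: 'f::field mat)"
proof -
 let ?P = "mat_of_rows_list 2 [[-1, 0], [0, 1]] :: 'f mat" and ?Q = "mat_of_rows_list 2 [[0, 1], [1, 0]] :: 'f mat"
 note c = pauli_generators_carrier(1)[of ?P, OF refl] pauli_generators_carrier(2)[of ?Q, OF refl]
 have "X_a r k ^\<^sub>m i k * X_b r k ^\<^sub>m j k = kron_list (map (%l. if l = k then pauli (i k) (j k) else (1\<^sub>m 2 :: 'f mat)) [1..<r+1])" for k
 proof -
  have "X_a r k ^\<^sub>m i k * X_b r k ^\<^sub>m j k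
    = kron_list (map (%l. (if l = k then ?P ^\<^sub>m i k else 1\<^sub>m 2) * (if l = k then ?Q ^\<^sub>m j k else 1\<^sub>m 2)) [1..<r+1])"
   unfolding X_a_def X_b_def in_factor_pow[OF c(1)] in_factor_pow[OF c(2)]
   by (rule kron_list_mult) (use c in auto)
  moreover have "(%l. (if l = k then ?P ^\<^sub>m i k else 1\<^sub>m 2) * (if l = k then ?Q ^\<^sub>m j k else 1\<^sub>m 2))
    = (%l. if l = k then pauli (i k) (j k) else (1\<^sub>m 2 :: 'f mat))"
   by (auto simp: fun_eq_iff pauli_def)
  ultimately show ?thesis by simp
 qed
 note f = this
 have len: "(2 :: nat) ^ r = 2 ^ length [1..<r+1]" by (simp only: length_upt add_diff_cancel_right')
 have "X_mat T r a b t = foldr (*) (map (%k. kron_list (map (%l. if l = k then pauli (i k) (j k) else 1\<^sub>m 2) [1..<r+1])) [1..<r+1])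
   (1\<^sub>m (2 ^ length [1..<r+1]) :: 'f mat)"
  unfolding X_mat_def ij Let_def prod.case f len ..
 also have "... = kron_list (map (%l. if l : set [1..<r+1] then pauli (i l) (j l) else 1\<^sub>m 2) [1..<r+1])"
  by (rule foldr_in_factor) auto
 also have "map (%l. if l : set [1..<r+1] then pauli (i l) (j l) else 1\<^sub>m 2) [1..<r+1] = map (%l. pauli (i l) (j l) :: 'f mat) [1..<r+1]"
  by (rule map_cong) auto
 finally show ?thesis .
qed

locale symplectic_group = elementary_2_group T for T :: "'t monoid" (structure) +
 fixes \<beta> :: "'t => 't => 'f::field" and r :: nat and a b :: "nat => 't"
 assumes beta': "nondeg_alternating_bicharacter T \<beta>"
  and two': "(2::'f) ~= 0"
  and basis: "symplectic_basis T \<beta> r a b"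
begin

lemma basis_carrier: "k : {1..r} ==> a k : \<T>" "k : {1..r} ==> b k : \<T>"
 using basis unfolding symplectic_basis_def by blast+

lemma basis_beta: "k : {1..r} ==> l : {1..r} ==> \<beta> (a k) (b l) = (if k = l then -1 else 1)"
 "k : {1..r} ==> l : {1..r} ==> \<beta> (a k) (a l) = 1" "k : {1..r} ==> l : {1..r} ==> \<beta> (b k) (b l) = 1"
 using basis unfolding symplectic_basis_def by blast+

lemma basis_bij: "bij_betw (basis_product T r a b) (exponents r) \<T>"
 using basis unfolding symplectic_basis_def by blast

text \<open>A power of two, hence nonzero in the field; the Fourier and Gauss sums depend on
  this.\<close>

lemma card_carrier: "card \<T> = 2 ^ r * 2 ^ r"
 unfolding bij_betw_same_card[OF basis_bij, symmetric]
 by (simp add: exponents_def card_cartesian_product card_PiE numeral_2_eq_2)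

sublocale bicharacter_group T \<beta>
 by unfold_locales (use beta' two' in \<open>simp_all add: card_carrier\<close>)

definition "ex t = the_inv_into (exponents r) (basis_product T r a b) t"
definition "ei t = fst (ex t)"
definition "ej t = snd (ex t)"
definition "bp i j = basis_product T r a b (i, j)"

lemma bp_eq: "bp i j = (\<Otimes>k\<in>{1..r}. a k [^] i k \<otimes> b k [^] j k)"
 by (simp add: bp_def basis_product_def)

lemma ex_mem: "t : \<T> ==> ex t : exponents r"
 using bij_betw_the_inv_into[OF basis_bij] by (auto simp: ex_def bij_betw_def)

lemma ex_pair: "ex t = (ei t, ej t)" by (simp add: ei_def ej_def)

lemma ei_ej_PiE:
 assumes "t : \<T>"
 shows "ei t : {1..r} \<rightarrow>\<^sub>E {0, 1}" "ej t : {1..r} \<rightarrow>\<^sub>E {0, 1}"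
 using ex_mem[OF assms] by (simp_all add: ex_pair exponents_def)

lemma ei_01: "t : \<T> ==> k : {1..r} ==> ei t k : {0, 1}"
 and ej_01: "t : \<T> ==> k : {1..r} ==> ej t k : {0, 1}"
 using PiE_mem[OF ei_ej_PiE(1)] PiE_mem[OF ei_ej_PiE(2)] by blast+

lemma bp_ex: "t : \<T> ==> bp (ei t) (ej t) = t"
 using f_the_inv_into_f_bij_betw[OF basis_bij, of t] by (simp add: bp_def ex_def[symmetric] ex_pair)

lemma ex_bp: "i : {1..r} \<rightarrow>\<^sub>E {0, 1} ==> j : {1..r} \<rightarrow>\<^sub>E {0, 1} ==> ei (bp i j) = i & ej (bp i j) = j"
 using the_inv_into_f_f[OF bij_betw_imp_inj_on[OF basis_bij], of "(i, j)"]
 by (simp add: ei_def ej_def ex_def bp_def exponents_def)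

lemma pow_add_mod: "x : \<T> ==> m : {0, 1 :: nat} ==> m' : {0, 1} ==> x [^] ((m + m') mod 2) = x [^] m \<otimes> x [^] m'"
 using sq by auto

lemma bp_mult:
 assumes "i : {1..r} \<rightarrow>\<^sub>E {0, 1}" "j : {1..r} \<rightarrow>\<^sub>E {0, 1}" "i' : {1..r} \<rightarrow>\<^sub>E {0, 1}" "j' : {1..r} \<rightarrow>\<^sub>E {0, 1}"
 shows "bp (\<lambda>k\<in>{1..r}. (i k + i' k) mod 2) (\<lambda>k\<in>{1..r}. (j k + j' k) mod 2) = bp i j \<otimes> bp i' j'"
proof -
 have m: "i k : {0, 1}" "j k : {0, 1}" "i' k : {0, 1}" "j' k : {0, 1}" if "k : {1..r}" for k
  using assms that by (blast dest: PiE_mem)+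
 have "bp i j \<otimes> bp i' j' = (\<Otimes>k\<in>{1..r}. (a k [^] i k \<otimes> b k [^] j k) \<otimes> (a k [^] i' k \<otimes> b k [^] j' k))"
  unfolding bp_eq using basis_carrier by (intro finprod_multf[symmetric]) auto
 also have "... = (\<Otimes>k\<in>{1..r}. a k [^] ((i k + i' k) mod 2) \<otimes> b k [^] ((j k + j' k) mod 2))"
 proof (rule finprod_cong'[OF refl])
  fix k assume k: "k : {1..r}"
  note c = basis_carrier[OF k]
  show "(a k [^] i k \<otimes> b k [^] j k) \<otimes> (a k [^] i' k \<otimes> b k [^] j' k) = a k [^] ((i k + i' k) mod 2) \<otimes> b k [^] ((j k + j' k) mod 2)"
   unfolding pow_add_mod[OF c(1) m(1,3)[OF k]] pow_add_mod[OF c(2) m(2,4)[OF k]] using c by (simp add: m_assoc m_lcomm)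
 qed (use basis_carrier in auto)
 also have "... = bp (\<lambda>k\<in>{1..r}. (i k + i' k) mod 2) (\<lambda>k\<in>{1..r}. (j k + j' k) mod 2)"
  unfolding bp_eq using basis_carrier by (intro finprod_cong'[OF refl]) auto
 finally show ?thesis ..
qed

lemma ex_mult:
 assumes "t : \<T>" "u : \<T>"
 shows "ei (t \<otimes> u) = (\<lambda>k\<in>{1..r}. (ei t k + ei u k) mod 2)" "ej (t \<otimes> u) = (\<lambda>k\<in>{1..r}. (ej t k + ej u k) mod 2)"
proof -
 note p = ei_ej_PiE[OF assms(1)] ei_ej_PiE[OF assms(2)]
 have "t \<otimes> u = bp (\<lambda>k\<in>{1..r}. (ei t k + ei u k) mod 2) (\<lambda>k\<in>{1..r}. (ej t k + ej u k) mod 2)"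
  unfolding bp_mult[OF p] bp_ex[OF assms(1)] bp_ex[OF assms(2)] ..
 moreover have "(\<lambda>k\<in>{1..r}. (f k + g k) mod 2) : {1..r} \<rightarrow>\<^sub>E {0, 1}" for f g :: "nat => nat" by auto
 ultimately show "ei (t \<otimes> u) = (\<lambda>k\<in>{1..r}. (ei t k + ei u k) mod 2)" "ej (t \<otimes> u) = (\<lambda>k\<in>{1..r}. (ej t k + ej u k) mod 2)"
  using ex_bp by simp_all
qed

lemma ex_one: "k : {1..r} ==> ei \<one> k = 0" "k : {1..r} ==> ej \<one> k = 0"
 using ex_mult[OF one_closed one_closed] ei_01[OF one_closed, of k] ej_01[OF one_closed, of k]
 by (auto dest!: fun_cong[of _ _ k])

lemma ex_eq: "t : \<T> ==> u : \<T> ==> (!!k. k : {1..r} ==> ei t k = ei u k & ej t k = ej u k) ==> t = u"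
 by (metis PiE_ext bp_ex ei_ej_PiE)

lemma beta_finprod_l: "finite A ==> f : A \<rightarrow> \<T> ==> u : \<T> ==> \<beta> (finprod T f A) u = (\<Prod>k\<in>A. \<beta> (f k) u)"
 by (induction A rule: finite_induct) (auto simp: beta_mult_l Pi_iff)

lemma beta_finprod_r: "finite A ==> f : A \<rightarrow> \<T> ==> u : \<T> ==> \<beta> u (finprod T f A) = (\<Prod>k\<in>A. \<beta> u (f k))"
 by (induction A rule: finite_induct) (auto simp: beta_mult_r Pi_iff)

definition sm :: "bool => 'f" where "sm x = (if x then -1 else 1)"
text \<open>The exponent of -1 pairs the b-exponents of t with the a-exponents of u, as each X_b in
  X_t is moved past the X_a in X_u. Bilinearity gives the cocycle identity, and antisymmetrising
  gives beta.\<close>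

definition "sg t u = (\<Prod>k\<in>{1..r}. sm (ej t k = 1 & ei u k = 1))"
definition "qf t = (\<Prod>k\<in>{1..r}. sm (ei t k = 1 & ej t k = 1))"

lemma sm_sq [simp]: "sm x * sm x = 1" by (simp add: sm_def)

lemma beta_basis:
 assumes kl: "k : {1..r}" "l : {1..r}" and m: "i : {0, 1 :: nat}" "j : {0, 1 :: nat}" "i' : {0, 1 :: nat}" "j' : {0, 1 :: nat}"
 shows "\<beta> (a k [^] i \<otimes> b k [^] j) (a l [^] i' \<otimes> b l [^] j')
  = (if l = k then sm (i = 1 & j' = 1) * sm (j = 1 & i' = 1) else 1)"
proof -
 note c = basis_carrier[OF kl(1)] basis_carrier[OF kl(2)]
 note B = basis_beta[OF kl] basis_beta[OF kl(2,1)] beta_sym[OF c(2,3)]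
 show ?thesis using m c by (elim insertE emptyE) (simp_all add: sm_def beta_mult_l beta_mult_r B)
qed

lemma beta_exponents:
 assumes "t : \<T>" "u : \<T>"
 shows "\<beta> t u = (\<Prod>k\<in>{1..r}. sm (ei t k = 1 & ej u k = 1) * sm (ej t k = 1 & ei u k = 1))"
proof -
 let ?f = "%t k. a k [^] ei t k \<otimes> b k [^] ej t k"
 have f: "?f t : {1..r} \<rightarrow> \<T>" for t using basis_carrier by auto
 have fT: "?f t k : \<T>" if "k : {1..r}" for t k using basis_carrier[OF that] by simp
 have "\<beta> t u = \<beta> (finprod T (?f t) {1..r}) u" using bp_ex[OF assms(1)] by (simp add: bp_eq)
 also have "... = (\<Prod>k\<in>{1..r}. \<beta> (?f t k) u)" by (rule beta_finprod_l[OF _ f assms(2)]) simp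
 also have "... = (\<Prod>k\<in>{1..r}. sm (ei t k = 1 & ej u k = 1) * sm (ej t k = 1 & ei u k = 1))"
 proof (rule prod.cong[OF refl])
  fix k assume k: "k : {1..r}"
  have "\<beta> (?f t k) u = \<beta> (?f t k) (finprod T (?f u) {1..r})" using bp_ex[OF assms(2)] by (simp add: bp_eq)
  also have "... = (\<Prod>l\<in>{1..r}. \<beta> (?f t k) (?f u l))" by (rule beta_finprod_r[OF _ f fT[OF k]]) simp
  also have "... = (\<Prod>l\<in>{1..r}. if l = k then sm (ei t k = 1 & ej u k = 1) * sm (ej t k = 1 & ei u k = 1) else 1)"
  proof (rule prod.cong[OF refl])
   fix l assume l: "l : {1..r}"
   show "\<beta> (?f t k) (?f u l) = (if l = k then sm (ei t k = 1 & ej u k = 1) * sm (ej t k = 1 & ei u k = 1) else 1)"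
    using beta_basis[OF k l ei_01[OF assms(1) k] ej_01[OF assms(1) k] ei_01[OF assms(2) l] ej_01[OF assms(2) l]]
    by (cases "l = k") simp_all
  qed
  also have "... = sm (ei t k = 1 & ej u k = 1) * sm (ej t k = 1 & ei u k = 1)" using k by (subst prod.delta) simp_all
  finally show "\<beta> (?f t k) u = sm (ei t k = 1 & ej u k = 1) * sm (ej t k = 1 & ei u k = 1)" .
 qed
 finally show ?thesis .
qed

lemma sg_pm: "sg t u = 1 | sg t u = -1"
proof -
 have "sg t u * sg t u = 1" unfolding sg_def prod.distrib[symmetric] by simp
 then show ?thesis by (simp add: square_eq_1_iff)
qed

lemma sg_nonzero: "sg t u ~= 0" using sg_pm[of t u] by auto

lemma sg_ones: "t : \<T> ==> sg \<one> t = 1" "t : \<T> ==> sg t \<one> = 1"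
 unfolding sg_def by (rule prod.neutral; simp add: ex_one sm_def)+

lemma sg_cocycle:
 assumes "t : \<T>" "u : \<T>" "v : \<T>"
 shows "sg t u * sg (t \<otimes> u) v = sg t (u \<otimes> v) * sg u v"
 unfolding sg_def prod.distrib[symmetric]
proof (rule prod.cong[OF refl])
 fix k assume k: "k : {1..r}"
 note m = ej_01[OF assms(1) k] ej_01[OF assms(2) k] ei_01[OF assms(2) k] ei_01[OF assms(3) k]
 show "sm (ej t k = 1 & ei u k = 1) * sm (ej (t \<otimes> u) k = 1 & ei v k = 1) = sm (ej t k = 1 & ei (u \<otimes> v) k = 1) * sm (ej u k = 1 & ei v k = 1)"
  unfolding ex_mult(1)[OF assms(2,3)] ex_mult(2)[OF assms(1,2)] using m k by (elim insertE emptyE) (simp_all add: sm_def)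
qed

lemma sg_commute:
 assumes "t : \<T>" "u : \<T>"
 shows "sg t u = \<beta> t u * sg u t"
 unfolding sg_def beta_exponents[OF assms] prod.distrib[symmetric]
proof (rule prod.cong[OF refl])
 fix k assume k: "k : {1..r}"
 note m = ej_01[OF assms(1) k] ej_01[OF assms(2) k] ei_01[OF assms(2) k] ei_01[OF assms(1) k]
 show "sm (ej t k = 1 & ei u k = 1) = sm (ei t k = 1 & ej u k = 1) * sm (ej t k = 1 & ei u k = 1) * sm (ej u k = 1 & ei t k = 1)"
  using m by (elim insertE emptyE) (simp_all add: sm_def)
qed

lemma qf_pm: "qf t = 1 | qf t = -1"
proof -
 have "qf t * qf t = 1" unfolding qf_def prod.distrib[symmetric] by simp
 then show ?thesis by (simp add: square_eq_1_iff)
qed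

lemma qf_mult:
 assumes "t : \<T>" "u : \<T>"
 shows "qf (t \<otimes> u) = qf t * qf u * \<beta> t u"
 unfolding qf_def beta_exponents[OF assms] prod.distrib[symmetric]
proof (rule prod.cong[OF refl])
 fix k assume k: "k : {1..r}"
 note m = ej_01[OF assms(1) k] ej_01[OF assms(2) k] ei_01[OF assms(2) k] ei_01[OF assms(1) k]
 show "sm (ei (t \<otimes> u) k = 1 & ej (t \<otimes> u) k = 1) = sm (ei t k = 1 & ej t k = 1) * sm (ei u k = 1 & ej u k = 1) *
   (sm (ei t k = 1 & ej u k = 1) * sm (ej t k = 1 & ei u k = 1))"
  unfolding ex_mult[OF assms] using m k by (elim insertE emptyE) (simp_all add: sm_def)
qed

abbreviation "d \<equiv> (2 :: nat) ^ r"
abbreviation "X t \<equiv> (X_mat T r a b t :: 'f mat)"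

lemma X_eq: "X t = kron_list (map (%l. pauli (ei t l) (ej t l)) [1..<r+1])"
 by (rule X_mat_eq) (simp add: ex_def[symmetric] ex_pair)

lemma len: "length [1..<r+1] = r" "set [1..<r+1] = {1..r}" by auto

lemma X_carrier: "X t : carrier_mat d d"
 using kron_list_carrier[of "%l. pauli (ei t l) (ej t l)" "[1..<r+1]"] unfolding X_eq len by simp

lemma X_mult:
 assumes "t : \<T>" "u : \<T>"
 shows "X t * X u = sg t u \<star> X (t \<otimes> u)"
proof -
 have "X t * X u = kron_list (map (%l. pauli (ei t l) (ej t l) * pauli (ei u l) (ej u l)) [1..<r+1])"
  unfolding X_eq by (rule kron_list_mult) simp_all
 also have "map (%l. pauli (ei t l) (ej t l) * pauli (ei u l) (ej u l)) [1..<r+1]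
   = map (%l. sm (ej t l = 1 & ei u l = 1) \<star> pauli (ei (t \<otimes> u) l) (ej (t \<otimes> u) l)) [1..<r+1]"
 proof (rule map_cong[OF refl])
  fix l assume "l : set [1..<r+1]"
  then have l: "l : {1..r}" unfolding len .
  show "pauli (ei t l) (ej t l) * pauli (ei u l) (ej u l) = sm (ej t l = 1 & ei u l = 1) \<star> pauli (ei (t \<otimes> u) l) (ej (t \<otimes> u) l)"
   unfolding ex_mult[OF assms] sm_def
   using pauli_mult[OF ei_01[OF assms(1) l] ej_01[OF assms(1) l] ei_01[OF assms(2) l] ej_01[OF assms(2) l]] l by simp
 qed
 also have "kron_list ... = sg t u \<star> X (t \<otimes> u)"
  using kron_list_smult[of "%l. pauli (ei (t \<otimes> u) l) (ej (t \<otimes> u) l)" "[1..<r+1]" "%l. sm (ej t l = 1 & ei u l = 1)"]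
  unfolding X_eq sg_def len by simp
 finally show ?thesis .
qed

lemma X_ip:
 assumes "t : \<T>" "u : \<T>"
 shows "mat_ip d (X t) (X u) = (if t = u then 2 ^ r else 0)"
proof -
 have "mat_ip d (X t) (X u) = (\<Prod>l\<in>{1..r}. mat_ip 2 (pauli (ei t l) (ej t l)) (pauli (ei u l) (ej u l) :: 'f mat))"
  using kron_list_ip[of "%l. pauli (ei t l) (ej t l)" "%l. pauli (ei u l) (ej u l) :: 'f mat" "[1..<r+1]"]
  unfolding X_eq len by simp
 also have "... = (\<Prod>l\<in>{1..r}. if ei t l = ei u l & ej t l = ej u l then 2 else 0)"
  by (rule prod.cong[OF refl], rule pauli_ip) (use ei_01 ej_01 assms in auto)
 also have "... = (if t = u then 2 ^ r else 0)"
 proof (cases "t = u")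
  case False
  then obtain l where "l : {1..r}" "~ (ei t l = ei u l & ej t l = ej u l)" using ex_eq[OF assms] by blast
  then have "(\<Prod>l\<in>{1..r}. if ei t l = ei u l & ej t l = ej u l then 2 else 0) = (0 :: 'f)" by (intro prod_zero) auto
  then show ?thesis using False by simp
 qed simp
 finally show ?thesis .
qed

lemma X_transpose:
 assumes "t : \<T>"
 shows "transpose_mat (X t) = qf t \<star> X t"
proof -
 have "transpose_mat (X t) = kron_list (map (%l. transpose_mat (pauli (ei t l) (ej t l))) [1..<r+1])"
  unfolding X_eq by (rule kron_list_transpose) simp
 also have "map (%l. transpose_mat (pauli (ei t l) (ej t l))) [1..<r+1]
   = map (%l. sm (ei t l = 1 & ej t l = 1) \<star> pauli (ei t l) (ej t l)) [1..<r+1]"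
 proof (rule map_cong[OF refl])
  fix l assume "l : set [1..<r+1]"
  then have l: "l : {1..r}" unfolding len .
  show "transpose_mat (pauli (ei t l) (ej t l)) = sm (ei t l = 1 & ej t l = 1) \<star> pauli (ei t l) (ej t l)"
   unfolding sm_def by (rule pauli_transpose[OF ei_01[OF assms l] ej_01[OF assms l]])
 qed
 also have "kron_list ... = qf t \<star> X t"
  using kron_list_smult[of "%l. pauli (ei t l) (ej t l)" "[1..<r+1]" "%l. sm (ei t l = 1 & ej t l = 1)"]
  unfolding X_eq qf_def len by simp
 finally show ?thesis .
qed

text \<open>The scalar in the definite description is unique because X_t has nonzero inner product
  with itself.\<close>

lemma quad_form_eq:
 assumes t: "t : \<T>"
 shows "quad_form T r a b t = qf t"
 unfolding quad_form_def
proof (rule the_equality)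
 show "transpose_mat (X t) = qf t \<star> X t" by (rule X_transpose[OF t])
next
 fix c assume c: "transpose_mat (X t) = c \<star> X t"
 have "mat_ip d (c \<star> X t) (X t) = mat_ip d (qf t \<star> X t) (X t)" using c X_transpose[OF t] by simp
 then have "c * 2 ^ r = qf t * 2 ^ r" unfolding mat_ip_smult[OF X_carrier] X_ip[OF t t] by simp
 then show "c = qf t" using two' by simp
qed

lemma X_one: "X \<one> = 1\<^sub>m d"
proof -
 have "map (%l. pauli (ei \<one> l) (ej \<one> l)) [1..<r+1] = map (%l. 1\<^sub>m 2 :: 'f mat) [1..<r+1]"
 proof (rule map_cong[OF refl])
  fix l assume "l : set [1..<r+1]"
  then have l: "l : {1..r}" unfolding len .
  show "pauli (ei \<one> l) (ej \<one> l) = (1\<^sub>m 2 :: 'f mat)"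
   unfolding ex_one[OF l] pauli_def using pauli_generators_carrier(1)[of "_ :: 'f mat", OF refl] pauli_generators_carrier(2)[of "_ :: 'f mat", OF refl] by simp
 qed
 then have "X \<one> = kron_list (map (%l. 1\<^sub>m 2) [1..<r+1])" unfolding X_eq by (rule arg_cong)
 then show ?thesis unfolding kron_list_one len .
qed

lemma X_spans: "mat_spans d (X ` \<T>)"
proof -
 have "{kron_list (map (%l. pauli (i l) (j l)) [1..<r+1]) :: 'f mat | i j. \<forall>l. i l : {0, 1} & j l : {0, 1}} <= X ` \<T>"
 proof
  fix Z assume "Z : {kron_list (map (%l. pauli (i l) (j l)) [1..<r+1]) :: 'f mat | i j. \<forall>l. i l : {0, 1} & j l : {0, 1}}"
  then obtain i j where Z: "Z = kron_list (map (%l. pauli (i l) (j l)) [1..<r+1])" and ij: "!!l. i l : {0, 1}" "!!l. j l : {0, 1 :: nat}" by blast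
  let ?t = "bp (restrict i {1..r}) (restrict j {1..r})"
  have e: "ei ?t = restrict i {1..r} & ej ?t = restrict j {1..r}" by (rule ex_bp) (use ij in auto)
  have "?t : \<T>" unfolding bp_eq using basis_carrier by (intro finprod_closed) auto
  moreover have "Z = X ?t" unfolding Z X_eq by (rule arg_cong[of _ _ kron_list], rule map_cong[OF refl]) (use e len in auto)
  ultimately show "Z : X ` \<T>" by blast
 qed
 moreover have "mat_spans d {kron_list (map (%l. pauli (i l) (j l)) [1..<r+1]) :: 'f mat | i j. \<forall>l. i l : {0, 1} & j l : {0, 1}}"
  using kron_list_spans[OF two', of "[1..<r+1]"] unfolding len by simp
 ultimately show ?thesis unfolding mat_spans_def using X_carrier by (meson image_subsetI subset_trans)
qed

sublocale quadratic_group T \<beta> "quad_form T r a b"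
 by unfold_locales (simp_all add: quad_form_eq qf_pm qf_mult)

end

section \<open>The matrix algebra as a twisted group algebra with involution\<close>

lemma sum_mat_mult_left:
 fixes E :: "'i => 'f::field mat"
 assumes E: "!!i. i : A ==> E i : carrier_mat n n" and Y: "Y : carrier_mat n n"
 shows "mat n n (%p. \<Sum>i\<in>A. c i * E i $$ p) * Y = mat n n (%p. \<Sum>i\<in>A. c i * (E i * Y) $$ p)"
proof (rule eq_matI)
 fix x y assume "x < dim_row (mat n n (%p. \<Sum>i\<in>A. c i * (E i * Y) $$ p))" "y < dim_col (mat n n (%p. \<Sum>i\<in>A. c i * (E i * Y) $$ p))"
 then have xy: "x < n" "y < n" by simp_all
 have "(mat n n (%p. \<Sum>i\<in>A. c i * E i $$ p) * Y) $$ (x, y) = (\<Sum>z<n. (\<Sum>i\<in>A. c i * E i $$ (x, z)) * Y $$ (z, y))"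
  using xy Y by (simp add: scalar_prod_def atLeast0LessThan)
 also have "... = (\<Sum>z<n. \<Sum>i\<in>A. c i * (E i $$ (x, z) * Y $$ (z, y)))" by (simp add: sum_distrib_right mult.assoc)
 also have "... = (\<Sum>i\<in>A. \<Sum>z<n. c i * (E i $$ (x, z) * Y $$ (z, y)))" by (rule sum.swap)
 also have "... = (\<Sum>i\<in>A. c i * (E i * Y) $$ (x, y))"
 proof (rule sum.cong[OF refl])
  fix i assume i: "i : A"
  show "(\<Sum>z<n. c i * (E i $$ (x, z) * Y $$ (z, y))) = c i * (E i * Y) $$ (x, y)"
   using xy E[OF i] Y by (simp add: scalar_prod_def atLeast0LessThan sum_distrib_left)
 qed
 finally show "(mat n n (%p. \<Sum>i\<in>A. c i * E i $$ p) * Y) $$ (x, y) = mat n n (%p. \<Sum>i\<in>A. c i * (E i * Y) $$ p) $$ (x, y)"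
  using xy by simp
qed (use Y in auto)

lemma sum_mat_mult_right:
 fixes E :: "'i => 'f::field mat"
 assumes E: "!!i. i : A ==> E i : carrier_mat n n" and Y: "Y : carrier_mat n n"
 shows "Y * mat n n (%p. \<Sum>i\<in>A. c i * E i $$ p) = mat n n (%p. \<Sum>i\<in>A. c i * (Y * E i) $$ p)"
proof (rule eq_matI)
 fix x y assume "x < dim_row (mat n n (%p. \<Sum>i\<in>A. c i * (Y * E i) $$ p))" "y < dim_col (mat n n (%p. \<Sum>i\<in>A. c i * (Y * E i) $$ p))"
 then have xy: "x < n" "y < n" by simp_all
 have "(Y * mat n n (%p. \<Sum>i\<in>A. c i * E i $$ p)) $$ (x, y) = (\<Sum>z<n. Y $$ (x, z) * (\<Sum>i\<in>A. c i * E i $$ (z, y)))"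
  using xy Y by (simp add: scalar_prod_def atLeast0LessThan)
 also have "... = (\<Sum>z<n. \<Sum>i\<in>A. c i * (Y $$ (x, z) * E i $$ (z, y)))" by (simp add: sum_distrib_left mult_ac)
 also have "... = (\<Sum>i\<in>A. \<Sum>z<n. c i * (Y $$ (x, z) * E i $$ (z, y)))" by (rule sum.swap)
 also have "... = (\<Sum>i\<in>A. c i * (Y * E i) $$ (x, y))"
 proof (rule sum.cong[OF refl])
  fix i assume i: "i : A"
  show "(\<Sum>z<n. c i * (Y $$ (x, z) * E i $$ (z, y))) = c i * (Y * E i) $$ (x, y)"
   using xy E[OF i] Y by (simp add: scalar_prod_def atLeast0LessThan sum_distrib_left)
 qed
 finally show "(Y * mat n n (%p. \<Sum>i\<in>A. c i * E i $$ p)) $$ (x, y) = mat n n (%p. \<Sum>i\<in>A. c i * (Y * E i) $$ p) $$ (x, y)"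
  using xy by simp
qed (use Y in auto)

lemma smult_smult_mat: "(c :: 'f::field) \<star> (c' \<star> A) = (c * c') \<star> A" by (rule eq_matI) auto

text \<open>Blocks are numbered from 0, whereas the indices in \<open>K\<close> start at 1; hence
  the shifts by one in \<open>FB\<close>.\<close>

definition block_mat :: "nat => nat => (nat => nat => 'f::field mat) => 'f mat"
 where "block_mat d l f = mat (l * d) (l * d) (%(x, y). f (x div d) (y div d) $$ (x mod d, y mod d))"

lemma block_mat_append:
 assumes d: "d > 0" and fg: "!!x y. x < l ==> y < l ==> h x y = f x y"
  "!!x y. x < l' ==> y < l' ==> h (l + x) (l + y) = g x y"
  "!!x y. x < l ==> y < l' ==> h x (l + y) = 0\<^sub>m d d & h (l + y) x = 0\<^sub>m d d"
 shows "four_block_mat (block_mat d l f) (0\<^sub>m (l * d) (l' * d)) (0\<^sub>m (l' * d) (l * d)) (block_mat d l' g) = block_mat d (l + l') h"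
  (is "?A = ?B")
proof (rule eq_matI)
 fix x y assume "x < dim_row ?B" "y < dim_col ?B"
 then have xy: "x < (l + l') * d" "y < (l + l') * d" by (simp_all add: block_mat_def)
 have m: "x mod d < d" "y mod d < d" using d by simp_all
 have lt: "z < l * d \<longleftrightarrow> z div d < l" for z using d by (simp add: div_less_iff_less_mult)
 have big: "z div d = l + (z - l * d) div d" "(z - l * d) mod d = z mod d" "(z - l * d) div d < l'" "z - l * d < l' * d"
  if "~ z < l * d" "z < (l + l') * d" for z
 proof -
  define w where "w = z - l * d"
  have w: "z = l * d + w" using that(1) by (simp add: w_def)
  then have "w < l' * d" using that(2) by (simp add: add_mult_distrib)
  then show "z div d = l + (z - l * d) div d" "(z - l * d) mod d = z mod d" "(z - l * d) div d < l'" "z - l * d < l' * d"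
   using d w by (simp_all add: less_mult_imp_div_less)
 qed
 have A: "?A $$ (x, y) = (if x < l * d then if y < l * d then f (x div d) (y div d) $$ (x mod d, y mod d) else 0
   else if y < l * d then 0 else g ((x - l * d) div d) ((y - l * d) div d) $$ (x mod d, y mod d))"
  using xy big[of x] big[of y] by (simp add: block_mat_def add_mult_distrib)
 have "h (x div d) (y div d) $$ (x mod d, y mod d) = (if x < l * d then if y < l * d then f (x div d) (y div d) $$ (x mod d, y mod d) else 0
   else if y < l * d then 0 else g ((x - l * d) div d) ((y - l * d) div d) $$ (x mod d, y mod d))"
 proof (cases "x < l * d"; cases "y < l * d")
  assume "x < l * d" "y < l * d" then show ?thesis using fg(1)[of "x div d" "y div d"] lt by simp
 next
  assume xy': "x < l * d" "~ y < l * d"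
  show ?thesis using xy' fg(3)[of "x div d" "(y - l * d) div d"] big[OF xy'(2) xy(2)] lt[of x] m by simp
 next
  assume xy': "~ x < l * d" "y < l * d"
  show ?thesis using xy' fg(3)[of "y div d" "(x - l * d) div d"] big[OF xy'(1) xy(1)] lt[of y] m by simp
 next
  assume xy': "~ x < l * d" "~ y < l * d"
  show ?thesis using xy' fg(2)[of "(x - l * d) div d" "(y - l * d) div d"] big[OF xy'(1) xy(1)] big[OF xy'(2) xy(2)] by simp
 qed
 then show "?A $$ (x, y) = ?B $$ (x, y)" unfolding A using xy by (simp add: block_mat_def)
qed (simp_all add: block_mat_def add_mult_distrib)

lemma block_mat_dim [simp]: "dim_row (block_mat d l f) = l * d" "dim_col (block_mat d l f) = l * d"
 by (simp_all add: block_mat_def)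

locale twisted_matrices = weyl_quad T \<beta> q s \<tau> r a b + symplectic_group T \<beta> r a b
 for T :: "'t monoid" (structure) and \<beta> :: "'t => 't => 'f::field" and q s \<tau> r a b +
 fixes \<mu> :: "nat => 'f" and n :: nat
 assumes mu: "j : {1..s} ==> \<mu> j ~= 0" and n_def: "n = (q + 2 * s) * 2 ^ r"
begin

abbreviation "k \<equiv> q + 2 * s"
definition "e = (%(i, t, j). kronecker (matrix_unit k i j) (X t))"
text \<open>The scalar in row block i of Phi; for a pair, \<mu> sits in the lower left
  block.\<close>

definition "mm i = (if sec i then \<mu> (pr i) else 1)"

lemma e_simp: "e (i, t, j) = kronecker (matrix_unit k i j) (X t)" by (simp add: e_def)

lemma e_carr: "e x : carrier_mat n n"
 unfolding n_def using kronecker_carrier[OF matrix_unit_carrier X_carrier] by (cases x) (simp add: e_simp)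

lemma e_mult:
 assumes "i : K" "j : K" "k' : K" "l : K" "t : \<T>" "u : \<T>"
 shows "e (i, t, j) * e (k', u, l) = (if j = k' then sg t u \<star> e (i, t \<otimes> u, l) else 0\<^sub>m n n)"
proof -
 have "e (i, t, j) * e (k', u, l) = kronecker (matrix_unit k i j * matrix_unit k k' l) (X t * X u)"
  unfolding e_simp by (rule kronecker_mult[of _ k _ _ d]) (simp_all add: X_carrier)
 also have "... = (if j = k' then sg t u \<star> e (i, t \<otimes> u, l) else 0\<^sub>m n n)"
  using kronecker_smult[OF matrix_unit_carrier X_carrier, of 1 k i l "sg t u" "t \<otimes> u"] kronecker_zero[of "X t * X u" d k]
   X_carrier[of "t \<otimes> u"] assms(2,3)
  unfolding K_def by (simp add: matrix_unit_mult X_mult[OF assms(5,6)] one_smult_mat e_simp n_def)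
 finally show ?thesis .
qed

lemma e_transpose: "t : \<T> ==> transpose_mat (e (i, t, j)) = qf t \<star> e (j, t, i)"
 unfolding e_simp kronecker_transpose[OF matrix_unit_carrier X_carrier] matrix_unit_transpose X_transpose
 using kronecker_smult[OF matrix_unit_carrier X_carrier, of 1 k j i "qf t" t] by (simp add: one_smult_mat)

sublocale mat_basis n B e "2 ^ r"
proof
 show "finite B" by (rule fin_B)
 show "e x : carrier_mat n n" if "x : B" for x by (rule e_carr)
 show "(2 :: 'f) ^ r ~= 0" using two' by simp
 show "mat_ip n (e x) (e y) = (if x = y then 2 ^ r else 0)" if xy: "x : B" "y : B" for x y
 proof -
  obtain i t j i' t' j' where x: "x = (i, t, j)" and y: "y = (i', t', j')" by (cases x; cases y)
  then have m: "i : K" "t : \<T>" "j : K" "i' : K" "t' : \<T>" "j' : K" using xy by simp_all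
  show ?thesis
   unfolding x y e_simp n_def mat_ip_kronecker[OF matrix_unit_carrier X_carrier matrix_unit_carrier X_carrier]
    matrix_unit_ip[OF m(1,3,4,6)[unfolded K_def]] X_ip[OF m(2,5)] by auto
 qed
 have eB: "e ` B = {kronecker C D | C D. C : {matrix_unit k i j | i j. i : {1..k} & j : {1..k}} & D : X ` \<T>}"
 proof (intro equalityI subsetI)
  fix Z assume "Z : e ` B"
  then obtain i t j where "Z = e (i, t, j)" "i : K" "t : \<T>" "j : K" by (auto simp: B_def)
  then show "Z : {kronecker C D | C D. C : {matrix_unit k i j | i j. i : {1..k} & j : {1..k}} & D : X ` \<T>}"
   unfolding e_simp K_def by blast
 next
  fix Z assume "Z : {kronecker C D | C D. C : {matrix_unit k i j | i j. i : {1..k} & j : {1..k}} & D : X ` \<T>}"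
  then obtain C D where Z: "Z = kronecker C D" "C : {matrix_unit k i j | i j. i : {1..k} & j : {1..k}}" "D : X ` \<T>" by blast
  obtain i j where ij: "C = matrix_unit k i j" "i : K" "j : K" using Z(2) unfolding K_def by blast
  obtain t where t: "D = X t" "t : \<T>" using Z(3) by blast
  have "Z = e (i, t, j)" unfolding Z(1) ij(1) t(1) e_simp ..
  moreover have "(i, t, j) : B" using ij(2,3) t(2) by simp
  ultimately show "Z : e ` B" by (rule image_eqI)
 qed
 have sp: "mat_spans n (e ` B)" unfolding eB n_def by (rule mat_spans_kronecker[OF matrix_unit_spans X_spans])
 have "mat_subspace n (mat_subspace n hull (e ` B))" by (rule mat_subspace_hull) (use e_carr in auto)
 then show "carrier_mat n n <= mat_subspace n hull (e ` B)"
  using mat_spansD[OF sp] hull_subset by metis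
qed

definition "FB x y = (if y + 1 = star (x + 1) then mm (x + 1) \<star> X (tt (x + 1)) else 0\<^sub>m d d)"

lemma diag_low: "q' <= q ==> diag_block_mat (map (%i. X (\<tau> i)) [1..<q'+1]) = block_mat d q' FB"
proof (induction q')
 case 0
 show ?case by (rule eq_matI) (simp_all add: block_mat_def)
next
 case (Suc p)
 have l: "[1..<Suc p + 1] = [1..<p+1] @ [Suc p]" by simp
 have X1: "X (\<tau> (Suc p)) = block_mat d 1 (%x y. X (\<tau> (Suc p)))"
  using X_carrier[of "\<tau> (Suc p)"] by (intro eq_matI) (auto simp: block_mat_def)
 have IH: "diag_block_mat (map (%i. X (\<tau> i)) [1..<p+1]) = block_mat d p FB" using Suc by simp
 have "diag_block_mat (map (%i. X (\<tau> i)) [1..<Suc p + 1])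
   = four_block_mat (block_mat d p FB) (0\<^sub>m (p * d) (1 * d)) (0\<^sub>m (1 * d) (p * d)) (block_mat d 1 (%x y. X (\<tau> (Suc p))))"
  unfolding l map_append list.map diag_block_mat_last IH Let_def X1[symmetric] using X_carrier[of "\<tau> (Suc p)"] by simp
 also have "... = block_mat d (p + 1) FB"
 proof (rule block_mat_append)
  show "FB (p + x) (p + y) = X (\<tau> (Suc p))" if "x < 1" "y < 1" for x y
   using that Suc.prems by (simp add: FB_def mm_def star_def sec_def tt_def one_smult_mat)
  show "FB x (p + y) = 0\<^sub>m d d & FB (p + y) x = 0\<^sub>m d d" if "x < p" "y < 1" for x y
   using that Suc.prems by (simp add: FB_def star_def)
 qed simp_all
 finally show ?case by simp
qed

text \<open>Pairs are appended one at a time. \<open>star\<close> does not lead out of the rows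
  already present, so the new off-diagonal blocks vanish.\<close>

lemma diag_all: "s' <= s ==> diag_block_mat (map (%i. X (\<tau> i)) [1..<q+1] @
   map (%j. four_block_mat (0\<^sub>m d d) (1\<^sub>m d) (\<mu> j \<star> 1\<^sub>m d) (0\<^sub>m d d)) [1..<s'+1]) = block_mat d (q + 2 * s') FB"
proof (induction s')
 case 0
 show ?case using diag_low[OF order_refl] by simp
next
 case (Suc p)
 let ?L = "map (%i. X (\<tau> i)) [1..<q+1]" and ?f = "%j. four_block_mat (0\<^sub>m d d) (1\<^sub>m d) (\<mu> j \<star> 1\<^sub>m d) (0\<^sub>m d d)"
 let ?l = "q + 2 * p"
 define g where "g = (%(x :: nat) (y :: nat). if x = 0 & y = 1 then 1\<^sub>m d else if x = 1 & y = 0 then \<mu> (Suc p) \<star> 1\<^sub>m d else (0\<^sub>m d d :: 'f mat))"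
 have l: "?L @ map ?f [1..<Suc p + 1] = (?L @ map ?f [1..<p+1]) @ [?f (Suc p)]" by simp
 have f: "?f (Suc p) = block_mat d 2 g"
 proof (rule eq_matI)
  fix x y assume "x < dim_row (block_mat d 2 g)" "y < dim_col (block_mat d 2 g)"
  then have xy: "x < 2 * d" "y < 2 * d" by simp_all
  have dd: "z div d = (if z < d then 0 else 1) & z mod d = (if z < d then z else z - d)" if "z < 2 * d" for z
  proof (cases "z < d")
   case False
   define w where "w = z - d"
   have "z = d + w" "w < d" using that False by (simp_all add: w_def)
   then show ?thesis by simp
  qed simp
  show "?f (Suc p) $$ (x, y) = block_mat d 2 g $$ (x, y)"
   using xy dd[OF xy(1)] dd[OF xy(2)] by (auto simp: block_mat_def g_def)
 qed simp_all
 have IH: "diag_block_mat (?L @ map ?f [1..<p+1]) = block_mat d ?l FB" using Suc by simp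
 have "diag_block_mat (?L @ map ?f [1..<Suc p + 1])
   = four_block_mat (block_mat d ?l FB) (0\<^sub>m (?l * d) (2 * d)) (0\<^sub>m (2 * d) (?l * d)) (block_mat d 2 g)"
  unfolding l diag_block_mat_last IH f Let_def by simp
 also have "... = block_mat d (?l + 2) FB"
 proof (rule block_mat_append)
  have st: "star (?l + 1) = ?l + 2" "star (?l + 2) = ?l + 1" by (simp_all add: star_def)
  have sc: "~ sec (?l + 1)" "sec (?l + 2)" "pr (?l + 2) = Suc p" "tt (?l + 1) = \<one>" "tt (?l + 2) = \<one>"
   by (simp_all add: sec_def pr_def tt_def)
  show "FB (?l + x) (?l + y) = g x y" if "x < 2" "y < 2" for x y
  proof -
   have "(x = 0 | x = 1) & (y = 0 | y = 1)" using that by auto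
   moreover have "Suc (q + 2 * p) = ?l + 1" "Suc (Suc (q + 2 * p)) = ?l + 2" by simp_all
   ultimately show ?thesis using st sc by (auto simp: FB_def g_def mm_def X_one one_smult_mat)
  qed
  have le: "star (x + 1) <= ?l" if "x < ?l" for x
  proof (cases "x + 1 <= q")
   case False
   then obtain w where w: "x + 1 = q + w" by (metis le_add_diff_inverse nat_le_linear)
   then have w2: "w <= 2 * p" "w \<ge> 1" using that False by auto
   then have "odd w ==> w + 1 <= 2 * p" by presburger
   then show ?thesis using w w2 by (auto simp: star_def)
  qed (use that in \<open>simp add: star_def\<close>)
  show "FB x (?l + y) = 0\<^sub>m d d & FB (?l + y) x = 0\<^sub>m d d" if xy: "x < ?l" "y < 2" for x y
  proof -
   have "?l + y + 1 ~= star (x + 1)" using le[OF xy(1)] by simp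
   moreover have "x + 1 ~= star (?l + y + 1)"
   proof -
    have "y = 0 | y = 1" using xy(2) by auto
    then have "star (?l + y + 1) > ?l" using st by auto
    then show ?thesis using xy(1) by simp
   qed
   ultimately show ?thesis by (simp add: FB_def add.assoc)
  qed
 qed simp_all
 finally show ?case by simp
qed

abbreviation "Phi \<equiv> (Phi_mat T r a b q s \<tau> \<mu> :: 'f mat)"

text \<open>The passage from the block matrix to the basis: Phi is monomial in the tensors of
  E_{i,i*} with X_{t_i}.\<close>

lemma Phi_sum: "Phi = mat n n (%p. \<Sum>i\<in>K. mm i * e (i, tt i, star i) $$ p)"
proof -
 have "Phi = block_mat d k FB" unfolding Phi_mat_def by (rule diag_all[OF order_refl])
 also have "... = mat n n (%p. \<Sum>i\<in>K. mm i * e (i, tt i, star i) $$ p)"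
 proof (rule eq_matI)
  fix x y assume "x < dim_row (mat n n (%p. \<Sum>i\<in>K. mm i * e (i, tt i, star i) $$ p))"
   "y < dim_col (mat n n (%p. \<Sum>i\<in>K. mm i * e (i, tt i, star i) $$ p))"
  then have xy: "x < k * d" "y < k * d" by (simp_all add: n_def)
  note dm = div_mod_less[OF xy(1)] div_mod_less[OF xy(2)]
  have iK: "x div d + 1 : K" using dm by (simp add: K_def)
  have "(\<Sum>i\<in>K. mm i * e (i, tt i, star i) $$ (x, y)) = (\<Sum>i\<in>K. if i = x div d + 1 then FB (x div d) (y div d) $$ (x mod d, y mod d) else 0)"
  proof (rule sum.cong[OF refl])
   fix i assume "i : K"
   show "mm i * e (i, tt i, star i) $$ (x, y) = (if i = x div d + 1 then FB (x div d) (y div d) $$ (x mod d, y mod d) else 0)"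
    unfolding e_simp kronecker_index[OF matrix_unit_carrier X_carrier xy] using dm X_carrier[of "tt i"]
    by (auto simp: matrix_unit_def FB_def)
  qed
  also have "... = FB (x div d) (y div d) $$ (x mod d, y mod d)" using iK fin_K by simp
  finally show "block_mat d k FB $$ (x, y) = mat n n (%p. \<Sum>i\<in>K. mm i * e (i, tt i, star i) $$ p) $$ (x, y)"
   using xy by (simp add: block_mat_def n_def)
 qed (simp_all add: n_def)
 finally show ?thesis .
qed

text \<open>Coefficients of the inverse of Phi, using that X_t has inverse X_t / sg(t, t).\<close>

definition "cm i = inverse (mm i * sg (tt i) (tt i))"
definition "Psi = mat n n (%p. \<Sum>i\<in>K. cm i * e (star i, tt i, i) $$ p)"

lemma mm_nz: "i : K ==> mm i ~= 0"
proof -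
 assume i: "i : K"
 show ?thesis
 proof (cases "sec i")
  case True
  define w where "w = i - q"
  have "even w" "0 < w" "w <= 2 * s" using True i by (auto simp: sec_def K_def w_def)
  then have "1 <= (w + 1) div 2 & (w + 1) div 2 <= s" by presburger
  then have "pr i : {1..s}" by (simp add: pr_def w_def)
  then show ?thesis using mu by (simp add: mm_def)
 qed (simp add: mm_def)
qed

lemma sum_single_mat:
 assumes "i : K" "!!j. j : K ==> Z j : carrier_mat n n" "!!j. j : K ==> j ~= i ==> Z j = 0\<^sub>m n n"
 shows "mat n n (%p. \<Sum>j\<in>K. c j * Z j $$ p) = (c i \<star> Z i :: 'f mat)"
proof (rule eq_matI)
 fix x y assume "x < dim_row (c i \<star> Z i)" "y < dim_col (c i \<star> Z i)"
 then have xy: "x < n" "y < n" using assms(2)[OF assms(1)] by auto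
 have "(\<Sum>j\<in>K. c j * Z j $$ (x, y)) = (\<Sum>j\<in>K. if j = i then c i * Z i $$ (x, y) else 0)"
  by (rule sum.cong[OF refl]) (use assms(3) xy in auto)
 also have "... = c i * Z i $$ (x, y)" using assms(1) fin_K by simp
 finally show "mat n n (%p. \<Sum>j\<in>K. c j * Z j $$ p) $$ (x, y) = (c i \<star> Z i) $$ (x, y)"
  using xy assms(2)[OF assms(1)] by simp
qed (use assms(2)[OF assms(1)] in auto)

lemma star_eq: "i : K ==> j : K ==> star i = j \<longleftrightarrow> i = star j" by auto

lemma Phi_carrier: "Phi : carrier_mat n n" unfolding Phi_sum by simp

lemma Psi_carrier: "Psi : carrier_mat n n" unfolding Psi_def by simp

lemma Phi_e:
 assumes "i : K" "t : \<T>" "j : K"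
 shows "Phi * e (star i, t, j) = (mm i * sg (tt i) t) \<star> e (i, tt i \<otimes> t, j)"
proof -
 have p: "e (l, tt l, star l) * e (star i, t, j) = (if l = i then sg (tt i) t \<star> e (i, tt i \<otimes> t, j) else 0\<^sub>m n n)" if l: "l : K" for l
  using e_mult[OF l star_K[OF l] star_K[OF assms(1)] assms(3) tt_T[OF l] assms(2)] star_eq[OF l star_K[OF assms(1)]] assms(1) by auto
 have "Phi * e (star i, t, j) = mat n n (%p. \<Sum>l\<in>K. mm l * (e (l, tt l, star l) * e (star i, t, j)) $$ p)"
  unfolding Phi_sum by (rule sum_mat_mult_left[OF e_carr e_carr])
 also have "... = mm i \<star> (e (i, tt i, star i) * e (star i, t, j))"
  by (rule sum_single_mat[OF assms(1)]) (use e_carr p in auto)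
 also have "... = (mm i * sg (tt i) t) \<star> e (i, tt i \<otimes> t, j)" unfolding p[OF assms(1)] by (simp add: smult_smult_mat)
 finally show ?thesis .
qed

lemma e_Phi:
 assumes "i : K" "t : \<T>" "j : K"
 shows "e (i, t, j) * Phi = (mm j * sg t (tt j)) \<star> e (i, t \<otimes> tt j, star j)"
proof -
 have p: "e (i, t, j) * e (l, tt l, star l) = (if l = j then sg t (tt j) \<star> e (i, t \<otimes> tt j, star j) else 0\<^sub>m n n)" if l: "l : K" for l
  using e_mult[OF assms(1,3) l star_K[OF l] assms(2) tt_T[OF l]] by auto
 have "e (i, t, j) * Phi = mat n n (%p. \<Sum>l\<in>K. mm l * (e (i, t, j) * e (l, tt l, star l)) $$ p)"
  unfolding Phi_sum by (rule sum_mat_mult_right[OF e_carr e_carr])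
 also have "... = mm j \<star> (e (i, t, j) * e (j, tt j, star j))"
  by (rule sum_single_mat[OF assms(3)]) (use e_carr p in auto)
 also have "... = (mm j * sg t (tt j)) \<star> e (i, t \<otimes> tt j, star j)" unfolding p[OF assms(3)] by (simp add: smult_smult_mat)
 finally show ?thesis .
qed

lemma Psi_e:
 assumes "i : K" "t : \<T>" "j : K"
 shows "Psi * e (i, t, j) = (cm i * sg (tt i) t) \<star> e (star i, tt i \<otimes> t, j)"
proof -
 have p: "e (star l, tt l, l) * e (i, t, j) = (if l = i then sg (tt i) t \<star> e (star i, tt i \<otimes> t, j) else 0\<^sub>m n n)" if l: "l : K" for l
  using e_mult[OF star_K[OF l] l assms(1,3) tt_T[OF l] assms(2)] by auto
 have "Psi * e (i, t, j) = mat n n (%p. \<Sum>l\<in>K. cm l * (e (star l, tt l, l) * e (i, t, j)) $$ p)"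
  unfolding Psi_def by (rule sum_mat_mult_left[OF e_carr e_carr])
 also have "... = cm i \<star> (e (star i, tt i, i) * e (i, t, j))"
  by (rule sum_single_mat[OF assms(1)]) (use e_carr p in auto)
 also have "... = (cm i * sg (tt i) t) \<star> e (star i, tt i \<otimes> t, j)" unfolding p[OF assms(1)] by (simp add: smult_smult_mat)
 finally show ?thesis .
qed

lemma sum_diag_units: "mat n n (%p. \<Sum>i\<in>K. 1 * e (i, \<one>, i) $$ p) = 1\<^sub>m n"
proof (rule eq_matI)
 fix x y assume "x < dim_row (1\<^sub>m n :: 'f mat)" "y < dim_col (1\<^sub>m n :: 'f mat)"
 then have xy: "x < k * d" "y < k * d" by (simp_all add: n_def)
 note dm = div_mod_less[OF xy(1)] div_mod_less[OF xy(2)]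
 have iK: "x div d + 1 : K" using dm by (simp add: K_def)
 have eq: "x = y \<longleftrightarrow> x div d = y div d & x mod d = y mod d" by (metis div_mult_mod_eq)
 have "(\<Sum>i\<in>K. 1 * e (i, \<one>, i) $$ (x, y)) = (\<Sum>i\<in>K. if i = x div d + 1 then (if x = y then 1 else 0) else 0)"
 proof (rule sum.cong[OF refl])
  fix i assume "i : K"
  show "1 * e (i, \<one>, i) $$ (x, y) = (if i = x div d + 1 then (if x = y then 1 else 0) else 0)"
   unfolding e_simp kronecker_index[OF matrix_unit_carrier X_carrier xy]
   unfolding X_one eq using dm
   by (auto simp: matrix_unit_def)
 qed
 also have "... = (if x = y then 1 else 0)" using iK fin_K by simp
 finally show "mat n n (%p. \<Sum>i\<in>K. 1 * e (i, \<one>, i) $$ p) $$ (x, y) = (1\<^sub>m n :: 'f mat) $$ (x, y)"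
  using xy by (simp add: n_def)
qed simp_all

lemma Phi_Psi: "Phi * Psi = 1\<^sub>m n"
proof -
 have "Phi * Psi = mat n n (%p. \<Sum>i\<in>K. cm i * (Phi * e (star i, tt i, i)) $$ p)"
  unfolding Psi_def by (rule sum_mat_mult_right[OF e_carr Phi_carrier])
 also have "... = mat n n (%p. \<Sum>i\<in>K. 1 * e (i, \<one>, i) $$ p)"
 proof (rule cong_mat[OF refl refl])
  fix x y assume xy: "x < n" "y < n"
  show "(\<Sum>i\<in>K. cm i * (Phi * e (star i, tt i, i)) $$ (x, y)) = (\<Sum>i\<in>K. 1 * e (i, \<one>, i) $$ (x, y))"
  proof (rule sum.cong[OF refl])
   fix i assume i: "i : K"
   have "mm i * sg (tt i) (tt i) ~= 0" using mm_nz[OF i] sg_pm[of "tt i" "tt i"] by auto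
   then have "cm i * (mm i * sg (tt i) (tt i)) = 1" unfolding cm_def by (rule left_inverse)
   then show "cm i * (Phi * e (star i, tt i, i)) $$ (x, y) = 1 * e (i, \<one>, i) $$ (x, y)"
    unfolding Phi_e[OF i tt_T[OF i] i] sq[OF tt_T[OF i]] using xy e_carr[of "(i, \<one>, i)"] by (simp flip: mult.assoc)
  qed
 qed
 also have "... = 1\<^sub>m n" by (rule sum_diag_units)
 finally show ?thesis .
qed

lemma inv_Phi: "inv\<^bsub>mat_ring n\<^esub> Phi = Psi"
proof -
 interpret R: semiring "ring_mat TYPE('f) n ()" by (rule semiring_mat)
 have "Psi * Phi = 1\<^sub>m n" by (rule mat_mult_left_right_inverse[OF Phi_carrier Psi_carrier Phi_Psi])
 then show ?thesis
  using Phi_Psi Phi_carrier Psi_carrier by (intro R.inv_char) (simp_all add: ring_mat_simps)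
qed

text \<open>The three factors come from the transpose, from right multiplication by Phi and from
  left multiplication by its inverse.\<close>

definition "eta = (%(i, t, j). qf t * (mm i * sg t (tt i)) * (cm j * sg (tt j) (t \<otimes> tt i)))"

lemma phi_map_e:
 assumes x: "x : B"
 shows "phi_map T r a b q s \<tau> \<mu> (e x) = eta x \<star> e (bphi x)"
proof -
 obtain i t j where xt: "x = (i, t, j)" by (cases x)
 then have ij: "i : K" "t : \<T>" "j : K" using x by simp_all
 note T = ij(2) tt_T[OF ij(1)] tt_T[OF ij(3)]
 have c: "e (j, t, i) : carrier_mat n n" "e (j, t \<otimes> tt i, star i) : carrier_mat n n" by (rule e_carr)+
 have ap: "Psi * (c1 \<star> Z) = c1 \<star> (Psi * Z)" "(c1 \<star> Z) * Phi = c1 \<star> (Z * Phi)" if "Z : carrier_mat n n" for c1 and Z :: "'f mat"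
  using mult_smult_distrib[OF Psi_carrier that] mult_smult_assoc_mat[OF that Phi_carrier] by auto
 have "phi_map T r a b q s \<tau> \<mu> (e x) = Psi * transpose_mat (e (i, t, j)) * Phi"
  unfolding phi_map_def Let_def n_def[symmetric] inv_Phi xt using e_carr[of "(i, t, j)"] by simp
 also have "... = Psi * (transpose_mat (e (i, t, j)) * Phi)"
  by (rule assoc_mult_mat[OF Psi_carrier _ Phi_carrier]) (use e_carr[of "(i, t, j)"] in simp)
 also have "... = (qf t * (mm i * sg t (tt i))) \<star> (Psi * e (j, t \<otimes> tt i, star i))"
  unfolding e_transpose[OF ij(2)] ap(2)[OF c(1)] e_Phi[OF ij(3,2,1)] smult_smult_mat ap(1)[OF c(2)] ..
 also have "... = eta x \<star> e (star j, tt j \<otimes> (t \<otimes> tt i), star i)"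
  unfolding Psi_e[OF ij(3) m_closed[OF T(1,2)] star_K[OF ij(1)]] by (simp add: smult_smult_mat eta_def xt)
 also have "tt j \<otimes> (t \<otimes> tt i) = t \<otimes> tt i \<otimes> tt j" using T by (simp add: m_comm)
 finally show ?thesis by (simp add: bphi_def xt)
qed

lemma eta_nonzero: "x : B ==> eta x ~= 0"
proof -
 assume "x : B"
 then obtain i t j where x: "x = (i, t, j)" "i : K" "j : K" by (cases x) auto
 have "sg u v ~= 0" "qf u ~= 0" for u v using sg_pm[of u v] qf_pm[of u] by auto
 then show ?thesis using mm_nz[OF x(2)] mm_nz[OF x(3)] by (simp add: x(1) eta_def cm_def)
qed

text \<open>The cocycle identity for (t, t_i, t_i) and one commutation leave beta(t_i, t) and
  sg(t_i, t_i); the latter cancels the normalisation in \<open>cm\<close>.\<close>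

lemma eta_diagonal:
 assumes i: "i : K" and t: "t : \<T>"
 shows "eta (i, t, i) = quad_form T r a b t * \<beta> (tt i) t"
proof -
 let ?u = "tt i"
 note u = tt_T[OF i]
 have 1: "sg t ?u * sg (t \<otimes> ?u) ?u = sg ?u ?u" using sg_cocycle[OF t u u] sg_ones(2)[OF t] by (simp add: sq[OF u])
 have 2: "sg ?u (t \<otimes> ?u) = \<beta> ?u t * sg (t \<otimes> ?u) ?u"
  using sg_commute[OF u m_closed[OF t u]] beta_mult_r[OF u t u] beta_self[OF u] by simp
 have "sg t ?u * sg ?u (t \<otimes> ?u) = \<beta> ?u t * sg ?u ?u" unfolding 2 1[symmetric] by simp
 then have "eta (i, t, i) = qf t * \<beta> ?u t * (mm i * sg ?u ?u * cm i)" by (simp add: eta_def mult_ac)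
 moreover have "mm i * sg ?u ?u * cm i = 1"
  unfolding cm_def by (rule right_inverse) (use mm_nz[OF i] sg_pm[of ?u ?u] in auto)
 ultimately show ?thesis by (simp add: quad_form_eq[OF t])
qed

lemma eta_hyperbolic:
 assumes ij: "i : K" "j : K" "~ i <= q" "~ j <= q" and t: "t : \<T>"
 shows "eta (i, t, j) = mm i / mm j * quad_form T r a b t"
proof -
 have "tt i = \<one>" "tt j = \<one>" using ij by (simp_all add: tt_def)
 then show ?thesis using t by (simp add: eta_def cm_def quad_form_eq sg_ones field_simps)
qed

end

section \<open>Equality of degrees\<close>

context weyl_data begin

abbreviation "WG \<equiv> word_group T q s"
abbreviation "I \<equiv> {1..q + 2 * s}"

lemma comm_group_word_group: "comm_group WG"
proof -
 have "group WG" unfolding word_group_def by (intro DirProd_group is_group product_group) simp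
 then show ?thesis
  by (rule group.group_comm_groupI) (auto simp: word_group_def m_comm intro!: restrict_ext)
qed

lemma word_carrier: "(t, z) : carrier WG \<longleftrightarrow> t : \<T> & z : extensional I"
 by (auto simp: word_group_def PiE_def)

lemma word_mult: "(t, z) \<otimes>\<^bsub>WG\<^esub> (t', z') = (t \<otimes> t', \<lambda>m\<in>I. z m + z' m)"
 by (simp add: word_group_def)

lemma word_one: "\<one>\<^bsub>WG\<^esub> = (\<one>, \<lambda>m\<in>I. 0)" by (simp add: word_group_def)

lemma word_inv:
 assumes "t : \<T>" "z : extensional I"
 shows "inv\<^bsub>WG\<^esub> (t, z) = (t, \<lambda>m\<in>I. - z m)"
proof -
 interpret WG: comm_group WG by (rule comm_group_word_group)
 show ?thesis
  by (rule WG.inv_equality) (use assms in \<open>auto simp: word_mult word_one word_carrier sq intro!: restrict_ext\<close>)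
qed

text \<open>A subgroup that contains the relators and is small enough to tell degrees apart.\<close>

definition "Good = {(t, z). t : \<T> & z : extensional I & (\<forall>m\<in>{1..q}. even (z m)) &
  (\<forall>i\<in>K. q < i --> z (star i) = z i) &
  (\<forall>v\<in>\<T>. \<beta> t v = (\<Prod>m\<in>{1..q}. if z m mod 4 = (0 :: int) then 1 else \<beta> (\<tau> m) v))}"

lemma GoodI:
 assumes "t : \<T>" "z : extensional I" "!!m. m : {1..q} ==> even (z m)" "!!i. i : K ==> q < i ==> z (star i) = z i"
  "!!v. v : \<T> ==> \<beta> t v = (\<Prod>m\<in>{1..q}. if z m mod 4 = (0 :: int) then 1 else \<beta> (\<tau> m) v)"
 shows "(t, z) : Good"
 using assms unfolding Good_def by blast

lemma GoodD:
 assumes "(t, z) : Good"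
 shows "t : \<T>" "z : extensional I" "m : {1..q} ==> even (z m)" "i : K ==> q < i ==> z (star i) = z i"
  "v : \<T> ==> \<beta> t v = (\<Prod>m\<in>{1..q}. if z m mod 4 = (0 :: int) then 1 else \<beta> (\<tau> m) v)"
 using assms unfolding Good_def by blast+

text \<open>Exponents at diagonal indices are even, so being 2 modulo 4 adds up modulo two, and the
  values of beta square to 1.\<close>

lemma subgroup_Good: "subgroup Good WG"
proof -
 interpret WG: comm_group WG by (rule comm_group_word_group)
 have IK: "star i : I" "i : I" if "i : K" for i using star_K[OF that] that unfolding K_def by simp_all
 have Iq: "m : I" if "m : {1..q}" for m using that by auto
 show ?thesis
 proof (rule WG.subgroupI)
  show "Good <= carrier WG" by (auto simp: Good_def word_carrier)
  have "(\<one>, \<lambda>m\<in>I. 0) : Good"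
  proof (rule GoodI)
   fix i assume i: "i : K"
   show "(\<lambda>m\<in>I. 0) (star i) = (\<lambda>m\<in>I. 0 :: int) i" by (simp only: restrict_apply IK[OF i] if_True)
  qed auto
  then show "Good ~= {}" by blast
 next
  fix x assume x: "x : Good"
  obtain t z where xz: "x = (t, z)" by (cases x)
  note D = GoodD[OF x[unfolded xz]]
  show "inv\<^bsub>WG\<^esub> x : Good"
   unfolding xz word_inv[OF D(1,2)]
  proof (rule GoodI)
   fix v assume v: "v : \<T>"
   show "\<beta> t v = (\<Prod>m\<in>{1..q}. if (\<lambda>m\<in>I. - z m) m mod 4 = 0 then 1 else \<beta> (\<tau> m) v)"
    unfolding D(5)[OF v]
   proof (rule prod.cong[OF refl])
    fix m assume m: "m : {1..q}"
    have "z m mod 4 = 0 \<longleftrightarrow> - z m mod 4 = 0" by presburger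
    then show "(if z m mod 4 = 0 then 1 else \<beta> (\<tau> m) v) = (if (\<lambda>m\<in>I. - z m) m mod 4 = 0 then 1 else \<beta> (\<tau> m) v)"
     using Iq[OF m] by simp
   qed
  qed (use D Iq IK in auto)
 next
  fix x y assume x: "x : Good" and y: "y : Good"
  obtain t z t' z' where xz: "x = (t, z)" "y = (t', z')" by (cases x; cases y)
  note D = GoodD[OF x[unfolded xz]] and D' = GoodD[OF y[unfolded xz]]
  show "x \<otimes>\<^bsub>WG\<^esub> y : Good"
   unfolding xz word_mult
  proof (rule GoodI)
   fix v assume v: "v : \<T>"
   show "\<beta> (t \<otimes> t') v = (\<Prod>m\<in>{1..q}. if (\<lambda>m\<in>I. z m + z' m) m mod 4 = 0 then 1 else \<beta> (\<tau> m) v)"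
    unfolding beta_mult_l[OF D(1) D'(1) v] D(5)[OF v] D'(5)[OF v] prod.distrib[symmetric]
   proof (rule prod.cong[OF refl])
    fix m assume m: "m : {1..q}"
    have "z m mod 4 = 0 | z m mod 4 = 2" "z' m mod 4 = 0 | z' m mod 4 = 2" using D(3)[OF m] D'(3)[OF m] by presburger+
    then have "(z m + z' m) mod 4 = 0 \<longleftrightarrow> (z m mod 4 = 0 \<longleftrightarrow> z' m mod 4 = 0)" by presburger
    then show "(if z m mod 4 = 0 then 1 else \<beta> (\<tau> m) v) * (if z' m mod 4 = 0 then 1 else \<beta> (\<tau> m) v)
      = (if (\<lambda>m\<in>I. z m + z' m) m mod 4 = 0 then 1 else \<beta> (\<tau> m) v)"
     using Iq[OF m] beta_sq[OF tau[OF m] v] by simp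
   qed
  qed (use D D' Iq IK in auto)
 qed
qed

text \<open>The equated words themselves lie in \<open>Good\<close>, not just their quotients, so
  their common value is killed as well. This is coarser than the relators, yet
  \<open>deg_eq_RR\<close> shows that it still separates unrelated labels.\<close>

lemma equated_words_carrier_Good: "w : equated_words T q s \<tau> ==> w : Good"
proof -
 interpret WG: comm_group WG by (rule comm_group_word_group)
 assume "w : equated_words T q s \<tau>"
 then consider i where "i : {1..q}" "w = word_symbol T q s i [^]\<^bsub>WG\<^esub> (2::nat) \<otimes>\<^bsub>WG\<^esub> word_T q s (\<tau> i)"
  | j where "j : {1..s}" "w = word_symbol T q s (q + 2*j - 1) \<otimes>\<^bsub>WG\<^esub> word_symbol T q s (q + 2*j)"
  unfolding equated_words_def by blast
 then show "w : Good"
 proof cases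
  case 1
  have c: "word_symbol T q s i : carrier WG" by (simp add: word_symbol_def word_carrier)
  have "word_symbol T q s i [^]\<^bsub>WG\<^esub> (2::nat) = word_symbol T q s i \<otimes>\<^bsub>WG\<^esub> word_symbol T q s i"
   using c by (simp add: numeral_2_eq_2)
  then have w: "w = (\<tau> i, \<lambda>m\<in>I. if m = i then 2 else 0)"
   unfolding 1(2) word_symbol_def word_T_def using tau[OF 1(1)] by (auto simp: word_mult intro!: restrict_ext)
  have st: "star j ~= i" if "j : K" "q < j" for j
   using that 1(1) star_star[OF that(1)] by (auto simp: star_def split: if_splits)
  show ?thesis
   unfolding w
  proof (rule GoodI)
   fix v assume v: "v : \<T>"
   have "(\<Prod>m\<in>{1..q}. if (\<lambda>m\<in>I. if m = i then 2 else 0) m mod 4 = (0 :: int) then 1 else \<beta> (\<tau> m) v)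
     = (\<Prod>m\<in>{1..q}. if m = i then \<beta> (\<tau> i) v else 1)"
    by (rule prod.cong) auto
   then show "\<beta> (\<tau> i) v = (\<Prod>m\<in>{1..q}. if (\<lambda>m\<in>I. if m = i then 2 else 0) m mod 4 = (0 :: int) then 1 else \<beta> (\<tau> m) v)"
    using 1(1) by simp
  next
   fix j assume j: "j : K" "q < j"
   then have "j : I" "star j : I" using star_K[OF j(1)] unfolding K_def by simp_all
   then show "(\<lambda>m\<in>I. if m = i then 2 else 0) (star j) = (\<lambda>m\<in>I. if m = i then 2 else (0 :: int)) j"
    using st[OF j] 1(1) j(2) by simp
  qed (use tau[OF 1(1)] in auto)
 next
  case 2
  have w: "w = (\<one>, \<lambda>m\<in>I. (if m = q + 2*j - 1 then 1 else 0) + (if m = q + 2*j then 1 else 0))"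
   unfolding 2(2) word_symbol_def by (auto simp: word_mult intro!: restrict_ext)
  show ?thesis
   unfolding w
  proof (rule GoodI)
   fix v assume v: "v : \<T>"
   have "(\<Prod>m\<in>{1..q}. if (\<lambda>m\<in>I. (if m = q + 2*j - 1 then 1 else 0) + (if m = q + 2*j then 1 else 0)) m mod 4 = (0 :: int) then 1 else \<beta> (\<tau> m) v) = 1"
    using 2(1) by (intro prod.neutral) auto
   then show "\<beta> \<one> v = (\<Prod>m\<in>{1..q}. if (\<lambda>m\<in>I. (if m = q + 2*j - 1 then 1 else 0) + (if m = q + 2*j then 1 else 0)) m mod 4 = (0 :: int) then 1 else \<beta> (\<tau> m) v)"
    using v by simp
  next
   fix i assume i: "i : K" "q < i"
   then have iI: "i : I" "star i : I" using star_K[OF i(1)] unfolding K_def by simp_all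
   have p1: "odd (q + 2*j - 1 - q)" "even (q + 2*j - q)" using 2(1) by auto
   have "(star i = q + 2*j \<longleftrightarrow> i = q + 2*j - 1) & (star i = q + 2*j - 1 \<longleftrightarrow> i = q + 2*j)"
   proof -
    have "star (q + 2*j - 1) = q + 2*j" "star (q + 2*j) = q + 2*j - 1" using 2(1) p1 by (auto simp: star_def)
    then show ?thesis using star_star[OF i(1)] by metis
   qed
   then show "(\<lambda>m\<in>I. (if m = q + 2*j - 1 then 1 else 0) + (if m = q + 2*j then 1 else 0)) (star i)
     = (\<lambda>m\<in>I. (if m = q + 2*j - 1 then 1 else 0) + (if m = q + 2*j then 1 else (0 :: int))) i"
    using iI 2(1) by auto
  qed (use 2(1) in auto)
 qed
qed

lemma relators_Good: "relators T q s \<tau> <= Good"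
 unfolding relators_def
proof (rule group.generate_subgroup_incl[OF _ _ subgroup_Good])
 show "group WG" using comm_group_word_group by (simp add: comm_group_def)
 show "{v \<otimes>\<^bsub>WG\<^esub> inv\<^bsub>WG\<^esub> w | v w. v : equated_words T q s \<tau> & w : equated_words T q s \<tau>} <= Good"
  using equated_words_carrier_Good subgroup.m_closed[OF subgroup_Good] subgroup.m_inv_closed[OF subgroup_Good] by blast
qed

lemma relators_normal: "relators T q s \<tau> \<lhd> WG"
proof -
 interpret WG: comm_group WG by (rule comm_group_word_group)
 have "{v \<otimes>\<^bsub>WG\<^esub> inv\<^bsub>WG\<^esub> w | v w. v : equated_words T q s \<tau> & w : equated_words T q s \<tau>} <= carrier WG"
  using equated_words_carrier_Good subgroup.mem_carrier[OF subgroup_Good] by blast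
 then have "subgroup (relators T q s \<tau>) WG" unfolding relators_def by (rule WG.generate_is_subgroup)
 then show ?thesis by (rule WG.subgroup_imp_normal)
qed

definition "word i t j = (t, \<lambda>m\<in>I. (if m = i then 1 else 0) - (if m = j then 1 else (0 :: int)))"

lemma deg_word:
 assumes "t : \<T>"
 shows "deg_M T q s \<tau> i t j = relators T q s \<tau> #>\<^bsub>WG\<^esub> word i t j"
proof -
 interpret WG: comm_group WG by (rule comm_group_word_group)
 interpret R: normal "relators T q s \<tau>" WG by (rule relators_normal)
 have c: "word_symbol T q s i : carrier WG" "word_T q s t : carrier WG" for i
  using assms by (simp_all add: word_symbol_def word_T_def word_carrier)
 have i: "inv\<^bsub>WG\<^esub> word_symbol T q s j : carrier WG" using c by simp
 have "deg_M T q s \<tau> i t j = relators T q s \<tau> #>\<^bsub>WG\<^esub> (word_symbol T q s i \<otimes>\<^bsub>WG\<^esub> word_T q s t \<otimes>\<^bsub>WG\<^esub> inv\<^bsub>WG\<^esub> word_symbol T q s j)"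
  unfolding deg_M_def Let_def G_tilde_def
  using c i R.inv_FactGroup[of "relators T q s \<tau> #>\<^bsub>WG\<^esub> word_symbol T q s j"] R.rcos_inv[OF c(1)[of j]]
  by (simp add: R.rcos_sum carrier_FactGroup)
 also have "word_symbol T q s i \<otimes>\<^bsub>WG\<^esub> word_T q s t \<otimes>\<^bsub>WG\<^esub> inv\<^bsub>WG\<^esub> word_symbol T q s j = word i t j"
  unfolding word_symbol_def word_T_def using assms
  by (auto simp: word_inv word_mult word_def intro!: restrict_ext)
 finally show ?thesis .
qed

lemma word_in: "t : \<T> ==> word i t j : carrier WG" by (simp add: word_def word_carrier)

lemma deg_eq_Good:
 assumes "t : \<T>" "t' : \<T>" "deg_M T q s \<tau> i t j = deg_M T q s \<tau> i' t' j'"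
 shows "(t \<otimes> t', \<lambda>m\<in>I. (if m = i then 1 else 0) - (if m = j then 1 else 0) - (if m = i' then 1 else 0) + (if m = j' then 1 else (0 :: int))) : Good"
proof -
 interpret WG: comm_group WG by (rule comm_group_word_group)
 have "word i t j \<otimes>\<^bsub>WG\<^esub> inv\<^bsub>WG\<^esub> word i' t' j' : relators T q s \<tau>"
  using assms(3) WG.rcos_eq_iff[OF normal_imp_subgroup[OF relators_normal] word_in[OF assms(1)] word_in[OF assms(2)]]
  unfolding deg_word[OF assms(1)] deg_word[OF assms(2)] by blast
 then have "word i t j \<otimes>\<^bsub>WG\<^esub> inv\<^bsub>WG\<^esub> word i' t' j' : Good" using relators_Good by blast
 moreover have "word i t j \<otimes>\<^bsub>WG\<^esub> inv\<^bsub>WG\<^esub> word i' t' j'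
  = (t \<otimes> t', \<lambda>m\<in>I. (if m = i then 1 else 0) - (if m = j then 1 else 0) - (if m = i' then 1 else 0) + (if m = j' then 1 else (0 :: int)))"
  unfolding word_def using assms(2) by (auto simp: word_inv word_mult intro!: restrict_ext)
 ultimately show ?thesis by simp
qed

lemma deg_diag: "t : \<T> ==> deg_M T q s \<tau> i t i = deg_M T q s \<tau> j t j"
proof -
 assume t: "t : \<T>"
 have "word i t i = word j t j" by (simp add: word_def)
 then show ?thesis unfolding deg_word[OF t] by simp
qed

lemma star_high: "i : K ==> q < i ==> star i ~= i" by (auto simp: star_def)

lemma star_low: "i : K ==> j : K ==> j <= q ==> star i = j \<longleftrightarrow> i = j"
 by (metis star_def star_star)

text \<open>The exponent vector \<open>z\<close> of the quotient of the degrees is supported on i,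
  j, i', j'. Even entries at diagonal indices and equal entries on pairs leave few coincidences
  among these four, and the condition on beta then fixes the middle entry.\<close>

lemma deg_eq_RR:
 assumes K: "i : K" "t : \<T>" "j : K" "i' : K" "t' : \<T>" "j' : K"
  and eq: "deg_M T q s \<tau> i t j = deg_M T q s \<tau> i' t' j'"
 shows "RR (i, t, j) (i', t', j')"
proof -
 define z where "z m = (if m = i then 1 else 0) - (if m = j then 1 else 0) - (if m = i' then 1 else 0) + (if m = j' then 1 else (0 :: int))" for m
 have G: "(t \<otimes> t', restrict z I) : Good" using deg_eq_Good[OF K(2,5) eq] unfolding z_def .
 have ev: "even (z m)" if "m : K" "m <= q" for m using GoodD(3)[OF G, of m] that by (auto simp: K_def)
 have st: "z (star m) = z m" if "m : K" "q < m" for m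
  using GoodD(4)[OF G that] that(1) star_K[OF that(1)] unfolding K_def by simp
 have bt: "\<beta> (t \<otimes> t') v = (\<Prod>m\<in>{1..q}. if z m mod 4 = 0 then 1 else \<beta> (\<tau> m) v)" if "v : \<T>" for v
  unfolding GoodD(5)[OF G that] by (rule prod.cong) auto
 have zero: "t = t'" if "!!m. z m = 0"
 proof -
  have "\<beta> (t \<otimes> t') v = 1" if "v : \<T>" for v unfolding bt[OF that] using \<open>!!m. z m = 0\<close> by simp
  then show ?thesis using beta_nondeg[of "t \<otimes> t'"] mult_eq_one K by simp
 qed
 \<comment> \<open>A lone entry 1 or -1 violates parity at a diagonal index and symmetry at a
   pair.\<close>
 have unit: False if "m : K" "z m = 1 | z m = -1" "!!l. l ~= m ==> z l = z m ==> False" for m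
 proof (cases "m <= q")
  case True then show False using ev[OF that(1)] that(2) by auto
 next
  case False then show False using st[OF that(1)] star_high[OF that(1)] that(3)[of "star m"] by simp
 qed
 consider "i = j" | "i' = j'" "i ~= j" | "i ~= j" "i' ~= j'" "i = i'" | "i ~= j" "i' ~= j'" "i ~= i'" "j = j'" | "i ~= j" "i' ~= j'" "i ~= i'" "j ~= j'"
  by blast
 then show ?thesis
 proof cases
  case 1
  have "i' = j'"
  proof (rule ccontr)
   assume ne: "i' ~= j'"
   show False by (rule unit[OF K(4)]) (use 1 ne in \<open>auto simp: z_def split: if_splits\<close>)
  qed
  moreover have "t = t'" by (rule zero) (use 1 calculation in \<open>simp add: z_def\<close>)
  ultimately show ?thesis using 1 K by (auto simp: RR_def)
 next
  case 2
  have False by (rule unit[OF K(1)]) (use 2 in \<open>auto simp: z_def split: if_splits\<close>)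
  then show ?thesis ..
 next
  case 3
  have "j = j'"
  proof (rule ccontr)
   assume ne: "j ~= j'"
   show False by (rule unit[OF K(3)]) (use 3 ne in \<open>auto simp: z_def split: if_splits\<close>)
  qed
  moreover have "t = t'" by (rule zero) (use 3 calculation in \<open>simp add: z_def\<close>)
  ultimately show ?thesis using 3 by (simp add: RR_def)
 next
  case 4
  have False by (rule unit[OF K(1)]) (use 4 in \<open>auto simp: z_def split: if_splits\<close>)
  then show ?thesis ..
 next
  case 5
  have j': "j' = star i"
  proof (cases "i <= q")
   case True
   then have "even (z i)" by (rule ev[OF K(1)])
   then have "i = j'" using 5 by (auto simp: z_def split: if_splits)
   then show ?thesis using True by (simp add: star_def)
  next
   case False
   then have "z (star i) = z i" "star i ~= i" using st[OF K(1)] star_high[OF K(1)] by auto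
   then show ?thesis using 5 by (auto simp: z_def split: if_splits)
  qed
  have i': "i' = star j"
  proof (cases "j <= q")
   case True
   then have "even (z j)" by (rule ev[OF K(3)])
   then have "j = i'" using 5 by (auto simp: z_def split: if_splits)
   then show ?thesis using True by (simp add: star_def)
  next
   case False
   then have "z (star j) = z j" "star j ~= j" using st[OF K(3)] star_high[OF K(3)] by auto
   then show ?thesis using 5 by (auto simp: z_def split: if_splits)
  qed
  \<comment> \<open>The entries 2 and -2 are both 2 modulo 4, so diagonal i and j contribute t_i and
    t_j to the condition on beta.\<close>
  have zm: "z m = (if m = i then 2 else 0) - (if m = j then 2 else 0)" if m: "m : {1..q}" for m
  proof -
   have mK: "m : K" "m <= q" using m by (auto simp: K_def)
   have "(m = star i) = (m = i)" "(m = star j) = (m = j)" using star_low[OF K(1) mK] star_low[OF K(3) mK] by metis+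
   then show ?thesis unfolding z_def i' j' by simp
  qed
  have tt: "\<beta> (tt l) v = (\<Prod>m\<in>{1..q}. if m = l then \<beta> (\<tau> m) v else 1)" if "l : K" "v : \<T>" for l v
  proof -
   have "(\<Prod>m\<in>{1..q}. if m = l then \<beta> (\<tau> m) v else 1) = (\<Prod>m\<in>{1..q}. if m = l then \<beta> (\<tau> l) v else 1)" by (rule prod.cong) auto
   then show ?thesis using that by (simp add: tt_def K_def)
  qed
  have "t \<otimes> t' = tt i \<otimes> tt j"
  proof (rule beta_inj)
   fix v assume v: "v : \<T>"
   show "\<beta> (t \<otimes> t') v = \<beta> (tt i \<otimes> tt j) v"
    unfolding bt[OF v] beta_mult_l[OF tt_T[OF K(1)] tt_T[OF K(3)] v] tt[OF K(1) v] tt[OF K(3) v] prod.distrib[symmetric]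
    by (rule prod.cong[OF refl]) (use 5(1) in \<open>auto simp: zm\<close>)
  qed (use K in auto)
  then have "t \<otimes> (t \<otimes> t') = t \<otimes> (tt i \<otimes> tt j)" by simp
  then have "t' = t \<otimes> tt i \<otimes> tt j" using K tt_T[OF K(1)] tt_T[OF K(3)] by (simp add: m_assoc)
  then show ?thesis by (simp add: RR_def bphi_def i' j')
 qed
qed

end

section \<open>Fineness\<close>

lemma (in mat_basis) coef_finsum:
 assumes "finite A" "!!g. g : A ==> F g : carrier_mat n n"
 shows "coef (\<Oplus>\<^bsub>mat_ring n\<^esub> g\<in>A. F g) b = (\<Sum>g\<in>A. coef (F g) b)" "(\<Oplus>\<^bsub>mat_ring n\<^esub> g\<in>A. F g) : carrier_mat n n"
proof -
 interpret R: ring "ring_mat TYPE('f) n ()" by (rule ring_mat)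
 have "coef (\<Oplus>\<^bsub>mat_ring n\<^esub> g\<in>A. F g) b = (\<Sum>g\<in>A. coef (F g) b) & (\<Oplus>\<^bsub>mat_ring n\<^esub> g\<in>A. F g) : carrier_mat n n"
  using assms
 proof (induction A rule: finite_induct)
  case empty
  then show ?case by (simp add: ring_mat_simps coef_0)
 next
  case (insert g A)
  have c: "F g : carrier_mat n n" "F : A \<rightarrow> carrier (ring_mat TYPE('f) n ())" using insert.prems by (auto simp: ring_mat_simps)
  have "(\<Oplus>\<^bsub>mat_ring n\<^esub> g\<in>insert g A. F g) = F g + (\<Oplus>\<^bsub>mat_ring n\<^esub> g\<in>A. F g)"
   using R.finsum_insert[OF insert.hyps c(2)] c(1) by (simp add: ring_mat_simps)
  then show ?case using insert c(1) by (simp add: coef_add)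
 qed
 then show "coef (\<Oplus>\<^bsub>mat_ring n\<^esub> g\<in>A. F g) b = (\<Sum>g\<in>A. coef (F g) b)" "(\<Oplus>\<^bsub>mat_ring n\<^esub> g\<in>A. F g) : carrier_mat n n" by blast+
qed

text \<open>A basis indexed by a group and multiplicative up to scalars. The homogeneous parts of a
  matrix are given by its coordinates, which yields existence and uniqueness of the
  decomposition.\<close>

lemma (in mat_basis) one_dim_grading:
 assumes H: "comm_group H" and h: "bij_betw h (carrier H) B"
  and m: "!!g g'. g : carrier H ==> g' : carrier H ==> \<exists>c. e (h g) * e (h g') = c \<star> e (h (g \<otimes>\<^bsub>H\<^esub> g'))"
 shows "mat_grading n H (%g. {c \<star> e (h g) | c. True})" (is "mat_grading n H ?A")
 unfolding mat_grading_def
proof (intro conjI ballI)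
 have hB: "h g : B" if "g : carrier H" for g using h that by (auto simp: bij_betw_def)
 have ec: "e (h g) : carrier_mat n n" if "g : carrier H" for g by (rule e_carrier[OF hB[OF that]])
 have fH: "finite (carrier H)" using bij_betw_finite[OF h] fin by simp
 have hinj: "h g = h g' \<longleftrightarrow> g = g'" if "g : carrier H" "g' : carrier H" for g g'
  using h that by (auto simp: bij_betw_def dest: inj_onD)
 show "comm_group H" by fact
 show "mat_subspace n (?A g)" if g: "g : carrier H" for g
 proof (rule mat_subspaceI)
  show "?A g <= carrier_mat n n" using ec[OF g] by auto
  have "0\<^sub>m n n = 0 \<star> e (h g)" using ec[OF g] by (intro eq_matI) auto
  then show "0\<^sub>m n n : ?A g" by blast
  show "Y + Z : ?A g" if "Y : ?A g" "Z : ?A g" for Y Z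
  proof -
   obtain c d where "Y = c \<star> e (h g)" "Z = d \<star> e (h g)" using \<open>Y : ?A g\<close> \<open>Z : ?A g\<close> by blast
   then have "Y + Z = (c + d) \<star> e (h g)" using add_smult_distrib_right_mat[OF ec[OF g], of c d] by simp
   then show ?thesis by blast
  qed
  show "c \<star> Y : ?A g" if "Y : ?A g" for c Y using that by (auto simp: smult_smult_mat)
 qed
 show "Y * Z : ?A (g \<otimes>\<^bsub>H\<^esub> g')" if g: "g : carrier H" "g' : carrier H" and YZ: "Y : ?A g" "Z : ?A g'" for g g' Y Z
 proof -
  obtain c d where yz: "Y = c \<star> e (h g)" "Z = d \<star> e (h g')" using YZ by blast
  obtain x where x: "e (h g) * e (h g') = x \<star> e (h (g \<otimes>\<^bsub>H\<^esub> g'))" using m[OF g] by blast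
  have "Y * Z = c \<star> (e (h g) * (d \<star> e (h g')))" unfolding yz
   by (rule mult_smult_assoc_mat[of _ n n _ n]) (use ec g in auto)
  also have "e (h g) * (d \<star> e (h g')) = d \<star> (e (h g) * e (h g'))" by (rule mult_smult_distrib[of _ n n _ n]) (use ec g in auto)
  also have "c \<star> ... = (c * (d * x)) \<star> e (h (g \<otimes>\<^bsub>H\<^esub> g'))" unfolding x by (simp add: smult_smult_mat)
  finally show ?thesis by blast
 qed
 fix X :: "'f mat" assume X: "X : carrier_mat n n"
 have key: "X = (\<Oplus>\<^bsub>mat_ring n\<^esub> g\<in>{g : carrier H. F g ~= 0\<^sub>m n n}. F g) \<longleftrightarrow> (\<forall>g\<in>carrier H. F g = coef X (h g) \<star> e (h g))"
  if F: "F : (\<Pi>\<^sub>E g\<in>carrier H. ?A g)" for F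
 proof -
  let ?S = "{g : carrier H. F g ~= 0\<^sub>m n n}"
  define cc where "cc g = (SOME c. F g = c \<star> e (h g))" for g
  have Fc: "F g = cc g \<star> e (h g)" if "g : carrier H" for g
  proof -
   have "F g : ?A g" using PiE_mem[OF F that] .
   then have "\<exists>c. F g = c \<star> e (h g)" by blast
   from someI_ex[OF this] show ?thesis unfolding cc_def .
  qed
  have Fm: "F g : carrier_mat n n" if "g : carrier H" for g using Fc[OF that] ec[OF that] by simp
  have coefF: "coef (F g) (h g') = (if g = g' then cc g else 0)" if "g : carrier H" "g' : carrier H" for g g'
   using Fc[OF that(1)] coef_smult[OF ec[OF that(1)]] coef_e[OF hB[OF that(1)] hB[OF that(2)]] hinj[OF that] by simp
  have S: "finite ?S" "!!g. g : ?S ==> F g : carrier_mat n n" using fH Fm by auto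
  have fs: "coef (\<Oplus>\<^bsub>mat_ring n\<^esub> g\<in>?S. F g) b = (\<Sum>g\<in>?S. coef (F g) b)" "(\<Oplus>\<^bsub>mat_ring n\<^esub> g\<in>?S. F g) : carrier_mat n n" for b
   by (rule coef_finsum; rule S; assumption)+
  have cs: "coef (\<Oplus>\<^bsub>mat_ring n\<^esub> g\<in>?S. F g) (h g') = cc g'" if g': "g' : carrier H" for g'
  proof -
   have "(\<Sum>g\<in>?S. coef (F g) (h g')) = (\<Sum>g\<in>?S. if g = g' then cc g' else 0)"
    by (rule sum.cong[OF refl]) (use coefF g' in auto)
   also have "... = (if g' : ?S then cc g' else 0)" using S(1) by simp
   also have "... = cc g'"
   proof (cases "g' : ?S")
    case False
    then have "F g' = 0\<^sub>m n n" using g' by simp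
    then have "cc g' = 0" using coefF[OF g' g'] coef_0 by simp
    then show ?thesis by simp
   qed simp
   finally show ?thesis unfolding fs(1) .
  qed
  have "X = (\<Oplus>\<^bsub>mat_ring n\<^esub> g\<in>?S. F g) \<longleftrightarrow> (\<forall>g\<in>carrier H. coef X (h g) = cc g)"
  proof
   assume "X = (\<Oplus>\<^bsub>mat_ring n\<^esub> g\<in>?S. F g)"
   then show "\<forall>g\<in>carrier H. coef X (h g) = cc g" using cs by simp
  next
   assume *: "\<forall>g\<in>carrier H. coef X (h g) = cc g"
   show "X = (\<Oplus>\<^bsub>mat_ring n\<^esub> g\<in>?S. F g)"
   proof (rule mat_coef_eqI[OF X fs(2)])
    fix b assume "b : B"
    then obtain g where "g : carrier H" "b = h g" using h by (auto simp: bij_betw_def)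
    then show "coef X b = coef (\<Oplus>\<^bsub>mat_ring n\<^esub> g\<in>?S. F g) b" using * cs by simp
   qed
  qed
  also have "... \<longleftrightarrow> (\<forall>g\<in>carrier H. F g = coef X (h g) \<star> e (h g))"
  proof (intro ball_cong refl iffI)
   fix g assume g: "g : carrier H"
   show "coef X (h g) = cc g ==> F g = coef X (h g) \<star> e (h g)" using Fc[OF g] by simp
   assume "F g = coef X (h g) \<star> e (h g)"
   then have "coef (F g) (h g) = coef X (h g)" using coef_smult[OF ec[OF g]] coef_e[OF hB[OF g] hB[OF g]] by simp
   then show "coef X (h g) = cc g" using coefF[OF g g] by simp
  qed
  finally show ?thesis .
 qed
 let ?F = "\<lambda>g\<in>carrier H. coef X (h g) \<star> e (h g)"
 show "\<exists>!f. f : (\<Pi>\<^sub>E g\<in>carrier H. ?A g) & finite {g : carrier H. f g ~= 0\<^sub>m n n} &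
   X = (\<Oplus>\<^bsub>mat_ring n\<^esub> g\<in>{g : carrier H. f g ~= 0\<^sub>m n n}. f g)"
 proof (rule ex1I)
  have F: "?F : (\<Pi>\<^sub>E g\<in>carrier H. ?A g)" by auto
  have "finite {g : carrier H. ?F g ~= 0\<^sub>m n n}" by (rule finite_subset[OF _ fH]) blast
  then show "?F : (\<Pi>\<^sub>E g\<in>carrier H. ?A g) & finite {g : carrier H. ?F g ~= 0\<^sub>m n n} &
    X = (\<Oplus>\<^bsub>mat_ring n\<^esub> g\<in>{g : carrier H. ?F g ~= 0\<^sub>m n n}. ?F g)"
   using F key[OF F] by simp
 next
  fix f assume f: "f : (\<Pi>\<^sub>E g\<in>carrier H. ?A g) & finite {g : carrier H. f g ~= 0\<^sub>m n n} &
   X = (\<Oplus>\<^bsub>mat_ring n\<^esub> g\<in>{g : carrier H. f g ~= 0\<^sub>m n n}. f g)"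
  then have "\<forall>g\<in>carrier H. f g = coef X (h g) \<star> e (h g)" using key by blast
  then have "f g = ?F g" for g using PiE_arb[OF conjunct1[OF f]] by (cases "g : carrier H") simp_all
  then show "f = ?F" by blast
 qed
qed

text \<open>Competing gradings in \<open>fine_phi_grading\<close> are by groups on natural numbers;
  a finite group is moved there along an injection.\<close>

definition transport_group :: "('a => 'b) => 'a monoid => 'b monoid"
 where "transport_group f G = \<lparr>carrier = f ` carrier G,
   monoid.mult = (%x y. f (inv_into (carrier G) f x \<otimes>\<^bsub>G\<^esub> inv_into (carrier G) f y)), one = f \<one>\<^bsub>G\<^esub>\<rparr>"

lemma comm_group_transport:
 assumes G: "comm_group G" and f: "inj_on f (carrier G)"
 shows "comm_group (transport_group f G)"
proof -
 interpret G: comm_group G by fact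
 note v = inv_into_f_f[OF f]
 show ?thesis
 proof (rule comm_groupI)
  fix x assume "x : carrier (transport_group f G)"
  then obtain y where y: "x = f y" "y : carrier G" by (auto simp: transport_group_def)
  then have "f (inv\<^bsub>G\<^esub> y) \<otimes>\<^bsub>transport_group f G\<^esub> x = \<one>\<^bsub>transport_group f G\<^esub>" "f (inv\<^bsub>G\<^esub> y) : carrier (transport_group f G)"
   using v by (simp_all add: transport_group_def)
  then show "\<exists>y\<in>carrier (transport_group f G). y \<otimes>\<^bsub>transport_group f G\<^esub> x = \<one>\<^bsub>transport_group f G\<^esub>" by blast
 qed (auto simp: transport_group_def v G.m_assoc G.m_comm G.m_lcomm)
qed

locale fine_matrices = twisted_matrices T \<beta> q s \<tau> r a b \<mu> n
 for T :: "'t monoid" (structure) and \<beta> :: "'t => 't => 'f::field" and q s \<tau> r a b \<mu> n +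
 assumes fine: "fine_phi_grading n (phi_map T r a b q s \<tau> \<mu>) (G_tilde0 T q s \<tau>) (Gamma_M T r a b q s \<tau>)"
begin

abbreviation "\<phi> \<equiv> phi_map T r a b q s \<tau> \<mu>"
abbreviation "G0 \<equiv> G_tilde0 T q s \<tau>"
abbreviation "\<Gamma> \<equiv> (Gamma_M T r a b q s \<tau> :: ('t \<times> (nat => int)) set => 'f mat set)"
definition "deg = (%(i, t, j). deg_M T q s \<tau> i t j)"

lemma phi_anti_aut: "\<phi> : anti_automorphisms n"
 and phi_Gamma: "g : carrier G0 ==> \<phi> ` \<Gamma> g = \<Gamma> g"
 and phi_square: "\<phi> \<otimes>\<^bsub>mat_bij_group n\<^esub> \<phi> : automorphisms n"
 using fine unfolding fine_phi_grading_def phi_grading_def Diag_gr_def by blast+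

lemma deg_carrier: "x : B ==> deg x : carrier G0"
 unfolding G_tilde0_def deg_def by (cases x) (auto simp: K_def intro!: generate.incl)

lemma Gamma_eq: "\<Gamma> g = {Y : carrier_mat n n. \<forall>x\<in>B. deg x ~= g --> coef Y x = 0}"
proof -
 have "{kronecker (matrix_unit k i j) (X t) | i t j. i : {1..k} & t : \<T> & j : {1..k} & deg_M T q s \<tau> i t j = g}
   = e ` {x : B. deg x = g}" (is "?L = ?R")
 proof (intro equalityI subsetI)
  fix Z assume "Z : ?L"
  then obtain i t j where "Z = e (i, t, j)" "(i, t, j) : B" "deg (i, t, j) = g" unfolding e_simp deg_def B_iff K_def by auto
  then show "Z : ?R" by blast
 next
  fix Z assume "Z : ?R"
  then obtain x where x: "Z = e x" "x : B" "deg x = g" by blast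
  obtain i t j where "x = (i, t, j)" by (cases x)
  then show "Z : ?L" using x unfolding K_def[symmetric] by (auto simp: e_simp deg_def)
 qed
 then have "\<Gamma> g = mat_subspace n hull (e ` {x : B. deg x = g})" unfolding Gamma_M_def n_def by simp
 also have "... = {Y : carrier_mat n n. \<forall>x\<in>B - {x : B. deg x = g}. coef Y x = 0}" by (rule hull_eq_coef_zero) blast
 finally show ?thesis by auto
qed

lemma e_Gamma: "x : B ==> e x : \<Gamma> (deg x)"
 unfolding Gamma_eq using e_carr coef_e by auto

text \<open>phi preserves every component and maps the basis matrix at x to a nonzero multiple of
  the one at \<open>bphi x\<close>, so no computation with words is required.\<close>

lemma deg_bphi:
 assumes x: "x : B"
 shows "deg (bphi x) = deg x"
proof (rule ccontr)
 assume ne: "deg (bphi x) ~= deg x"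
 have "\<phi> (e x) : \<Gamma> (deg x)" using phi_Gamma[OF deg_carrier[OF x]] e_Gamma[OF x] by blast
 then have "coef (eta x \<star> e (bphi x)) (bphi x) = 0"
  unfolding Gamma_eq phi_map_e[OF x] using ne bphi_B[OF x] by blast
 then show False using eta_nonzero[OF x] coef_smult[OF e_carr] coef_e[OF bphi_B[OF x] bphi_B[OF x]] by simp
qed

lemma deg_iff:
 assumes x: "x : B" and y: "y : B"
 shows "deg x = deg y \<longleftrightarrow> RR x y"
proof
 assume eq: "deg x = deg y"
 obtain i t j i' t' j' where xy: "x = (i, t, j)" "y = (i', t', j')" by (cases x; cases y)
 show "RR x y" unfolding xy by (rule deg_eq_RR) (use x y eq xy in \<open>auto simp: deg_def\<close>)
next
 assume "RR x y"
 then consider i j t where "i : K" "j : K" "x = (i, t, i)" "y = (j, t, j)" | "y = x" | "y = bphi x" unfolding RR_def by blast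
 then show "deg x = deg y"
 proof cases
  case 1
  then show ?thesis using deg_diag[of t i j] x by (simp add: deg_def)
 qed (use deg_bphi[OF x] in simp_all)
qed

lemma components_eq: "components n G0 \<Gamma> = (%x. {Y : carrier_mat n n. \<forall>y\<in>B. ~ RR x y --> coef Y y = 0}) ` B"
proof -
 have G: "\<Gamma> (deg x) = {Y : carrier_mat n n. \<forall>y\<in>B. ~ RR x y --> coef Y y = 0}" if "x : B" for x
 proof -
  have "deg y ~= deg x \<longleftrightarrow> ~ RR x y" if "y : B" for y using deg_iff[OF \<open>x : B\<close> that] by metis
  then show ?thesis unfolding Gamma_eq by (simp cong: ball_cong)
 qed
 have e0: "e x ~= 0\<^sub>m n n" if "x : B" for x using coef_e[OF that that] coef_0[of x] by auto
 have "components n G0 \<Gamma> = (%x. \<Gamma> (deg x)) ` B"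
 proof (intro equalityI subsetI)
  fix V assume "V : components n G0 \<Gamma>"
  then obtain g where g: "V = \<Gamma> g" "V ~= {0\<^sub>m n n}" unfolding components_def by blast
  have "\<exists>x\<in>B. deg x = g"
  proof (rule ccontr)
   assume "~ (\<exists>x\<in>B. deg x = g)"
   then have "V = {Y : carrier_mat n n. \<forall>x\<in>B. coef Y x = 0}" unfolding g(1) Gamma_eq by auto
   also have "... = {0\<^sub>m n n}" using mat_coef_eqI[of _ "0\<^sub>m n n"] coef_0 by auto
   finally show False using g(2) by simp
  qed
  then show "V : (%x. \<Gamma> (deg x)) ` B" using g(1) by blast
 next
  fix V assume "V : (%x. \<Gamma> (deg x)) ` B"
  then obtain x where x: "x : B" "V = \<Gamma> (deg x)" by blast
  then have "V ~= {0\<^sub>m n n}" using e_Gamma[OF x(1)] e0[OF x(1)] by blast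
  then show "V : components n G0 \<Gamma>" unfolding components_def using x deg_carrier by blast
 qed
 then show ?thesis using G by (simp cong: image_cong)
qed

section \<open>The Pauli refinement in the excluded case\<close>

definition "pauli_labels = \<T> \<times> ({0, 1 :: int} \<times> {0, 1 :: int})"
lemma pauli_labels_iff: "(t, p, l) : pauli_labels \<longleftrightarrow> t : \<T> & p : {0, 1} & l : {0, 1}"
 unfolding pauli_labels_def mem_Times_iff by simp

text \<open>For q + 2s = 2 the algebra is the tensor product of M_2 with D. This basis has Pauli
  matrices in place of matrix units in the first factor and is graded by T x Z_2^2.\<close>

definition "pf = (%(t, p, l). kronecker (pauli (nat p) (nat l)) (X t))"
definition "pauli_group = T \<times>\<times> (integer_mod_group 2 \<times>\<times> integer_mod_group 2)"

lemma pauli_group_carrier: "carrier pauli_group = pauli_labels"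
 by (simp add: pauli_group_def pauli_labels_def Z2_carrier)

lemma comm_pauli_group: "comm_group pauli_group"
proof -
 have "group pauli_group" unfolding pauli_group_def by (intro DirProd_group is_group) simp_all
 then show ?thesis
  by (rule group.group_comm_groupI) (auto simp: pauli_group_def m_comm add.commute)
qed

lemma nat_01: "p : {0, 1 :: int} ==> nat p : {0, 1}" by auto

lemma pf_carrier: "n = 2 * 2 ^ r ==> pf x : carrier_mat n n"
 using kronecker_carrier[OF pauli_carrier X_carrier] by (cases x) (simp add: pf_def)

lemma pf_basis:
 assumes n2: "n = 2 * 2 ^ r"
 shows "mat_basis n pauli_labels pf (2 * 2 ^ r)"
proof
 show "finite pauli_labels" using fin_T by (simp add: pauli_labels_def)
 show "pf x : carrier_mat n n" for x by (rule pf_carrier[OF n2])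
 show "(2 :: 'f) * 2 ^ r ~= 0" using two' by simp
 show "mat_ip n (pf x) (pf y) = (if x = y then 2 * 2 ^ r else 0)" if xy: "x : pauli_labels" "y : pauli_labels" for x y
 proof -
  obtain t p l t' p' l' where x: "x = (t, p, l)" and y: "y = (t', p', l')" by (cases x; cases y)
  have m: "t : \<T>" "t' : \<T>" "p : {0, 1}" "l : {0, 1}" "p' : {0, 1}" "l' : {0, 1}"
   using xy unfolding x y pauli_labels_iff by blast+
  have "nat p = nat p' \<longleftrightarrow> p = p'" "nat l = nat l' \<longleftrightarrow> l = l'" using m by auto
  then show ?thesis
   unfolding x y pf_def prod.case n2 mat_ip_kronecker[OF pauli_carrier X_carrier pauli_carrier X_carrier] X_ip[OF m(1,2)]
    pauli_ip[OF nat_01[OF m(3)] nat_01[OF m(4)] nat_01[OF m(5)] nat_01[OF m(6)]] by auto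
 qed
 have sub: "{kronecker C D | C D. C : {pauli i j | i j. i : {0, 1} & j : {0, 1}} & D : X ` \<T>} <= pf ` pauli_labels"
 proof
  fix Z assume "Z : {kronecker C D | C D. C : {pauli i j | i j. i : {0, 1} & j : {0, 1}} & D : X ` \<T>}"
  then obtain C D where Z: "Z = kronecker C D" "C : {pauli i j | i j. i : {0, 1} & j : {0, 1}}" "D : X ` \<T>" by blast
  obtain i j where ij: "C = pauli i j" "i : {0, 1}" "j : {0, 1}" using Z(2) by blast
  obtain t where t: "D = X t" "t : \<T>" using Z(3) by blast
  have "Z = pf (t, int i, int j)" unfolding Z(1) ij(1) t(1) pf_def by simp
  moreover have "(t, int i, int j) : pauli_labels" unfolding pauli_labels_iff using ij(2,3) t(2) by auto
  ultimately show "Z : pf ` pauli_labels" by (rule image_eqI)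
 qed
 have sp: "mat_spans n {kronecker C D | C D. C : {pauli i j | i j. i : {0, 1} & j : {0, 1}} & D : X ` \<T>}"
  unfolding n2 by (rule mat_spans_kronecker[OF pauli_spans[OF two'] X_spans])
 have "mat_subspace n (mat_subspace n hull (pf ` pauli_labels))" by (rule mat_subspace_hull) (use pf_carrier[OF n2] in auto)
 then show "carrier_mat n n <= mat_subspace n hull (pf ` pauli_labels)"
  by (rule mat_spansD[OF sp]) (rule subset_trans[OF sub hull_subset])
qed

lemma pf_mult:
 assumes "x : pauli_labels" "y : pauli_labels"
 shows "\<exists>c. pf x * pf y = c \<star> pf (x \<otimes>\<^bsub>pauli_group\<^esub> y)"
proof -
 obtain t p l t' p' l' where x: "x = (t, p, l)" and y: "y = (t', p', l')" by (cases x; cases y)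
 have m: "t : \<T>" "t' : \<T>" "p : {0, 1}" "l : {0, 1}" "p' : {0, 1}" "l' : {0, 1}"
  using assms unfolding x y pauli_labels_iff by blast+
 have e: "(nat p + nat p') mod 2 = nat ((p + p') mod 2)" "(nat l + nat l') mod 2 = nat ((l + l') mod 2)" using m by auto
 obtain c where c: "pauli (nat p) (nat l) * pauli (nat p') (nat l') = (c :: 'f) \<star> pauli (nat ((p + p') mod 2)) (nat ((l + l') mod 2))"
  using pauli_mult[OF nat_01[OF m(3)] nat_01[OF m(4)] nat_01[OF m(5)] nat_01[OF m(6)], where ?'f = 'f] unfolding e by blast
 have "pf x * pf y = (c * sg t t') \<star> kronecker (pauli (nat ((p + p') mod 2)) (nat ((l + l') mod 2))) (X (t \<otimes> t'))"
  unfolding x y pf_def prod.case kronecker_mult[OF pauli_carrier pauli_carrier X_carrier X_carrier] c X_mult[OF m(1,2)]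
  by (rule kronecker_smult[OF pauli_carrier X_carrier])
 then show ?thesis unfolding x y by (auto simp: pf_def pauli_group_def)
qed

lemma pauli_matrix_unit:
 assumes "p : {0, 1 :: nat}" "l : {0, 1 :: nat}"
 shows "pauli p l = (if p = 1 then -1 else 1 :: 'f) \<star> matrix_unit 2 1 (1 + l) + matrix_unit 2 2 (2 - l)" (is "_ = ?M")
proof (rule eq_matI)
 fix x y assume "x < dim_row ?M" "y < dim_col ?M"
 then have xy: "x < 2" "y < 2" by (simp_all add: matrix_unit_def)
 show "pauli p l $$ (x, y) = ?M $$ (x, y)"
  unfolding pauli_index[OF assms xy]
  using assms less_2_cases[OF xy(1)] less_2_cases[OF xy(2)] by (elim insertE emptyE disjE) (simp_all add: matrix_unit_def)
qed (simp_all add: matrix_unit_def)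

text \<open>In the configuration to be excluded the two labels on the right are related, so the line
  of a Pauli product lies in one component.\<close>

lemma pf_e:
 assumes k2: "q + 2 * s = 2" and p: "p : {0, 1}" and l: "l : {0, 1}"
 shows "pf (t, p, l) = (if p = 1 then -1 else 1) \<star> e (1, t, 1 + nat l) + e (2, t, 2 - nat l)"
proof -
 have "kronecker (pauli (nat p) (nat l)) (X t)
   = kronecker ((if nat p = 1 then -1 else 1) \<star> matrix_unit 2 1 (1 + nat l)) (X t) + kronecker (matrix_unit 2 2 (2 - nat l)) (X t)"
  unfolding pauli_matrix_unit[OF nat_01[OF p] nat_01[OF l]] by (rule kronecker_add_left[OF smult_carrier_mat[OF matrix_unit_carrier] matrix_unit_carrier X_carrier])
 also have "kronecker ((if nat p = 1 then -1 else 1) \<star> matrix_unit 2 1 (1 + nat l)) (X t)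
   = (if nat p = 1 then -1 else 1) \<star> kronecker (matrix_unit 2 1 (1 + nat l)) (X t)"
  using kronecker_smult[OF matrix_unit_carrier X_carrier, of "if nat p = 1 then -1 else 1" 2 1 "1 + nat l" 1 t] by (simp add: one_smult_mat)
 also have "nat p = 1 \<longleftrightarrow> p = 1" using p by auto
 finally show ?thesis unfolding pf_def e_simp prod.case k2 .
qed

lemma e_nonzero: "x : B ==> e x ~= 0\<^sub>m n n"
 using coef_e[of x x] coef_0[of x] by auto

text \<open>
 For two equal elements of \<open>T\<close> and no hyperbolic pair, the components can be refined to lines spanned by
 products of Pauli matrices, which contradicts fineness.
\<close>

lemma not_two_equal: "~ (q = 2 & s = 0 & \<tau> 1 = \<tau> 2)"
proof
 assume bad: "q = 2 & s = 0 & \<tau> 1 = \<tau> 2"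
 then have qs2: "q + 2 * s = 2" and q2: "2 <= q" and \<tau>12: "\<tau> 2 = \<tau> 1" by auto
 have n2: "n = 2 * 2 ^ r" unfolding n_def qs2 ..
 interpret F: mat_basis n pauli_labels pf "2 * 2 ^ r" by (rule pf_basis[OF n2])
 note Bij = anti_automorphismsD(1)[OF phi_anti_aut] and lin = anti_automorphismsD(2)[OF phi_anti_aut]
 have K12: "1 : K" "2 : K" unfolding K_def qs2 by auto
 define om where "om t = eta (1, t, 1)" for t
 have K12': "i = 1 | i = 2" if "i : K" for i using that unfolding K_def qs2 by auto
 have tt: "tt i = \<tau> 1" "mm i = 1" "star i = i" if "i : K" for i
 proof -
  have "i <= q" using K12'[OF that] q2 by auto
  then show "tt i = \<tau> 1" "mm i = 1" "star i = i"
   using K12'[OF that] \<tau>12 by (auto simp: tt_def mm_def sec_def star_def)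
 qed
 \<comment> \<open>For t_1 = t_2 the weight of phi depends on the middle entry alone, and phi
   exchanges the outer indices. Pauli products therefore become eigenvectors of phi.\<close>
 have phe: "\<phi> (e (i, t, j)) = om t \<star> e (j, t, i)" if ij: "i : K" "t : \<T>" "j : K" for i t j
 proof -
  have T: "\<tau> 1 : \<T>" using tt_T[OF K12(1)] tt(1)[OF K12(1)] by simp
  have "eta (i, t, j) = om t" unfolding om_def eta_def prod.case cm_def using tt ij K12 by simp
  moreover have "bphi (i, t, j) = (j, t, i)" using tt ij T by (simp add: bphi_def m_assoc sq)
  ultimately show ?thesis using phi_map_e[of "(i, t, j)"] ij by simp
 qed
 have om0: "om t ~= 0" if "t : \<T>" for t unfolding om_def by (rule eta_nonzero) (use that K12 in simp)
 have phf: "\<exists>w. w ~= 0 & \<phi> (pf x) = w \<star> pf x" if x: "x : pauli_labels" for x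
 proof -
  obtain t p l where x': "x = (t, p, l)" by (cases x)
  have xt: "x = (t, p, l)" "t : \<T>" "p : {0, 1}" "l : {0, 1}" using x' x unfolding x' pauli_labels_iff by blast+
  define c :: 'f where "c = (if p = 1 then -1 else 1)"
  have cc: "c * c = 1" "c ~= 0" by (simp_all add: c_def)
  have lK: "1 + nat l : K" "2 - nat l : K" using xt(4) K12 by (auto simp: numeral_2_eq_2)
  have pfx: "pf x = c \<star> e (1, t, 1 + nat l) + e (2, t, 2 - nat l)"
   unfolding xt(1) c_def by (rule pf_e[OF qs2 xt(3,4)])
  have "\<phi> (pf x) = c \<star> \<phi> (e (1, t, 1 + nat l)) + \<phi> (e (2, t, 2 - nat l))"
   unfolding pfx using lin_mapD(2)[OF lin smult_carrier_mat[OF e_carr] e_carr] lin_mapD(3)[OF lin e_carr] by simp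
  also have "... = (c * om t) \<star> e (1 + nat l, t, 1) + om t \<star> e (2 - nat l, t, 2)"
   unfolding phe[OF K12(1) xt(2) lK(1)] phe[OF K12(2) xt(2) lK(2)] smult_smult_mat ..
  also have "... = ((if l = 0 then 1 else c) * om t) \<star> pf x"
  proof (cases "l = 0")
   case True
   show ?thesis
    unfolding pfx True using add_smult_distrib_left_mat[OF smult_carrier_mat[OF e_carr] e_carr, of "om t" c "(1, t, 1)" "(2, t, 2)"]
    by (simp add: smult_smult_mat mult.commute)
  next
   case False
   then have l1: "nat l = 1" "1 + (1 :: nat) = 2" "2 - (1 :: nat) = 1" using xt(4) by auto
   have co: "c * om t * c = om t" using cc(1) by (simp add: mult.commute mult.left_commute)
   have "(c * om t) \<star> (c \<star> e (1, t, 2) + e (2, t, 1)) = om t \<star> e (1, t, 2) + (c * om t) \<star> e (2, t, 1)"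
    unfolding add_smult_distrib_left_mat[OF smult_carrier_mat[OF e_carr] e_carr] smult_smult_mat co ..
   also have "... = (c * om t) \<star> e (2, t, 1) + om t \<star> e (1, t, 2)"
    by (rule comm_add_mat[OF smult_carrier_mat[OF e_carr] smult_carrier_mat[OF e_carr]])
   finally show ?thesis unfolding pfx l1 using False by simp
  qed
  finally show ?thesis using cc(2) om0[OF xt(2)] by (intro exI[of _ "(if l = 0 then 1 else c) * om t"]) simp
 qed
 obtain g :: "'t \<times> int \<times> int => nat" where g: "inj_on g pauli_labels" using finite_imp_inj_to_nat_seg[OF F.fin] by blast
 define H where "H = transport_group g pauli_group"
 define h where "h = inv_into pauli_labels g"
 define A where "A y = {c \<star> pf (h y) | c. True}" for y
 have HC: "carrier H = g ` pauli_labels" by (simp add: H_def transport_group_def pauli_group_carrier)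
 have hg: "h (g x) = x" if "x : pauli_labels" for x unfolding h_def by (rule inv_into_f_f[OF g that])
 have hb: "bij_betw h (carrier H) pauli_labels" unfolding HC h_def by (rule bij_betw_inv_into) (use g in \<open>simp add: bij_betw_def\<close>)
 have hI: "h y : pauli_labels" if "y : carrier H" for y using hb that by (auto simp: bij_betw_def)
 have Hm: "h (y \<otimes>\<^bsub>H\<^esub> y') = h y \<otimes>\<^bsub>pauli_group\<^esub> h y'" if "y : carrier H" "y' : carrier H" for y y'
 proof -
  interpret P: comm_group pauli_group by (rule comm_pauli_group)
  have "h y \<otimes>\<^bsub>pauli_group\<^esub> h y' : pauli_labels" using P.m_closed[of "h y" "h y'"] hI that unfolding pauli_group_carrier by blast
  then show ?thesis using hg by (simp add: H_def transport_group_def h_def[symmetric] pauli_group_carrier)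
 qed
 have gr: "mat_grading n H A"
  unfolding A_def
 proof (rule F.one_dim_grading[OF _ hb])
  show "comm_group H" unfolding H_def by (rule comm_group_transport[OF comm_pauli_group]) (use g in \<open>simp add: pauli_group_carrier\<close>)
  show "\<exists>c. pf (h y) * pf (h y') = c \<star> pf (h (y \<otimes>\<^bsub>H\<^esub> y'))" if "y : carrier H" "y' : carrier H" for y y'
   unfolding Hm[OF that] by (rule pf_mult[OF hI[OF that(1)] hI[OF that(2)]])
 qed
 have phA: "\<exists>w. w ~= 0 & (\<forall>Y\<in>A y. \<phi> Y = w \<star> Y)" if y: "y : carrier H" for y
 proof -
  obtain w where w: "w ~= 0" "\<phi> (pf (h y)) = w \<star> pf (h y)" using phf[OF hI[OF y]] by blast
  have "\<phi> Y = w \<star> Y" if "Y : A y" for Y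
  proof -
   obtain c where "Y = c \<star> pf (h y)" using \<open>Y : A y\<close> unfolding A_def by blast
   then show ?thesis using lin_mapD(3)[OF lin pf_carrier[OF n2]] w(2) by (simp add: smult_smult_mat mult.commute)
  qed
  then show ?thesis using w(1) by blast
 qed
 have Asm: "c \<star> Y : A y" if "Y : A y" for c Y y using that unfolding A_def by (auto simp: smult_smult_mat)
 have Ac: "A y <= carrier_mat n n" for y unfolding A_def using smult_carrier_mat[OF pf_carrier[OF n2, of "h y"]] by blast
 have pg: "phi_grading n \<phi> H A"
  unfolding phi_grading_def
 proof (intro conjI ballI phi_anti_aut gr)
  fix y assume y: "y : carrier H"
  obtain w where w: "w ~= 0" "!!Y. Y : A y ==> \<phi> Y = w \<star> Y" using phA[OF y] by blast
  show "\<phi> ` A y = A y"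
  proof (intro equalityI subsetI)
   fix Y assume "Y : \<phi> ` A y"
   then show "Y : A y" using w(2) Asm by auto
  next
   fix Y assume Y: "Y : A y"
   have "inverse w \<star> Y : A y" by (rule Asm[OF Y])
   moreover have "\<phi> (inverse w \<star> Y) = Y" unfolding w(2)[OF Asm[OF Y]] using w(1) by (simp add: smult_smult_mat one_smult_mat)
   ultimately show "Y : \<phi> ` A y" by (metis imageI)
  qed
 next
  show "\<phi> \<otimes>\<^bsub>mat_bij_group n\<^esub> \<phi> : Diag_gr n H A"
   unfolding Diag_gr_def mem_Collect_eq
  proof (intro conjI phi_square ballI)
   fix V assume "V : components n H A"
   then obtain y where y: "y : carrier H" "V = A y" unfolding components_def by blast
   obtain w where w: "w ~= 0" "!!Y. Y : A y ==> \<phi> Y = w \<star> Y" using phA[OF y(1)] by blast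
   have "(\<phi> \<otimes>\<^bsub>mat_bij_group n\<^esub> \<phi>) Y = (w * w) \<star> Y" if Y: "Y : A y" for Y
   proof -
    have "(\<phi> \<otimes>\<^bsub>mat_bij_group n\<^esub> \<phi>) Y = \<phi> (\<phi> Y)" using Bij Y Ac by (auto simp: BijGroup_def compose_def)
    then show ?thesis unfolding w(2)[OF Y] w(2)[OF Asm[OF Y]] smult_smult_mat .
   qed
   then show "\<exists>c. c ~= 0 & (\<forall>Y\<in>V. (\<phi> \<otimes>\<^bsub>mat_bij_group n\<^esub> \<phi>) Y = c \<star> Y)" unfolding y(2) using w(1) by (intro exI[of _ "w * w"]) simp
  qed
 qed
 have "mat_grading n G0 \<Gamma>" using fine unfolding fine_phi_grading_def phi_grading_def by (elim conjE)
 then have Gsub: "mat_subspace n (\<Gamma> x)" if "x : carrier G0" for x using that by (simp add: mat_grading_def)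
 have comp: "\<Gamma> (deg x) : components n G0 \<Gamma>" if "x : B" for x
 proof -
  have "\<Gamma> (deg x) ~= {0\<^sub>m n n}"
  proof
   assume "\<Gamma> (deg x) = {0\<^sub>m n n}"
   then show False using e_Gamma[OF that] e_nonzero[OF that] by simp
  qed
  then show ?thesis unfolding components_def mem_Collect_eq using deg_carrier[OF that] by (intro exI[of _ "deg x"]) simp
 qed
 have pfG: "pf (t, p, l) : \<Gamma> (deg (1, t, 1 + nat l)) & (1, t, 1 + nat l) : B"
  if t: "t : \<T>" and p: "p : {0, 1}" and l: "l : {0, 1}" for t p l
 proof -
  have B1: "(1, t, 1 + nat l) : B" and B2: "(2, t, 2 - nat l) : B" using l t K12 by (auto simp: numeral_2_eq_2)
  have d: "deg (2, t, 2 - nat l) = deg (1, t, 1 + nat l)"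
  proof (cases "l = 0")
   case True then show ?thesis using deg_diag[OF t, of 2 1] by (simp add: deg_def)
  next
   case False
   then have l1: "l = 1" using l by simp
   have "bphi (1, t, 2) = (2, t, 1)" using tt[OF K12(1)] tt[OF K12(2)] tt_T[OF K12(1)] t by (simp add: bphi_def m_assoc sq)
   then show ?thesis using deg_bphi[of "(1, t, 2)"] t K12 l1 by (simp add: numeral_2_eq_2)
  qed
  note V = mat_subspaceD[OF Gsub[OF deg_carrier[OF B1]]]
  have "pf (t, p, l) : \<Gamma> (deg (1, t, 1 + nat l))"
   unfolding pf_e[OF qs2 p l] using V(3)[OF V(4)[OF e_Gamma[OF B1]] e_Gamma[OF B2, unfolded d]] .
  then show ?thesis using B1 by blast
 qed
 have sub: "\<exists>V\<in>components n G0 \<Gamma>. V' <= V" if V': "V' : components n H A" for V'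
 proof -
  obtain y where y: "y : carrier H" "V' = A y" using V' unfolding components_def by blast
  obtain t p l where x': "h y = (t, p, l)" by (cases "h y")
  have x: "h y = (t, p, l)" "t : \<T>" "p : {0, 1}" "l : {0, 1}" using x' hI[OF y(1)] unfolding x' pauli_labels_iff by blast+
  note P = pfG[OF x(2-4)]
  have "V' <= \<Gamma> (deg (1, t, 1 + nat l))"
   unfolding y(2) A_def x(1) using P mat_subspaceD(4)[OF Gsub[OF deg_carrier[of "(1, t, 1 + nat l)"]]] by blast
  then show ?thesis using comp[of "(1, t, 1 + nat l)"] P by blast
 qed
 \<comment> \<open>These labels give two independent matrices in the identity component, whereas the
   refined components are lines; so the refinement is proper.\<close>
 have x0: "(\<one>, 0, 0) : pauli_labels" and x1: "(\<one>, 1, 0) : pauli_labels" by (simp_all add: pauli_labels_def)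
 have "A (g (\<one>, 0, 0)) : components n H A"
 proof -
  have "pf (\<one>, 0, 0) ~= 0\<^sub>m n n" using F.coef_e[OF x0 x0] F.coef_0[of "(\<one>, 0, 0)"] by auto
  moreover have "pf (\<one>, 0, 0) : A (g (\<one>, 0, 0))"
   unfolding A_def hg[OF x0] mem_Collect_eq by (intro exI[of _ 1]) (simp add: one_smult_mat)
  ultimately have "A (g (\<one>, 0, 0)) ~= {0\<^sub>m n n}" by blast
  then show ?thesis unfolding components_def HC using x0 by blast
 qed
 moreover have "A (g (\<one>, 0, 0)) \<subset> \<Gamma> (deg (1, \<one>, 1))"
 proof -
  have P: "pf (\<one>, 0, 0) : \<Gamma> (deg (1, \<one>, 1))" "pf (\<one>, 1, 0) : \<Gamma> (deg (1, \<one>, 1))" "(1, \<one>, 1) : B"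
   using pfG[OF one_closed, of 0 0] pfG[OF one_closed, of 1 0] by simp_all
  have "A (g (\<one>, 0, 0)) <= \<Gamma> (deg (1, \<one>, 1))"
   unfolding A_def hg[OF x0] using P(1) mat_subspaceD(4)[OF Gsub[OF deg_carrier[OF P(3)]]] by blast
  moreover have "pf (\<one>, 1, 0) \<notin> A (g (\<one>, 0, 0))"
  proof
   assume "pf (\<one>, 1, 0) : A (g (\<one>, 0, 0))"
   then obtain c where c: "pf (\<one>, 1, 0) = c \<star> pf (\<one>, 0, 0)" unfolding A_def hg[OF x0] by blast
   have "F.coef (pf (\<one>, 1, 0)) (\<one>, 1, 0) = 0" unfolding c F.coef_smult[OF pf_carrier[OF n2]] F.coef_e[OF x0 x1] by simp
   then show False unfolding F.coef_e[OF x1 x1] by simp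
  qed
  ultimately show ?thesis using P(2) by blast
 qed
 moreover have "\<Gamma> (deg (1, \<one>, 1)) : components n G0 \<Gamma>" by (rule comp) (use K12 in simp)
 ultimately have "proper_coarsening (components n G0 \<Gamma>) (components n H A)"
  unfolding proper_coarsening_def using sub by blast
 then show False using fine pg unfolding fine_phi_grading_def by blast
qed

end

theorem theorem3p12:
  fixes T :: "'t monoid"
    and \<beta> :: "'t \<Rightarrow> 't \<Rightarrow> 'f::alg_closed_field"
    and a b \<tau> :: "nat \<Rightarrow> 't"
    and \<mu> :: "nat \<Rightarrow> 'f"
    and r q s n :: nat
    and \<Gamma> :: "('t \<times> (nat \<Rightarrow> int)) set \<Rightarrow> 'f mat set"
    and G :: "('t \<times> (nat \<Rightarrow> int)) set monoid"
    and \<phi> :: "'f mat \<Rightarrow> 'f mat"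
  assumes char: "CHAR('f) \<noteq> 2"
    and T: "elementary_abelian_2_group T"
    and beta: "nondeg_alternating_bicharacter T \<beta>"
    and basis: "symplectic_basis T \<beta> r a b"
    and qs: "\<not> (q = 0 \<and> s = 0)"
    and tau: "\<forall>i\<in>{1..q}. \<tau> i \<in> carrier T"
    and mu: "\<forall>j\<in>{1..s}. \<mu> j \<noteq> 0"
    and n_def: "n = (q + 2*s) * 2^r"
    and G_def: "G = G_tilde0 T q s \<tau>"
    and Gamma_def: "\<Gamma> = Gamma_M T r a b q s \<tau>"
    and phi_def: "\<phi> = phi_map T r a b q s \<tau> \<mu>"
    and fine: "fine_phi_grading n \<phi> G \<Gamma>"
  shows "Stab_phi n G \<Gamma> \<phi> = Diag_gr n G \<Gamma>
    \<and> is_extension_of_by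
        ((mat_bij_group n)\<lparr>carrier := Aut_star n G \<Gamma> \<phi>\<rparr> Mod Stab_phi n G \<Gamma> \<phi>)
        (Weyl_star_group T \<beta> q s \<tau>)
        (tuples_mod_diag (q + s) (integer_mod_group 2))
        (Z2_act T q s \<tau>)
    \<and> ((\<forall>X\<in>carrier_mat n n. \<phi> (\<phi> X) = X) \<longrightarrow>
        (mat_bij_group n)\<lparr>carrier := Aut_phi n G \<Gamma> \<phi>\<rparr> Mod Stab_phi n G \<Gamma> \<phi>
          \<cong> Weyl_group T \<beta> r a b q s \<tau>)"
proof -
 interpret comm_group T using T by (simp add: elementary_abelian_2_group_def)
 interpret elementary_2_group T by unfold_locales (use T in \<open>simp_all add: elementary_abelian_2_group_def\<close>)
 have two: "(2 :: 'f) ~= 0"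
 proof
  assume "(2 :: 'f) = 0"
  then have "of_nat 2 = (0 :: 'f)" by simp
  then have "CHAR('f) dvd 2" by (simp only: of_nat_eq_0_iff_char_dvd)
  \<comment> \<open>A divisor of 2 other than 2 itself is 1, which is no characteristic of a
    field.\<close>
  then have "CHAR('f) = 1" using char by (metis prime_nat_iff two_is_prime_nat)
  then show False using of_nat_CHAR[where ?'a = 'f] by simp
 qed
 interpret symplectic_group T \<beta> r a b by unfold_locales (use beta basis two in auto)
 interpret weyl_data T \<beta> q s \<tau> by unfold_locales (use tau qs in auto)
 interpret weyl_quad T \<beta> q s \<tau> r a b by unfold_locales
 interpret M: fine_matrices T \<beta> q s \<tau> r a b \<mu> n
  by unfold_locales (use mu n_def fine in \<open>auto simp: G_def Gamma_def phi_def\<close>)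
 interpret A: graded_matrix_algebra T \<beta> q s \<tau> r a b n M.e "2 ^ r" sg M.eta M.mm
  "phi_map T r a b q s \<tau> \<mu>" "G_tilde0 T q s \<tau>" "Gamma_M T r a b q s \<tau>"
  by unfold_locales
   (rule M.e_mult sg_nonzero sg_ones sg_cocycle sg_commute M.components_eq M.phi_anti_aut M.phi_map_e
    M.eta_nonzero M.eta_diagonal M.eta_hyperbolic M.mm_nz M.not_two_equal; (assumption)?)+
 show ?thesis
  unfolding G_def Gamma_def phi_def
  by (rule conjI[OF A.Stab_phi_eq conjI[OF A.Aut_star_extension impI]], rule A.Aut_phi_iso) blast
qed

end
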